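(* Let $n\in\mathbb N$, $n\ge2$, $\alpha\in(0,1)$, $1<p<\infty$, and $f\in C_c(\mathbb H^n)\cap\mathrm{Lip}^\alpha_{\mathrm{loc}}(\mathbb H^n)$. There exist $\gamma_n\in\mathbb R$ (depending only on $n$) and $\delta_{n,p}\in\mathbb R$ (depending only on $n$ and $p$) such that, for every $x\in\mathbb H^n$, $$(\log(-\Delta_{\mathbb H^n})_p)f(x)=\lim_{t\to0^+}\sigma_{n,p}\Big(E_n\big(\Phi_p(f(x)-f(\cdot))-\Phi_p(f(x))\big)(x,t)+\gamma_n\Phi_p(f(x))\log t\Big)+\delta_{n,p}\Phi_p(f(x)).$$
   Context: Hyperbolic space: $\mathbb H^n=\{(x_0,\dots,x_n)\in\mathbb R^{n+1}: x_0^2-x_1^2-\cdots-x_n^2=1,\ x_0>0\}$, with the Riemannian metric induced by the Lorentzian metric $-dx_0^2+dx_1^2+\cdots+dx_n^2$. In polar coordinates $x=(\cosh\rho,\omega\sinh\rho)$, $\rho>0$, $\omega\in S^{n-1}$, the metric is $d\rho^2+(\sinh\rho)^2d\omega^2$ and the volume element (written $dy$) is $(\sinh\rho)^{n-1}d\rho\,d\omega$. $d_{\mathbb H^n}(x,y)$ denotes the geodesic distance, i.e. $\cosh d_{\mathbb H^n}(x,y)=x_0y_0-x_1y_1-\cdots-x_ny_n$. Function spaces: $C_c(\mathbb H^n)$ is the space of continuous complex functions with compact support in $\mathbb H^n$. $\mathrm{Lip}^\alpha_{\mathrm{loc}}(\mathbb H^n)$ is the space of complex functions $f$ on $\mathbb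 H^n$ such that for every $x\in\mathbb H^n$ and $r>0$, $\sup_{y\ne x,\ d_{\mathbb H^n}(x,y)\le r}\frac{|f(x)-f(y)|}{d_{\mathbb H^n}(x,y)^\alpha}<\infty$. $\Phi_p(z)=|z|^{p-2}z$, with $\Phi_p(0)=0$. Fractional $p$-Laplacian: for $s\in(0,1)$, $$(-\Delta_{\mathbb H^n})_p^sf(x)=\mathrm{P.V.}\int_{\mathbb H^n}\Phi_p(f(x)-f(y))\,\mathcal K_{n,s,p}(d_{\mathbb H^n}(x,y))\,dy,$$ where P.V. means $\lim_{\varepsilon\to0^+}\int_{d_{\mathbb H^n}(x,y)>\varepsilon}$. The kernel is, for $\rho>0$, $$\mathcal K_{n,s,p}(\rho)=s\,a_{n,s,p}\Big(-\frac1{\sinh\rho}\frac{\partial}{\partial\rho}\Big)^{\frac{n-1}2}\Big[\rho^{-\frac{1+sp}2}K_{\frac{1+sp}2}\big(\tfrac{n-1}2\rho\big)\Big]$$ when $n\ge3$ is odd, and $$\mathcal K_{n,s,p}(\rho)=\frac{s\,a_{n,s,p}}{\sqrt\pi}\int_\rho^\infty\frac{\sinh r}{\sqrt{\cosh r-\cosh\rho}}\Big(-\frac1{\sinh r}\frac{\partial}{\partial r}\Big)^{\frac n2}\Big[r^{-\frac{1+sp}2}K_{\frac{1+sp}2}\big(\tfrac{n-1}2r\big)\Big]dr$$ when $n$ is even, where $K_\nu$ is the modified Bessel function of the second kind of order $\nu$ and $$a_{n,s,p}=\frac{p\,(n-1)^{\frac{1+sp}2}}{2^{s(p-2)+\frac{n+3}2}\,\pi^{\frac{n-1}2}\,\Gamma(\frac{p+1}2)\,\Gamma(1-s)}.$$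 Logarithmic operator: let $A_{n,p}>0$ be the (unique) constant, depending only on $n$ and $p$, such that $\lim_{s\to0^+}(-\Delta_{\mathbb H^n})_p^sf(x)=A_{n,p}\Phi_p(f(x))$ for all $x\in\mathbb H^n$ and all $f\in C_c(\mathbb H^n)\cap\mathrm{Lip}^\alpha_{\mathrm{loc}}(\mathbb H^n)$, $\alpha\in(0,1)$ (such a constant exists). Then $$(\log(-\Delta_{\mathbb H^n})_p)f(x)=\lim_{s\to0^+}\frac{(-\Delta_{\mathbb H^n})_p^sf(x)-A_{n,p}\Phi_p(f(x))}{s},\qquad x\in\mathbb H^n.$$ Poisson type kernel: with $\mathbb K_n(u)=u^{-1/2}K_{1/2}(\frac{n-1}2u)=\big(\frac{\pi}{n-1}\big)^{1/2}\frac{e^{-\frac{n-1}2u}}u$, $u>0$, for $\rho>0$, $t\ge0$, $$P_n(\rho,t)=\Big(-\frac1{\sinh\rho}\frac{\partial}{\partial\rho}\Big)^{\frac{n-1}2}\big(\mathbb K_n(\sqrt{\rho^2+t^2})\big)\quad(n\ge3\text{ odd}),$$ $$P_n(\rho,t)=\int_\rho^\infty\frac{\sinh r}{\sqrt{\cosh r-\cosh\rho}}\Big(-\frac1{\sinh r}\frac{\partial}{\partial r}\Big)^{\frac n2}\big(\mathbb K_n(\sqrt{r^2+t^2})\big)dr\quad(n\text{ even}).$$ Extension operator: $E_n(g)(x,t)=\int_{\mathbb H^n}g(y)P_n(d_{\mathbb H^n}(x,y),t)\,dy$, $x\in\mathbb H^n$, $t>0$. In the claim, $x$ is fixed and $E_n$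 is applied to the function $y\mapsto\Phi_p(f(x)-f(y))-\Phi_p(f(x))$ and evaluated at $(x,t)$. Constant $\sigma_{n,p}$: with $c_{n,p}=a_{n,0,p}$ (the formula for $a_{n,s,p}$ at $s=0$), $\sigma_{n,p}=c_{n,p}$ if $n\ge3$ is odd and $\sigma_{n,p}=\pi^{-1/2}c_{n,p}$ if $n$ is even. *)

theory Defs
  imports "HOL-Analysis.Analysis"
begin

section \<open>Hyperbolic space\<close>

text \<open>The dimension is \<open>n = CARD('n)\<close>. A point \<open>(x\<^sub>0, x\<^sub>1, \<dots>, x\<^sub>n)\<close> is the pair of \<open>x\<^sub>0\<close> and
  the vector of the remaining coordinates.\<close>

type_synonym 'n point = "real \<times> (real ^ 'n)"

definition lorentz :: "'n::finite point \<Rightarrow> 'n point \<Rightarrow> real" where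
  "lorentz x y = fst x * fst y - snd x \<bullet> snd y"

definition hyperboloid :: "'n::finite point set" where
  "hyperboloid = {x. lorentz x x = 1 \<and> fst x > 0}"

definition hdist :: "'n::finite point \<Rightarrow> 'n point \<Rightarrow> real" where
  "hdist x y = arcosh (lorentz x y)"

text \<open>The surface measure \<open>d\<omega>\<close> on the unit sphere: \<open>A\<close> has measure \<open>n\<close> times the Lebesgue measure
  of the cone \<open>{r\<omega> | 0 < r \<le> 1, \<omega> \<in> A}\<close>.\<close>

definition sphere_measure :: "(real ^ 'n::finite) measure" where
  "sphere_measure =
     distr (scale_measure (of_nat CARD('n)) (restrict_space lborel (cball 0 1 - {0})))
       (restrict_space borel (sphere 0 1)) sgn"

text \<open>The volume element \<open>(sinh \<rho>)\<^bsup>n-1\<^esup> d\<rho> d\<omega>\<close>, transported to the hyperboloid by polar coordinates.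
  The point \<open>\<rho> = 0\<close> that they omit is a null set.\<close>

definition hyp_vol :: "'n::finite point measure" where
  "hyp_vol =
     distr
       (density (restrict_space lborel {0<..} \<Otimes>\<^sub>M (sphere_measure :: (real ^ 'n) measure))
          (\<lambda>(\<rho>, \<omega>). ennreal (sinh \<rho> ^ (CARD('n) - 1))))
       (restrict_space borel hyperboloid)
       (\<lambda>(\<rho>, \<omega>). (cosh \<rho>, sinh \<rho> *\<^sub>R \<omega>))"

section \<open>Function spaces\<close>

text \<open>Functions on hyperbolic space are functions on the ambient space whose values off the
  hyperboloid are irrelevant.\<close>

definition Cc_hyp :: "('n::finite point \<Rightarrow> complex) set" where
  "Cc_hyp = {f. continuous_on hyperboloid f \<and>
                compact (hyperboloid \<inter> closure {x \<in> hyperboloid. f x \<noteq> 0})}"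

definition Lip_loc :: "real \<Rightarrow> ('n::finite point \<Rightarrow> complex) set" where
  "Lip_loc \<alpha> = {f. \<forall>x\<in>hyperboloid. \<forall>r>0.
     bdd_above ((\<lambda>y. cmod (f x - f y) / hdist x y powr \<alpha>) `
                 {y \<in> hyperboloid. y \<noteq> x \<and> hdist x y \<le> r})}"

section \<open>Kernels\<close>

text \<open>The modified Bessel function of the second kind, for positive argument \<open>z\<close>, by its classical
  integral representation.\<close>

definition bessel_K :: "real \<Rightarrow> real \<Rightarrow> real" where
  "bessel_K \<nu> z = (LINT t:{0<..}|lborel. exp (- z * cosh t) * cosh (\<nu> * t))"

definition radial_deriv :: "(real \<Rightarrow> real) \<Rightarrow> real \<Rightarrow> real" where
  "radial_deriv h \<rho> = - (1 / sinh \<rho>) * deriv h \<rho>"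

text \<open>In both kernels below the radial derivatives are followed by an Abel type integral when \<open>n\<close> is
  even. Odd \<open>n\<close> is understood to be at least \<open>3\<close>.\<close>

definition abel_integral :: "(real \<Rightarrow> real) \<Rightarrow> real \<Rightarrow> real" where
  "abel_integral h \<rho> = (LINT r:{\<rho><..}|lborel. sinh r / sqrt (cosh r - cosh \<rho>) * h r)"

definition a_const :: "nat \<Rightarrow> real \<Rightarrow> real \<Rightarrow> real" where
  "a_const n s p =
     p * (real n - 1) powr ((1 + s * p) / 2) /
     (2 powr (s * (p - 2) + (real n + 3) / 2) * pi powr ((real n - 1) / 2)
        * Gamma ((p + 1) / 2) * Gamma (1 - s))"

definition frac_kernel :: "nat \<Rightarrow> real \<Rightarrow> real \<Rightarrow> real \<Rightarrow> real" where
  "frac_kernel n s p \<rho> =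
     (let h = (\<lambda>r. r powr (- ((1 + s * p) / 2)) * bessel_K ((1 + s * p) / 2) ((real n - 1) / 2 * r))
      in if odd n
         then s * a_const n s p * (radial_deriv ^^ ((n - 1) div 2)) h \<rho>
         else s * a_const n s p / sqrt pi * abel_integral ((radial_deriv ^^ (n div 2)) h) \<rho>)"

definition bessel_K_half :: "nat \<Rightarrow> real \<Rightarrow> real" where
  "bessel_K_half n u = u powr (- (1 / 2)) * bessel_K (1 / 2) ((real n - 1) / 2 * u)"

definition poisson_kernel :: "nat \<Rightarrow> real \<Rightarrow> real \<Rightarrow> real" where
  "poisson_kernel n \<rho> t =
     (let h = (\<lambda>r. bessel_K_half n (sqrt (r\<^sup>2 + t\<^sup>2)))
      in if odd n
         then (radial_deriv ^^ ((n - 1) div 2)) h \<rho>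
         else abel_integral ((radial_deriv ^^ (n div 2)) h) \<rho>)"

definition sigma_const :: "nat \<Rightarrow> real \<Rightarrow> real" where
  "sigma_const n p = (if odd n then a_const n 0 p else a_const n 0 p / sqrt pi)"

section \<open>Operators\<close>

definition Phi :: "real \<Rightarrow> complex \<Rightarrow> complex" where
  "Phi p z = of_real (cmod z powr (p - 2)) * z"

definition frac_plap :: "real \<Rightarrow> real \<Rightarrow> ('n::finite point \<Rightarrow> complex) \<Rightarrow> 'n point \<Rightarrow> complex" where
  "frac_plap s p f x =
     Lim (at_right 0) (\<lambda>\<epsilon>. LINT y:{y \<in> hyperboloid. hdist x y > \<epsilon>}|hyp_vol.
       Phi p (f x - f y) * of_real (frac_kernel CARD('n) s p (hdist x y)))"

text \<open>The constant \<open>A\<^bsub>n,p\<^esub>\<close>; the type argument carries the dimension.\<close>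

definition A_const :: "'n::finite itself \<Rightarrow> real \<Rightarrow> real" where
  "A_const (_ :: 'n itself) p =
     (THE A. A > 0 \<and>
        (\<forall>\<alpha>\<in>{0<..<1}. \<forall>f \<in> Cc_hyp \<inter> Lip_loc \<alpha>. \<forall>x \<in> (hyperboloid :: 'n point set).
           ((\<lambda>s. frac_plap s p f x) \<longlongrightarrow> of_real A * Phi p (f x)) (at_right 0)))"

definition log_quotient :: "real \<Rightarrow> ('n::finite point \<Rightarrow> complex) \<Rightarrow> 'n point \<Rightarrow> real \<Rightarrow> complex" where
  "log_quotient p f x s =
     (frac_plap s p f x - of_real (A_const TYPE('n) p) * Phi p (f x)) / of_real s"

definition log_plap :: "real \<Rightarrow> ('n::finite point \<Rightarrow> complex) \<Rightarrow> 'n point \<Rightarrow> complex" where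
  "log_plap p f x = Lim (at_right 0) (log_quotient p f x)"

definition ext_op :: "('n::finite point \<Rightarrow> complex) \<Rightarrow> 'n point \<Rightarrow> real \<Rightarrow> complex" where
  "ext_op g x t = (LINT y|hyp_vol. g y * of_real (poisson_kernel CARD('n) (hdist x y) t))"

end

(* Let p_u be the heat kernel of hyperbolic space at time u, up to a constant. The integral
   representation r^-nu K_nu(c r) = const * INT u^(-nu-1) exp(-c^2 u - r^2/(4u)) du of the Bessel
   function survives the radial derivatives and the Abel integral, so that

     frac_kernel = s G(s) INT u^(-1-sp/2) p_u du,   poisson_kernel = const * INT u^-1 exp(-t^2/(4u)) p_u du.

   Since arcosh(x)^2 is a Bernstein function of x, p_u is positive, and integration by parts reduces
   its radial moments to Gaussian ones: the mass of p_u is k1 + O(1/u) for large u and k0 + O(sqrt u)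
   for small u, the mass outside the unit ball is O(sqrt u) for small u, and the mass inside is O(1/u)
   for large u. Hence the integral of INT u^(-1-a) p_u du outside the unit ball is k1/a + L(a), and
   that of the Poisson kernel over the unit ball is a multiple of ln t plus eta(t), where L and eta
   converge at 0.

   Split Phi(f x - f y) = local_part + 1_{d(x,y)>1} Phi(f x). The local part has bounded support and is
   O(d^beta) at x, so by dominated convergence its integrals against the fractional kernels as s -> 0
   and against the Poisson kernels as t -> 0 have the same limit J. The first order expansion in s of
   the fractional operator then gives A, and log_plap = G(0) J plus multiples of Phi(f x), while
   ext_op = const * J plus a multiple of (ln t) Phi(f x) plus a convergent multiple of Phi(f x). *)
theory Submission
  imports Defs "HOL-Probability.Distributions" "HOL-Real_Asymp.Real_Asymp"
begin

section \<open>Integration on the line\<close>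

text \<open>The kernels are radial derivatives of Bessel functions whose order depends on
  \<open>s\<close>, followed in even dimension by a singular integral; bounding them uniformly in
  \<open>s\<close> near the diagonal and at infinity would be laborious. As mixtures over the time u
  they depend on \<open>s\<close> and \<open>t\<close> only through scalar weights, and since p_u is
  positive, Tonelli applies throughout: only radial averages of p_u have to be estimated. Positivity
  is visible in the variable x = cosh r, where the radial derivative is -d/dx and the Gaussian is
  exp(-l arcosh(x)^2). The time factor u^(-1/2) exp(-c^2 u) with c = (n-1)/2 balances the growth
  exp(c r) that the integrations by parts leave of the volume, so the mass of p_u converges for
  large u; its positive limit yields the pole 1/a that the factor \<open>s\<close> of the kernel
  turns into A. The volume is defined by polar coordinates about one point, so Lorentz invariance is
  what makes the constants independent of \<open>x\<close>. As A is given by a definite description,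
  its uniqueness is a separate obligation, met by a test function.\<close>

lemma nn_integral_substitution_exhaust:
  fixes f :: "real \<Rightarrow> ennreal" and g g' :: "real \<Rightarrow> real" and a b :: "nat \<Rightarrow> real"
  assumes [measurable]: "f \<in> borel_measurable borel" "g \<in> borel_measurable borel" "g' \<in> borel_measurable borel"
    and deriv: "\<And>x. x \<in> S \<Longrightarrow> (g has_real_derivative g' x) (at x)"
    and cont: "continuous_on S g'" and nonneg: "\<And>x. x \<in> S \<Longrightarrow> 0 \<le> g' x"
    and ab: "\<And>i. a i < b i" "decseq a" "incseq b"
    and S: "S = (\<Union>i. {a i..b i})" and T: "T = (\<Union>i. {g (a i)..g (b i)})"
  shows "(\<integral>\<^sup>+x. f x * indicator T x \<partial>lborel) = (\<integral>\<^sup>+x. f (g x) * g' x * indicator S x \<partial>lborel)"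
proof -
  have mono: "g x \<le> g y" if "x \<le> y" "{x..y} \<subseteq> S" for x y
    using that(2) by (intro DERIV_nonneg_imp_nondecreasing[OF that(1), of g]) (metis atLeastAtMost_iff deriv nonneg subsetD)
  have ai: "a i \<in> S" "b i \<in> S" "{a i..b i} \<subseteq> S" for i
    using ab(1)[of i] by (auto simp: S intro!: exI[of _ i])
  have incS: "{a i..b i} \<subseteq> {a j..b j}" if "i \<le> j" for i j
    using decseqD[OF ab(2) that] incseqD[OF ab(3) that] by auto
  have incT: "{g (a i)..g (b i)} \<subseteq> {g (a j)..g (b j)}" if "i \<le> j" for i j
  proof -
    have l: "a j \<le> a i" "b i \<le> b j" using decseqD[OF ab(2) that] incseqD[OF ab(3) that] by auto
    have "{a j..a i} \<subseteq> S" "{b i..b j} \<subseteq> S"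
      using ai(3)[of j] ab(1)[of i] l by (auto simp: subset_eq)
    then have "g (a j) \<le> g (a i)" "g (b i) \<le> g (b j)" using mono l by auto
    then show ?thesis by auto
  qed
  \<comment> \<open>Both sides are treated by monotone convergence along the compact intervals, on
    each of which the ordinary substitution rule holds; for this the indicator of the union is
    written as a supremum of indicators.\<close>
  have sup: "f' * indicator (\<Union>i. A i) x = (SUP i. f' * indicator (A i) x)"
    if "\<And>i j. i \<le> j \<Longrightarrow> A i \<subseteq> A j" for A :: "nat \<Rightarrow> real set" and x and f' :: ennreal
  proof (cases "x \<in> (\<Union>i. A i)")
    case True
    then obtain i where "x \<in> A i" by auto
    then have "(SUP i. f' * indicator (A i) x) = f'"
      by (intro antisym SUP_least SUP_upper2[of i]) (auto simp: indicator_def)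
    then show ?thesis using True by simp
  qed auto
  have "(\<integral>\<^sup>+x. f x * indicator T x \<partial>lborel) = (\<integral>\<^sup>+x. (SUP i. f x * indicator {g (a i)..g (b i)} x) \<partial>lborel)"
    unfolding T using incT by (subst sup) auto
  also have "\<dots> = (SUP i. \<integral>\<^sup>+x. f x * indicator {g (a i)..g (b i)} x \<partial>lborel)"
    using incT by (intro nn_integral_monotone_convergence_SUP)
       (force simp: incseq_def le_fun_def intro!: mult_left_mono split: split_indicator)+
  also have "\<dots> = (SUP i. \<integral>\<^sup>+x. f (g x) * g' x * indicator {a i..b i} x \<partial>lborel)"
  proof (intro SUP_cong refl)
    fix i
    show "(\<integral>\<^sup>+x. f x * indicator {g (a i)..g (b i)} x \<partial>lborel) = (\<integral>\<^sup>+x. f (g x) * g' x * indicator {a i..b i} x \<partial>lborel)"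
      using ai(3)[of i] by (intro nn_integral_substitution_aux deriv nonneg continuous_on_subset[OF cont] ab(1)) auto
  qed
  also have "\<dots> = (\<integral>\<^sup>+x. (SUP i. f (g x) * g' x * indicator {a i..b i} x) \<partial>lborel)"
    using incS by (intro nn_integral_monotone_convergence_SUP[symmetric])
       (force simp: incseq_def le_fun_def intro!: mult_left_mono split: split_indicator)+
  also have "\<dots> = (\<integral>\<^sup>+x. f (g x) * g' x * indicator S x \<partial>lborel)"
    unfolding S using incS by (subst sup) auto
  finally show ?thesis .
qed

text \<open>Both sides are the integral of f(x) psi'(y) over the region 0 <= y <= x: integrating in
  y first gives psi(x), in x first gives F(y). Tonelli covers infinite values as well.\<close>

lemma nn_integral_by_parts_half_line:
  fixes F f \<psi> \<psi>' :: "real \<Rightarrow> real"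
  assumes [measurable]: "F \<in> borel_measurable borel" "f \<in> borel_measurable borel" "\<psi> \<in> borel_measurable borel" "\<psi>' \<in> borel_measurable borel"
    and F: "\<And>x. 0 \<le> x \<Longrightarrow> (F has_real_derivative - f x) (at x)" "\<And>x. 0 \<le> x \<Longrightarrow> 0 \<le> f x" "(F \<longlongrightarrow> 0) at_top"
    and \<psi>: "\<And>x. 0 \<le> x \<Longrightarrow> (\<psi> has_real_derivative \<psi>' x) (at x)" "\<And>x. 0 \<le> x \<Longrightarrow> 0 \<le> \<psi>' x" "\<psi> 0 = 0"
  shows "(\<integral>\<^sup>+x. ennreal (f x * \<psi> x) * indicator {0..} x \<partial>lborel) = (\<integral>\<^sup>+x. ennreal (F x * \<psi>' x) * indicator {0..} x \<partial>lborel)"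
proof -
  have \<psi>_eq: "(\<integral>\<^sup>+y. ennreal (\<psi>' y) * indicator {0..x} y \<partial>lborel) = ennreal (\<psi> x)" if "0 \<le> x" for x
    using nn_integral_FTC_Icc[of \<psi>' 0 x \<psi>] that \<psi>
    by (simp add: has_vector_derivative_at_within has_real_derivative_iff_has_vector_derivative[symmetric])
  have F_eq: "(\<integral>\<^sup>+x. ennreal (f x) * indicator {y..} x \<partial>lborel) = ennreal (F y)" if "0 \<le> y" for y
  proof -
    have "(\<integral>\<^sup>+x. ennreal (f x) * indicator {y..} x \<partial>lborel) = ennreal (0 - (- F y))"
      using that F(2) by (intro nn_integral_FTC_atLeast[where F = "\<lambda>x. - F x"] DERIV_minus[OF F(1), simplified]
        tendsto_minus[OF F(3), simplified]) auto
    then show ?thesis by simp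
  qed
  have F_nonneg: "0 \<le> F y" if "0 \<le> y" for y
  proof (rule tendsto_upperbound[OF F(3)])
    show "\<forall>\<^sub>F x in at_top. F x \<le> F y"
      using eventually_ge_at_top[of y]
    proof eventually_elim
      case (elim x)
      show ?case
        using DERIV_nonpos_imp_nonincreasing[OF elim, of F] that F(1,2) neg_le_0_iff_le by (meson order_trans)
    qed
  qed auto
  have \<psi>_nonneg: "0 \<le> \<psi> y" if "0 \<le> y" for y
    using DERIV_nonneg_imp_nondecreasing[OF that, of \<psi>] \<psi> by metis
  have "(\<integral>\<^sup>+x. ennreal (f x * \<psi> x) * indicator {0..} x \<partial>lborel)
      = (\<integral>\<^sup>+x. \<integral>\<^sup>+y. ennreal (f x) * ennreal (\<psi>' y) * indicator {(x, y). 0 \<le> y \<and> y \<le> x} (x, y) \<partial>lborel \<partial>lborel)"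
  proof (intro nn_integral_cong)
    fix x :: real
    show "ennreal (f x * \<psi> x) * indicator {0..} x = (\<integral>\<^sup>+y. ennreal (f x) * ennreal (\<psi>' y) * indicator {(x, y). 0 \<le> y \<and> y \<le> x} (x, y) \<partial>lborel)"
    proof (cases "0 \<le> x")
      case True
      have "(\<integral>\<^sup>+y. ennreal (f x) * ennreal (\<psi>' y) * indicator {(x, y). 0 \<le> y \<and> y \<le> x} (x, y) \<partial>lborel)
         = (\<integral>\<^sup>+y. ennreal (f x) * (ennreal (\<psi>' y) * indicator {0..x} y) \<partial>lborel)"
        by (intro nn_integral_cong) (auto split: split_indicator)
      also have "\<dots> = ennreal (f x) * ennreal (\<psi> x)" using True by (subst nn_integral_cmult) (auto simp: \<psi>_eq)
      finally show ?thesis using True F(2) \<psi>_nonneg by (simp add: ennreal_mult')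
    qed (auto split: split_indicator)
  qed
  also have "\<dots> = (\<integral>\<^sup>+y. \<integral>\<^sup>+x. ennreal (f x) * ennreal (\<psi>' y) * indicator {(x, y). 0 \<le> y \<and> y \<le> x} (x, y) \<partial>lborel \<partial>lborel)"
    by (rule lborel_pair.Fubini'[symmetric]) measurable
  also have "\<dots> = (\<integral>\<^sup>+x. ennreal (F x * \<psi>' x) * indicator {0..} x \<partial>lborel)"
  proof (intro nn_integral_cong)
    fix y :: real
    show "(\<integral>\<^sup>+x. ennreal (f x) * ennreal (\<psi>' y) * indicator {(x, y). 0 \<le> y \<and> y \<le> x} (x, y) \<partial>lborel) = ennreal (F y * \<psi>' y) * indicator {0..} y"
    proof (cases "0 \<le> y")
      case True
      have "(\<integral>\<^sup>+x. ennreal (f x) * ennreal (\<psi>' y) * indicator {(x, y). 0 \<le> y \<and> y \<le> x} (x, y) \<partial>lborel)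
         = (\<integral>\<^sup>+x. (ennreal (f x) * indicator {y..} x) * ennreal (\<psi>' y) \<partial>lborel)"
        using True by (intro nn_integral_cong) (auto split: split_indicator)
      also have "\<dots> = ennreal (F y) * ennreal (\<psi>' y)" using True by (subst nn_integral_multc) (auto simp: F_eq)
      finally show ?thesis using True F_nonneg \<psi>(2) by (simp add: ennreal_mult')
    qed (auto split: split_indicator)
  qed
  finally show ?thesis .
qed

text \<open>Limits at \<open>a\<close> are tested on sequences, which reduces the claim to dominated
  convergence of sequences. The second conclusion exempts the trivial filter, along which nothing
  relates \<open>l\<close> to \<open>f\<close>.\<close>

lemma integral_dominated_convergence_at:
  fixes f :: "'c::first_countable_topology \<Rightarrow> 'a \<Rightarrow> 'b::{banach, second_countable_topology}"
  assumes meas: "l \<in> borel_measurable M" "\<And>t. t \<in> S - {a} \<Longrightarrow> f t \<in> borel_measurable M" and w: "integrable M w"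
    and lim: "AE x in M. ((\<lambda>t. f t x) \<longlongrightarrow> l x) (at a within S)"
    and bound: "\<And>t. t \<in> S - {a} \<Longrightarrow> AE x in M. norm (f t x) \<le> w x"
  shows "((\<lambda>t. integral\<^sup>L M (f t)) \<longlongrightarrow> integral\<^sup>L M l) (at a within S)" "integrable M l \<or> at a within S = bot"
proof -
  have seq: "(\<lambda>i. integral\<^sup>L M (f (X i))) \<longlonglongrightarrow> integral\<^sup>L M l \<and> integrable M l"
    if X: "\<And>i. X i \<in> S - {a}" "X \<longlonglongrightarrow> a" for X
  proof -
    have "AE x in M. (\<lambda>i. f (X i) x) \<longlonglongrightarrow> l x"
      using lim
    proof eventually_elim
      case (elim x)
      then show ?case using X unfolding tendsto_at_iff_sequentially by (auto simp: o_def)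
    qed
    then show ?thesis
      using integral_dominated_convergence[where w = w and f = l and s = "\<lambda>i. f (X i)" and M = M, OF meas(1) meas(2)[OF X(1)] w _ bound[OF X(1)]]
        integrable_dominated_convergence[where w = w and f = l and s = "\<lambda>i. f (X i)" and M = M, OF meas(1) meas(2)[OF X(1)] w _ bound[OF X(1)]] by blast
  qed
  show "((\<lambda>t. integral\<^sup>L M (f t)) \<longlongrightarrow> integral\<^sup>L M l) (at a within S)"
    unfolding tendsto_at_iff_sequentially using seq by (auto simp: o_def)
  show "integrable M l \<or> at a within S = bot"
  proof (cases "at a within S = bot")
    case False
    then have "a islimpt S" by (simp add: trivial_limit_within)
    then obtain X where "\<And>i. X i \<in> S - {a}" "X \<longlonglongrightarrow> a" using islimpt_sequential by blast
    then show ?thesis using seq by auto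
  qed auto
qed

text \<open>The mean value inequality on the convex set \<open>U\<close> turns the bound
  \<open>w\<close> on the derivatives into a bound on the difference quotients, so dominated
  convergence applies to them.\<close>

lemma has_real_derivative_integral:
  fixes f f' :: "real \<Rightarrow> 'a \<Rightarrow> real"
  assumes U: "open U" "convex U" "x0 \<in> U"
    and int: "\<And>x. x \<in> U \<Longrightarrow> integrable M (f x)"
    and deriv: "\<And>x u. x \<in> U \<Longrightarrow> u \<in> space M \<Longrightarrow> ((\<lambda>x. f x u) has_real_derivative f' x u) (at x)"
    and meas: "f' x0 \<in> borel_measurable M"
    and bound: "\<And>x u. x \<in> U \<Longrightarrow> u \<in> space M \<Longrightarrow> \<bar>f' x u\<bar> \<le> w u" and w: "integrable M w"
  shows "((\<lambda>x. \<integral>u. f x u \<partial>M) has_real_derivative (\<integral>u. f' x0 u \<partial>M)) (at x0)"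
proof -
  have "((\<lambda>x. \<integral>u. (f x u - f x0 u) / (x - x0) \<partial>M) \<longlongrightarrow> (\<integral>u. f' x0 u \<partial>M)) (at x0 within U)"
  proof (rule integral_dominated_convergence_at[where w = w])
    show "AE u in M. ((\<lambda>x. (f x u - f x0 u) / (x - x0)) \<longlongrightarrow> f' x0 u) (at x0 within U)"
    proof (rule AE_I2)
      fix u assume "u \<in> space M"
      from deriv[OF U(3) this] show "((\<lambda>x. (f x u - f x0 u) / (x - x0)) \<longlongrightarrow> f' x0 u) (at x0 within U)"
        unfolding has_field_derivative_iff by (rule tendsto_within_subset) simp
    qed
    show "AE u in M. norm ((f x u - f x0 u) / (x - x0)) \<le> w u" if "x \<in> U - {x0}" for x
    proof (rule AE_I2)
      fix u assume u: "u \<in> space M"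
      have "norm (f x u - f x0 u) \<le> w u * norm (x - x0)"
        by (rule field_differentiable_bound[OF U(2)])
           (use that U u deriv bound in \<open>auto intro: has_field_derivative_at_within\<close>)
      then show "norm ((f x u - f x0 u) / (x - x0)) \<le> w u"
        using that by (simp add: divide_simps)
    qed
  qed (use meas w int U in auto)
  also have "?this \<longleftrightarrow> (((\<lambda>x. ((\<integral>u. f x u \<partial>M) - (\<integral>u. f x0 u \<partial>M)) / (x - x0)) \<longlongrightarrow> (\<integral>u. f' x0 u \<partial>M)) (at x0 within U))"
    using int U by (intro filterlim_cong refl) (simp add: eventually_at_filter)
  finally show ?thesis
    unfolding has_field_derivative_iff at_within_open[OF U(3,1)] .
qed

section \<open>Radial derivatives of Gaussians\<close>

text \<open>This is (-1)^j times the j-th derivative of 2 arcosh(x) / sqrt(x^2 - 1). The integral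
  form shows the alternating signs of the derivatives and is regular at x = 1, where the closed form
  is singular.\<close>

definition cm_moment :: "nat \<Rightarrow> real \<Rightarrow> real" where
  "cm_moment j x = 4 * fact j * integral {0..1} (\<lambda>v. (2 * v) ^ j / (v\<^sup>2 + 2 * x * v + 1) ^ Suc j)"

lemma cm_denominator_pos: "0 < v\<^sup>2 + 2 * x * v + (1::real)" if "0 < x" "0 \<le> v"
  using that by (intro add_nonneg_pos add_nonneg_nonneg) auto

lemma cm_moment_integrable:
  "0 < x \<Longrightarrow> (\<lambda>v. (2 * v) ^ j / (v\<^sup>2 + 2 * x * v + 1) ^ Suc j) integrable_on {0..1::real}"
  using cm_denominator_pos[of x] by (intro integrable_continuous_real continuous_intros) (auto simp: less_imp_neq[symmetric] simp del: power_Suc)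

lemma has_real_derivative_cm_moment:
  assumes "0 < x"
  shows "(cm_moment j has_real_derivative - cm_moment (Suc j) x) (at x)"
proof -
  define f where "f = (\<lambda>x v::real. (2 * v) ^ j / (v\<^sup>2 + 2 * x * v + 1) ^ Suc j)"
  define f' where "f' = (\<lambda>x v::real. - real (Suc j) * ((2 * v) ^ Suc j / (v\<^sup>2 + 2 * x * v + 1) ^ Suc (Suc j)))"
  have nz: "v\<^sup>2 + 2 * x * v + 1 \<noteq> 0" if "0 < x" "0 \<le> v" for x v :: real
    using cm_denominator_pos[OF that] by simp
  have "((\<lambda>x. integral (cbox 0 1) (f x)) has_field_derivative integral (cbox 0 1) (f' x)) (at x within {0<..})"
  proof (rule leibniz_rule_field_derivative)
    fix y t :: real assume "y \<in> {0<..}" "t \<in> cbox 0 1"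
    then have d: "t\<^sup>2 + 2 * y * t + 1 \<noteq> 0" using nz by auto
    define D where "D = t\<^sup>2 + 2 * y * t + 1"
    have dD: "D \<noteq> 0" using d by (simp add: D_def)
    have "((\<lambda>y. (2 * t) ^ j * inverse (t\<^sup>2 + 2 * y * t + 1) ^ Suc j) has_field_derivative
       (2*t)^j * (real (Suc j) * inverse D ^ j * (- (inverse D * (2 * t) * inverse D)))) (at y within {0<..})"
      unfolding D_def by (rule derivative_eq_intros refl d | simp)+
    moreover have "(2*t)^j * (real (Suc j) * inverse D ^ j * (- (inverse D * (2 * t) * inverse D))) = f' y t"
      unfolding f'_def D_def[symmetric] using dD by (simp add: field_simps)
    ultimately show "((\<lambda>y. f y t) has_field_derivative f' y t) (at y within {0<..})"
      by (simp add: f_def divide_inverse power_inverse)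
  next
    show "f y integrable_on cbox 0 1" if "y \<in> {0<..}" for y
      using cm_moment_integrable[of y j] that by (simp add: f_def)
    show "continuous_on ({0<..} \<times> cbox 0 1) (\<lambda>(x, t). f' x t)"
      using nz unfolding f'_def case_prod_beta by (intro continuous_intros) (auto simp del: power_Suc)
  qed (use assms in auto)
  then have "((\<lambda>x. 4 * fact j * integral (cbox 0 1) (f x)) has_field_derivative 4 * fact j * integral (cbox 0 1) (f' x)) (at x)"
    using assms by (intro DERIV_cmult) (simp add: at_within_open[of x "{0<..}"])
  moreover have "4 * fact j * integral (cbox 0 1) (f' x) = - cm_moment (Suc j) x"
    unfolding f'_def cm_moment_def integral_mult_right by (simp add: fact_Suc algebra_simps del: power_Suc)
  moreover have "(\<lambda>x. 4 * fact j * integral (cbox 0 1) (f x)) = cm_moment j"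
    by (simp add: cm_moment_def f_def fun_eq_iff del: power_Suc)
  ultimately show ?thesis by simp
qed

lemma cm_moment_nonneg: "0 < x \<Longrightarrow> 0 \<le> cm_moment j x"
  unfolding cm_moment_def using cm_denominator_pos[of x]
  by (intro mult_nonneg_nonneg integral_nonneg cm_moment_integrable) (auto simp: less_imp_le)

text \<open>The denominator is at least 1 + x v, hence at least (x v)^(3/4), and v^(-3/4) has
  integral 4 over the unit interval. The exponent lies strictly between 1/2 and 1: below 1 for this
  integrability, above 1/2 so that the Abel integral of the decay converges.\<close>

lemma cm_moment_le:
  assumes "1 \<le> x"
  shows "cm_moment j x \<le> 16 * fact j * 2 ^ j * x powr - (3/4)"
proof -
  \<comment> \<open>At v = 0 the integrand is 0^j, which is 1 for j = 0, whereas \<open>powr\<close>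
    with base 0 gives 0; hence the separate value 1.\<close>
  define g where "g = (\<lambda>v::real. if v = 0 then 1 else 2 ^ j * x powr - (3/4) * v powr - (3/4))"
  have "((\<lambda>v. v powr - (3/4)) has_integral 4) {0..1::real}"
    using has_integral_powr_from_0[of "- (3/4)" 1] by simp
  then have "((\<lambda>v. 2 ^ j * x powr - (3/4) * v powr - (3/4)) has_integral 2 ^ j * x powr - (3/4) * 4) {0..1::real}"
    by (rule has_integral_mult_right)
  then have hi: "(g has_integral 2 ^ j * x powr - (3/4) * 4) {0..1::real}"
    by (rule has_integral_spike_finite[rotated 2, of _ _ _ "{0}"]) (auto simp: g_def)
  have "integral {0..1} (\<lambda>v. (2 * v) ^ j / (v\<^sup>2 + 2 * x * v + 1) ^ Suc j) \<le> integral {0..1} g"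
  proof (intro integral_le cm_moment_integrable)
    show "g integrable_on {0..1}" using hi by blast
    fix v :: real assume v: "v \<in> {0..1}"
    show "(2 * v) ^ j / (v\<^sup>2 + 2 * x * v + 1) ^ Suc j \<le> g v"
    proof (cases "v = 0")
      case True
      then show ?thesis by (simp add: g_def power_0_left)
    next
      case False
      with v assms have pos: "0 < v" "v \<le> 1" "0 < x * v" by auto
      have D: "1 + x * v \<le> v\<^sup>2 + 2 * x * v + 1"
        using add_nonneg_nonneg[OF less_imp_le[OF pos(3)] zero_le_power2[of v]] by (simp add: mult.commute)
      have "(x * v) powr (3/4) \<le> 1 + x * v"
      proof (cases "x * v \<le> 1")
        case True
        then have "(x * v) powr (3/4) \<le> 1" using pos by (intro powr_le1) auto
        then show ?thesis using pos by linarith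
      next
        case False
        then have "(x * v) powr (3/4) \<le> (x * v) powr 1" by (intro powr_mono) auto
        then show ?thesis using pos by simp
      qed
      then have D': "(x * v) powr (3/4) \<le> v\<^sup>2 + 2 * x * v + 1" using D by linarith
      have "(2 * v) ^ j / (v\<^sup>2 + 2 * x * v + 1) ^ Suc j \<le> 2 ^ j / (x * v) powr (3/4)"
      proof (rule frac_le)
        show "(2 * v) ^ j \<le> 2 ^ j" using pos by (intro power_mono) auto
        show "0 < (x * v) powr (3/4)" using pos by auto
        have "1 \<le> (v\<^sup>2 + 2 * x * v + 1) ^ j" using D pos by (intro one_le_power) linarith
        then have "(v\<^sup>2 + 2 * x * v + 1) * 1 \<le> (v\<^sup>2 + 2 * x * v + 1) * (v\<^sup>2 + 2 * x * v + 1) ^ j"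
          using D pos by (intro mult_left_mono) linarith+
        then show "(x * v) powr (3/4) \<le> (v\<^sup>2 + 2 * x * v + 1) ^ Suc j" using D' by simp
      qed auto
      then show ?thesis using pos assms False by (simp add: g_def powr_minus_divide powr_mult)
    qed
  qed (use assms in auto)
  also have "\<dots> = 2 ^ j * x powr - (3/4) * 4" using hi by (rule integral_unique)
  finally have "4 * fact j * integral {0..1} (\<lambda>v. (2 * v) ^ j / (v\<^sup>2 + 2 * x * v + 1) ^ Suc j) \<le> 4 * fact j * (2 ^ j * x powr - (3/4) * 4)"
    by (rule mult_left_mono) simp
  then show ?thesis by (simp add: cm_moment_def algebra_simps)
qed

text \<open>The denominator v^2 + 2 v cosh r + 1 factors as (v + exp(-r)) (v + exp r), so partial
  fractions give an antiderivative made of logarithms. Both sides are odd in r, which settles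
  negative arguments.\<close>

lemma cm_moment_0_cosh: "cm_moment 0 (cosh r) * sinh r = 2 * r"
proof -
  have pos: "cm_moment 0 (cosh r) * sinh r = 2 * r" if "0 < r" for r :: real
  proof -
    define F where "F = (\<lambda>v. (ln (v + exp (- r)) - ln (v + exp r)) / (2 * sinh r))"
    have s: "sinh r > 0" using that by simp
    have "((\<lambda>v. 1 / (v\<^sup>2 + 2 * cosh r * v + 1)) has_integral F 1 - F 0) {0..1}"
    proof (rule fundamental_theorem_of_calculus)
      fix v :: real assume v: "v \<in> {0..1}"
      then have p: "0 < v + exp (- r)" "0 < v + exp r" by (auto intro: add_nonneg_pos)
      have e: "exp r * exp (- r) = 1" by (simp flip: exp_add)
      have eq: "v\<^sup>2 + 2 * cosh r * v + 1 = (v + exp (- r)) * (v + exp r)"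
        using e by (simp add: cosh_def algebra_simps power2_eq_square)
      have "((\<lambda>v. ln (v + exp (- r)) - ln (v + exp r)) has_real_derivative (1 / (v + exp (- r)) - 1 / (v + exp r))) (at v within {0..1})"
        using p by (auto intro!: derivative_eq_intros)
      then have "(F has_real_derivative (1 / (v + exp (- r)) - 1 / (v + exp r)) / (2 * sinh r)) (at v within {0..1})"
        unfolding F_def by (rule DERIV_cdivide)
      also have "(1 / (v + exp (- r)) - 1 / (v + exp r)) / (2 * sinh r) = 1 / (v\<^sup>2 + 2 * cosh r * v + 1)"
      proof -
        have "1 / (v + exp (- r)) - 1 / (v + exp r) = (exp r - exp (- r)) / ((v + exp (- r)) * (v + exp r))"
          using p by (simp add: diff_frac_eq)
        also have "\<dots> = 2 * sinh r / (v\<^sup>2 + 2 * cosh r * v + 1)"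
        proof -
          have "exp r - exp (- r) = 2 * sinh r" by (simp add: sinh_def)
          then show ?thesis unfolding eq by simp
        qed
        finally show ?thesis using s by simp
      qed
      finally show "(F has_vector_derivative 1 / (v\<^sup>2 + 2 * cosh r * v + 1)) (at v within {0..1})"
        by (simp add: has_real_derivative_iff_has_vector_derivative)
    qed simp
    then have "cm_moment 0 (cosh r) = 4 * (F 1 - F 0)"
      by (simp add: cm_moment_def integral_unique)
    moreover have "1 + exp r = exp r * (1 + exp (- r))" by (simp add: algebra_simps flip: exp_add)
    then have "ln (1 + exp r) = r + ln (1 + exp (- r))"
      using add_pos_pos[of 1 "exp (- r)"] by (simp add: ln_mult)
    then have "F 1 - F 0 = r / (2 * sinh r)"
      by (simp add: F_def diff_divide_distrib[symmetric] add_divide_distrib[symmetric])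
    ultimately show ?thesis using s by simp
  qed
  show ?thesis
    using pos[of r] pos[of "-r"] by (cases "r = 0"; cases "0 < r") (auto simp: sinh_minus cosh_minus)
qed

text \<open>\<open>l * cm_moment 0\<close> is the derivative of \<open>l * (arcosh x)\<^sup>2\<close>, a Bernstein function. The class
  below is closed under \<open>- d/dx\<close> and contains, after division by \<open>exp (- l * (arcosh x)\<^sup>2)\<close>, all the
  functions \<open>(- d/dx)\<^sup>m exp (- l * (arcosh x)\<^sup>2)\<close> with \<open>m \<ge> 1\<close>.\<close>

inductive_set cm_class :: "(real \<Rightarrow> real \<Rightarrow> real) set" where
  moment: "(\<lambda>l x. l * cm_moment j x) \<in> cm_class"
| add: "f \<in> cm_class \<Longrightarrow> g \<in> cm_class \<Longrightarrow> (\<lambda>l x. f l x + g l x) \<in> cm_class"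
| mult: "f \<in> cm_class \<Longrightarrow> g \<in> cm_class \<Longrightarrow> (\<lambda>l x. f l x * g l x) \<in> cm_class"

lemma cm_class_deriv:
  assumes "f \<in> cm_class"
  shows "\<exists>g\<in>cm_class. \<forall>l. \<forall>x>0. (f l has_real_derivative - g l x) (at x)"
  using assms
proof induction
  case (moment j)
  have "((\<lambda>x. l * cm_moment j x) has_real_derivative - (l * cm_moment (Suc j) x)) (at x)" if "0 < x" for l x
    using DERIV_cmult[OF has_real_derivative_cm_moment[OF that], of l] by simp
  then show ?case using cm_class.moment[of "Suc j"] by (auto intro!: bexI)
next
  case (add f g)
  then obtain f' g' where *: "f' \<in> cm_class" "g' \<in> cm_class"
    "\<And>l x. x > 0 \<Longrightarrow> (f l has_real_derivative - f' l x) (at x)"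
    "\<And>l x. x > 0 \<Longrightarrow> (g l has_real_derivative - g' l x) (at x)" by metis
  show ?case
    by (rule bexI[OF _ cm_class.add[OF *(1,2)]]) (auto intro!: derivative_eq_intros *(3,4))
next
  case (mult f g)
  then obtain f' g' where *: "f' \<in> cm_class" "g' \<in> cm_class"
    "\<And>l x. x > 0 \<Longrightarrow> (f l has_real_derivative - f' l x) (at x)"
    "\<And>l x. x > 0 \<Longrightarrow> (g l has_real_derivative - g' l x) (at x)" by metis
  show ?case
    by (rule bexI[OF _ cm_class.add[OF cm_class.mult[OF *(1) mult.hyps(2)] cm_class.mult[OF mult.hyps(1) *(2)]]])
       (auto intro!: derivative_eq_intros *(3,4))
qed

lemma cm_class_nonneg: "f \<in> cm_class \<Longrightarrow> 0 \<le> l \<Longrightarrow> 0 < x \<Longrightarrow> 0 \<le> f l x"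
  by (induction rule: cm_class.induct) (auto intro!: mult_nonneg_nonneg add_nonneg_nonneg cm_moment_nonneg)

lemma cm_class_bound:
  assumes "f \<in> cm_class"
  shows "\<exists>C\<ge>0. \<exists>k. \<forall>l\<ge>0. \<forall>x\<ge>1. f l x \<le> C * (1 + l) ^ k * x powr - (3/4)"
  using assms
proof induction
  case (moment j)
  show ?case
  proof (intro exI[of _ "16 * fact j * 2 ^ j :: real"] exI[of _ "1::nat"] conjI allI impI)
    fix l x :: real assume "0 \<le> l" "1 \<le> x"
    then show "l * cm_moment j x \<le> 16 * fact j * 2 ^ j * (1 + l) ^ 1 * x powr - (3 / 4)"
      using mult_mono[OF _ cm_moment_le[of x j], of l "1 + l"] cm_moment_nonneg[of x j] by (simp add: algebra_simps)
  qed simp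
next
  case (add f g)
  then obtain C k D m where *: "C \<ge> 0" "D \<ge> 0"
    "\<And>l x. l \<ge> 0 \<Longrightarrow> x \<ge> 1 \<Longrightarrow> f l x \<le> C * (1 + l) ^ k * x powr - (3/4)"
    "\<And>l x. l \<ge> 0 \<Longrightarrow> x \<ge> 1 \<Longrightarrow> g l x \<le> D * (1 + l) ^ m * x powr - (3/4)" by metis
  show ?case
  proof (intro exI[of _ "C + D"] exI[of _ "max k m"] conjI allI impI)
    fix l x :: real assume lx: "0 \<le> l" "1 \<le> x"
    have "C * (1 + l) ^ k * x powr - (3/4) \<le> C * (1 + l) ^ max k m * x powr - (3/4)"
      "D * (1 + l) ^ m * x powr - (3/4) \<le> D * (1 + l) ^ max k m * x powr - (3/4)"
      using * lx by (auto intro!: mult_right_mono mult_left_mono power_increasing)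
    then show "f l x + g l x \<le> (C + D) * (1 + l) ^ max k m * x powr - (3 / 4)"
      using *(3,4)[OF lx] by (simp add: algebra_simps)
  qed (use * in auto)
next
  case (mult f g)
  then obtain C k D m where *: "C \<ge> 0" "D \<ge> 0"
    "\<And>l x. l \<ge> 0 \<Longrightarrow> x \<ge> 1 \<Longrightarrow> f l x \<le> C * (1 + l) ^ k * x powr - (3/4)"
    "\<And>l x. l \<ge> 0 \<Longrightarrow> x \<ge> 1 \<Longrightarrow> g l x \<le> D * (1 + l) ^ m * x powr - (3/4)" by metis
  show ?case
  proof (intro exI[of _ "C * D"] exI[of _ "k + m"] conjI allI impI)
    fix l x :: real assume lx: "0 \<le> l" "1 \<le> x"
    have "f l x * g l x \<le> (C * (1 + l) ^ k * x powr - (3/4)) * (D * (1 + l) ^ m * x powr - (3/4))"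
      using * lx cm_class_nonneg[OF mult.hyps(1), of l x] cm_class_nonneg[OF mult.hyps(2), of l x]
      by (intro mult_mono) auto
    \<comment> \<open>One factor of decay is kept; the other is at most 1 because
      \<open>x >= 1\<close>.\<close>
    also have "\<dots> \<le> (C * (1 + l) ^ k * x powr - (3/4)) * (D * (1 + l) ^ m * 1)"
      using * lx powr_mono[of "-(3/4)" 0 x] by (intro mult_left_mono) auto
    finally show "f l x * g l x \<le> (C * D) * (1 + l) ^ (k + m) * x powr - (3 / 4)"
      by (simp add: algebra_simps power_add)
  qed (use * in auto)
qed

lemma cm_class_continuous:
  "f \<in> cm_class \<Longrightarrow> continuous_on (UNIV \<times> {0<..}) (\<lambda>z. f (fst z) (snd z))"
proof (induction rule: cm_class.induct)
  case (moment j)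
  have "continuous_on {0<..} (cm_moment j)"
    by (intro continuous_at_imp_continuous_on ballI DERIV_isCont[OF has_real_derivative_cm_moment]) auto
  then have "continuous_on (UNIV \<times> {0<..}) (\<lambda>z::real \<times> real. cm_moment j (snd z))"
    by (rule continuous_on_compose2) (auto intro: continuous_intros)
  then show ?case by (intro continuous_intros)
qed (auto intro: continuous_on_add continuous_on_mult)

text \<open>A choice of the negative derivative that again belongs to the class and serves all
  \<open>l\<close> at once, so that differentiation can be iterated inside the class.\<close>

definition cm_neg_deriv :: "(real \<Rightarrow> real \<Rightarrow> real) \<Rightarrow> real \<Rightarrow> real \<Rightarrow> real" where
  "cm_neg_deriv f = (SOME g. g \<in> cm_class \<and> (\<forall>l. \<forall>x>0. (f l has_real_derivative - g l x) (at x)))"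

lemma cm_neg_deriv:
  assumes "f \<in> cm_class"
  shows "cm_neg_deriv f \<in> cm_class" "\<And>l x. 0 < x \<Longrightarrow> (f l has_real_derivative - cm_neg_deriv f l x) (at x)"
  using someI_ex[of "\<lambda>g. g \<in> cm_class \<and> (\<forall>l. \<forall>x>0. (f l has_real_derivative - g l x) (at x))"] cm_class_deriv[OF assms]
  unfolding cm_neg_deriv_def[symmetric] by blast+

text \<open>The product rule for -d/dx applied to a prefactor times exp(-l arcosh(x)^2): the first
  summand differentiates the prefactor, the second the exponential. Index 0 already stands for the
  first derivative, because the constant prefactor 1 is not in the class.\<close>

primrec cm_iter :: "nat \<Rightarrow> real \<Rightarrow> real \<Rightarrow> real" where
  "cm_iter 0 = (\<lambda>l x. l * cm_moment 0 x)"
| "cm_iter (Suc m) = (\<lambda>l x. cm_neg_deriv (cm_iter m) l x + (l * cm_moment 0 x) * cm_iter m l x)"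

lemma cm_iter_in_class: "cm_iter m \<in> cm_class"
  by (induction m) (simp_all add: cm_class.intros cm_neg_deriv)

text \<open>The m-fold iterate of -(1 / sinh r) d/dr on exp(-l r^2), in a form that makes sense at r
  = 0 too. \<open>Suc m\<close> goes with \<open>cm_iter m\<close> since the latter counts from the
  first derivative.\<close>

fun gauss_deriv :: "nat \<Rightarrow> real \<Rightarrow> real \<Rightarrow> real" where
  "gauss_deriv 0 l r = exp (- l * r\<^sup>2)"
| "gauss_deriv (Suc m) l r = cm_iter m l (cosh r) * exp (- l * r\<^sup>2)"

text \<open>The factor 2 r from the exponent is rewritten as
  \<open>cm_moment 0 (cosh r) * sinh r\<close>; thus \<open>sinh r\<close> factors out and no
  division occurs at r = 0.\<close>

lemma has_real_derivative_gauss_deriv: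
  "(gauss_deriv m l has_real_derivative - sinh r * gauss_deriv (Suc m) l r) (at r)"
proof (cases m)
  case 0
  have "(gauss_deriv 0 l has_real_derivative exp (- l * r\<^sup>2) * (- l * (2 * r))) (at r)"
    unfolding gauss_deriv.simps by (auto intro!: derivative_eq_intros simp: power2_eq_square)
  moreover have "exp (- l * r\<^sup>2) * (- l * (2 * r)) = - sinh r * gauss_deriv (Suc 0) l r"
  proof -
    have "exp (- l * r\<^sup>2) * (- l * (2 * r)) = - (exp (- l * r\<^sup>2) * l) * (cm_moment 0 (cosh r) * sinh r)"
      by (simp only: cm_moment_0_cosh) simp
    then show ?thesis by (simp only: gauss_deriv.simps cm_iter.simps) simp
  qed
  ultimately show ?thesis using 0 by (simp only:)
next
  case (Suc k)
  have "((\<lambda>r. cm_iter k l (cosh r)) has_real_derivative - cm_neg_deriv (cm_iter k) l (cosh r) * sinh r) (at r)"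
    by (rule DERIV_chain2[OF cm_neg_deriv(2)[OF cm_iter_in_class]]) (auto intro!: derivative_eq_intros)
  then have "(gauss_deriv (Suc k) l has_real_derivative
     - cm_neg_deriv (cm_iter k) l (cosh r) * sinh r * exp (- l * r\<^sup>2) + cm_iter k l (cosh r) * (exp (- l * r\<^sup>2) * (- l * (2 * r)))) (at r)"
    unfolding gauss_deriv.simps by (auto intro!: derivative_eq_intros simp: power2_eq_square)
  moreover have "- l * (2 * r) = - sinh r * (l * cm_moment 0 (cosh r))"
    by (simp add: cm_moment_0_cosh[symmetric])
  ultimately show ?thesis using Suc by (simp only: cm_iter.simps gauss_deriv.simps) (simp add: algebra_simps)
qed

lemma gauss_deriv_nonneg: "0 \<le> l \<Longrightarrow> 0 \<le> gauss_deriv m l r"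
  by (cases m) (auto intro!: mult_nonneg_nonneg cm_class_nonneg[OF cm_iter_in_class])

lemma gauss_deriv_bound:
  obtains C k where "0 \<le> C" "\<And>l r. 0 \<le> l \<Longrightarrow> gauss_deriv (Suc m) l r \<le> C * (1 + l) ^ k * cosh r powr - (3/4) * exp (- l * r\<^sup>2)"
proof -
  obtain C k where C: "C \<ge> 0" "\<And>l x. l \<ge> 0 \<Longrightarrow> x \<ge> 1 \<Longrightarrow> cm_iter m l x \<le> C * (1 + l) ^ k * x powr - (3/4)"
    using cm_class_bound[OF cm_iter_in_class[of m]] by metis
  show ?thesis
    by (rule that[of C k]) (use C cosh_real_ge_1 in \<open>simp_all add: mult.assoc [symmetric] del: mult.assoc\<close>)
qed

lemma gauss_deriv_continuous: "continuous_on UNIV (\<lambda>z. gauss_deriv m (fst z) (snd z))"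
proof (cases m)
  case (Suc k)
  have "continuous_on UNIV (\<lambda>z::real \<times> real. cm_iter k (fst z) (cosh (snd z)))"
  proof -
    have "continuous_on UNIV (\<lambda>z::real \<times> real. (fst z, cosh (snd z)))"
      by (intro continuous_intros)
    moreover have "range (\<lambda>z::real \<times> real. (fst z, cosh (snd z))) \<subseteq> UNIV \<times> {0<..}" by auto
    ultimately show ?thesis
      using continuous_on_compose2[OF cm_class_continuous[OF cm_iter_in_class[of k]]] by fastforce
  qed
  then have "continuous_on UNIV (\<lambda>z. cm_iter k (fst z) (cosh (snd z)) * exp (- fst z * (snd z)\<^sup>2))"
    by (intro continuous_intros)
  then show ?thesis using Suc by simp
next
  case 0
  then show ?thesis by (simp, intro continuous_intros)
qed

lemma gauss_deriv_measurable [measurable]: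
  assumes [measurable]: "f \<in> borel_measurable M" "g \<in> borel_measurable M"
  shows "(\<lambda>x. gauss_deriv m (f x) (g x)) \<in> borel_measurable M"
  using borel_measurable_continuous_on[OF gauss_deriv_continuous[of m], of "\<lambda>x. (f x, g x)" M] by simp

section \<open>Mass of the heat profiles\<close>

lemma sinh_borel [measurable]: "sinh \<in> borel_measurable (borel :: real measure)"
  by (intro borel_measurable_continuous_onI continuous_intros)

lemma cosh_borel [measurable]: "cosh \<in> borel_measurable (borel :: real measure)"
  by (intro borel_measurable_continuous_onI continuous_intros)

lemma sinh_square_versine: "(sinh r)\<^sup>2 = (cosh r - 1)\<^sup>2 + 2 * (cosh r - 1)" for r :: real
  unfolding sinh_square_eq by (simp add: power2_eq_square algebra_simps)

lemma versine_half: "cosh r - 1 = 2 * (sinh (r / 2))\<^sup>2" for r :: real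
  using cosh_double[of "r / 2"] by (simp add: cosh_square_eq)

lemma sinh_half: "sinh r = 2 * sinh (r / 2) * cosh (r / 2)" for r :: real
  using sinh_double[of "r / 2"] by simp

lemma versine_nonneg: "0 \<le> cosh r - 1" for r :: real
  using cosh_real_ge_1[of r] by simp

lemma gauss_deriv_le_exp:
  obtains C k where "0 \<le> C" "\<And>l r. 0 \<le> l \<Longrightarrow> gauss_deriv m l r \<le> C * (1 + l) ^ k * exp (- l * r\<^sup>2)"
proof (cases m)
  case 0
  show ?thesis by (rule that[of 1 0]) (auto simp: 0)
next
  case (Suc k)
  obtain C j where C: "0 \<le> C" "\<And>l r. 0 \<le> l \<Longrightarrow> gauss_deriv (Suc k) l r \<le> C * (1 + l) ^ j * cosh r powr - (3/4) * exp (- l * r\<^sup>2)"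
    using gauss_deriv_bound by blast
  show ?thesis
  proof (rule that[OF C(1)])
    fix l r :: real assume l: "0 \<le> l"
    have "cosh r powr - (3/4) \<le> cosh r powr 0" by (intro powr_mono cosh_real_ge_1) auto
    then have "C * (1 + l) ^ j * cosh r powr - (3/4) * exp (- l * r\<^sup>2) \<le> C * (1 + l) ^ j * 1 * exp (- l * r\<^sup>2)"
      using C l by (intro mult_right_mono mult_left_mono) auto
    then show "gauss_deriv m l r \<le> C * (1 + l) ^ j * exp (- l * r\<^sup>2)" using C(2)[OF l, of r] Suc by (simp del: gauss_deriv.simps)
  qed
qed

lemma gauss_deriv_tendsto_0:
  assumes "0 < l"
  shows "(gauss_deriv m l \<longlongrightarrow> 0) at_top"
proof -
  obtain C k where C: "0 \<le> C" "\<And>l r. 0 \<le> l \<Longrightarrow> gauss_deriv m l r \<le> C * (1 + l) ^ k * exp (- l * r\<^sup>2)"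
    using gauss_deriv_le_exp by blast
  have "((\<lambda>r. exp (- l * r\<^sup>2)) \<longlongrightarrow> 0) at_top"
  proof (rule filterlim_compose[OF exp_at_bot])
    have "filterlim (\<lambda>r::real. r\<^sup>2) at_top at_top" by (rule filterlim_pow_at_top) (auto simp: filterlim_ident)
    then show "filterlim (\<lambda>r::real. - l * r\<^sup>2) at_bot at_top"
      using filterlim_tendsto_neg_mult_at_bot[OF tendsto_const, of "- l"] assms by simp
  qed
  then have "((\<lambda>r. C * (1 + l) ^ k * exp (- l * r\<^sup>2)) \<longlongrightarrow> 0) at_top" by (rule tendsto_mult_right_zero)
  then show ?thesis
    by (rule tendsto_sandwich[OF _ _ tendsto_const, rotated 2]) (use assms C gauss_deriv_nonneg in auto)
qed

text \<open>One integration by parts lowers the number of radial derivatives. The boundary term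
  vanishes at infinity by Gaussian decay and at 0 by the condition on the test function.\<close>

lemma gauss_deriv_by_parts:
  assumes l: "0 < l" and [measurable]: "\<psi> \<in> borel_measurable borel" "\<psi>' \<in> borel_measurable borel"
    and \<psi>: "\<And>x. 0 \<le> x \<Longrightarrow> (\<psi> has_real_derivative \<psi>' x) (at x)" "\<And>x. 0 \<le> x \<Longrightarrow> 0 \<le> \<psi>' x" "\<psi> 0 = 0"
  shows "(\<integral>\<^sup>+r. ennreal (sinh r * gauss_deriv (Suc m) l r * \<psi> r) * indicator {0..} r \<partial>lborel) =
    (\<integral>\<^sup>+r. ennreal (gauss_deriv m l r * \<psi>' r) * indicator {0..} r \<partial>lborel)"
  by (rule nn_integral_by_parts_half_line)
     (use has_real_derivative_gauss_deriv[of m l] l \<psi> in \<open>auto intro!: gauss_deriv_tendsto_0 mult_nonneg_nonneg gauss_deriv_nonneg simp del: gauss_deriv.simps\<close>)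

text \<open>For n = 2 k + 1 the volume density is sinh^(2k). A power of cosh r - 1 is carried along
  because each integration by parts may raise it.\<close>

definition odd_mass :: "real \<Rightarrow> nat \<Rightarrow> nat \<Rightarrow> ennreal" where
  "odd_mass l k j = (\<integral>\<^sup>+r. ennreal (gauss_deriv k l r * sinh r ^ (2 * k) * (cosh r - 1) ^ j) * indicator {0..} r \<partial>lborel)"

text \<open>With v = cosh r - 1 one has cosh r = 1 + v and (sinh r)^2 = v^2 + 2 v. The derivative of
  sinh^(2k+1) v^j is therefore sinh^(2k) times a combination of v^j and v^(j+1), with the stated
  coefficients.\<close>

lemma odd_mass_Suc:
  assumes l: "0 < l"
  shows "odd_mass l (Suc k) j = ennreal (2 * k + 1 + 2 * j) * odd_mass l k j + ennreal (2 * k + 1 + j) * odd_mass l k (Suc j)"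
proof -
  define \<psi> where "\<psi> = (\<lambda>r::real. sinh r ^ (2 * k + 1) * (cosh r - 1) ^ j)"
  define \<psi>' where "\<psi>' = (\<lambda>r::real. sinh r ^ (2 * k) * (real (2 * k + 1 + 2 * j) * (cosh r - 1) ^ j + real (2 * k + 1 + j) * (cosh r - 1) ^ Suc j))"
  have D: "(\<psi> has_real_derivative \<psi>' r) (at r)" for r
  proof -
    define v where "v = cosh r - 1"
    have "(\<psi> has_real_derivative (real (2 * k + 1) * (sinh r ^ (2 * k) * cosh r) * (cosh r - 1) ^ j
        + real j * ((cosh r - 1) ^ (j - 1) * sinh r) * sinh r ^ (2 * k + 1))) (at r)"
    proof -
      have "((\<lambda>r. sinh r ^ Suc (2 * k)) has_real_derivative (1 + real (2 * k)) * (cosh r * sinh r ^ (2 * k))) (at r)"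
        by (rule DERIV_power_Suc) (auto intro!: derivative_eq_intros)
      moreover have "((\<lambda>r. (cosh r - 1) ^ j) has_real_derivative real j * ((cosh r - 1) ^ (j - 1) * sinh r)) (at r)"
        by (auto intro!: derivative_eq_intros)
      ultimately show ?thesis
        unfolding \<psi>_def by (auto intro!: derivative_eq_intros simp del: power_Suc simp: mult_ac)
    qed
    moreover have "real (2 * k + 1) * (sinh r ^ (2 * k) * cosh r) * (cosh r - 1) ^ j
        + real j * ((cosh r - 1) ^ (j - 1) * sinh r) * sinh r ^ (2 * k + 1)
      = sinh r ^ (2 * k) * (real (2 * k + 1) * (1 + v) * v ^ j + real j * v ^ (j - 1) * (sinh r)\<^sup>2)"
      by (simp add: v_def algebra_simps power2_eq_square)
    moreover have "real j * v ^ (j - 1) * (sinh r)\<^sup>2 = real j * v ^ Suc j + real (2 * j) * v ^ j"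
      unfolding sinh_square_versine by (cases j) (simp_all add: v_def algebra_simps power2_eq_square)
    moreover have "sinh r ^ (2 * k) * (real (2 * k + 1) * (1 + v) * v ^ j + (real j * v ^ Suc j + real (2 * j) * v ^ j)) = \<psi>' r"
      unfolding \<psi>'_def v_def[symmetric] by (simp add: algebra_simps)
    ultimately show ?thesis by (simp only:)
  qed
  have "odd_mass l (Suc k) j = (\<integral>\<^sup>+r. ennreal (sinh r * gauss_deriv (Suc k) l r * \<psi> r) * indicator {0..} r \<partial>lborel)"
    unfolding odd_mass_def \<psi>_def by (intro nn_integral_cong) (simp del: gauss_deriv.simps add: mult_ac)
  also have "\<dots> = (\<integral>\<^sup>+r. ennreal (gauss_deriv k l r * \<psi>' r) * indicator {0..} r \<partial>lborel)"
    using l D by (intro gauss_deriv_by_parts)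
      (auto simp: \<psi>_def \<psi>'_def intro!: mult_nonneg_nonneg add_nonneg_nonneg zero_le_power versine_nonneg[simplified])
  also have "\<dots> = (\<integral>\<^sup>+r. ennreal (2 * k + 1 + 2 * j) * (ennreal (gauss_deriv k l r * sinh r ^ (2 * k) * (cosh r - 1) ^ j) * indicator {0..} r)
     + ennreal (2 * k + 1 + j) * (ennreal (gauss_deriv k l r * sinh r ^ (2 * k) * (cosh r - 1) ^ Suc j) * indicator {0..} r) \<partial>lborel)"
  proof (rule nn_integral_cong)
    fix r :: real
    have "0 \<le> gauss_deriv k l r" using l by (intro gauss_deriv_nonneg) auto
    then show "ennreal (gauss_deriv k l r * \<psi>' r) * indicator {0..} r = ennreal (2 * k + 1 + 2 * j) * (ennreal (gauss_deriv k l r * sinh r ^ (2 * k) * (cosh r - 1) ^ j) * indicator {0..} r)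
     + ennreal (2 * k + 1 + j) * (ennreal (gauss_deriv k l r * sinh r ^ (2 * k) * (cosh r - 1) ^ Suc j) * indicator {0..} r)"
      using versine_nonneg[of r]
      by (auto simp: \<psi>'_def indicator_def algebra_simps simp flip: ennreal_mult ennreal_plus simp del: power_Suc gauss_deriv.simps intro!: arg_cong[of _ _ ennreal])
  qed
  also have "\<dots> = ennreal (2 * k + 1 + 2 * j) * odd_mass l k j + ennreal (2 * k + 1 + j) * odd_mass l k (Suc j)"
    unfolding odd_mass_def by (subst nn_integral_add) (auto simp: nn_integral_cmult simp del: power_Suc gauss_deriv.simps)
  finally show ?thesis .
qed

text \<open>The exponent \<open>e\<close> is \<open>1\<close> in even dimensions and \<open>0\<close> in odd ones.\<close>

definition gauss_moment :: "nat \<Rightarrow> real \<Rightarrow> nat \<Rightarrow> ennreal" where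
  "gauss_moment e l j = (\<integral>\<^sup>+r. ennreal (exp (- l * r\<^sup>2) * cosh (r / 2) ^ e * (cosh r - 1) ^ j) * indicator {0..} r \<partial>lborel)"

text \<open>The recursion is unrolled without computing the coefficients. The top one has to be
  positive: its moment grows fastest and fixes the limit of the mass for large times.\<close>

lemma odd_mass_eq_sum:
  "\<exists>c. (\<forall>i. 0 \<le> c i) \<and> 0 < c k \<and> (\<forall>l>0. odd_mass l k j = (\<Sum>i\<le>k. ennreal (c i) * gauss_moment 0 l (j + i)))"
proof (induction k arbitrary: j)
  case 0
  show ?case by (rule exI[of _ "\<lambda>_. 1"]) (simp add: odd_mass_def gauss_moment_def)
next
  case (Suc k)
  obtain c where c: "\<And>i. 0 \<le> c i" "0 < c k" "\<And>l. l > 0 \<Longrightarrow> odd_mass l k j = (\<Sum>i\<le>k. ennreal (c i) * gauss_moment 0 l (j + i))"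
    using Suc.IH[of j] by blast
  obtain d where d: "\<And>i. 0 \<le> d i" "0 < d k" "\<And>l. l > 0 \<Longrightarrow> odd_mass l k (Suc j) = (\<Sum>i\<le>k. ennreal (d i) * gauss_moment 0 l (Suc j + i))"
    using Suc.IH[of "Suc j"] by blast
  define a where "a = real (2 * k + 1 + 2 * j)"
  define b where "b = real (2 * k + 1 + j)"
  define g where "g = (\<lambda>i. (if i \<le> k then a * c i else 0) + (if i = 0 then 0 else b * d (i - 1)))"
  have ab: "0 < a" "0 < b" by (simp_all add: a_def b_def)
  show ?case
  proof (intro exI[of _ g] conjI allI impI)
    show "0 \<le> g i" for i using ab c(1) d(1) by (simp add: g_def)
    show "0 < g (Suc k)" using ab d(2) by (simp add: g_def)
    fix l :: real assume l: "0 < l"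
    have 1: "ennreal a * odd_mass l k j = (\<Sum>i\<le>Suc k. ennreal (if i \<le> k then a * c i else 0) * gauss_moment 0 l (j + i))"
      using ab c(1) by (simp add: c(3)[OF l] sum_distrib_left ennreal_mult mult.assoc)
    have 2: "ennreal b * odd_mass l k (Suc j) = (\<Sum>i\<le>Suc k. ennreal (if i = 0 then 0 else b * d (i - 1)) * gauss_moment 0 l (j + i))"
      using ab d(1) by (subst sum.atMost_Suc_shift) (simp add: d(3)[OF l] sum_distrib_left ennreal_mult mult.assoc)
    show "odd_mass l (Suc k) j = (\<Sum>i\<le>Suc k. ennreal (g i) * gauss_moment 0 l (j + i))"
      unfolding odd_mass_Suc[OF l] a_def[symmetric] b_def[symmetric] 1 2 sum.distrib[symmetric]
      using ab c(1) d(1) by (intro sum.cong refl) (simp add: g_def ennreal_plus distrib_right)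
  qed
qed

text \<open>In even dimension the Abel integral, transposed onto the volume weight, produces odd
  powers of sinh(r/2) by \<open>beta_versine\<close>; this is the remaining integral against the
  derivative of the Gaussian.\<close>

definition even_mass :: "real \<Rightarrow> nat \<Rightarrow> nat \<Rightarrow> ennreal" where
  "even_mass l k i = (\<integral>\<^sup>+r. ennreal (sinh r * gauss_deriv k l r * sinh (r / 2) ^ (2 * i + 1)) * indicator {0..} r \<partial>lborel)"

text \<open>Differentiating sinh(r/2)^(2i+1) leaves sinh(r/2)^(2i) cosh(r/2), in which one sinh(r/2)
  combines with cosh(r/2) to (sinh r) / 2. So each step gives a single integral of the same kind,
  and after the last one cosh(r/2) (cosh r - 1)^j remains.\<close>

lemma even_mass_eq:
  "\<exists>c>0. \<forall>l>0. even_mass l (Suc k) (k + j) = ennreal c * gauss_moment 1 l j"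
proof -
  have step: "even_mass l (Suc k) i = (\<integral>\<^sup>+r. ennreal (gauss_deriv k l r * (real (2 * i + 1) / 2 * (sinh (r / 2) ^ (2 * i) * cosh (r / 2)))) * indicator {0..} r \<partial>lborel)"
    if "0 < l" for l k i
    unfolding even_mass_def
  proof (rule gauss_deriv_by_parts[OF that])
    fix x :: real
    have "((\<lambda>r. sinh (r / 2)) has_real_derivative cosh (x / 2) / 2) (at x)"
      by (auto intro!: derivative_eq_intros)
    from DERIV_power_Suc[OF this, of "2 * i"]
    show "((\<lambda>r. sinh (r / 2) ^ (2 * i + 1)) has_real_derivative real (2 * i + 1) / 2 * (sinh (x / 2) ^ (2 * i) * cosh (x / 2))) (at x)"
      by (simp add: mult_ac)
  qed auto
  show ?thesis
  proof (induction k)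
    case 0
    show ?case
    proof (intro exI[of _ "real (2 * j + 1) / 2 / 2 ^ j"] conjI allI impI)
      fix l :: real assume l: "0 < l"
      have "even_mass l (Suc 0) (0 + j) = (\<integral>\<^sup>+r. ennreal (real (2 * j + 1) / 2 / 2 ^ j) * (ennreal (exp (- l * r\<^sup>2) * cosh (r / 2) ^ 1 * (cosh r - 1) ^ j) * indicator {0..} r) \<partial>lborel)"
        unfolding step[OF l]
        by (intro nn_integral_cong) (simp add: versine_half power_mult_distrib power_mult[symmetric] mult_ac indicator_def flip: ennreal_mult')
      also have "\<dots> = ennreal (real (2 * j + 1) / 2 / 2 ^ j) * gauss_moment 1 l j"
        unfolding gauss_moment_def by (intro nn_integral_cmult) measurable
      finally show "even_mass l (Suc 0) (0 + j) = \<dots>" .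
    qed simp
  next
    case (Suc k)
    then obtain c where c: "c > 0" "\<And>l. l > 0 \<Longrightarrow> even_mass l (Suc k) (k + j) = ennreal c * gauss_moment 1 l j" by blast
    define a where "a = real (2 * (Suc k + j) + 1) / 4"
    have a: "0 < a" by (simp add: a_def)
    show ?case
    proof (intro exI[of _ "a * c"] conjI allI impI)
      fix l :: real assume l: "0 < l"
      have "even_mass l (Suc (Suc k)) (Suc k + j) = (\<integral>\<^sup>+r. ennreal a * (ennreal (sinh r * gauss_deriv (Suc k) l r * sinh (r / 2) ^ (2 * (k + j) + 1)) * indicator {0..} r) \<partial>lborel)"
        unfolding step[OF l]
      proof (rule nn_integral_cong)
        fix r :: real
        have "gauss_deriv (Suc k) l r * (real (2 * (Suc k + j) + 1) / 2 * (sinh (r / 2) ^ (2 * (Suc k + j)) * cosh (r / 2)))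
          = a * (sinh r * gauss_deriv (Suc k) l r * sinh (r / 2) ^ (2 * (k + j) + 1))"
          unfolding sinh_half[of r] a_def by (simp del: gauss_deriv.simps add: power_add algebra_simps)
        then show "ennreal (gauss_deriv (Suc k) l r * (real (2 * (Suc k + j) + 1) / 2 * (sinh (r / 2) ^ (2 * (Suc k + j)) * cosh (r / 2)))) * indicator {0..} r
          = ennreal a * (ennreal (sinh r * gauss_deriv (Suc k) l r * sinh (r / 2) ^ (2 * (k + j) + 1)) * indicator {0..} r)"
          using a by (simp only: ennreal_mult' mult.assoc less_imp_le)
      qed
      also have "\<dots> = ennreal a * even_mass l (Suc k) (k + j)"
        unfolding even_mass_def by (intro nn_integral_cmult) measurable
      finally show "even_mass l (Suc (Suc k)) (Suc k + j) = ennreal (a * c) * gauss_moment 1 l j"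
        using a c(1) by (simp only: c(2)[OF l] ennreal_mult' less_imp_le mult.assoc)
    qed (use a c in simp)
  qed
qed

text \<open>Up to a factor depending on the time and the dimension, this is the hyperbolic heat
  kernel at time u for l = 1/(4u). In both parities \<open>n div 2\<close> is the number of radial
  derivatives.\<close>

definition heat_profile :: "nat \<Rightarrow> real \<Rightarrow> real \<Rightarrow> real" where
  "heat_profile n l \<rho> = (if odd n then gauss_deriv (n div 2) l \<rho> else abel_integral (gauss_deriv (n div 2) l) \<rho>)"

text \<open>Allows an antiderivative to be used on closed half lines away from the left endpoint,
  where the Abel integrand is singular.\<close>

lemma nn_integral_greaterThan_le:
  fixes f :: "real \<Rightarrow> ennreal"
  assumes [measurable]: "f \<in> borel_measurable borel"
    and le: "\<And>b. a < b \<Longrightarrow> (\<integral>\<^sup>+x. f x * indicator {b..} x \<partial>lborel) \<le> B"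
  shows "(\<integral>\<^sup>+x. f x * indicator {a<..} x \<partial>lborel) \<le> B"
proof -
  let ?A = "\<lambda>i::nat. {a + 1 / (real i + 1)..}"
  have "(\<Union>i. ?A i) = {a<..}"
  proof (intro equalityI subsetI)
    fix x assume "x \<in> {a<..}"
    then obtain i where "inverse (real (Suc i)) < x - a" using reals_Archimedean[of "x - a"] by auto
    then show "x \<in> (\<Union>i. ?A i)" by (auto simp: inverse_eq_divide add.commute intro!: exI[of _ i])
  next
    fix x assume "x \<in> (\<Union>i. ?A i)"
    then obtain i where "a + 1 / (real i + 1) \<le> x" by auto
    moreover have "0 < 1 / (real i + 1)" by simp
    ultimately show "x \<in> {a<..}" by (simp only: greaterThan_iff)
  qed
  moreover have "incseq ?A"
    by (auto simp: incseq_def frac_le intro: order_trans[rotated])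
  ultimately have "(\<integral>\<^sup>+x. f x * indicator {a<..} x \<partial>lborel) = (SUP i. \<integral>\<^sup>+x. f x * indicator (?A i) x \<partial>lborel)"
    using SUP_emeasure_incseq[of ?A "density lborel f", symmetric] by (simp add: emeasure_density image_subset_iff)
  also have "\<dots> \<le> B" by (intro SUP_least le) simp
  finally show ?thesis .
qed

text \<open>The extended-valued form of \<open>abel_integral\<close>, for which Tonelli is available
  before finiteness is known.\<close>

definition abel_nn :: "(real \<Rightarrow> real) \<Rightarrow> real \<Rightarrow> ennreal" where
  "abel_nn h \<rho> = (\<integral>\<^sup>+r. ennreal (sinh r / sqrt (cosh r - cosh \<rho>) * h r) * indicator {\<rho><..} r \<partial>lborel)"

text \<open>With s = sqrt(cosh r - cosh rho), cosh r is at least (1 + s)^2 / 2, and sinh r / s is 2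
  s'. The integrand is thus at most 2^(3/4) times the derivative of -4 (1 + s)^(-1/2), which gives a
  bound uniform in rho.\<close>

lemma abel_nn_decay:
  assumes \<rho>: "0 \<le> \<rho>"
  shows "abel_nn (\<lambda>r. cosh r powr - (3/4)) \<rho> \<le> ennreal (4 * 2 powr (3/4))"
proof -
  define s where "s = (\<lambda>r. sqrt (cosh r - cosh \<rho>))"
  define f where "f = (\<lambda>r. sinh r / s r * (1 + s r) powr - (3/2))"
  have [measurable]: "f \<in> borel_measurable borel" unfolding f_def s_def by measurable
  have le: "sinh r / s r * cosh r powr - (3/4) \<le> 2 powr (3/4) * f r" if "\<rho> < r" for r
  proof -
    have s: "0 < s r" using that \<rho> cosh_real_nonneg_less_iff[of \<rho> r] by (simp add: s_def)
    have s2: "(s r)\<^sup>2 = cosh r - cosh \<rho>" using that \<rho> cosh_real_nonneg_less_iff[of \<rho> r] by (simp add: s_def)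
    have "0 \<le> (1 - s r)\<^sup>2" by simp
    then have "(1 + s r)\<^sup>2 \<le> 2 * (1 + (s r)\<^sup>2)" by (simp add: power2_eq_square algebra_simps)
    also have "\<dots> \<le> 2 * cosh r" unfolding s2 using cosh_real_ge_1[of \<rho>] by simp
    finally have "((1 + s r) powr 2) powr (3/4) \<le> (2 * cosh r) powr (3/4)"
      using s by (intro powr_mono2) (auto simp: powr_numeral)
    then have "(1 + s r) powr (3/2) \<le> 2 powr (3/4) * cosh r powr (3/4)"
      by (simp add: powr_powr powr_mult)
    then have "cosh r powr - (3/4) \<le> 2 powr (3/4) * (1 + s r) powr - (3/2)"
      using s by (simp add: powr_minus field_simps)
    moreover have "0 \<le> sinh r / s r" using s that \<rho> by simp
    ultimately have "sinh r / s r * cosh r powr - (3/4) \<le> sinh r / s r * (2 powr (3/4) * (1 + s r) powr - (3/2))"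
      by (rule mult_left_mono)
    then show ?thesis by (simp add: f_def mult_ac)
  qed
  have I: "(\<integral>\<^sup>+r. ennreal (f r) * indicator {\<rho><..} r \<partial>lborel) \<le> 4"
  proof (rule nn_integral_greaterThan_le)
    fix b assume b: "\<rho> < b"
    define F where "F = (\<lambda>r. - 4 * (1 + s r) powr - (1/2))"
    have spos: "0 < s r" if "b \<le> r" for r using that b \<rho> cosh_real_nonneg_less_iff[of \<rho> r] by (simp add: s_def)
    have "(\<integral>\<^sup>+r. ennreal (f r) * indicator {b..} r \<partial>lborel) = 0 - F b"
    proof (rule nn_integral_FTC_atLeast)
      fix r assume r: "b \<le> r"
      have c: "0 < cosh r - cosh \<rho>" using r b \<rho> cosh_real_nonneg_less_iff[of \<rho> r] by simp
      have "(s has_real_derivative sinh r / (2 * s r)) (at r)"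
        unfolding s_def using c by (auto intro!: derivative_eq_intros simp: divide_simps)
      then have "((\<lambda>r. 1 + s r) has_real_derivative sinh r / (2 * s r)) (at r)"
        by (auto intro!: derivative_eq_intros)
      from has_real_derivative_powr[of "1 + s r" "- (1/2)"] spos[OF r]
      have "((\<lambda>z. z powr - (1/2)) has_real_derivative - (1/2) * (1 + s r) powr (- (1/2) - 1)) (at (1 + s r))" by simp
      from DERIV_chain2[OF this \<open>((\<lambda>r. 1 + s r) has_real_derivative sinh r / (2 * s r)) (at r)\<close>]
      have "((\<lambda>r. (1 + s r) powr - (1/2)) has_real_derivative - (1/2) * (1 + s r) powr (- (1/2) - 1) * (sinh r / (2 * s r))) (at r)" .
      from DERIV_cmult[OF this, of "-4"]
      show "(F has_real_derivative f r) (at r)" by (simp add: F_def f_def mult_ac)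
      show "0 \<le> f r" using spos[OF r] r b \<rho> by (simp add: f_def)
    next
      have "filterlim s at_top at_top"
        unfolding s_def
        by (intro filterlim_compose[OF sqrt_at_top] filterlim_tendsto_add_at_top[OF tendsto_const, of cosh at_top "- cosh \<rho>", simplified] cosh_real_at_top)
      then have "filterlim (\<lambda>r. 1 + s r) at_top at_top" by (intro filterlim_tendsto_add_at_top[OF tendsto_const])
      then have "((\<lambda>r. (1 + s r) powr - (1/2)) \<longlongrightarrow> 0) at_top" by (intro tendsto_neg_powr) auto
      from tendsto_mult[OF tendsto_const[of "-4"] this] show "(F \<longlongrightarrow> 0) at_top" by (simp add: F_def)
    qed measurable
    also have "\<dots> \<le> ennreal 4"
    proof (rule ennreal_leI)
      have "(1 + s b) powr - (1/2) \<le> (1 + s b) powr 0" using spos[of b] by (intro powr_mono) auto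
      then show "0 - F b \<le> 4" using spos[of b] by (simp add: F_def)
    qed
    finally show "(\<integral>\<^sup>+r. ennreal (f r) * indicator {b..} r \<partial>lborel) \<le> 4" by simp
  qed measurable
  have "abel_nn (\<lambda>r. cosh r powr - (3/4)) \<rho> \<le> (\<integral>\<^sup>+r. ennreal (2 powr (3/4)) * (ennreal (f r) * indicator {\<rho><..} r) \<partial>lborel)"
    unfolding abel_nn_def
    using le[unfolded s_def] by (intro nn_integral_mono) (auto simp: indicator_def simp flip: ennreal_mult' intro!: ennreal_leI)
  moreover have "\<dots> = ennreal (2 powr (3/4)) * (\<integral>\<^sup>+r. ennreal (f r) * indicator {\<rho><..} r \<partial>lborel)"
    by (rule nn_integral_cmult) measurable
  ultimately have "abel_nn (\<lambda>r. cosh r powr - (3/4)) \<rho> \<le> ennreal (2 powr (3/4)) * (\<integral>\<^sup>+r. ennreal (f r) * indicator {\<rho><..} r \<partial>lborel)"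
    by (simp only:)
  also have "\<dots> \<le> ennreal (2 powr (3/4)) * 4" using I by (rule mult_left_mono) simp
  finally show ?thesis by (simp add: ennreal_mult' mult.commute)
qed

lemma abel_integral_eq_nn:
  assumes "0 \<le> \<rho>" and [measurable]: "h \<in> borel_measurable borel" and h: "\<And>r. 0 \<le> h r" and fin: "abel_nn h \<rho> < \<infinity>"
  shows "ennreal (abel_integral h \<rho>) = abel_nn h \<rho>"
proof -
  have eq: "(\<integral>\<^sup>+r. ennreal (indicator {\<rho><..} r *\<^sub>R (sinh r / sqrt (cosh r - cosh \<rho>) * h r)) \<partial>lborel) = abel_nn h \<rho>"
    unfolding abel_nn_def by (intro nn_integral_cong) (auto simp: indicator_def)
  have nn: "0 \<le> indicator {\<rho><..} r *\<^sub>R (sinh r / sqrt (cosh r - cosh \<rho>) * h r)" for r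
    using assms(1) h[of r] cosh_real_nonneg_le_iff[of \<rho> r] by (auto simp: indicator_def intro!: mult_nonneg_nonneg)
  have "integrable lborel (\<lambda>r. indicator {\<rho><..} r *\<^sub>R (sinh r / sqrt (cosh r - cosh \<rho>) * h r))"
    using fin nn by (intro integrableI_nonneg) (auto simp: eq[simplified])
  from nn_integral_eq_integral[OF this] nn show ?thesis
    unfolding abel_integral_def set_lebesgue_integral_def eq by simp
qed

text \<open>For r > rho the Gaussian is at most its value at rho and leaves the integral; what
  remains is the decay treated in \<open>abel_nn_decay\<close>.\<close>

lemma abel_nn_gauss_deriv_le:
  obtains C k where "0 \<le> C" "\<And>l \<rho>. 0 \<le> l \<Longrightarrow> 0 \<le> \<rho> \<Longrightarrow> abel_nn (gauss_deriv (Suc m) l) \<rho> \<le> ennreal (C * (1 + l) ^ k * exp (- l * \<rho>\<^sup>2))"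
proof -
  obtain C k where C: "0 \<le> C" "\<And>l r. 0 \<le> l \<Longrightarrow> gauss_deriv (Suc m) l r \<le> C * (1 + l) ^ k * cosh r powr - (3/4) * exp (- l * r\<^sup>2)"
    using gauss_deriv_bound by blast
  show ?thesis
  proof (rule that[of "C * (4 * 2 powr (3/4))" k])
    fix l \<rho> :: real assume l: "0 \<le> l" "0 \<le> \<rho>"
    define D where "D = C * (1 + l) ^ k * exp (- l * \<rho>\<^sup>2)"
    have D: "0 \<le> D" using C l by (simp add: D_def)
    have "abel_nn (gauss_deriv (Suc m) l) \<rho> \<le> (\<integral>\<^sup>+r. ennreal D * (ennreal (sinh r / sqrt (cosh r - cosh \<rho>) * cosh r powr - (3/4)) * indicator {\<rho><..} r) \<partial>lborel)"
      unfolding abel_nn_def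
    proof (rule nn_integral_mono)
      fix r :: real
      show "ennreal (sinh r / sqrt (cosh r - cosh \<rho>) * gauss_deriv (Suc m) l r) * indicator {\<rho><..} r
        \<le> ennreal D * (ennreal (sinh r / sqrt (cosh r - cosh \<rho>) * cosh r powr - (3/4)) * indicator {\<rho><..} r)"
      proof (cases "\<rho> < r")
        case True
        have q: "0 \<le> sinh r / sqrt (cosh r - cosh \<rho>)" using True l cosh_real_nonneg_le_iff[of \<rho> r] by simp
        have "\<rho>\<^sup>2 \<le> r\<^sup>2" using True l by (intro power_mono) auto
        then have "exp (- l * r\<^sup>2) \<le> exp (- l * \<rho>\<^sup>2)" using l by (simp add: mult_left_mono)
        then have "C * (1 + l) ^ k * cosh r powr - (3/4) * exp (- l * r\<^sup>2) \<le> C * (1 + l) ^ k * cosh r powr - (3/4) * exp (- l * \<rho>\<^sup>2)"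
          using C l by (intro mult_left_mono) auto
        then have "gauss_deriv (Suc m) l r \<le> D * cosh r powr - (3/4)"
          using C(2)[OF l(1), of r] by (simp add: D_def mult_ac del: gauss_deriv.simps)
        from mult_left_mono[OF this q] show ?thesis
          using True D by (simp add: mult_ac ennreal_leI del: gauss_deriv.simps flip: ennreal_mult')
      qed simp
    qed
    also have "\<dots> = ennreal D * abel_nn (\<lambda>r. cosh r powr - (3/4)) \<rho>"
      unfolding abel_nn_def by (rule nn_integral_cmult) measurable
    also have "\<dots> \<le> ennreal D * ennreal (4 * 2 powr (3/4))" by (intro mult_left_mono abel_nn_decay l) simp
    also have "\<dots> = ennreal (C * (4 * 2 powr (3/4)) * (1 + l) ^ k * exp (- l * \<rho>\<^sup>2))"
      using D by (simp add: D_def mult_ac flip: ennreal_mult)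
    finally show "abel_nn (gauss_deriv (Suc m) l) \<rho> \<le> \<dots>" .
  qed (use C in simp)
qed

lemma heat_profile_even:
  assumes "even n" "2 \<le> n" "0 \<le> l" "0 \<le> \<rho>"
  shows "ennreal (heat_profile n l \<rho>) = abel_nn (gauss_deriv (n div 2) l) \<rho>"
proof -
  obtain m where m: "n div 2 = Suc m" using assms by (cases "n div 2") auto
  obtain C k where "abel_nn (gauss_deriv (Suc m) l) \<rho> \<le> ennreal (C * (1 + l) ^ k * exp (- l * \<rho>\<^sup>2))"
    using abel_nn_gauss_deriv_le[of m] assms by metis
  then have "abel_nn (gauss_deriv (Suc m) l) \<rho> < \<infinity>" by (rule order.strict_trans1) simp
  with assms show ?thesis
    unfolding heat_profile_def m by (simp add: abel_integral_eq_nn gauss_deriv_nonneg del: gauss_deriv.simps)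
qed

lemma heat_profile_nonneg:
  assumes "2 \<le> n" "0 \<le> l" "0 \<le> \<rho>"
  shows "0 \<le> heat_profile n l \<rho>"
proof (cases "odd n")
  case False
  have "0 \<le> abel_integral (gauss_deriv (n div 2) l) \<rho>"
    unfolding abel_integral_def set_lebesgue_integral_def
    using assms cosh_real_nonneg_le_iff[of \<rho>] gauss_deriv_nonneg[of l "n div 2"]
    by (intro integral_nonneg_AE AE_I2) (auto simp: indicator_def intro!: mult_nonneg_nonneg)
  then show ?thesis using False by (simp add: heat_profile_def)
qed (use assms in \<open>simp add: heat_profile_def gauss_deriv_nonneg\<close>)

lemma heat_profile_bound:
  assumes n: "2 \<le> n"
  obtains C k where "0 \<le> C" "\<And>l \<rho>. 0 \<le> l \<Longrightarrow> 0 \<le> \<rho> \<Longrightarrow> heat_profile n l \<rho> \<le> C * (1 + l) ^ k * exp (- l * \<rho>\<^sup>2)"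
proof (cases "odd n")
  case True
  obtain C k where "0 \<le> C" "\<And>l r. 0 \<le> l \<Longrightarrow> gauss_deriv (n div 2) l r \<le> C * (1 + l) ^ k * exp (- l * r\<^sup>2)"
    using gauss_deriv_le_exp by blast
  then show ?thesis by (intro that[of C k]) (simp_all add: heat_profile_def True)
next
  case False
  obtain m where m: "n div 2 = Suc m" using n by (cases "n div 2") auto
  obtain C k where C: "0 \<le> C" "\<And>l \<rho>. 0 \<le> l \<Longrightarrow> 0 \<le> \<rho> \<Longrightarrow> abel_nn (gauss_deriv (Suc m) l) \<rho> \<le> ennreal (C * (1 + l) ^ k * exp (- l * \<rho>\<^sup>2))"
    using abel_nn_gauss_deriv_le[of m] by metis
  show ?thesis
  proof (rule that[OF C(1)])
    fix l \<rho> :: real assume l: "0 \<le> l" "0 \<le> \<rho>"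
    have "ennreal (heat_profile n l \<rho>) \<le> ennreal (C * (1 + l) ^ k * exp (- l * \<rho>\<^sup>2))"
      using C(2)[OF l] heat_profile_even[of n l \<rho>] n False l by (simp add: m del: gauss_deriv.simps)
    then show "heat_profile n l \<rho> \<le> C * (1 + l) ^ k * exp (- l * \<rho>\<^sup>2)"
      using C(1) l by (subst (asm) ennreal_le_iff) auto
  qed
qed

lemma heat_profile_measurable [measurable]:
  assumes [measurable]: "f \<in> borel_measurable M" "g \<in> borel_measurable M"
  shows "(\<lambda>x. heat_profile n (f x) (g x)) \<in> borel_measurable M"
proof -
  have "(\<lambda>x. \<integral>r. (if g x < r then sinh r / sqrt (cosh r - cosh (g x)) * gauss_deriv (n div 2) (f x) r else 0) \<partial>lborel) \<in> borel_measurable M"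
    by (rule lborel.borel_measurable_lebesgue_integral) measurable
  moreover have "abel_integral (gauss_deriv (n div 2) l) \<rho> = (\<integral>r. (if \<rho> < r then sinh r / sqrt (cosh r - cosh \<rho>) * gauss_deriv (n div 2) l r else 0) \<partial>lborel)" for l \<rho>
    unfolding abel_integral_def set_lebesgue_integral_def by (intro Bochner_Integration.integral_cong) auto
  ultimately have "(\<lambda>x. abel_integral (gauss_deriv (n div 2) (f x)) (g x)) \<in> borel_measurable M" by simp
  then show ?thesis unfolding heat_profile_def by measurable
qed

text \<open>The substitution z = (cosh rho - 1) / (cosh r - 1) gives the Beta integral B(q + 1, 1/2)
  times (cosh r - 1)^(q + 1/2), and cosh r - 1 = 2 sinh(r/2)^2 turns this power into an odd power of
  sinh(r/2).\<close>

lemma beta_versine: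
  assumes r: "0 < r"
  shows "(\<integral>\<^sup>+\<rho>. ennreal (sinh \<rho> / sqrt (cosh r - cosh \<rho>) * (cosh \<rho> - 1) ^ q) * indicator {0..<r} \<rho> \<partial>lborel)
    = ennreal (Beta (real q + 1) (1/2) * 2 ^ q * sqrt 2 * sinh (r / 2) ^ (2 * q + 1))"
proof -
  define V where "V = cosh r - 1"
  have V: "0 < V" using r cosh_real_nonneg_less_iff[of 0 r] by (simp add: V_def)
  define f where "f = (\<lambda>z::real. z ^ q / sqrt (1 - z))"
  have [measurable]: "f \<in> borel_measurable borel" unfolding f_def by measurable
  have "((\<lambda>t. t powr (real q + 1 - 1) * (1 - t) powr (1/2 - 1)) has_integral Beta (real q + 1) (1/2)) {0..1::real}"
    by (rule has_integral_Beta_real) auto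
  then have "(f has_integral Beta (real q + 1) (1/2)) {0..1}"
    by (rule has_integral_spike_finite[of "{0}", rotated 2])
       (auto simp: f_def powr_realpow powr_minus_divide powr_half_sqrt)
  then have "ennreal (Beta (real q + 1) (1/2)) = (\<integral>\<^sup>+z. ennreal (f z * indicator {0..1} z) \<partial>lborel)"
    by (subst nn_integral_has_integral_lebesgue[symmetric]) (auto simp: f_def nn_integral_completion mult.commute indicator_def intro!: nn_integral_cong)
  also have "\<dots> = (\<integral>\<^sup>+z. ennreal (f z) * indicator {(cosh 0 - 1) / V..(cosh r - 1) / V} z \<partial>lborel)"
    using V by (intro nn_integral_cong) (auto simp: V_def indicator_def)
  also have "\<dots> = (\<integral>\<^sup>+\<rho>. ennreal (f ((cosh \<rho> - 1) / V)) * ennreal (sinh \<rho> / V) * indicator {0..r} \<rho> \<partial>lborel)"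
    using r V by (intro nn_integral_substitution_aux) (auto intro!: derivative_eq_intros continuous_intros)
  also have "\<dots> = (\<integral>\<^sup>+\<rho>. ennreal (1 / (V ^ q * sqrt V)) * (ennreal (sinh \<rho> / sqrt (cosh r - cosh \<rho>) * (cosh \<rho> - 1) ^ q) * indicator {0..<r} \<rho>) \<partial>lborel)"
  proof (intro nn_integral_cong_AE eventually_mono[OF AE_lborel_singleton[of r]])
    fix \<rho> assume "\<rho> \<noteq> r"
    show "ennreal (f ((cosh \<rho> - 1) / V)) * ennreal (sinh \<rho> / V) * indicator {0..r} \<rho>
      = ennreal (1 / (V ^ q * sqrt V)) * (ennreal (sinh \<rho> / sqrt (cosh r - cosh \<rho>) * (cosh \<rho> - 1) ^ q) * indicator {0..<r} \<rho>)"
    proof (cases "0 \<le> \<rho> \<and> \<rho> < r")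
      case True
      define v where "v = cosh \<rho> - 1"
      have v: "0 \<le> v" "v < V" using True cosh_real_nonneg_less_iff[of \<rho> r] versine_nonneg[of \<rho>] by (auto simp: v_def V_def)
      have "1 - v / V = (V - v) / V" using V by (simp add: diff_divide_distrib)
      then have "f (v / V) * (sinh \<rho> / V) = v ^ q / V ^ q * (sqrt V / sqrt (V - v)) * (sinh \<rho> / (sqrt V * sqrt V))"
        using V by (simp add: f_def power_divide real_sqrt_divide)
      also have "\<dots> = 1 / (V ^ q * sqrt V) * (sinh \<rho> / sqrt (V - v) * v ^ q)"
        using V by (simp add: divide_simps)
      finally have "f (v / V) * (sinh \<rho> / V) = 1 / (V ^ q * sqrt V) * (sinh \<rho> / sqrt (V - v) * v ^ q)" .
      moreover have "V - v = cosh r - cosh \<rho>" by (simp add: V_def v_def)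
      moreover have "0 \<le> f (v / V)" using v V by (simp add: f_def)
      ultimately show ?thesis using True V v by (simp add: v_def indicator_def flip: ennreal_mult')
    next
      case False
      then have "\<rho> \<notin> {0..r}" "\<rho> \<notin> {0..<r}" using \<open>\<rho> \<noteq> r\<close> by auto
      then show ?thesis by simp
    qed
  qed
  also have "\<dots> = ennreal (1 / (V ^ q * sqrt V)) * (\<integral>\<^sup>+\<rho>. ennreal (sinh \<rho> / sqrt (cosh r - cosh \<rho>) * (cosh \<rho> - 1) ^ q) * indicator {0..<r} \<rho> \<partial>lborel)"
    by (rule nn_integral_cmult) measurable
  finally have "ennreal (V ^ q * sqrt V) * ennreal (Beta (real q + 1) (1/2)) = ennreal (V ^ q * sqrt V) * (ennreal (1 / (V ^ q * sqrt V)) * (\<integral>\<^sup>+\<rho>. ennreal (sinh \<rho> / sqrt (cosh r - cosh \<rho>) * (cosh \<rho> - 1) ^ q) * indicator {0..<r} \<rho> \<partial>lborel))" by simp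
  also have "\<dots> = (\<integral>\<^sup>+\<rho>. ennreal (sinh \<rho> / sqrt (cosh r - cosh \<rho>) * (cosh \<rho> - 1) ^ q) * indicator {0..<r} \<rho> \<partial>lborel)"
    using V by (simp add: mult.assoc[symmetric] flip: ennreal_mult')
  finally have "(\<integral>\<^sup>+\<rho>. ennreal (sinh \<rho> / sqrt (cosh r - cosh \<rho>) * (cosh \<rho> - 1) ^ q) * indicator {0..<r} \<rho> \<partial>lborel)
     = ennreal (V ^ q * sqrt V * Beta (real q + 1) (1/2))" using V by (simp add: ennreal_mult')
  also have "V ^ q * sqrt V = 2 ^ q * sqrt 2 * sinh (r / 2) ^ (2 * q + 1)"
    using r by (simp add: V_def versine_half power_mult_distrib real_sqrt_mult power_mult)
  finally show ?thesis by (simp add: mult_ac)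
qed

lemma heat_mass_odd:
  assumes "odd n" "2 \<le> n"
  shows "\<exists>c. (\<forall>i. 0 \<le> c i) \<and> 0 < c (n div 2) \<and> (\<forall>l>0.
    (\<integral>\<^sup>+r. ennreal (heat_profile n l r * sinh r ^ (n - 1) * (cosh r - 1) ^ j) * indicator {0..} r \<partial>lborel)
      = (\<Sum>i\<le>n div 2. ennreal (c i) * gauss_moment 0 l (j + i)))"
proof -
  have "n - 1 = 2 * (n div 2)" using assms by presburger
  then have "(\<integral>\<^sup>+r. ennreal (heat_profile n l r * sinh r ^ (n - 1) * (cosh r - 1) ^ j) * indicator {0..} r \<partial>lborel) = odd_mass l (n div 2) j" for l
    using assms by (simp add: odd_mass_def heat_profile_def)
  with odd_mass_eq_sum[of "n div 2" j] show ?thesis by simp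
qed

text \<open>Tonelli lets the Abel integral be carried out first over the inner radius, against the
  volume weight. That weight is sinh rho times a polynomial in v = cosh rho - 1, since (sinh rho)^2
  = v (v + 2), so \<open>beta_versine\<close> applies to each monomial.\<close>

lemma heat_mass_even:
  assumes n: "n = 2 * Suc m"
  shows "\<exists>c. (\<forall>i. 0 \<le> c i) \<and> 0 < c m \<and> (\<forall>l>0.
    (\<integral>\<^sup>+r. ennreal (heat_profile n l r * sinh r ^ (n - 1) * (cosh r - 1) ^ j) * indicator {0..} r \<partial>lborel)
      = (\<Sum>i\<le>m. ennreal (c i) * gauss_moment 1 l (j + i)))"
proof -
  \<comment> \<open>The factor v^m of (v (v + 2))^m makes every exponent at least \<open>m\<close>,
    which is what the \<open>m + 1\<close> integrations by parts of \<open>even_mass_eq\<close>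
    consume.\<close>
  define q where "q = (\<lambda>i. m + (j + i))"
  define b where "b = (\<lambda>i. real (m choose i) * 2 ^ (m - i) * (Beta (real (q i) + 1) (1/2) * 2 ^ q i * sqrt 2))"
  obtain c where c: "\<And>i. c i > 0" "\<And>i l. l > 0 \<Longrightarrow> even_mass l (Suc m) (m + i) = ennreal (c i) * gauss_moment 1 l i"
    using even_mass_eq[of m] by metis
  have Beta_pos: "0 < Beta (real i + 1) (1/2)" for i by (simp add: Beta_def add_pos_nonneg)
  have b: "0 \<le> b i" for i using less_imp_le[OF Beta_pos] by (simp add: b_def)
  have b': "0 < b m" using Beta_pos by (simp add: b_def)
  have W: "sinh \<rho> ^ (n - 1) * (cosh \<rho> - 1) ^ j = (\<Sum>i\<le>m. real (m choose i) * 2 ^ (m - i) * (sinh \<rho> * (cosh \<rho> - 1) ^ q i))" for \<rho> :: real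
  proof -
    define v where "v = cosh \<rho> - 1"
    have "sinh \<rho> ^ (n - 1) * v ^ j = sinh \<rho> * ((sinh \<rho>)\<^sup>2) ^ m * v ^ j" by (simp add: n power_mult)
    also have "(sinh \<rho>)\<^sup>2 = v * (v + 2)" unfolding sinh_square_versine v_def by (simp add: power2_eq_square algebra_simps)
    also have "sinh \<rho> * (v * (v + 2)) ^ m * v ^ j = sinh \<rho> * v ^ (m + j) * (\<Sum>i\<le>m. real (m choose i) * v ^ i * 2 ^ (m - i))"
      by (simp add: power_mult_distrib binomial_ring power_add mult_ac)
    also have "\<dots> = (\<Sum>i\<le>m. real (m choose i) * 2 ^ (m - i) * (sinh \<rho> * v ^ q i))"
      unfolding sum_distrib_left by (intro sum.cong refl) (simp add: q_def power_add mult_ac)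
    finally show ?thesis unfolding v_def .
  qed
  have V: "(\<integral>\<^sup>+\<rho>. ennreal (1 / sqrt (cosh r - cosh \<rho>) * (sinh \<rho> ^ (n - 1) * (cosh \<rho> - 1) ^ j)) * indicator {0..<r} \<rho> \<partial>lborel)
      = (\<Sum>i\<le>m. ennreal (b i * sinh (r / 2) ^ (2 * q i + 1)))" if r: "0 < r" for r
  proof -
    have "(\<integral>\<^sup>+\<rho>. ennreal (1 / sqrt (cosh r - cosh \<rho>) * (sinh \<rho> ^ (n - 1) * (cosh \<rho> - 1) ^ j)) * indicator {0..<r} \<rho> \<partial>lborel)
      = (\<integral>\<^sup>+\<rho>. (\<Sum>i\<le>m. ennreal (real (m choose i) * 2 ^ (m - i)) * (ennreal (sinh \<rho> / sqrt (cosh r - cosh \<rho>) * (cosh \<rho> - 1) ^ q i) * indicator {0..<r} \<rho>)) \<partial>lborel)"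
    proof (rule nn_integral_cong)
      fix \<rho> :: real
      show "ennreal (1 / sqrt (cosh r - cosh \<rho>) * (sinh \<rho> ^ (n - 1) * (cosh \<rho> - 1) ^ j)) * indicator {0..<r} \<rho>
        = (\<Sum>i\<le>m. ennreal (real (m choose i) * 2 ^ (m - i)) * (ennreal (sinh \<rho> / sqrt (cosh r - cosh \<rho>) * (cosh \<rho> - 1) ^ q i) * indicator {0..<r} \<rho>))"
      proof (cases "\<rho> \<in> {0..<r}")
        case True
        have nn: "0 \<le> sinh \<rho> / sqrt (cosh r - cosh \<rho>) * (cosh \<rho> - 1) ^ q i" for i
          using True cosh_real_nonneg_le_iff[of \<rho> r] versine_nonneg[of \<rho>] by auto
        have "ennreal (1 / sqrt (cosh r - cosh \<rho>) * (sinh \<rho> ^ (n - 1) * (cosh \<rho> - 1) ^ j))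
          = ennreal (\<Sum>i\<le>m. real (m choose i) * 2 ^ (m - i) * (sinh \<rho> / sqrt (cosh r - cosh \<rho>) * (cosh \<rho> - 1) ^ q i))"
          unfolding W sum_distrib_left by (intro arg_cong[of _ _ ennreal] sum.cong refl) simp
        also have "\<dots> = (\<Sum>i\<le>m. ennreal (real (m choose i) * 2 ^ (m - i)) * ennreal (sinh \<rho> / sqrt (cosh r - cosh \<rho>) * (cosh \<rho> - 1) ^ q i))"
        proof -
          have "ennreal (\<Sum>i\<le>m. real (m choose i) * 2 ^ (m - i) * (sinh \<rho> / sqrt (cosh r - cosh \<rho>) * (cosh \<rho> - 1) ^ q i))
            = (\<Sum>i\<le>m. ennreal (real (m choose i) * 2 ^ (m - i) * (sinh \<rho> / sqrt (cosh r - cosh \<rho>) * (cosh \<rho> - 1) ^ q i)))"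
            by (rule sum_ennreal[symmetric]) (intro mult_nonneg_nonneg[OF _ nn], simp)
          also have "\<dots> = (\<Sum>i\<le>m. ennreal (real (m choose i) * 2 ^ (m - i)) * ennreal (sinh \<rho> / sqrt (cosh r - cosh \<rho>) * (cosh \<rho> - 1) ^ q i))"
            by (intro sum.cong refl ennreal_mult') simp
          finally show ?thesis .
        qed
        finally show ?thesis using True by simp
      qed simp
    qed
    also have "\<dots> = (\<Sum>i\<le>m. ennreal (real (m choose i) * 2 ^ (m - i)) * ennreal (Beta (real (q i) + 1) (1/2) * 2 ^ q i * sqrt 2 * sinh (r / 2) ^ (2 * q i + 1)))"
    proof (subst nn_integral_sum)
      show "(\<Sum>i\<le>m. \<integral>\<^sup>+\<rho>. ennreal (real (m choose i) * 2 ^ (m - i)) * (ennreal (sinh \<rho> / sqrt (cosh r - cosh \<rho>) * (cosh \<rho> - 1) ^ q i) * indicator {0..<r} \<rho>) \<partial>lborel)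
        = (\<Sum>i\<le>m. ennreal (real (m choose i) * 2 ^ (m - i)) * ennreal (Beta (real (q i) + 1) (1/2) * 2 ^ q i * sqrt 2 * sinh (r / 2) ^ (2 * q i + 1)))"
      proof (rule sum.cong[OF refl])
        fix i
        show "(\<integral>\<^sup>+\<rho>. ennreal (real (m choose i) * 2 ^ (m - i)) * (ennreal (sinh \<rho> / sqrt (cosh r - cosh \<rho>) * (cosh \<rho> - 1) ^ q i) * indicator {0..<r} \<rho>) \<partial>lborel)
          = ennreal (real (m choose i) * 2 ^ (m - i)) * ennreal (Beta (real (q i) + 1) (1/2) * 2 ^ q i * sqrt 2 * sinh (r / 2) ^ (2 * q i + 1))"
          unfolding beta_versine[OF r, symmetric] by (rule nn_integral_cmult) measurable
      qed
    qed measurable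
    also have "\<dots> = (\<Sum>i\<le>m. ennreal (b i * sinh (r / 2) ^ (2 * q i + 1)))"
      unfolding b_def by (intro sum.cong refl) (simp add: mult.assoc ennreal_mult')
    finally show ?thesis .
  qed
  show ?thesis
  proof (intro exI[of _ "\<lambda>i. b i * c (j + i)"] conjI allI impI)
    show "0 \<le> b i * c (j + i)" for i using b c(1)[of "j + i"] by simp
    show "0 < b m * c (j + m)" using b' c(1) by simp
    fix l :: real assume l: "0 < l"
    define g where "g = gauss_deriv (Suc m) l"
    have [measurable]: "g \<in> borel_measurable borel" by (simp add: g_def del: gauss_deriv.simps)
    have g: "0 \<le> g r" for r using l unfolding g_def by (intro gauss_deriv_nonneg) simp
    have "(\<integral>\<^sup>+\<rho>. ennreal (heat_profile n l \<rho> * sinh \<rho> ^ (n - 1) * (cosh \<rho> - 1) ^ j) * indicator {0..} \<rho> \<partial>lborel)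
      = (\<integral>\<^sup>+\<rho>. (\<integral>\<^sup>+r. ennreal (sinh r / sqrt (cosh r - cosh \<rho>) * g r) * ennreal (sinh \<rho> ^ (n - 1) * (cosh \<rho> - 1) ^ j) * indicator {(\<rho>, r). 0 \<le> \<rho> \<and> \<rho> < r} (\<rho>, r) \<partial>lborel) \<partial>lborel)"
    proof (rule nn_integral_cong)
      fix \<rho> :: real
      show "ennreal (heat_profile n l \<rho> * sinh \<rho> ^ (n - 1) * (cosh \<rho> - 1) ^ j) * indicator {0..} \<rho>
        = (\<integral>\<^sup>+r. ennreal (sinh r / sqrt (cosh r - cosh \<rho>) * g r) * ennreal (sinh \<rho> ^ (n - 1) * (cosh \<rho> - 1) ^ j) * indicator {(\<rho>, r). 0 \<le> \<rho> \<and> \<rho> < r} (\<rho>, r) \<partial>lborel)"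
      proof (cases "0 \<le> \<rho>")
        case True
        have "ennreal (heat_profile n l \<rho> * sinh \<rho> ^ (n - 1) * (cosh \<rho> - 1) ^ j) = ennreal (heat_profile n l \<rho>) * ennreal (sinh \<rho> ^ (n - 1) * (cosh \<rho> - 1) ^ j)"
          using True l heat_profile_nonneg[of n l \<rho>] n by (simp add: ennreal_mult' mult.assoc)
        also have "\<dots> = abel_nn g \<rho> * ennreal (sinh \<rho> ^ (n - 1) * (cosh \<rho> - 1) ^ j)"
          using True l heat_profile_even[of n l \<rho>] n by (simp add: g_def del: gauss_deriv.simps)
        also have "\<dots> = (\<integral>\<^sup>+r. ennreal (sinh r / sqrt (cosh r - cosh \<rho>) * g r) * indicator {\<rho><..} r * ennreal (sinh \<rho> ^ (n - 1) * (cosh \<rho> - 1) ^ j) \<partial>lborel)"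
          unfolding abel_nn_def by (rule nn_integral_multc[symmetric]) measurable
        also have "\<dots> = (\<integral>\<^sup>+r. ennreal (sinh r / sqrt (cosh r - cosh \<rho>) * g r) * ennreal (sinh \<rho> ^ (n - 1) * (cosh \<rho> - 1) ^ j) * indicator {(\<rho>, r). 0 \<le> \<rho> \<and> \<rho> < r} (\<rho>, r) \<partial>lborel)"
          using True by (intro nn_integral_cong) (simp add: indicator_def)
        finally show ?thesis using True by simp
      qed simp
    qed
    also have "\<dots> = (\<integral>\<^sup>+r. (\<integral>\<^sup>+\<rho>. ennreal (sinh r / sqrt (cosh r - cosh \<rho>) * g r) * ennreal (sinh \<rho> ^ (n - 1) * (cosh \<rho> - 1) ^ j) * indicator {(\<rho>, r). 0 \<le> \<rho> \<and> \<rho> < r} (\<rho>, r) \<partial>lborel) \<partial>lborel)"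
      by (rule lborel_pair.Fubini'[symmetric]) measurable
    also have "\<dots> = (\<integral>\<^sup>+r. (\<Sum>i\<le>m. ennreal (b i) * (ennreal (sinh r * g r * sinh (r / 2) ^ (2 * q i + 1)) * indicator {0..} r)) \<partial>lborel)"
    proof (rule nn_integral_cong)
      fix r :: real
      show "(\<integral>\<^sup>+\<rho>. ennreal (sinh r / sqrt (cosh r - cosh \<rho>) * g r) * ennreal (sinh \<rho> ^ (n - 1) * (cosh \<rho> - 1) ^ j) * indicator {(\<rho>, r). 0 \<le> \<rho> \<and> \<rho> < r} (\<rho>, r) \<partial>lborel)
        = (\<Sum>i\<le>m. ennreal (b i) * (ennreal (sinh r * g r * sinh (r / 2) ^ (2 * q i + 1)) * indicator {0..} r))"
      proof (cases "0 < r")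
        case True
        have "(\<integral>\<^sup>+\<rho>. ennreal (sinh r / sqrt (cosh r - cosh \<rho>) * g r) * ennreal (sinh \<rho> ^ (n - 1) * (cosh \<rho> - 1) ^ j) * indicator {(\<rho>, r). 0 \<le> \<rho> \<and> \<rho> < r} (\<rho>, r) \<partial>lborel)
          = (\<integral>\<^sup>+\<rho>. ennreal (sinh r * g r) * (ennreal (1 / sqrt (cosh r - cosh \<rho>) * (sinh \<rho> ^ (n - 1) * (cosh \<rho> - 1) ^ j)) * indicator {0..<r} \<rho>) \<partial>lborel)"
        proof (rule nn_integral_cong)
          fix \<rho> :: real
          have "ennreal (sinh r / sqrt (cosh r - cosh \<rho>) * g r) * ennreal (sinh \<rho> ^ (n - 1) * (cosh \<rho> - 1) ^ j) = ennreal (sinh r * g r) * ennreal (1 / sqrt (cosh r - cosh \<rho>) * (sinh \<rho> ^ (n - 1) * (cosh \<rho> - 1) ^ j))"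
            if "0 \<le> \<rho>" "\<rho> < r"
            using that True g[of r] versine_nonneg[of \<rho>] cosh_real_nonneg_le_iff[of \<rho> r] by (simp add: mult_ac flip: ennreal_mult')
          then show "ennreal (sinh r / sqrt (cosh r - cosh \<rho>) * g r) * ennreal (sinh \<rho> ^ (n - 1) * (cosh \<rho> - 1) ^ j) * indicator {(\<rho>, r). 0 \<le> \<rho> \<and> \<rho> < r} (\<rho>, r)
            = ennreal (sinh r * g r) * (ennreal (1 / sqrt (cosh r - cosh \<rho>) * (sinh \<rho> ^ (n - 1) * (cosh \<rho> - 1) ^ j)) * indicator {0..<r} \<rho>)"
            by (cases "0 \<le> \<rho> \<and> \<rho> < r") auto
        qed
        also have "\<dots> = ennreal (sinh r * g r) * (\<Sum>i\<le>m. ennreal (b i * sinh (r / 2) ^ (2 * q i + 1)))"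
          by (subst nn_integral_cmult) (auto simp: V[OF True, simplified])
        also have "\<dots> = (\<Sum>i\<le>m. ennreal (b i) * (ennreal (sinh r * g r * sinh (r / 2) ^ (2 * q i + 1)) * indicator {0..} r))"
          unfolding sum_distrib_left using True b g[of r]
          by (intro sum.cong refl) (simp add: mult_ac flip: ennreal_mult')
        finally show ?thesis .
      next
        case False
        then have "(\<integral>\<^sup>+\<rho>. ennreal (sinh r / sqrt (cosh r - cosh \<rho>) * g r) * ennreal (sinh \<rho> ^ (n - 1) * (cosh \<rho> - 1) ^ j) * indicator {(\<rho>, r). 0 \<le> \<rho> \<and> \<rho> < r} (\<rho>, r) \<partial>lborel) = (\<integral>\<^sup>+\<rho>. 0 \<partial>(lborel :: real measure))"
          by (intro nn_integral_cong) (auto simp: indicator_def)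
        then show ?thesis using False by (cases "r = 0") auto
      qed
    qed
    also have "\<dots> = (\<Sum>i\<le>m. ennreal (b i) * even_mass l (Suc m) (q i))"
      unfolding even_mass_def g_def
      by (subst nn_integral_sum) (auto simp: nn_integral_cmult simp del: gauss_deriv.simps)
    also have "\<dots> = (\<Sum>i\<le>m. ennreal (b i * c (j + i)) * gauss_moment 1 l (j + i))"
      unfolding q_def using b by (intro sum.cong refl) (simp only: c(2)[OF l] ennreal_mult' mult.assoc)
    finally show "(\<integral>\<^sup>+r. ennreal (heat_profile n l r * sinh r ^ (n - 1) * (cosh r - 1) ^ j) * indicator {0..} r \<partial>lborel) = \<dots>" .
  qed
qed

text \<open>A common form for both parities. The relation between \<open>L\<close>, \<open>e\<close>
  and \<open>n\<close> says that for \<open>j = 0\<close> the top moment has an integrand growing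
  like exp((n - 1) r / 2), apart from the Gaussian.\<close>

lemma heat_mass:
  assumes n: "2 \<le> n"
  obtains c L e where "\<And>i. 0 \<le> c i" "0 < c L" "2 * L + e + 1 = n" "e \<le> 1"
    "\<And>l. 0 < l \<Longrightarrow> (\<integral>\<^sup>+r. ennreal (heat_profile n l r * sinh r ^ (n - 1) * (cosh r - 1) ^ j) * indicator {0..} r \<partial>lborel)
      = (\<Sum>i\<le>L. ennreal (c i) * gauss_moment e l (j + i))"
proof (cases "odd n")
  case True
  then have "2 * (n div 2) + 0 + 1 = n" by presburger
  then show ?thesis using that[of _ "n div 2" 0] heat_mass_odd[OF True n, of j] by auto
next
  case False
  then obtain m where m: "n = 2 * Suc m" using n by (metis evenE mult_0_right not0_implies_Suc not_numeral_le_zero)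
  then show ?thesis using that[of _ m 1] heat_mass_even[OF m, of j] by auto
qed

section \<open>The kernels as mixtures of heat profiles\<close>

text \<open>A single term of the exponential series at b (1 + x) already gives the bound.\<close>

lemma exp_dominates_power:
  fixes b x :: real
  assumes "0 < b" "0 \<le> x"
  shows "(1 + x) ^ N * exp (- b * x) \<le> fact N / b ^ N * exp b"
proof -
  define y where "y = b * (1 + x)"
  have y: "0 \<le> y" using assms by (simp add: y_def)
  have "y ^ N / fact N \<le> exp y"
  proof -
    have "(\<Sum>i<Suc N. y ^ i /\<^sub>R fact i) \<le> exp y"
      unfolding exp_def using y summable_exp_generic[of y] by (intro sum_le_suminf) auto
    moreover have "y ^ N / fact N \<le> (\<Sum>i<Suc N. y ^ i /\<^sub>R fact i)"
      using y by (auto simp: divide_inverse mult.commute intro!: sum_nonneg)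
    ultimately show ?thesis by linarith
  qed
  then have "b ^ N * (1 + x) ^ N \<le> fact N * (exp b * exp (b * x))"
  proof -
    have "y ^ N = b ^ N * (1 + x) ^ N" by (simp only: y_def power_mult_distrib)
    moreover have "exp y = exp b * exp (b * x)" by (simp add: y_def distrib_left exp_add)
    ultimately show ?thesis using \<open>y ^ N / fact N \<le> exp y\<close> by (simp add: divide_le_eq mult.commute)
  qed
  then have "(1 + x) ^ N \<le> fact N / b ^ N * exp b * exp (b * x)"
    using assms by (simp add: field_simps)
  then have "(1 + x) ^ N * exp (- b * x) \<le> fact N / b ^ N * exp b * exp (b * x) * exp (- b * x)"
    by (rule mult_right_mono) simp
  then show ?thesis by (simp add: mult.assoc flip: exp_add)
qed

lemma integrable_exp_half_line:
  assumes "0 < a"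
  shows "integrable lborel (\<lambda>u::real. indicator {0<..} u * exp (- a * u))"
proof -
  have "(\<integral>\<^sup>+u. ennreal (exp (- a * u)) * indicator {0..} u \<partial>lborel) = ennreal (0 - (- exp (- a * 0) / a))"
  proof (rule nn_integral_FTC_atLeast)
    have "((\<lambda>u. exp (- a * u)) \<longlongrightarrow> 0) at_top"
      using assms by (intro filterlim_compose[OF exp_at_bot] filterlim_tendsto_neg_mult_at_bot[OF tendsto_const _ filterlim_ident]) auto
    from tendsto_divide[OF tendsto_minus[OF this] tendsto_const[of a]] assms
    show "((\<lambda>u. - exp (- a * u) / a) \<longlongrightarrow> 0) at_top" by simp
  qed (use assms in \<open>auto intro!: derivative_eq_intros\<close>)
  moreover have "(\<integral>\<^sup>+u. ennreal (norm (indicator {0<..} u * exp (- a * u))) \<partial>lborel) \<le> (\<integral>\<^sup>+u. ennreal (exp (- a * u)) * indicator {0..} u \<partial>lborel)"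
    by (intro nn_integral_mono) (auto simp: indicator_def)
  ultimately show ?thesis by (intro integrableI_bounded) (auto simp: less_top[symmetric] top_unique)
qed

text \<open>The majorant for all mixtures at distances bounded away from 0: exp(-b/u) absorbs any
  power of 1/u at small times, and exp(-a u) gives integrability at large ones.\<close>

lemma integrable_heat_dominator:
  assumes "0 < a" "0 < b"
  shows "integrable lborel (\<lambda>u::real. indicator {0<..} u * ((1 + 1 / u) ^ N * exp (- a * u) * exp (- b / u)))"
proof (rule Bochner_Integration.integrable_bound)
  show "integrable lborel (\<lambda>u::real. fact N / b ^ N * exp b * (indicator {0<..} u * exp (- a * u)))"
    by (intro integrable_mult_right integrable_exp_half_line assms)
  show "AE u in lborel. norm (indicator {0<..} u * ((1 + 1 / u) ^ N * exp (- a * u) * exp (- b / u)))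
      \<le> norm (fact N / b ^ N * exp b * (indicator {0<..} u * exp (- a * u)))"
  proof (rule AE_I2)
    fix u :: real
    show "norm (indicator {0<..} u * ((1 + 1 / u) ^ N * exp (- a * u) * exp (- b / u)))
      \<le> norm (fact N / b ^ N * exp b * (indicator {0<..} u * exp (- a * u)))"
    proof (cases "0 < u")
      case True
      have "(1 + 1 / u) ^ N * exp (- b / u) \<le> fact N / b ^ N * exp b"
        using exp_dominates_power[OF assms(2), of "1 / u" N] True by simp
      from mult_right_mono[OF this, of "exp (- a * u)"] True assms show ?thesis
        by (simp add: abs_mult mult_ac)
    qed simp
  qed
qed measurable

text \<open>Polynomial growth in 1/u is what the Gaussian exp(-r^2/(4u)) can compensate at every
  fixed r > 0.\<close>

definition heat_weight :: "(real \<Rightarrow> real) \<Rightarrow> bool" where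
  "heat_weight w \<longleftrightarrow> w \<in> borel_measurable borel \<and> (\<exists>C N. \<forall>u>0. 0 \<le> w u \<and> w u \<le> C * (1 + 1 / u) ^ N)"

lemma heat_weight_powr:
  assumes "0 \<le> q"
  shows "heat_weight (\<lambda>u. u powr (- q) * exp (- b\<^sup>2 / (4 * u)))"
proof -
  obtain N :: nat where N: "q \<le> real N" using real_arch_simple by blast
  have "u powr (- q) * exp (- b\<^sup>2 / (4 * u)) \<le> 1 * (1 + 1 / u) ^ N" if u: "0 < u" for u
  proof -
    have "u powr (- q) = (1 / u) powr q" using u by (simp add: powr_divide powr_minus_divide)
    also have "\<dots> \<le> (1 + 1 / u) powr q" using u assms by (intro powr_mono2) auto
    also have "\<dots> \<le> (1 + 1 / u) powr real N" using u N by (intro powr_mono) auto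
    also have "\<dots> = (1 + 1 / u) ^ N" using u by (simp add: powr_realpow add_pos_pos)
    finally have "u powr (- q) * exp (- b\<^sup>2 / (4 * u)) \<le> (1 + 1 / u) ^ N * 1"
      using u by (intro mult_mono) auto
    then show ?thesis by simp
  qed
  moreover have "(\<lambda>u. u powr (- q) * exp (- b\<^sup>2 / (4 * u))) \<in> borel_measurable borel" by measurable
  ultimately show ?thesis unfolding heat_weight_def by (intro conjI exI[of _ "1::real"] exI[of _ N]) auto
qed

definition gauss_mix :: "nat \<Rightarrow> real \<Rightarrow> (real \<Rightarrow> real) \<Rightarrow> real \<Rightarrow> real" where
  "gauss_mix m a w r = (\<integral>u. indicator {0<..} u * (w u * exp (- a * u) * gauss_deriv m (1 / (4 * u)) r) \<partial>lborel)"

definition heat_mix :: "nat \<Rightarrow> real \<Rightarrow> (real \<Rightarrow> real) \<Rightarrow> real \<Rightarrow> real" where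
  "heat_mix n a w \<rho> = (\<integral>u. indicator {0<..} u * (w u * exp (- a * u) * heat_profile n (1 / (4 * u)) \<rho>) \<partial>lborel)"

text \<open>The majorant depends on the radius only through a lower bound \<open>r0\<close>, so it
  serves a whole neighbourhood when differentiating under the integral.\<close>

lemma mix_dominated:
  fixes g :: "real \<Rightarrow> real \<Rightarrow> real"
  assumes w: "heat_weight w" and C: "0 \<le> C" "\<And>l r. 0 \<le> l \<Longrightarrow> 0 \<le> r \<Longrightarrow> 0 \<le> g l r \<and> g l r \<le> C * (1 + l) ^ k * exp (- l * r\<^sup>2)"
  obtains K N where "0 \<le> K" "\<And>u r0 r. 0 < r0 \<Longrightarrow> r0 \<le> r \<Longrightarrow>
    \<bar>indicator {0<..} u * (w u * exp (- a * u) * g (1 / (4 * u)) r)\<bar> \<le> K * (indicator {0<..} u * ((1 + 1 / u) ^ N * exp (- a * u) * exp (- (r0\<^sup>2 / 4) / u)))"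
proof -
  obtain D N where D: "\<And>u. u > 0 \<Longrightarrow> 0 \<le> w u \<and> w u \<le> D * (1 + 1 / u) ^ N" using w by (auto simp: heat_weight_def)
  \<comment> \<open>\<open>heat_weight\<close> says nothing about the sign of the constant;
    evaluating the bound at u = 1 does.\<close>
  have "0 \<le> D * 2 ^ N" using D[of 1] by simp
  then have D0: "0 \<le> D" using mult_neg_pos[of D "2 ^ N"] by (cases "D < 0") auto
  show ?thesis
  proof (rule that[of "D * C" "N + k"])
    fix u r0 r :: real assume r: "0 < r0" "r0 \<le> r"
    show "\<bar>indicator {0<..} u * (w u * exp (- a * u) * g (1 / (4 * u)) r)\<bar> \<le> D * C * (indicator {0<..} u * ((1 + 1 / u) ^ (N + k) * exp (- a * u) * exp (- (r0\<^sup>2 / 4) / u)))"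
    proof (cases "0 < u")
      case True
      have g: "0 \<le> g (1 / (4 * u)) r" "g (1 / (4 * u)) r \<le> C * (1 + 1 / (4 * u)) ^ k * exp (- (1 / (4 * u)) * r\<^sup>2)"
        using C(2)[of "1 / (4 * u)" r] True r by auto
      have "r0\<^sup>2 \<le> r\<^sup>2" using r by (intro power_mono) auto
      then have e: "exp (- (1 / (4 * u)) * r\<^sup>2) \<le> exp (- (r0\<^sup>2 / 4) / u)"
        using True by (simp add: divide_right_mono)
      have "(1 + 1 / (4 * u)) ^ k \<le> (1 + 1 / u) ^ k"
        using True by (intro power_mono add_left_mono) (auto simp: field_simps)
      then have "C * (1 + 1 / (4 * u)) ^ k * exp (- (1 / (4 * u)) * r\<^sup>2) \<le> C * (1 + 1 / u) ^ k * exp (- (r0\<^sup>2 / 4) / u)"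
        using C(1) e True by (intro mult_mono mult_left_mono) auto
      with g have g': "g (1 / (4 * u)) r \<le> C * (1 + 1 / u) ^ k * exp (- (r0\<^sup>2 / 4) / u)" by linarith
      have "w u * exp (- a * u) * g (1 / (4 * u)) r \<le> (D * (1 + 1 / u) ^ N * exp (- a * u)) * (C * (1 + 1 / u) ^ k * exp (- (r0\<^sup>2 / 4) / u))"
        using D[OF True] D0 g g' True by (intro mult_mono mult_right_mono mult_nonneg_nonneg) auto
      then show ?thesis using True D[OF True] g by (simp add: power_add abs_mult mult_ac)
    qed simp
  qed (use D0 C in simp)
qed

lemma mix_integrable:
  fixes g :: "real \<Rightarrow> real \<Rightarrow> real"
  assumes w: "heat_weight w" and a: "0 < a" and C: "0 \<le> C" "\<And>l r. 0 \<le> l \<Longrightarrow> 0 \<le> r \<Longrightarrow> 0 \<le> g l r \<and> g l r \<le> C * (1 + l) ^ k * exp (- l * r\<^sup>2)"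
    and meas: "(\<lambda>u. g (1 / (4 * u)) r) \<in> borel_measurable borel" and r: "0 < r"
  shows "integrable lborel (\<lambda>u. indicator {0<..} u * (w u * exp (- a * u) * g (1 / (4 * u)) r))"
proof -
  have [measurable]: "w \<in> borel_measurable borel" using w by (simp add: heat_weight_def)
  note [measurable] = meas
  obtain K N where KN: "0 \<le> K" "\<And>u r0 r. 0 < r0 \<Longrightarrow> r0 \<le> r \<Longrightarrow>
    \<bar>indicator {0<..} u * (w u * exp (- a * u) * g (1 / (4 * u)) r)\<bar> \<le> K * (indicator {0<..} u * ((1 + 1 / u) ^ N * exp (- a * u) * exp (- (r0\<^sup>2 / 4) / u)))"
    using mix_dominated[OF w C] by metis
  show ?thesis
  proof (rule Bochner_Integration.integrable_bound)
    show "integrable lborel (\<lambda>u. K * (indicator {0<..} u * ((1 + 1 / u) ^ N * exp (- a * u) * exp (- (r\<^sup>2 / 4) / u))))"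
      using r by (intro integrable_mult_right integrable_heat_dominator a) auto
    show "AE u in lborel. norm (indicator {0<..} u * (w u * exp (- a * u) * g (1 / (4 * u)) r))
        \<le> norm (K * (indicator {0<..} u * ((1 + 1 / u) ^ N * exp (- a * u) * exp (- (r\<^sup>2 / 4) / u))))"
      unfolding real_norm_def by (rule AE_I2, rule order_trans[OF KN(2)[OF r order.refl] abs_ge_self])
  qed measurable
qed

lemma gauss_mix_integrable:
  assumes "heat_weight w" "0 < a" "0 < r"
  shows "integrable lborel (\<lambda>u. indicator {0<..} u * (w u * exp (- a * u) * gauss_deriv m (1 / (4 * u)) r))"
proof -
  obtain C k where C: "0 \<le> C" "\<And>l r. 0 \<le> l \<Longrightarrow> gauss_deriv m l r \<le> C * (1 + l) ^ k * exp (- l * r\<^sup>2)"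
    using gauss_deriv_le_exp by blast
  show ?thesis
    by (rule mix_integrable[of w a C "gauss_deriv m" k]) (use assms C gauss_deriv_nonneg in auto)
qed

lemma heat_mix_integrable:
  assumes "2 \<le> n" "heat_weight w" "0 < a" "0 < r"
  shows "integrable lborel (\<lambda>u. indicator {0<..} u * (w u * exp (- a * u) * heat_profile n (1 / (4 * u)) r))"
proof -
  obtain C k where C: "0 \<le> C" "\<And>l \<rho>. 0 \<le> l \<Longrightarrow> 0 \<le> \<rho> \<Longrightarrow> heat_profile n l \<rho> \<le> C * (1 + l) ^ k * exp (- l * \<rho>\<^sup>2)"
    using heat_profile_bound[OF assms(1)] by blast
  show ?thesis
    by (rule mix_integrable[of w a C "heat_profile n" k]) (use assms C heat_profile_nonneg in auto)
qed

text \<open>Differentiation under the integral on the interval from r/2 to 2 r: there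
  \<open>sinh\<close> is at most sinh(2 r), and the majorant belonging to r/2 is uniform.\<close>

lemma has_real_derivative_gauss_mix:
  assumes w: "heat_weight w" and a: "0 < a" and r: "0 < r"
  shows "(gauss_mix m a w has_real_derivative - sinh r * gauss_mix (Suc m) a w r) (at r)"
proof -
  have [measurable]: "w \<in> borel_measurable borel" using w by (simp add: heat_weight_def)
  obtain C k where C: "0 \<le> C" "\<And>l r. 0 \<le> l \<Longrightarrow> gauss_deriv (Suc m) l r \<le> C * (1 + l) ^ k * exp (- l * r\<^sup>2)"
    using gauss_deriv_le_exp by blast
  have C': "0 \<le> gauss_deriv (Suc m) l r \<and> gauss_deriv (Suc m) l r \<le> C * (1 + l) ^ k * exp (- l * r\<^sup>2)" if "0 \<le> l" for l r
    using C(2)[OF that] gauss_deriv_nonneg[OF that] by blast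
  obtain K N where KN: "0 \<le> K" "\<And>u r0 r. 0 < r0 \<Longrightarrow> r0 \<le> r \<Longrightarrow>
    \<bar>indicator {0<..} u * (w u * exp (- a * u) * gauss_deriv (Suc m) (1 / (4 * u)) r)\<bar> \<le> K * (indicator {0<..} u * ((1 + 1 / u) ^ N * exp (- a * u) * exp (- (r0\<^sup>2 / 4) / u)))"
    using mix_dominated[OF w C(1) C'] by metis
  define f where "f = (\<lambda>r u. indicator {0<..} u * (w u * exp (- a * u) * gauss_deriv m (1 / (4 * u)) r))"
  define h where "h = (\<lambda>r u. indicator {0<..} u * (w u * exp (- a * u) * gauss_deriv (Suc m) (1 / (4 * u)) r))"
  have "((\<lambda>r. \<integral>u. f r u \<partial>lborel) has_real_derivative (\<integral>u. - sinh r * h r u \<partial>lborel)) (at r)"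
  proof (rule has_real_derivative_integral[of "{r/2<..<2*r}"])
    show "((\<lambda>r. f r u) has_real_derivative - sinh x * h x u) (at x)" for x u
      using DERIV_cmult[OF has_real_derivative_gauss_deriv[of m "1 / (4 * u)" x], of "indicator {0<..} u * (w u * exp (- a * u))"]
      unfolding f_def h_def by (simp del: gauss_deriv.simps add: mult_ac)
    show "(\<lambda>u. - sinh r * h r u) \<in> borel_measurable lborel" unfolding h_def by measurable
    show "integrable lborel (f x)" if "x \<in> {r/2<..<2*r}" for x
      unfolding f_def using that r by (intro gauss_mix_integrable w a) auto
    show "integrable lborel (\<lambda>u. sinh (2 * r) * (K * (indicator {0<..} u * ((1 + 1 / u) ^ N * exp (- a * u) * exp (- ((r/2)\<^sup>2 / 4) / u)))))"
      using r by (intro integrable_mult_right integrable_heat_dominator a) auto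
    show "\<bar>- sinh x * h x u\<bar> \<le> sinh (2 * r) * (K * (indicator {0<..} u * ((1 + 1 / u) ^ N * exp (- a * u) * exp (- ((r/2)\<^sup>2 / 4) / u))))"
      if "x \<in> {r/2<..<2*r}" for x u
    proof -
      have x: "0 < x" "r / 2 \<le> x" "x \<le> 2 * r" using that r by auto
      have "\<bar>sinh x\<bar> \<le> sinh (2 * r)" using x by (simp add: abs_of_nonneg)
      then show ?thesis
        using KN(2)[of "r / 2" x u] r x unfolding abs_mult[of "- sinh x"] abs_minus_cancel h_def
        by (intro mult_mono) (auto simp del: gauss_deriv.simps)
    qed
  qed (use r in auto)
  then show ?thesis by (simp add: gauss_mix_def[abs_def] f_def h_def del: gauss_deriv.simps)
qed

lemma radial_deriv_iter_gauss_mix: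
  assumes w: "heat_weight w" and a: "0 < a" and h: "\<And>r. 0 < r \<Longrightarrow> h r = gauss_mix 0 a w r" and r: "0 < r"
  shows "(radial_deriv ^^ m) h r = gauss_mix m a w r"
  using r
proof (induction m arbitrary: r)
  case (Suc m)
  \<comment> \<open>A derivative depends only on nearby values, so agreement with the mixture on the
    open half line is enough.\<close>
  have "((radial_deriv ^^ m) h has_real_derivative - sinh r * gauss_mix (Suc m) a w r) (at r)"
    by (rule has_field_derivative_transform_within_open[OF has_real_derivative_gauss_mix[OF w a Suc.prems], of "{0<..}"])
       (use Suc in auto)
  then have "deriv ((radial_deriv ^^ m) h) r = - sinh r * gauss_mix (Suc m) a w r" by (rule DERIV_imp_deriv)
  moreover have "(radial_deriv ^^ Suc m) h r = - (1 / sinh r) * deriv ((radial_deriv ^^ m) h) r"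
    unfolding funpow.simps o_apply by (rule radial_deriv_def)
  ultimately show ?case using Suc.prems by simp
qed (use h in simp)

text \<open>A divergent integral has the default value 0 on either side, so the identity holds
  before convergence is known.\<close>

lemma abel_integral_eq_enn2real:
  assumes "0 \<le> \<rho>" and [measurable]: "h \<in> borel_measurable borel" and h: "\<And>r. \<rho> < r \<Longrightarrow> 0 \<le> h r"
  shows "abel_integral h \<rho> = enn2real (abel_nn h \<rho>)"
proof -
  have "abel_integral h \<rho> = enn2real (\<integral>\<^sup>+r. ennreal (indicator {\<rho><..} r *\<^sub>R (sinh r / sqrt (cosh r - cosh \<rho>) * h r)) \<partial>lborel)"
    unfolding abel_integral_def set_lebesgue_integral_def
    using assms(1) h cosh_real_nonneg_le_iff[of \<rho>]
    by (intro integral_eq_nn_integral AE_I2) (auto simp: indicator_def intro!: mult_nonneg_nonneg)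
  also have "(\<integral>\<^sup>+r. ennreal (indicator {\<rho><..} r *\<^sub>R (sinh r / sqrt (cosh r - cosh \<rho>) * h r)) \<partial>lborel) = abel_nn h \<rho>"
    unfolding abel_nn_def by (intro nn_integral_cong) (auto simp: indicator_def)
  finally show ?thesis .
qed

text \<open>Mixing over time and Abel integration commute by Tonelli, all integrands being
  nonnegative.\<close>

lemma gauss_mix_eq_heat_mix:
  assumes n: "2 \<le> n" and w: "heat_weight w" and a: "0 < a" and \<rho>: "0 < \<rho>"
    and h: "\<And>r. 0 < r \<Longrightarrow> h r = gauss_mix (n div 2) a w r"
  shows "(if odd n then h \<rho> else abel_integral h \<rho>) = heat_mix n a w \<rho>"
proof (cases "odd n")
  case True
  then show ?thesis using h[OF \<rho>] by (simp add: gauss_mix_def heat_mix_def heat_profile_def)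
next
  case False
  have [measurable]: "w \<in> borel_measurable borel" using w by (simp add: heat_weight_def)
  have w0: "0 \<le> w u" if "0 < u" for u using w that by (auto simp: heat_weight_def)
  define g where "g = gauss_mix (n div 2) a w"
  have [measurable]: "g \<in> borel_measurable borel"
    unfolding g_def gauss_mix_def[abs_def] by (rule lborel.borel_measurable_lebesgue_integral) measurable
  define F where "F = (\<lambda>u r. indicator {0<..} u * (w u * exp (- a * u) * gauss_deriv (n div 2) (1 / (4 * u)) r))"
  have F0: "0 \<le> F u r" for u r
    using w0[of u] gauss_deriv_nonneg[of "1 / (4 * u)" "n div 2" r] by (auto simp: F_def indicator_def)
  have g_eq: "ennreal (g r) = (\<integral>\<^sup>+u. ennreal (F u r) \<partial>lborel)" if "0 < r" for r
    using gauss_mix_integrable[OF w a that, of "n div 2"] F0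
    unfolding g_def gauss_mix_def F_def by (intro nn_integral_eq_integral[symmetric]) auto
  have g0: "0 \<le> g r" for r unfolding g_def gauss_mix_def using F0 unfolding F_def by (intro integral_nonneg_AE AE_I2) auto
  have "abel_integral h \<rho> = abel_integral g \<rho>"
    unfolding abel_integral_def set_lebesgue_integral_def
    using h \<rho> by (intro Bochner_Integration.integral_cong) (auto simp: indicator_def g_def)
  also have "\<dots> = enn2real (abel_nn g \<rho>)" using \<rho> g0 by (intro abel_integral_eq_enn2real) auto
  also have "abel_nn g \<rho> = (\<integral>\<^sup>+r. (\<integral>\<^sup>+u. ennreal (F u r) * (ennreal (sinh r / sqrt (cosh r - cosh \<rho>)) * indicator {\<rho><..} r) \<partial>lborel) \<partial>lborel)"
    unfolding abel_nn_def
  proof (rule nn_integral_cong)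
    fix r :: real
    show "ennreal (sinh r / sqrt (cosh r - cosh \<rho>) * g r) * indicator {\<rho><..} r = (\<integral>\<^sup>+u. ennreal (F u r) * (ennreal (sinh r / sqrt (cosh r - cosh \<rho>)) * indicator {\<rho><..} r) \<partial>lborel)"
    proof (cases "\<rho> < r")
      case True
      have "(\<integral>\<^sup>+u. ennreal (F u r) * (ennreal (sinh r / sqrt (cosh r - cosh \<rho>)) * indicator {\<rho><..} r) \<partial>lborel)
        = (\<integral>\<^sup>+u. ennreal (F u r) \<partial>lborel) * (ennreal (sinh r / sqrt (cosh r - cosh \<rho>)) * indicator {\<rho><..} r)"
        by (rule nn_integral_multc) (unfold F_def, measurable)
      moreover have "ennreal (sinh r / sqrt (cosh r - cosh \<rho>) * g r) = (\<integral>\<^sup>+u. ennreal (F u r) \<partial>lborel) * ennreal (sinh r / sqrt (cosh r - cosh \<rho>))"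
        using True \<rho> by (subst ennreal_mult''[OF g0]) (simp add: g_eq mult.commute)
      ultimately show ?thesis using True by simp
    qed simp
  qed
  also have "\<dots> = (\<integral>\<^sup>+u. (\<integral>\<^sup>+r. ennreal (F u r) * (ennreal (sinh r / sqrt (cosh r - cosh \<rho>)) * indicator {\<rho><..} r) \<partial>lborel) \<partial>lborel)"
    unfolding F_def by (rule lborel_pair.Fubini') measurable
  also have "\<dots> = (\<integral>\<^sup>+u. ennreal (indicator {0<..} u * (w u * exp (- a * u) * heat_profile n (1 / (4 * u)) \<rho>)) \<partial>lborel)"
  proof (rule nn_integral_cong)
    fix u :: real
    show "(\<integral>\<^sup>+r. ennreal (F u r) * (ennreal (sinh r / sqrt (cosh r - cosh \<rho>)) * indicator {\<rho><..} r) \<partial>lborel)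
       = ennreal (indicator {0<..} u * (w u * exp (- a * u) * heat_profile n (1 / (4 * u)) \<rho>))"
    proof (cases "0 < u")
      case True
      have "(\<integral>\<^sup>+r. ennreal (F u r) * (ennreal (sinh r / sqrt (cosh r - cosh \<rho>)) * indicator {\<rho><..} r) \<partial>lborel)
        = (\<integral>\<^sup>+r. ennreal (w u * exp (- a * u)) * (ennreal (sinh r / sqrt (cosh r - cosh \<rho>) * gauss_deriv (n div 2) (1 / (4 * u)) r) * indicator {\<rho><..} r) \<partial>lborel)"
      proof (rule nn_integral_cong)
        fix r :: real
        show "ennreal (F u r) * (ennreal (sinh r / sqrt (cosh r - cosh \<rho>)) * indicator {\<rho><..} r)
          = ennreal (w u * exp (- a * u)) * (ennreal (sinh r / sqrt (cosh r - cosh \<rho>) * gauss_deriv (n div 2) (1 / (4 * u)) r) * indicator {\<rho><..} r)"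
        proof (cases "\<rho> < r")
          case True
          have q: "0 \<le> sinh r / sqrt (cosh r - cosh \<rho>)" using True \<rho> cosh_real_nonneg_le_iff[of \<rho> r] by simp
          have "ennreal (F u r) * ennreal (sinh r / sqrt (cosh r - cosh \<rho>)) = ennreal (w u * exp (- a * u)) * ennreal (sinh r / sqrt (cosh r - cosh \<rho>) * gauss_deriv (n div 2) (1 / (4 * u)) r)"
            unfolding ennreal_mult''[OF q, symmetric] using w0[OF \<open>0 < u\<close>] \<open>0 < u\<close>
            by (subst ennreal_mult'[symmetric]) (simp_all add: F_def mult_ac del: gauss_deriv.simps)
          then show ?thesis using True by simp
        qed simp
      qed
      also have "\<dots> = ennreal (w u * exp (- a * u)) * abel_nn (gauss_deriv (n div 2) (1 / (4 * u))) \<rho>"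
        unfolding abel_nn_def by (rule nn_integral_cmult) measurable
      also have "abel_nn (gauss_deriv (n div 2) (1 / (4 * u))) \<rho> = ennreal (heat_profile n (1 / (4 * u)) \<rho>)"
        using False n True \<rho> by (intro heat_profile_even[symmetric]) auto
      finally show ?thesis using True w0[OF True] by (simp add: ennreal_mult' del: gauss_deriv.simps)
    qed (simp add: F_def)
  qed
  also have "enn2real (\<integral>\<^sup>+u. ennreal (indicator {0<..} u * (w u * exp (- a * u) * heat_profile n (1 / (4 * u)) \<rho>)) \<partial>lborel) = heat_mix n a w \<rho>"
    unfolding heat_mix_def using w0 heat_profile_nonneg[OF n] \<rho>
    by (intro integral_eq_nn_integral[symmetric] AE_I2) (auto simp: indicator_def)
  finally show ?thesis using False by simp
qed

lemma exp_substitution: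
  fixes f :: "real \<Rightarrow> ennreal"
  assumes [measurable]: "f \<in> borel_measurable borel" and a: "0 < a"
  shows "(\<integral>\<^sup>+u. f u * indicator {0<..} u \<partial>lborel) = (\<integral>\<^sup>+t. f (a * exp t) * ennreal (a * exp t) \<partial>lborel)"
proof -
  have "(\<integral>\<^sup>+u. f u * indicator {0<..} u \<partial>lborel) = (\<integral>\<^sup>+t. f (a * exp t) * ennreal (a * exp t) * indicator UNIV t \<partial>lborel)"
  proof (rule nn_integral_substitution_exhaust[where a = "\<lambda>i. - real i - 1" and b = "\<lambda>i. real i"])
    show S: "UNIV = (\<Union>i. {- real i - 1..real i})"
    proof -
      have "\<exists>i. - real i - 1 \<le> x \<and> x \<le> real i" for x
      proof -
        obtain i :: nat where "\<bar>x\<bar> \<le> real i" using real_arch_simple by blast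
        then show ?thesis by (intro exI[of _ i]) (simp add: abs_le_iff)
      qed
      then show ?thesis by auto
    qed
    show "{0<..} = (\<Union>i. {a * exp (- real i - 1)..a * exp (real i)})"
    proof (intro equalityI subsetI)
      fix u :: real assume "u \<in> {0<..}"
      then have u: "u = a * exp (ln (u / a))" using a by simp
      obtain i where "- real i - 1 \<le> ln (u / a)" "ln (u / a) \<le> real i"
      proof -
        have "ln (u / a) \<in> (\<Union>i. {- real i - 1..real i})" using S by blast
        then show ?thesis using that by auto
      qed
      then show "u \<in> (\<Union>i. {a * exp (- real i - 1)..a * exp (real i)})"
        using a by (subst u) (auto intro!: exI[of _ i] mult_left_mono)
    next
      fix u assume "u \<in> (\<Union>i. {a * exp (- real i - 1)..a * exp (real i)})"
      then obtain i where "a * exp (- real i - 1) \<le> u" by auto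
      moreover have "0 < a * exp (- real i - 1)" using a by simp
      ultimately show "u \<in> {0<..}" by (metis greaterThan_iff order.strict_trans2)
    qed
  qed (use a in \<open>auto intro!: derivative_eq_intros continuous_intros simp: decseq_def incseq_def\<close>)
  then show ?thesis by simp
qed

text \<open>The substitution u = a exp(t) is centred at a = r/(2c), where c^2 u and r^2/(4u)
  coincide; their sum becomes c r cosh t. The power of u leaves a^(-nu) exp(-nu t), and folding the
  line at t = 0 turns the exponential into 2 cosh(nu t).\<close>

lemma bessel_K_mixture:
  assumes r: "0 < r" and c: "0 < c"
  shows "r powr (- \<nu>) * bessel_K \<nu> (c * r) = (1/2) * (2 * c) powr (- \<nu>) *
    (\<integral>u. indicator {0<..} u * (u powr (- \<nu> - 1) * exp (- c\<^sup>2 * u) * exp (- (1 / (4 * u)) * r\<^sup>2)) \<partial>lborel)"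
proof -
  define a where "a = r / (2 * c)"
  have a: "0 < a" using r c by (simp add: a_def)
  define g where "g = (\<lambda>t. exp (- (c * r) * cosh t))"
  have [measurable]: "g \<in> borel_measurable borel" unfolding g_def by measurable
  have g: "0 \<le> g t" "g (- t) = g t" for t by (auto simp: g_def)
  define I where "I = (\<integral>\<^sup>+t. ennreal (g t * cosh (\<nu> * t)) * indicator {0<..} t \<partial>lborel)"
  have K: "bessel_K \<nu> (c * r) = enn2real I"
  proof -
    have "bessel_K \<nu> (c * r) = enn2real (\<integral>\<^sup>+t. ennreal (indicator {0<..} t *\<^sub>R (exp (- (c * r) * cosh t) * cosh (\<nu> * t))) \<partial>lborel)"
      unfolding bessel_K_def set_lebesgue_integral_def by (intro integral_eq_nn_integral AE_I2) (auto intro!: mult_nonneg_nonneg)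
    also have "(\<integral>\<^sup>+t. ennreal (indicator {0<..} t *\<^sub>R (exp (- (c * r) * cosh t) * cosh (\<nu> * t))) \<partial>lborel) = I"
      unfolding I_def g_def by (intro nn_integral_cong) (auto simp: indicator_def)
    finally show ?thesis .
  qed
  define J where "J = (\<integral>\<^sup>+u. ennreal (u powr (- \<nu> - 1) * exp (- c\<^sup>2 * u) * exp (- (1 / (4 * u)) * r\<^sup>2)) * indicator {0<..} u \<partial>lborel)"
  have "J = (\<integral>\<^sup>+t. ennreal ((a * exp t) powr (- \<nu> - 1) * exp (- c\<^sup>2 * (a * exp t)) * exp (- (1 / (4 * (a * exp t))) * r\<^sup>2)) * ennreal (a * exp t) \<partial>lborel)"
    unfolding J_def using a by (intro exp_substitution) measurable
  also have "\<dots> = (\<integral>\<^sup>+t. ennreal (a powr (- \<nu>)) * ennreal (g t * exp (- \<nu> * t)) \<partial>lborel)"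
  proof (rule nn_integral_cong)
    fix t :: real
    have "(a * exp t) powr (- \<nu> - 1) * (a * exp t) = (a * exp t) powr (- \<nu>)"
      using a by (simp add: powr_diff)
    also have "\<dots> = a powr (- \<nu>) * exp (- \<nu> * t)" using a by (simp add: powr_mult exp_powr_real mult.commute)
    finally have 1: "(a * exp t) powr (- \<nu> - 1) * (a * exp t) = a powr (- \<nu>) * exp (- \<nu> * t)" .
    have 2: "exp (- c\<^sup>2 * (a * exp t)) * exp (- (1 / (4 * (a * exp t))) * r\<^sup>2) = g t"
      unfolding exp_add[symmetric] g_def
    proof (rule arg_cong[of _ _ exp])
      have "1 / (4 * (a * exp t)) * r\<^sup>2 = c * r / 2 * exp (- t)"
        using r c by (simp add: a_def exp_minus power2_eq_square field_simps)
      moreover have "c\<^sup>2 * (a * exp t) = c * r / 2 * exp t"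
        using c by (simp add: a_def power2_eq_square)
      moreover have "c * r / 2 * exp (- t) + c * r / 2 * exp t = (c * r) * cosh t"
        by (simp add: cosh_def algebra_simps)
      ultimately show "- c\<^sup>2 * (a * exp t) + - (1 / (4 * (a * exp t))) * r\<^sup>2 = - (c * r) * cosh t"
        by (simp only: mult_minus_left)
    qed
    have "(a * exp t) powr (- \<nu> - 1) * exp (- c\<^sup>2 * (a * exp t)) * exp (- (1 / (4 * (a * exp t))) * r\<^sup>2) * (a * exp t)
      = ((a * exp t) powr (- \<nu> - 1) * (a * exp t)) * (exp (- c\<^sup>2 * (a * exp t)) * exp (- (1 / (4 * (a * exp t))) * r\<^sup>2))"
      by (simp only: mult_ac)
    then have "(a * exp t) powr (- \<nu> - 1) * exp (- c\<^sup>2 * (a * exp t)) * exp (- (1 / (4 * (a * exp t))) * r\<^sup>2) * (a * exp t) = a powr (- \<nu>) * (g t * exp (- \<nu> * t))"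
      unfolding 1 2 by (simp only: mult_ac)
    then show "ennreal ((a * exp t) powr (- \<nu> - 1) * exp (- c\<^sup>2 * (a * exp t)) * exp (- (1 / (4 * (a * exp t))) * r\<^sup>2)) * ennreal (a * exp t) = ennreal (a powr (- \<nu>)) * ennreal (g t * exp (- \<nu> * t))"
      using a g(1)[of t] by (simp only: ennreal_mult'[symmetric] ennreal_mult''[symmetric] mult_nonneg_nonneg less_imp_le exp_ge_zero powr_ge_zero mult.assoc)
  qed
  also have "\<dots> = ennreal (a powr (- \<nu>)) * (\<integral>\<^sup>+t. ennreal (g t * exp (- \<nu> * t)) \<partial>lborel)"
    by (rule nn_integral_cmult) measurable
  also have "(\<integral>\<^sup>+t. ennreal (g t * exp (- \<nu> * t)) \<partial>lborel) = 2 * I"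
  proof -
    have "(\<integral>\<^sup>+t. ennreal (g t * exp (- \<nu> * t)) \<partial>lborel)
      = (\<integral>\<^sup>+t. ennreal (g t * exp (- \<nu> * t)) * indicator {0<..} t + ennreal (g t * exp (- \<nu> * t)) * indicator {..<0} t \<partial>lborel)"
      by (intro nn_integral_cong_AE eventually_mono[OF AE_lborel_singleton[of 0]]) (auto simp: indicator_def)
    also have "\<dots> = (\<integral>\<^sup>+t. ennreal (g t * exp (- \<nu> * t)) * indicator {0<..} t \<partial>lborel) + (\<integral>\<^sup>+t. ennreal (g t * exp (- \<nu> * t)) * indicator {..<0} t \<partial>lborel)"
      by (rule nn_integral_add) measurable
    also have "(\<integral>\<^sup>+t. ennreal (g t * exp (- \<nu> * t)) * indicator {..<0} t \<partial>lborel) = (\<integral>\<^sup>+t. ennreal (g t * exp (\<nu> * t)) * indicator {0<..} t \<partial>lborel)"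
      by (subst nn_integral_real_affine[where c = "-1" and t = 0]) (auto simp: g indicator_def intro!: nn_integral_cong)
    also have "(\<integral>\<^sup>+t. ennreal (g t * exp (- \<nu> * t)) * indicator {0<..} t \<partial>lborel) + (\<integral>\<^sup>+t. ennreal (g t * exp (\<nu> * t)) * indicator {0<..} t \<partial>lborel)
      = (\<integral>\<^sup>+t. ennreal (g t * exp (- \<nu> * t)) * indicator {0<..} t + ennreal (g t * exp (\<nu> * t)) * indicator {0<..} t \<partial>lborel)"
      by (rule nn_integral_add[symmetric]) measurable
    also have "\<dots> = (\<integral>\<^sup>+t. 2 * (ennreal (g t * cosh (\<nu> * t)) * indicator {0<..} t) \<partial>lborel)"
    proof (rule nn_integral_cong)
      fix t :: real
      have "ennreal (g t * exp (- \<nu> * t)) + ennreal (g t * exp (\<nu> * t)) = ennreal (g t * exp (- \<nu> * t) + g t * exp (\<nu> * t))"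
        using g(1)[of t] by (intro ennreal_plus[symmetric]) auto
      also have "g t * exp (- \<nu> * t) + g t * exp (\<nu> * t) = 2 * (g t * cosh (\<nu> * t))" by (simp add: cosh_def algebra_simps)
      also have "ennreal (2 * (g t * cosh (\<nu> * t))) = 2 * ennreal (g t * cosh (\<nu> * t))" by (subst ennreal_mult') auto
      finally show "ennreal (g t * exp (- \<nu> * t)) * indicator {0<..} t + ennreal (g t * exp (\<nu> * t)) * indicator {0<..} t
        = 2 * (ennreal (g t * cosh (\<nu> * t)) * indicator {0<..} t)" by (simp add: indicator_def)
    qed
    also have "\<dots> = 2 * I" unfolding I_def by (rule nn_integral_cmult) measurable
    finally show ?thesis .
  qed
  finally have J: "J = ennreal (a powr (- \<nu>)) * (2 * I)" .
  have "(\<integral>u. indicator {0<..} u * (u powr (- \<nu> - 1) * exp (- c\<^sup>2 * u) * exp (- (1 / (4 * u)) * r\<^sup>2)) \<partial>lborel)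
    = enn2real (\<integral>\<^sup>+u. ennreal (indicator {0<..} u * (u powr (- \<nu> - 1) * exp (- c\<^sup>2 * u) * exp (- (1 / (4 * u)) * r\<^sup>2))) \<partial>lborel)"
    by (intro integral_eq_nn_integral AE_I2) (auto intro!: mult_nonneg_nonneg)
  also have "(\<integral>\<^sup>+u. ennreal (indicator {0<..} u * (u powr (- \<nu> - 1) * exp (- c\<^sup>2 * u) * exp (- (1 / (4 * u)) * r\<^sup>2))) \<partial>lborel) = J"
    unfolding J_def by (intro nn_integral_cong) (auto simp: indicator_def)
  also have "enn2real J = 2 * a powr (- \<nu>) * bessel_K \<nu> (c * r)" unfolding J K by (simp add: enn2real_mult)
  also have "r powr (- \<nu>) * bessel_K \<nu> (c * r) = (1/2) * (2 * c) powr (- \<nu>) * (2 * a powr (- \<nu>) * bessel_K \<nu> (c * r))"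
    using r c by (simp add: a_def powr_divide)
  finally show ?thesis by simp
qed

lemma frac_kernel_eq_heat_mix:
  fixes n :: nat and s p \<rho> :: real
  assumes n: "2 \<le> n" and s: "0 \<le> s * p" and \<rho>: "0 < \<rho>"
  defines "c \<equiv> (real n - 1) / 2" and "\<nu> \<equiv> (1 + s * p) / 2"
  shows "frac_kernel n s p \<rho> = s * (if odd n then a_const n s p else a_const n s p / sqrt pi) * ((1/2) * (2 * c) powr (- \<nu>))
     * heat_mix n (c\<^sup>2) (\<lambda>u. u powr (- (\<nu> + 1))) \<rho>"
proof -
  have c: "0 < c" using n by (simp add: c_def)
  have w: "heat_weight (\<lambda>u. u powr (- (\<nu> + 1)))" using heat_weight_powr[of "\<nu> + 1" 0] s by (simp add: \<nu>_def)
  define k where "k = (1/2) * (2 * c) powr (- \<nu>)"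
  have k: "k \<noteq> 0" using c by (simp add: k_def)
  define h where "h = (\<lambda>r. r powr (- ((1 + s * p) / 2)) * bessel_K ((1 + s * p) / 2) ((real n - 1) / 2 * r))"
  \<comment> \<open>The constant is absorbed into the weight, so that \<open>h\<close> is itself a
    mixture and the radial derivatives and the Abel integral can act on it directly.\<close>
  define wk where "wk = (\<lambda>u. k * u powr (- (\<nu> + 1)))"
  have wk: "heat_weight wk"
  proof -
    obtain C N where C: "\<And>u. u > 0 \<Longrightarrow> u powr (- (\<nu> + 1)) \<le> C * (1 + 1 / u) ^ N" using w by (auto simp: heat_weight_def)
    have "0 \<le> wk u \<and> wk u \<le> (k * C) * (1 + 1 / u) ^ N" if "0 < u" for u
      using mult_left_mono[OF C[OF that], of k] c by (simp add: wk_def k_def mult_ac)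
    moreover have "wk \<in> borel_measurable borel" unfolding wk_def by measurable
    ultimately show ?thesis unfolding heat_weight_def by blast
  qed
  have hk: "h r = gauss_mix 0 (c\<^sup>2) wk r" if "0 < r" for r
    using bessel_K_mixture[OF that c, of \<nu>]
    unfolding gauss_mix_def wk_def gauss_deriv.simps h_def \<nu>_def[symmetric] c_def[symmetric] k_def[symmetric]
    by (simp add: mult_ac flip: integral_mult_right_zero)
  have iter: "(radial_deriv ^^ (n div 2)) h r = gauss_mix (n div 2) (c\<^sup>2) wk r" if "0 < r" for r
    using c hk that by (intro radial_deriv_iter_gauss_mix wk) auto
  have "(if odd n then (radial_deriv ^^ (n div 2)) h \<rho> else abel_integral ((radial_deriv ^^ (n div 2)) h) \<rho>) = heat_mix n (c\<^sup>2) wk \<rho>"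
    using c by (intro gauss_mix_eq_heat_mix n wk \<rho> iter) auto
  moreover have "heat_mix n (c\<^sup>2) wk \<rho> = k * heat_mix n (c\<^sup>2) (\<lambda>u. u powr (- (\<nu> + 1))) \<rho>"
    unfolding heat_mix_def wk_def by (simp add: mult_ac flip: integral_mult_right_zero)
  moreover have "(n - 1) div 2 = n div 2" if "odd n" using that by presburger
  ultimately show ?thesis
    unfolding frac_kernel_def Let_def h_def[symmetric] k_def[symmetric] by (auto split: if_splits)
qed

lemma poisson_kernel_eq_heat_mix:
  fixes n :: nat and t \<rho> :: real
  assumes n: "2 \<le> n" and \<rho>: "0 < \<rho>"
  defines "c \<equiv> (real n - 1) / 2"
  shows "poisson_kernel n \<rho> t = ((1/2) * (2 * c) powr (- (1/2))) * heat_mix n (c\<^sup>2) (\<lambda>u. u powr (- (3/2)) * exp (- t\<^sup>2 / (4 * u))) \<rho>"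
proof -
  have c: "0 < c" using n by (simp add: c_def)
  define k where "k = (1/2) * (2 * c) powr (- (1/2))"
  define h where "h = (\<lambda>r. bessel_K_half n (sqrt (r\<^sup>2 + t\<^sup>2)))"
  define w where "w = (\<lambda>u. u powr (- (3/2)) * exp (- t\<^sup>2 / (4 * u)))"
  define wk where "wk = (\<lambda>u. k * w u)"
  have w: "heat_weight w" unfolding w_def by (rule heat_weight_powr) simp
  have wk: "heat_weight wk"
  proof -
    obtain C N where C: "\<And>u. u > 0 \<Longrightarrow> w u \<le> C * (1 + 1 / u) ^ N" using w by (auto simp: heat_weight_def)
    have "0 \<le> wk u \<and> wk u \<le> (k * C) * (1 + 1 / u) ^ N" if "0 < u" for u
      using mult_left_mono[OF C[OF that], of k] c by (simp add: wk_def w_def k_def mult_ac)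
    moreover have "wk \<in> borel_measurable borel" unfolding wk_def w_def by measurable
    ultimately show ?thesis unfolding heat_weight_def by blast
  qed
  have hk: "h r = gauss_mix 0 (c\<^sup>2) wk r" if r: "0 < r" for r
  proof -
    \<comment> \<open>The Gaussian at distance R splits into the Gaussian at r and exp(-t^2/(4u)),
      which does not depend on r and joins the weight.\<close>
    define R where "R = sqrt (r\<^sup>2 + t\<^sup>2)"
    have R: "0 < R" "R\<^sup>2 = r\<^sup>2 + t\<^sup>2" using r by (auto simp: R_def add_pos_nonneg)
    have "h r = k * (\<integral>u. indicator {0<..} u * (u powr (- (1/2) - 1) * exp (- c\<^sup>2 * u) * exp (- (1 / (4 * u)) * R\<^sup>2)) \<partial>lborel)"
      unfolding h_def R_def[symmetric] bessel_K_half_def c_def[symmetric] k_def by (rule bessel_K_mixture[OF R(1) c])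
    also have "\<dots> = gauss_mix 0 (c\<^sup>2) wk r"
      unfolding gauss_mix_def integral_mult_right_zero[symmetric]
    proof (rule Bochner_Integration.integral_cong[OF refl])
      fix u :: real
      have "exp (- (1 / (4 * u)) * R\<^sup>2) = exp (- t\<^sup>2 / (4 * u)) * exp (- (1 / (4 * u)) * r\<^sup>2)"
        unfolding R(2) exp_add[symmetric] by (simp add: add_divide_distrib)
      then show "k * (indicator {0<..} u * (u powr (- (1/2) - 1) * exp (- c\<^sup>2 * u) * exp (- (1 / (4 * u)) * R\<^sup>2)))
        = indicator {0<..} u * (wk u * exp (- c\<^sup>2 * u) * gauss_deriv 0 (1 / (4 * u)) r)"
        by (simp add: wk_def w_def)
    qed
    finally show ?thesis .
  qed
  have iter: "(radial_deriv ^^ (n div 2)) h r = gauss_mix (n div 2) (c\<^sup>2) wk r" if "0 < r" for r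
    using c hk that by (intro radial_deriv_iter_gauss_mix wk) auto
  have "(if odd n then (radial_deriv ^^ (n div 2)) h \<rho> else abel_integral ((radial_deriv ^^ (n div 2)) h) \<rho>) = heat_mix n (c\<^sup>2) wk \<rho>"
    using c by (intro gauss_mix_eq_heat_mix n wk \<rho> iter) auto
  moreover have "heat_mix n (c\<^sup>2) wk \<rho> = k * heat_mix n (c\<^sup>2) w \<rho>"
    unfolding heat_mix_def wk_def by (simp add: mult_ac flip: integral_mult_right_zero)
  moreover have "(n - 1) div 2 = n div 2" if "odd n" using that by presburger
  ultimately show ?thesis
    unfolding poisson_kernel_def Let_def h_def[symmetric] k_def[symmetric] w_def by (auto split: if_splits)
qed

section \<open>Lorentz invariance of the volume\<close>

lemma nn_integral_lborel_affine:
  fixes f :: "'a::euclidean_space \<Rightarrow> ennreal"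
  assumes [measurable]: "f \<in> borel_measurable borel" and "c \<noteq> 0"
  shows "(\<integral>\<^sup>+x. f x \<partial>lborel) = ennreal (\<bar>c\<bar> ^ DIM('a)) * (\<integral>\<^sup>+x. f (t + c *\<^sub>R x) \<partial>lborel)"
proof -
  have "(\<integral>\<^sup>+x. f x \<partial>lborel) = (\<integral>\<^sup>+x. f x \<partial>density (distr lborel borel (\<lambda>x. t + c *\<^sub>R x)) (\<lambda>_. ennreal (\<bar>c\<bar> ^ DIM('a))))"
    using lborel_affine[OF \<open>c \<noteq> 0\<close>, of t] by simp
  also have "\<dots> = (\<integral>\<^sup>+x. ennreal (\<bar>c\<bar> ^ DIM('a)) * f (t + c *\<^sub>R x) \<partial>lborel)"
    by (subst nn_integral_density) (auto simp: nn_integral_distr)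
  also have "\<dots> = ennreal (\<bar>c\<bar> ^ DIM('a)) * (\<integral>\<^sup>+x. f (t + c *\<^sub>R x) \<partial>lborel)"
    by (rule nn_integral_cmult) measurable
  finally show ?thesis .
qed

text \<open>Haar uniqueness: the image measure is translation invariant, so it is a multiple of Lebesgue
  measure, and the factor squares to one.\<close>

lemma distr_lborel_linear_involution:
  fixes R :: "'a::euclidean_space \<Rightarrow> 'a"
  assumes lin: "linear R" and inv: "\<And>x. R (R x) = x"
  shows "distr lborel borel R = lborel"
proof -
  have [measurable]: "R \<in> borel_measurable borel"
    using lin by (intro borel_measurable_continuous_onI linear_continuous_on) (simp add: linear_conv_bounded_linear)
  define B :: "'a set" where "B = cbox 0 One"
  have [measurable]: "B \<in> sets borel" by (simp add: B_def)
  have B1: "emeasure lborel B = 1"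
    by (simp add: B_def emeasure_lborel_cbox_eq inner_diff_left)
  define k where "k = emeasure lborel (R -` B)"
  have M: "emeasure lborel (R -` A) = k * emeasure lborel A" if [measurable]: "A \<in> sets borel" for A
  proof -
    have vm: "emeasure lborel (R -` X) = (\<integral>\<^sup>+x. indicator X (R x) \<partial>lborel)" if [measurable]: "X \<in> sets borel" for X
    proof -
      have "emeasure lborel (R -` X) = (\<integral>\<^sup>+x. indicator (R -` X) x \<partial>lborel)"
        using measurable_sets[of R borel borel X] by (subst nn_integral_indicator) auto
      then show ?thesis by (simp add: indicator_def)
    qed
    have "emeasure lborel (R -` A) = (\<integral>\<^sup>+x. indicator A (R x) * emeasure lborel B \<partial>lborel)"
      by (simp add: vm B1)
    \<comment> \<open>The volume of a translate of the unit cube is inserted and the integrals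
      exchanged. Translating x by \<open>R y\<close> translates \<open>R x\<close> by y, after which
      the integral over y yields the volume of \<open>A\<close>.\<close>
    also have "\<dots> = (\<integral>\<^sup>+x. \<integral>\<^sup>+y. indicator A (R x) * indicator B (R x + y) \<partial>lborel \<partial>lborel)"
    proof (rule nn_integral_cong)
      fix x
      have "(\<integral>\<^sup>+y. indicator A (R x) * indicator B (R x + y) \<partial>lborel) = indicator A (R x) * (\<integral>\<^sup>+y. indicator B (R x + y) \<partial>lborel)"
        by (rule nn_integral_cmult) measurable
      also have "(\<integral>\<^sup>+y. indicator B (R x + y) \<partial>lborel) = (emeasure lborel B :: ennreal)"
        using nn_integral_lborel_affine[of "indicator B" 1 "R x"] by simp
      finally show "indicator A (R x) * emeasure lborel B = (\<integral>\<^sup>+y. indicator A (R x) * indicator B (R x + y) \<partial>lborel)" by simp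
    qed
    also have "\<dots> = (\<integral>\<^sup>+y. \<integral>\<^sup>+x. indicator A (R x) * indicator B (R x + y) \<partial>lborel \<partial>lborel)"
      by (rule lborel_pair.Fubini'[symmetric]) measurable
    also have "\<dots> = (\<integral>\<^sup>+y. \<integral>\<^sup>+x. indicator A (R x - y) * indicator B (R x) \<partial>lborel \<partial>lborel)"
    proof (rule nn_integral_cong)
      fix y
      have "(\<integral>\<^sup>+x. indicator A (R x - y) * indicator B (R x) \<partial>lborel) =
          (\<integral>\<^sup>+x. indicator A (R (R y + x) - y) * indicator B (R (R y + x)) \<partial>lborel :: ennreal)"
        using nn_integral_lborel_affine[of "\<lambda>x. indicator A (R x - y) * indicator B (R x)" 1 "R y"] by simp
      also have "\<dots> = (\<integral>\<^sup>+x. indicator A (R x) * indicator B (R x + y) \<partial>lborel)"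
        using lin by (simp add: linear_add inv add.commute)
      finally show "(\<integral>\<^sup>+x. indicator A (R x) * indicator B (R x + y) \<partial>lborel)
        = (\<integral>\<^sup>+x. indicator A (R x - y) * indicator B (R x) \<partial>lborel :: ennreal)" by simp
    qed
    also have "\<dots> = (\<integral>\<^sup>+x. \<integral>\<^sup>+y. indicator A (R x - y) * indicator B (R x) \<partial>lborel \<partial>lborel)"
      by (rule lborel_pair.Fubini') measurable
    also have "\<dots> = (\<integral>\<^sup>+x. emeasure lborel A * indicator B (R x) \<partial>lborel)"
    proof (rule nn_integral_cong)
      fix x
      have "(\<integral>\<^sup>+y. indicator A (R x - y) * indicator B (R x) \<partial>lborel) = (\<integral>\<^sup>+y. indicator A (R x - y) \<partial>lborel) * indicator B (R x)"
        by (rule nn_integral_multc) measurable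
      also have "(\<integral>\<^sup>+y. indicator A (R x - y) \<partial>lborel) = (emeasure lborel A :: ennreal)"
        using nn_integral_lborel_affine[of "indicator A" "-1" "R x"] by simp
      finally show "(\<integral>\<^sup>+y. indicator A (R x - y) * indicator B (R x) \<partial>lborel) = emeasure lborel A * indicator B (R x)" .
    qed
    also have "\<dots> = emeasure lborel A * (\<integral>\<^sup>+x. indicator B (R x) \<partial>lborel)"
      by (rule nn_integral_cmult) measurable
    finally show ?thesis by (simp add: k_def vm mult.commute)
  qed
  have "R -` (R -` B) = B" using inv by auto
  then have "k * k = 1"
    using M[of "R -` B"] B1 measurable_sets[of R borel borel B] by (simp add: k_def)
  then have k1: "k = 1"
  proof (cases k)
    case (real r)
    then have "r * r = 1" using \<open>k * k = 1\<close> by (simp flip: ennreal_mult ennreal_1)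
    then have "r = 1" using real by (metis mult_1 mult_cancel_left2 power2_eq_1_iff power2_eq_square neg_equal_0_iff_equal neg_0_le_iff_le not_one_le_zero)
    then show ?thesis using real by simp
  qed (use \<open>k * k = 1\<close> in simp)
  show ?thesis
    by (rule measure_eqI) (auto simp: emeasure_distr M k1)
qed

section \<open>Lorentz reflections\<close>

abbreviation hyp_origin :: "'n::finite point" where "hyp_origin \<equiv> (1, 0)"

text \<open>The reflection in the Lorentz-orthogonal complement of \<open>w\<close>. If
  \<open>lorentz w w\<close> is 0, division by zero makes it the identity, so involution and
  isometry hold for every \<open>w\<close>.\<close>

definition lorentz_refl :: "'n::finite point \<Rightarrow> 'n point \<Rightarrow> 'n point" where
  "lorentz_refl w z = z - (2 * lorentz z w / lorentz w w) *\<^sub>R w"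

lemma lorentz_simps:
  "lorentz (a + b) c = lorentz a c + lorentz b c" "lorentz c (a + b) = lorentz c a + lorentz c b"
  "lorentz (a - b) c = lorentz a c - lorentz b c" "lorentz c (a - b) = lorentz c a - lorentz c b"
  "lorentz (r *\<^sub>R a) c = r * lorentz a c" "lorentz c (r *\<^sub>R a) = r * lorentz c a"
  by (simp_all add: lorentz_def inner_left_distrib inner_right_distrib inner_diff_left inner_diff_right algebra_simps)

lemma lorentz_commute: "lorentz a b = lorentz b a"
  by (simp add: lorentz_def inner_commute mult.commute)

lemma linear_lorentz_refl: "linear (lorentz_refl w)"
  by (rule linearI) (simp_all add: lorentz_refl_def lorentz_simps algebra_simps add_divide_distrib)

lemma lorentz_refl_self: "lorentz w w \<noteq> 0 \<Longrightarrow> lorentz (lorentz_refl w z) w = - lorentz z w"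
  by (simp add: lorentz_refl_def lorentz_simps)

lemma lorentz_refl_invol: "lorentz_refl w (lorentz_refl w z) = z"
proof (cases "lorentz w w = 0")
  case False
  then show ?thesis
    using lorentz_refl_self[OF False, of z] unfolding lorentz_refl_def[of w "lorentz_refl w z"] by (simp add: lorentz_refl_def)
qed (simp add: lorentz_refl_def)

lemma lorentz_refl_isometry: "lorentz (lorentz_refl w a) (lorentz_refl w b) = lorentz a b"
proof (cases "lorentz w w = 0")
  case False
  have "lorentz (lorentz_refl w a) (lorentz_refl w b) = lorentz (lorentz_refl w a) b - 2 * lorentz b w / lorentz w w * lorentz (lorentz_refl w a) w"
    unfolding lorentz_refl_def[of w b] lorentz_simps ..
  also have "\<dots> = lorentz a b"
    unfolding lorentz_refl_self[OF False] unfolding lorentz_refl_def lorentz_simps lorentz_commute[of w b] by simp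
  finally show ?thesis .
qed (simp add: lorentz_refl_def)

text \<open>For forward timelike vectors the time component exceeds the norm of the space component,
  so the product of the former beats the Cauchy-Schwarz bound on the latter.\<close>

lemma lorentz_forward_pos:
  assumes "lorentz a a > 0" "fst a > 0" "lorentz b b > 0" "fst b > 0"
  shows "lorentz a b > 0"
proof -
  have "norm (snd a) < fst a" "norm (snd b) < fst b"
    using assms by (auto simp: lorentz_def dot_square_norm abs_less_iff simp flip: power2_eq_square intro!: power2_less_imp_less[of "norm _"])
  then have "norm (snd a) * norm (snd b) < fst a * fst b"
    by (intro mult_strict_mono) (auto intro: order.strict_trans1[OF norm_ge_zero])
  moreover have "snd a \<bullet> snd b \<le> norm (snd a) * norm (snd b)" by (rule norm_cauchy_schwarz)
  ultimately show ?thesis by (simp add: lorentz_def)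
qed

lemma hyperboloid_fst: "x \<in> hyperboloid \<Longrightarrow> fst x = sqrt (1 + (norm (snd x))\<^sup>2)"
  by (intro real_sqrt_unique[symmetric]) (auto simp: hyperboloid_def lorentz_def dot_square_norm power2_eq_square algebra_simps)

text \<open>The reflection along the difference of two points of equal Lorentz square exchanges
  them. If \<open>x\<close> is the origin the difference is 0 and the reflection is the
  identity.\<close>

lemma ex_lorentz_involution:
  fixes x :: "'n::finite point"
  assumes x: "x \<in> hyperboloid"
  obtains R where "linear R" "\<And>z. R (R z) = z" "\<And>a b. lorentz (R a) (R b) = lorentz a b" "R x = hyp_origin"
proof -
  define w where "w = x - hyp_origin"
  have xx: "lorentz x x = 1" "lorentz x hyp_origin = fst x" "lorentz hyp_origin x = fst x" "lorentz hyp_origin hyp_origin = (1::real)"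
    using x by (auto simp: hyperboloid_def lorentz_def)
  have ww: "lorentz w w = 2 - 2 * fst x" "lorentz x w = 1 - fst x"
    by (simp_all add: w_def lorentz_simps xx)
  have "lorentz_refl w x = hyp_origin"
  proof (cases "fst x = 1")
    case True
    then have "norm (snd x) = 0" using hyperboloid_fst[OF x] by (simp add: real_sqrt_eq_iff)
    then have "x = hyp_origin" using True by (simp add: prod_eq_iff)
    then show ?thesis by (simp add: lorentz_refl_def w_def)
  next
    case False
    then have "2 * lorentz x w / lorentz w w = 1" unfolding ww by (simp add: divide_simps)
    then show ?thesis unfolding lorentz_refl_def by (simp add: w_def)
  qed
  then show ?thesis
    using that[of "lorentz_refl w"] linear_lorentz_refl lorentz_refl_invol lorentz_refl_isometry by blast
qed

section \<open>Surface measure and polar coordinates in Euclidean space\<close>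

lemma punctured_cball_measurable [measurable]: "cball 0 1 - {0::'a::euclidean_space} \<in> sets borel"
  by simp

lemma sphere_borel [measurable]: "sphere (0::'a::euclidean_space) 1 \<in> sets borel"
  by (simp add: borel_closed)

lemma sets_sphere_measure: "sets (sphere_measure :: (real ^ 'n::finite) measure) = sets (restrict_space borel (sphere 0 1))"
  by (simp add: sphere_measure_def)

lemma space_sphere_measure [simp]: "space (sphere_measure :: (real ^ 'n::finite) measure) = sphere 0 1"
  by (simp add: sphere_measure_def space_restrict_space)

lemma measurable_sgn_sphere:
  "sgn \<in> measurable (restrict_space lborel (cball 0 1 - {0})) (restrict_space borel (sphere (0::'a::euclidean_space) 1))"
  by (intro measurable_restrict_space2 measurable_restrict_space1) (auto simp: space_restrict_space norm_sgn)

lemma emeasure_sphere_measure: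
  fixes B :: "(real ^ 'n::finite) set"
  assumes "B \<in> sets sphere_measure"
  shows "emeasure sphere_measure B = of_nat CARD('n) * (\<integral>\<^sup>+v. indicator B (sgn v) * indicator (cball 0 1 - {0}) v \<partial>lborel)"
proof -
  have B: "B \<in> sets (restrict_space borel (sphere 0 1))" using assms by (simp add: sets_sphere_measure)
  have "emeasure sphere_measure B = of_nat CARD('n) * emeasure (restrict_space lborel (cball 0 1 - {0})) (sgn -` B \<inter> (cball 0 1 - {0}))"
  proof -
    have "sgn \<in> measurable (scale_measure (of_nat CARD('n)) (restrict_space lborel (cball 0 1 - {0}))) (restrict_space borel (sphere (0::real^'n) 1))"
      using measurable_sgn_sphere by (subst measurable_cong_sets[OF sets_scale_measure refl])
    from emeasure_distr[OF this B] show ?thesis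
      by (simp add: sphere_measure_def space_restrict_space space_scale_measure)
  qed
  also have "emeasure (restrict_space lborel (cball 0 1 - {0})) (sgn -` B \<inter> (cball 0 1 - {0})) =
     (\<integral>\<^sup>+v. indicator (sgn -` B \<inter> (cball 0 1 - {0})) v \<partial>restrict_space lborel (cball 0 1 - {0}))"
    using measurable_sets[OF measurable_sgn_sphere B] by (subst nn_integral_indicator) (auto simp: space_restrict_space)
  also have "\<dots> = (\<integral>\<^sup>+v. indicator B (sgn v) * indicator (cball 0 1 - {0}) v \<partial>lborel)"
    by (subst nn_integral_restrict_space) (auto intro!: nn_integral_cong split: split_indicator)
  finally show ?thesis .
qed

lemma emeasure_sphere_measure_sphere:
  "emeasure (sphere_measure :: (real ^ 'n::finite) measure) (sphere 0 1)
    = of_nat CARD('n) * emeasure lborel (cball (0 :: real ^ 'n) 1)"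
proof -
  have "(\<integral>\<^sup>+v. indicator (sphere 0 1) (sgn v) * indicator (cball 0 1 - {0 :: real ^ 'n}) v \<partial>lborel)
      = (\<integral>\<^sup>+v. indicator (cball 0 1 - {0 :: real ^ 'n}) v \<partial>lborel)"
    by (intro nn_integral_cong) (auto simp: norm_sgn split: split_indicator)
  also have "\<dots> = emeasure lborel (cball 0 1 - {0 :: real ^ 'n})" by (rule nn_integral_indicator) simp
  also have "\<dots> = emeasure lborel (cball (0 :: real ^ 'n) 1)"
    by (rule emeasure_Diff_null_set) auto
  finally show ?thesis
    using sets.top[of "sphere_measure :: (real ^ 'n) measure"] by (simp add: emeasure_sphere_measure)
qed

lemma finite_sphere_measure: "emeasure (sphere_measure :: (real ^ 'n::finite) measure) (sphere 0 1) < \<infinity>"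
  using emeasure_lborel_cball_finite[of "0 :: real ^ 'n" 1]
  by (simp add: emeasure_sphere_measure_sphere ennreal_mult_less_top of_nat_less_top)

lemma sphere_measure_pos: "emeasure (sphere_measure :: (real ^ 'n::finite) measure) (sphere 0 1) > 0"
  using emeasure_cball[of 1 "0 :: real ^ 'n"] unit_ball_vol_pos[of "real DIM(real ^ 'n)"]
  by (simp add: emeasure_sphere_measure_sphere ennreal_zero_less_mult_iff)

lemma finite_measure_sphere: "finite_measure (sphere_measure :: (real ^ 'n::finite) measure)"
  using finite_sphere_measure[where 'n = 'n] by (intro finite_measureI) (auto simp: less_top[symmetric])

definition radial_measure :: "nat \<Rightarrow> real measure" where
  "radial_measure n = density lborel (\<lambda>r. ennreal (r ^ (n - 1)) * indicator {0<..1} r)"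

lemma emeasure_radial_measure:
  assumes "0 < n" "0 \<le> x" "x \<le> 1"
  shows "emeasure (radial_measure n) {x<..} = ennreal ((1 - x ^ n) / n)"
proof -
  have "emeasure (radial_measure n) {x<..} = (\<integral>\<^sup>+r. ennreal (r ^ (n - 1)) * indicator {x..1} r \<partial>lborel)"
    unfolding radial_measure_def using assms
    by (subst emeasure_density) (auto intro!: nn_integral_cong_AE eventually_mono[OF AE_lborel_singleton[of x]] split: split_indicator)
  also have "\<dots> = ennreal (1 ^ n / n - x ^ n / n)"
    using assms by (intro nn_integral_FTC_Icc) (auto intro!: derivative_eq_intros)
  finally show ?thesis by (simp add: diff_divide_distrib)
qed

lemma norm_sgn_measurable:
  "(\<lambda>v. (norm v, sgn v)) \<in> measurable (restrict_space lborel (cball 0 1 - {0})) (borel \<Otimes>\<^sub>M restrict_space borel (sphere (0::'a::euclidean_space) 1))"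
  using measurable_sgn_sphere by (intro measurable_Pair) (auto intro: measurable_restrict_space1)

text \<open>Scaling by x maps the sector over \<open>B\<close> in the unit ball onto its part of
  radius at most x, so this part carries the fraction x^n of the mass. The radial law is thereby
  known on all half lines, and it is finite.\<close>

lemma emeasure_polar_aux:
  fixes B :: "(real ^ 'n::finite) set"
  assumes B: "B \<in> sets sphere_measure" and A: "A \<in> sets borel"
  shows "emeasure (radial_measure CARD('n)) A * emeasure sphere_measure B =
    (\<integral>\<^sup>+v. indicator A (norm v) * (indicator B (sgn v) * indicator (cball 0 1 - {0}) v) \<partial>lborel)"
proof -
  let ?n = "CARD('n)"
  have [measurable]: "B \<in> sets borel"
    using B by (auto simp: sets_sphere_measure sets_restrict_space)
  have [measurable]: "A \<in> sets borel" by fact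
  define D where "D = (\<lambda>v::real^'n. indicator B (sgn v) * indicator (cball 0 1 - {0}) v :: ennreal)"
  have [measurable]: "D \<in> borel_measurable borel" unfolding D_def by measurable
  have D_le: "D v \<le> indicator (cball 0 1) v" for v :: "real ^ 'n" by (auto simp: D_def split: split_indicator)
  have ID: "(\<integral>\<^sup>+v. D v \<partial>lborel) < \<infinity>"
  proof -
    have "(\<integral>\<^sup>+v. D v \<partial>lborel) \<le> (\<integral>\<^sup>+v. indicator (cball 0 1) (v :: real ^ 'n) \<partial>lborel)" by (intro nn_integral_mono D_le)
    also have "\<dots> < \<infinity>" using emeasure_lborel_cball_finite[of "0 :: real ^ 'n" 1] by simp
    finally show ?thesis .
  qed
  define M where "M = distr (density lborel D) borel norm"
  define N where "N = scale_measure (emeasure sphere_measure B) (radial_measure ?n)"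
  have M: "emeasure M A = (\<integral>\<^sup>+v. indicator A (norm v) * D v \<partial>lborel)" if [measurable]: "A \<in> sets borel" for A
    unfolding M_def by (simp add: emeasure_distr emeasure_density measurable_sets_borel[of norm borel] vimage_def)
       (auto intro!: nn_integral_cong split: split_indicator)
  have sB: "emeasure sphere_measure B = ennreal ?n * (\<integral>\<^sup>+v. D v \<partial>lborel)"
    using emeasure_sphere_measure[OF B] by (simp add: D_def ennreal_of_nat_eq_real_of_nat)
  have main: "emeasure M {x<..} = emeasure N {x<..}" if x: "0 \<le> x" "x < 1" for x
  proof -
    have small: "(\<integral>\<^sup>+v. indicator {..x} (norm v) * D v \<partial>lborel) = ennreal (x ^ ?n) * (\<integral>\<^sup>+v. D v \<partial>lborel)"
    proof (cases "x = 0")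
      case True
      have "(\<integral>\<^sup>+v. indicator {..x} (norm v) * D v \<partial>lborel) = (\<integral>\<^sup>+v. 0 \<partial>(lborel :: (real ^ 'n) measure))"
        by (rule nn_integral_cong) (auto simp: D_def True split: split_indicator)
      then show ?thesis using True by simp
    next
      case False
      then have x0: "0 < x" using x by simp
      have "(\<integral>\<^sup>+v. indicator {..x} (norm v) * D v \<partial>lborel) = ennreal (x ^ ?n) * (\<integral>\<^sup>+v. indicator {..x} (norm (x *\<^sub>R v)) * D (x *\<^sub>R v) \<partial>lborel)"
        using nn_integral_lborel_affine[of "\<lambda>v. indicator {..x} (norm v) * D v" x 0] x0 by simp
      also have "(\<integral>\<^sup>+v. indicator {..x} (norm (x *\<^sub>R v)) * D (x *\<^sub>R v) \<partial>lborel) = (\<integral>\<^sup>+v. D v \<partial>lborel)"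
        using x0 x mult_left_le[of "norm _" x] by (intro nn_integral_cong)
          (auto simp: D_def sgn_scaleR split: split_indicator intro: order_trans[OF mult_left_mono[of _ 1 x]])
      finally show ?thesis .
    qed
    have "(\<integral>\<^sup>+v. D v \<partial>lborel) = (\<integral>\<^sup>+v. indicator {x<..} (norm v) * D v + indicator {..x} (norm v) * D v \<partial>lborel)"
      by (intro nn_integral_cong) (auto split: split_indicator)
    also have "\<dots> = emeasure M {x<..} + ennreal (x ^ ?n) * (\<integral>\<^sup>+v. D v \<partial>lborel)"
      by (subst nn_integral_add) (auto simp: M small)
    finally have eq: "(\<integral>\<^sup>+v. D v \<partial>lborel) = emeasure M {x<..} + ennreal (x ^ ?n) * (\<integral>\<^sup>+v. D v \<partial>lborel)" .
    obtain d where d: "d \<ge> 0" "(\<integral>\<^sup>+v. D v \<partial>lborel) = ennreal d" using ID by (cases "\<integral>\<^sup>+v. D v \<partial>lborel") auto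
    then obtain e where e: "e \<ge> 0" "emeasure M {x<..} = ennreal e"
      using eq by (cases "emeasure M {x<..}") auto
    have "d = e + x ^ ?n * d"
      using eq d e x by (simp flip: ennreal_mult ennreal_plus)
    then have "e = d * (1 - x ^ ?n)" by (simp add: algebra_simps)
    then have e_eq: "e = ?n * d * ((1 - x ^ ?n) / ?n)" by simp
    show ?thesis
      unfolding N_def e emeasure_scale_measure sB d using x d
      by (subst emeasure_radial_measure) (auto simp: e_eq power_le_one simp flip: ennreal_mult)
  qed
  \<comment> \<open>Measures finite on half lines are determined by their values there. Below 0 the
    half line has the mass of the one starting at 0, from 1 on both measures vanish.\<close>
  have "M = N"
  proof (rule measure_eqI_lessThan)
    fix x :: real
    have neg: "emeasure M {x<..} = emeasure M {0<..}" if "x < 0"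
    proof -
      have "indicator {x<..} (norm v) * D v = indicator {0<..} (norm v) * D v" for v
        using order.strict_trans2[OF that norm_ge_zero[of v]] by (auto simp: D_def split: split_indicator)
      then show ?thesis by (simp add: M)
    qed
    have neg': "emeasure (radial_measure ?n) {x<..} = emeasure (radial_measure ?n) {0<..}" if "x < 0"
      using that unfolding radial_measure_def by (subst (1 2) emeasure_density) (auto intro!: nn_integral_cong split: split_indicator)
    have big: "emeasure M {x<..} = 0" if "1 \<le> x"
    proof -
      have "emeasure M {x<..} = (\<integral>\<^sup>+v. 0 \<partial>(lborel :: (real ^ 'n) measure))"
        using that by (subst M, simp) (rule nn_integral_cong, auto simp: D_def split: split_indicator)
      then show ?thesis by simp
    qed
    have big': "emeasure (radial_measure ?n) {x<..} = 0" if "1 \<le> x"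
    proof -
      have "emeasure (radial_measure ?n) {x<..} = (\<integral>\<^sup>+r. 0 \<partial>(lborel :: real measure))"
        using that unfolding radial_measure_def
        by (subst emeasure_density, simp, simp) (rule nn_integral_cong, auto split: split_indicator)
      then show ?thesis by simp
    qed
    show "emeasure M {x<..} = emeasure N {x<..}"
    proof (cases "x < 0 \<or> 1 \<le> x")
      case True
      then show ?thesis
      proof
        assume "x < 0"
        with main[of 0] show ?thesis by (simp only: neg N_def emeasure_scale_measure neg')
      qed (simp add: N_def big big')
    qed (simp add: main)
    have "emeasure M {x<..} \<le> (\<integral>\<^sup>+v. D v \<partial>lborel)" by (subst M) (auto intro!: nn_integral_mono split: split_indicator)
    then show "emeasure M {x<..} < \<infinity>" using ID by (rule order.strict_trans1)
  qed (auto simp: M_def N_def radial_measure_def)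
  then have "emeasure M A = emeasure N A" by simp
  then show ?thesis by (simp add: M A N_def D_def mult.commute)
qed

text \<open>The image of Lebesgue measure on the punctured unit ball under the map to (norm v, sgn
  v) is the product of \<open>radial_measure\<close> and \<open>sphere_measure\<close>: by
  \<open>emeasure_polar_aux\<close> they agree on rectangles.\<close>

lemma nn_integral_polar_cball:
  fixes f :: "real ^ 'n::finite \<Rightarrow> ennreal"
  assumes [measurable]: "f \<in> borel_measurable borel"
  shows "(\<integral>\<^sup>+v. f v * indicator (cball 0 1) v \<partial>lborel) =
    (\<integral>\<^sup>+\<omega>. (\<integral>\<^sup>+r. f (r *\<^sub>R \<omega>) * ennreal (r ^ (CARD('n) - 1)) * indicator {0<..1} r \<partial>lborel) \<partial>sphere_measure)"
proof -
  let ?S = "sphere_measure :: (real ^ 'n) measure" and ?R = "radial_measure CARD('n)"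
  let ?M = "distr (restrict_space lborel (cball 0 1 - {0})) (borel \<Otimes>\<^sub>M restrict_space borel (sphere (0::real^'n) 1)) (\<lambda>v. (norm v, sgn v))"
  interpret S: finite_measure ?S by (rule finite_measure_sphere)
  have fin: "emeasure ?R UNIV < \<infinity>"
  proof -
    have "emeasure ?R UNIV = emeasure ?R {0<..}"
      unfolding radial_measure_def by (subst (1 2) emeasure_density) (auto intro!: nn_integral_cong split: split_indicator)
    then show ?thesis by (simp add: emeasure_radial_measure)
  qed
  interpret R: finite_measure ?R
    by (rule finite_measureI) (use fin in \<open>auto simp: radial_measure_def\<close>)
  have sets_R [measurable_cong]: "sets ?R = sets borel" by (simp add: radial_measure_def)
  note sets_sphere_measure [measurable_cong]
  have fm: "(\<lambda>z. (case z of (r, \<omega>) \<Rightarrow> f (r *\<^sub>R \<omega>))) \<in> borel_measurable (borel \<Otimes>\<^sub>M restrict_space borel (sphere (0::real^'n) 1))"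
    unfolding case_prod_beta
    by (intro measurable_compose[OF _ assms] borel_measurable_scaleR measurable_fst
      measurable_compose[OF measurable_snd measurable_restrict_space1[OF measurable_ident, unfolded id_def]])
  have eq: "?R \<Otimes>\<^sub>M ?S = ?M"
  proof (rule pair_measure_eqI)
    show "sets (?R \<Otimes>\<^sub>M ?S) = sets ?M"
      by (simp cong: sets_pair_measure_cong add: sets_sphere_measure sets_R)
    fix A B assume A: "A \<in> sets ?R" and B: "B \<in> sets ?S"
    have AB: "A \<times> B \<in> sets (borel \<Otimes>\<^sub>M restrict_space borel (sphere (0::real^'n) 1))"
      using A B by (auto simp: sets_R sets_sphere_measure)
    have "emeasure ?M (A \<times> B) = (\<integral>\<^sup>+z. indicator (A \<times> B) z \<partial>?M)" using AB by simp
    also have "\<dots> = (\<integral>\<^sup>+v. indicator (A \<times> B) (norm v, sgn v) \<partial>restrict_space lborel (cball 0 1 - {0}))"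
      using AB by (intro nn_integral_distr norm_sgn_measurable) auto
    also have "\<dots> = (\<integral>\<^sup>+v. indicator A (norm v) * (indicator B (sgn v) * indicator (cball 0 1 - {0}) v) \<partial>lborel)"
      by (subst nn_integral_restrict_space) (auto intro!: nn_integral_cong split: split_indicator)
    also have "\<dots> = emeasure ?R A * emeasure ?S B"
      using emeasure_polar_aux[OF B, of A] A by (simp add: sets_R)
    finally show "emeasure ?R A * emeasure ?S B = emeasure ?M (A \<times> B)" by simp
  qed unfold_locales
  have "(\<integral>\<^sup>+v. f v * indicator (cball 0 1) v \<partial>lborel) = (\<integral>\<^sup>+v. f v * indicator (cball 0 1 - {0}) v \<partial>lborel)"
    by (intro nn_integral_cong_AE eventually_mono[OF AE_lborel_singleton[of 0]]) (auto split: split_indicator)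
  also have "\<dots> = (\<integral>\<^sup>+v. f (norm v *\<^sub>R sgn v) * indicator (cball 0 1 - {0}) v \<partial>lborel)"
    by (intro nn_integral_cong) (auto simp: sgn_div_norm split: split_indicator)
  also have "\<dots> = (\<integral>\<^sup>+v. f (norm v *\<^sub>R sgn v) \<partial>restrict_space lborel (cball 0 1 - {0}))"
    by (subst nn_integral_restrict_space) auto
  also have "\<dots> = (\<integral>\<^sup>+z. (case z of (r, \<omega>) \<Rightarrow> f (r *\<^sub>R \<omega>)) \<partial>?M)"
    using fm by (subst nn_integral_distr[OF norm_sgn_measurable]) auto
  also have "\<dots> = (\<integral>\<^sup>+z. (case z of (r, \<omega>) \<Rightarrow> f (r *\<^sub>R \<omega>)) \<partial>(?R \<Otimes>\<^sub>M ?S))" unfolding eq ..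
  also have "\<dots> = (\<integral>\<^sup>+\<omega>. \<integral>\<^sup>+r. f (r *\<^sub>R \<omega>) \<partial>?R \<partial>?S)"
  proof -
    interpret pair_sigma_finite ?R ?S ..
    have "(\<lambda>z. (case z of (r, \<omega>) \<Rightarrow> f (r *\<^sub>R \<omega>))) \<in> borel_measurable (?R \<Otimes>\<^sub>M ?S)"
      using fm by (simp cong: measurable_cong_sets sets_pair_measure_cong add: sets_sphere_measure sets_R)
    from nn_integral_snd[OF this] show ?thesis by simp
  qed
  also have "\<dots> = (\<integral>\<^sup>+\<omega>. (\<integral>\<^sup>+r. f (r *\<^sub>R \<omega>) * ennreal (r ^ (CARD('n) - 1)) * indicator {0<..1} r \<partial>lborel) \<partial>?S)"
    unfolding radial_measure_def by (subst nn_integral_density) (auto simp: mult_ac)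
  finally show ?thesis .
qed

lemma measurable_polar_hyperboloid:
  "(\<lambda>(\<rho>, \<omega>). (cosh \<rho>, sinh \<rho> *\<^sub>R \<omega>)) \<in>
    measurable (restrict_space lborel {0<..} \<Otimes>\<^sub>M (sphere_measure :: (real ^ 'n::finite) measure)) (restrict_space borel hyperboloid)"
proof (rule measurable_restrict_space2)
  have [measurable]: "fst \<in> borel_measurable (restrict_space lborel {0::real<..} \<Otimes>\<^sub>M (sphere_measure :: (real ^ 'n) measure))"
    by (rule measurable_compose[OF measurable_fst measurable_restrict_space1[OF measurable_ident_sets]]) simp
  have "(\<lambda>\<omega>. \<omega>) \<in> borel_measurable (sphere_measure :: (real ^ 'n) measure)"
    unfolding measurable_cong_sets[OF sets_sphere_measure refl] by (rule measurable_restrict_space1) simp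
  from measurable_compose[OF measurable_snd this]
  have [measurable]: "snd \<in> borel_measurable (restrict_space lborel {0::real<..} \<Otimes>\<^sub>M (sphere_measure :: (real ^ 'n) measure))" .
  show "(\<lambda>(\<rho>, \<omega>). (cosh \<rho>, sinh \<rho> *\<^sub>R \<omega>)) \<in> borel_measurable (restrict_space lborel {0::real<..} \<Otimes>\<^sub>M (sphere_measure :: (real ^ 'n) measure))"
    unfolding case_prod_beta
    by (intro borel_measurable_Pair borel_measurable_scaleR
         measurable_compose[OF _ borel_measurable_continuous_onI[of cosh]] measurable_compose[OF _ borel_measurable_continuous_onI[of sinh]])
       (auto intro!: continuous_intros)
  show "(\<lambda>(\<rho>, \<omega>). (cosh \<rho>, sinh \<rho> *\<^sub>R \<omega>)) \<in> space (restrict_space lborel {0<..} \<Otimes>\<^sub>M (sphere_measure :: (real ^ 'n) measure)) \<rightarrow> hyperboloid"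
    by (auto simp: space_pair_measure hyperboloid_def lorentz_def dot_square_norm cosh_square_eq power2_eq_square[symmetric])
qed

lemma nn_integral_hyp_vol:
  fixes G :: "'n::finite point \<Rightarrow> ennreal"
  assumes G: "G \<in> borel_measurable (restrict_space borel hyperboloid)"
  shows "(\<integral>\<^sup>+y. G y \<partial>hyp_vol) = (\<integral>\<^sup>+\<omega>. (\<integral>\<^sup>+\<rho>. G (cosh \<rho>, sinh \<rho> *\<^sub>R \<omega>) * ennreal (sinh \<rho> ^ (CARD('n) - 1)) * indicator {0<..} \<rho> \<partial>lborel) \<partial>sphere_measure)"
proof -
  let ?S = "sphere_measure :: (real ^ 'n) measure" and ?L = "restrict_space lborel {0::real<..}"
  let ?\<phi> = "\<lambda>(\<rho>, \<omega>). (cosh \<rho>, sinh \<rho> *\<^sub>R \<omega>) :: 'n point"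
  interpret S: finite_measure ?S by (rule finite_measure_sphere)
  interpret L: sigma_finite_measure ?L
    by (intro sigma_finite_measure_restrict_space) (auto intro: sigma_finite_lborel)
  interpret pair_sigma_finite ?L ?S ..
  have [measurable]: "(\<lambda>\<rho>. \<rho>) \<in> borel_measurable ?L"
    by (rule measurable_restrict_space1) simp
  have sh: "(\<lambda>(\<rho>, \<omega>). ennreal (sinh \<rho> ^ (CARD('n) - 1))) \<in> borel_measurable (?L \<Otimes>\<^sub>M ?S)"
    unfolding case_prod_beta
    by (intro measurable_compose[OF _ measurable_ennreal] borel_measurable_power measurable_compose[OF _ borel_measurable_continuous_onI[of sinh]] measurable_compose[OF measurable_fst])
       (auto intro!: continuous_intros)
  have G\<phi>: "(\<lambda>z. G (?\<phi> z)) \<in> borel_measurable (?L \<Otimes>\<^sub>M ?S)"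
    by (rule measurable_compose[OF measurable_polar_hyperboloid G])
  have "(\<integral>\<^sup>+y. G y \<partial>hyp_vol) = (\<integral>\<^sup>+z. G (?\<phi> z) \<partial>density (?L \<Otimes>\<^sub>M ?S) (\<lambda>(\<rho>, \<omega>). ennreal (sinh \<rho> ^ (CARD('n) - 1))))"
    unfolding hyp_vol_def using measurable_polar_hyperboloid G by (subst nn_integral_distr) auto
  also have "\<dots> = (\<integral>\<^sup>+z. (case z of (\<rho>, \<omega>) \<Rightarrow> ennreal (sinh \<rho> ^ (CARD('n) - 1)) * G (cosh \<rho>, sinh \<rho> *\<^sub>R \<omega>)) \<partial>(?L \<Otimes>\<^sub>M ?S))"
    using sh G\<phi> by (subst nn_integral_density) (auto simp: case_prod_unfold)
  also have "\<dots> = (\<integral>\<^sup>+\<omega>. \<integral>\<^sup>+\<rho>. ennreal (sinh \<rho> ^ (CARD('n) - 1)) * G (cosh \<rho>, sinh \<rho> *\<^sub>R \<omega>) \<partial>?L \<partial>?S)"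
    using borel_measurable_times_ennreal[OF sh G\<phi>] by (subst nn_integral_snd[symmetric]) (auto simp: case_prod_unfold)
  also have "\<dots> = (\<integral>\<^sup>+\<omega>. (\<integral>\<^sup>+\<rho>. G (cosh \<rho>, sinh \<rho> *\<^sub>R \<omega>) * ennreal (sinh \<rho> ^ (CARD('n) - 1)) * indicator {0<..} \<rho> \<partial>lborel) \<partial>?S)"
    by (subst nn_integral_restrict_space) (auto simp: mult_ac)
  finally show ?thesis .
qed

text \<open>Up to the factor \<open>n + 1\<close>, the volume is the image of Lebesgue measure on this cone under
  \<open>z / sqrt (lorentz z z)\<close>, a description in which the Lorentz invariance is visible.\<close>

definition unit_cone :: "'n::finite point set" where
  "unit_cone = {z. 0 < fst z \<and> 0 < lorentz z z \<and> lorentz z z \<le> 1}"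

lemma lorentz_measurable [measurable]:
  assumes [measurable]: "f \<in> borel_measurable M" "g \<in> borel_measurable M"
  shows "(\<lambda>x. lorentz (f x) (g x)) \<in> borel_measurable M"
proof -
  have "(\<lambda>x. fst (f x)) \<in> borel_measurable M" "(\<lambda>x. fst (g x)) \<in> borel_measurable M"
    "(\<lambda>x. snd (f x)) \<in> borel_measurable M" "(\<lambda>x. snd (g x)) \<in> borel_measurable M"
    by (rule measurable_compose[OF assms(1) borel_measurable_continuous_onI] measurable_compose[OF assms(2) borel_measurable_continuous_onI],
        intro continuous_intros)+
  then show ?thesis unfolding lorentz_def by measurable
qed

lemma unit_cone_measurable: "unit_cone \<in> sets (borel :: 'n::finite point measure)"
proof -
  have eq: "unit_cone = {z :: 'n point. 0 < fst z} \<inter> {z \<in> space borel. 0 < lorentz z z \<and> lorentz z z \<le> 1}"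
    by (auto simp: unit_cone_def)
  have "open {z :: 'n point. 0 < fst z}"
    by (intro open_Collect_less continuous_intros)
  moreover have "{z \<in> space borel. 0 < lorentz z z \<and> lorentz z z \<le> 1} \<in> sets (borel :: 'n point measure)"
    by measurable
  ultimately show ?thesis unfolding eq by (rule sets.Int[OF borel_open])
qed

lemma nn_integral_power_to:
  assumes "0 < b"
  shows "(\<integral>\<^sup>+t. ennreal (t ^ n) * indicator {0<..b} t \<partial>lborel) = ennreal (b ^ Suc n / Suc n)"
proof -
  have "(\<integral>\<^sup>+t. ennreal (t ^ n) * indicator {0<..b} t \<partial>lborel) = (\<integral>\<^sup>+t. ennreal (t ^ n) * indicator {0..b} t \<partial>lborel)"
    by (intro nn_integral_cong_AE eventually_mono[OF AE_lborel_singleton[of 0]]) (auto split: split_indicator)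
  also have "\<dots> = ennreal (b ^ Suc n / Suc n - 0 ^ Suc n / Suc n)"
    using assms by (intro nn_integral_FTC_Icc) (auto intro!: derivative_eq_intros simp del: power_Suc simp: divide_simps)
  finally show ?thesis by simp
qed

lemma one_minus_tanh_square: "1 - (tanh x)\<^sup>2 = 1 / (cosh x)\<^sup>2" for x :: real
proof -
  have "1 - (tanh x)\<^sup>2 = ((cosh x)\<^sup>2 - (sinh x)\<^sup>2) / (cosh x)\<^sup>2"
    by (simp add: tanh_def power_divide diff_divide_distrib)
  then show ?thesis by (simp add: cosh_square_eq)
qed

lemma tanh_substitution:
  fixes f :: "real \<Rightarrow> ennreal"
  assumes [measurable]: "f \<in> borel_measurable borel"
  shows "(\<integral>\<^sup>+r. f r * indicator {0<..<1} r \<partial>lborel) = (\<integral>\<^sup>+\<rho>. f (tanh \<rho>) * ennreal (1 / (cosh \<rho>)\<^sup>2) * indicator {0<..} \<rho> \<partial>lborel)"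
proof (rule nn_integral_substitution_exhaust[where a = "\<lambda>i. 1 / (real i + 1)" and b = "\<lambda>i. real i + 2"])
  show "tanh \<in> borel_measurable (borel :: real measure)" "(\<lambda>\<rho>::real. 1 / (cosh \<rho>)\<^sup>2) \<in> borel_measurable borel"
    by (auto intro!: borel_measurable_continuous_onI continuous_intros)
  show "(tanh has_real_derivative 1 / (cosh x)\<^sup>2) (at x)" for x :: real
  proof -
    have "cosh x \<noteq> 0" by simp
    have "(tanh has_real_derivative (1 - tanh x ^ 2) * 1) (at x)"
      by (rule has_field_derivative_tanh) (auto intro!: derivative_eq_intros)
    then show ?thesis by (simp add: one_minus_tanh_square)
  qed
  show S: "{0<..} = (\<Union>i. {1 / (real i + 1)..real i + 2})"
  proof (intro equalityI subsetI)
    fix x :: real assume "x \<in> {0<..}"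
    then have "0 < x" by simp
    obtain i where i: "max x (1 / x) < real i" using reals_Archimedean2 by blast
    then have "1 / x < real i + 1" "x \<le> real i + 2" by auto
    then have "1 / (real i + 1) \<le> x" using \<open>0 < x\<close> by (simp add: field_simps)
    then show "x \<in> (\<Union>i. {1 / (real i + 1)..real i + 2})" using \<open>x \<le> real i + 2\<close> by auto
  next
    fix x :: real assume "x \<in> (\<Union>i. {1 / (real i + 1)..real i + 2})"
    then obtain i where "1 / (real i + 1) \<le> x" by auto
    moreover have "0 < 1 / (real i + 1)" by simp
    ultimately show "x \<in> {0<..}" by (metis greaterThan_iff order.strict_trans2)
  qed
  show "{0<..<1} = (\<Union>i. {tanh (1 / (real i + 1))..tanh (real i + 2)})"
  proof (intro equalityI subsetI)
    fix r :: real assume r: "r \<in> {0<..<1}"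
    define x where "x = artanh r"
    have rx: "r = tanh x"
    proof -
      have "exp (- (2 * x)) = (1 - r) / (1 + r)" using r unfolding exp_minus by (simp add: x_def artanh_def)
      then have "r * (1 + exp (- (2 * x))) = 1 - exp (- (2 * x))" using r by (simp add: field_simps)
      moreover have "1 + exp (- (2 * x)) \<noteq> 0" using add_pos_pos[of 1 "exp (- (2 * x))"] by simp
      ultimately show ?thesis by (simp add: tanh_real_altdef eq_divide_eq)
    qed
    then have "x \<in> {0<..}" using r by simp
    then obtain i where "1 / (real i + 1) \<le> x" "x \<le> real i + 2" unfolding S by auto
    then show "r \<in> (\<Union>i. {tanh (1 / (real i + 1))..tanh (real i + 2)})" by (auto simp: rx intro!: exI[of _ i])
  next
    fix r :: real assume "r \<in> (\<Union>i. {tanh (1 / (real i + 1))..tanh (real i + 2)})"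
    then obtain i where "tanh (1 / (real i + 1)) \<le> r" "r \<le> tanh (real i + 2)" by auto
    moreover have "0 < tanh (1 / (real i + 1))" "tanh (real i + 2) < 1" using tanh_real_bounds[of "real i + 2"] by auto
    ultimately show "r \<in> {0<..<1}" by (metis greaterThanLessThan_iff order.strict_trans1 order.strict_trans2)
  qed
  show "1 / (real i + 1) < real i + 2" for i
    by (rule order.strict_trans1[of _ 1]) auto
qed (auto intro!: continuous_intros simp: decseq_def incseq_def frac_le)

text \<open>Write z = (t, t w) with norm w < 1, so that \<open>lorentz z z\<close> is t^2 (1 -
  norm(w)^2) and the Jacobian is t^n. Integrating t^n up to 1/sqrt(1 - norm(w)^2) gives the factor
  1/(n + 1). In polar coordinates for w, the Klein model, the substitution norm w = tanh rho then
  produces sinh(rho)^(n-1).\<close>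

lemma nn_integral_cone:
  fixes G :: "'n::finite point \<Rightarrow> ennreal"
  assumes G [measurable]: "G \<in> borel_measurable borel"
  shows "(\<integral>\<^sup>+z. G (z /\<^sub>R sqrt (lorentz z z)) * indicator unit_cone z \<partial>lborel) = ennreal (1 / (CARD('n) + 1)) * (\<integral>\<^sup>+y. G y \<partial>hyp_vol)"
proof -
  let ?n = "CARD('n)"
  note [measurable] = unit_cone_measurable
  define H where "H = (\<lambda>z. G (z /\<^sub>R sqrt (lorentz z z)) * indicator unit_cone z)"
  have [measurable]: "H \<in> borel_measurable borel" unfolding H_def by measurable
  define s where "s = (\<lambda>r::real. sqrt (1 - r\<^sup>2))"
  have [measurable]: "s \<in> borel_measurable borel" unfolding s_def by measurable
  define F where "F = (\<lambda>w::real^'n. G (1 / s (norm w), w /\<^sub>R s (norm w)))"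
  have [measurable]: "F \<in> borel_measurable borel" unfolding F_def s_def by measurable
  have s_pos: "0 < s r" if "0 \<le> r" "r < 1" for r
    using that by (simp add: s_def power_less_one_iff abs_square_less_1)
  have H_eq: "H (t, t *\<^sub>R w) = F w * indicator {w. norm w < 1} w * indicator {0<..1 / s (norm w)} t" if "0 < t" for t w
  proof -
    have l: "lorentz (t, t *\<^sub>R w) (t, t *\<^sub>R w) = t\<^sup>2 * (1 - (norm w)\<^sup>2)"
      by (simp add: lorentz_def dot_square_norm power2_eq_square algebra_simps)
    show ?thesis
    proof (cases "norm w < 1")
      case True
      have "0 < 1 - (norm w)\<^sup>2" using True by (simp add: abs_square_less_1)
      have sq: "sqrt (t\<^sup>2 * (1 - (norm w)\<^sup>2)) = t * s (norm w)" using that by (simp add: s_def real_sqrt_mult)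
      have ss: "(s (norm w))\<^sup>2 = 1 - (norm w)\<^sup>2" using \<open>0 < 1 - (norm w)\<^sup>2\<close> by (simp add: s_def)
      have "(t, t *\<^sub>R w) \<in> unit_cone \<longleftrightarrow> (t * s (norm w))\<^sup>2 \<le> 1"
        using that \<open>0 < 1 - (norm w)\<^sup>2\<close> by (simp add: unit_cone_def l power_mult_distrib ss)
      also have "\<dots> \<longleftrightarrow> t * s (norm w) \<le> 1"
        using that s_pos[of "norm w"] True by (simp add: abs_square_le_1)
      also have "\<dots> \<longleftrightarrow> t \<le> 1 / s (norm w)"
        using s_pos[of "norm w"] True by (simp add: field_simps)
      finally have "(t, t *\<^sub>R w) \<in> unit_cone \<longleftrightarrow> t \<le> 1 / s (norm w)" .
      moreover have "(t, t *\<^sub>R w) /\<^sub>R sqrt (lorentz (t, t *\<^sub>R w) (t, t *\<^sub>R w)) = (1 / s (norm w), w /\<^sub>R s (norm w))"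
        unfolding l sq using that by (simp add: divide_simps)
      ultimately show ?thesis using True that by (simp add: H_def F_def indicator_def inverse_eq_divide)
    next
      case False
      then have "1 \<le> (norm w)\<^sup>2" by (simp add: one_le_power)
      then have "t\<^sup>2 * (1 - (norm w)\<^sup>2) \<le> 0" by (intro mult_nonneg_nonpos) auto
      then show ?thesis using False by (simp add: H_def unit_cone_def l indicator_def)
    qed
  qed
  have "(\<integral>\<^sup>+z. H z \<partial>lborel) = (\<integral>\<^sup>+t. \<integral>\<^sup>+v. H (t, v) \<partial>lborel \<partial>lborel)"
    by (subst lborel_prod[symmetric], subst lborel.nn_integral_fst) (auto simp: lborel_prod)
  also have "\<dots> = (\<integral>\<^sup>+t. \<integral>\<^sup>+w. ennreal (t ^ ?n) * (F w * indicator {w. norm w < 1} w * indicator {0<..1 / s (norm w)} t) \<partial>lborel \<partial>lborel)"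
  proof (rule nn_integral_cong)
    fix t :: real
    show "(\<integral>\<^sup>+v. H (t, v) \<partial>lborel) = (\<integral>\<^sup>+w. ennreal (t ^ ?n) * (F w * indicator {w. norm w < 1} w * indicator {0<..1 / s (norm w)} t) \<partial>lborel)"
    proof (cases "0 < t")
      case True
      have "(\<integral>\<^sup>+v. H (t, v) \<partial>lborel) = ennreal (t ^ ?n) * (\<integral>\<^sup>+w. H (t, t *\<^sub>R w) \<partial>lborel)"
        using nn_integral_lborel_affine[of "\<lambda>v. H (t, v)" t 0] True by simp
      also have "\<dots> = ennreal (t ^ ?n) * (\<integral>\<^sup>+w. F w * indicator {w. norm w < 1} w * indicator {0<..1 / s (norm w)} t \<partial>lborel)"
        using True by (simp add: H_eq)
      also have "\<dots> = (\<integral>\<^sup>+w. ennreal (t ^ ?n) * (F w * indicator {w. norm w < 1} w * indicator {0<..1 / s (norm w)} t) \<partial>lborel)"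
        unfolding s_def by (rule nn_integral_cmult[symmetric]) (unfold indicator_def greaterThanAtMost_iff, measurable)
      finally show ?thesis .
    qed (simp add: H_def unit_cone_def)
  qed
  also have "\<dots> = (\<integral>\<^sup>+w. \<integral>\<^sup>+t. ennreal (t ^ ?n) * (F w * indicator {w. norm w < 1} w * indicator {0<..1 / s (norm w)} t) \<partial>lborel \<partial>lborel)"
    unfolding s_def by (rule lborel_pair.Fubini'[symmetric]) (unfold indicator_def greaterThanAtMost_iff, measurable)
  also have "\<dots> = (\<integral>\<^sup>+w. (F w * ennreal ((1 / s (norm w)) ^ Suc ?n / Suc ?n) * indicator {w. norm w < 1} w) * indicator (cball 0 1) w \<partial>lborel)"
  proof (rule nn_integral_cong)
    fix w :: "real ^ 'n"
    have "(\<integral>\<^sup>+t. ennreal (t ^ ?n) * (F w * indicator {w. norm w < 1} w * indicator {0<..1 / s (norm w)} t) \<partial>lborel) =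
      (\<integral>\<^sup>+t. (F w * indicator {w. norm w < 1} w) * (ennreal (t ^ ?n) * indicator {0<..1 / s (norm w)} t) \<partial>lborel)"
      by (intro nn_integral_cong) (simp add: mult_ac)
    also have "\<dots> = (F w * indicator {w. norm w < 1} w) * (\<integral>\<^sup>+t. (ennreal (t ^ ?n) * indicator {0<..1 / s (norm w)} t) \<partial>lborel)"
      by (rule nn_integral_cmult) measurable
    also have "\<dots> = (F w * ennreal ((1 / s (norm w)) ^ Suc ?n / Suc ?n) * indicator {w. norm w < 1} w) * indicator (cball 0 1) w"
    proof (cases "norm w < 1")
      case True
      then show ?thesis
        using s_pos[of "norm w"] by (subst nn_integral_power_to) (auto simp del: power_Suc)
    qed simp
    finally show "(\<integral>\<^sup>+t. ennreal (t ^ ?n) * (F w * indicator {w. norm w < 1} w * indicator {0<..1 / s (norm w)} t) \<partial>lborel) = \<dots>" .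
  qed
  also have "\<dots> = (\<integral>\<^sup>+\<omega>. (\<integral>\<^sup>+r. (F (r *\<^sub>R \<omega>) * ennreal ((1 / s (norm (r *\<^sub>R \<omega>))) ^ Suc ?n / Suc ?n) * indicator {w. norm w < 1} (r *\<^sub>R \<omega>))
      * ennreal (r ^ (?n - 1)) * indicator {0<..1} r \<partial>lborel) \<partial>sphere_measure)"
    unfolding s_def by (rule nn_integral_polar_cball) measurable
  also have "\<dots> = (\<integral>\<^sup>+\<omega>. ennreal (1 / (?n + 1)) * (\<integral>\<^sup>+\<rho>. G (cosh \<rho>, sinh \<rho> *\<^sub>R \<omega>) * ennreal (sinh \<rho> ^ (CARD('n) - 1)) * indicator {0<..} \<rho> \<partial>lborel) \<partial>sphere_measure)"
  proof (rule nn_integral_cong)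
    fix \<omega> :: "real ^ 'n" assume "\<omega> \<in> space sphere_measure"
    then have \<omega>: "norm \<omega> = 1" by simp
    define f where "f = (\<lambda>r. G (1 / s r, (r / s r) *\<^sub>R \<omega>) * ennreal ((1 / s r) ^ Suc ?n / Suc ?n * r ^ (?n - 1)))"
    have [measurable]: "f \<in> borel_measurable borel" unfolding f_def s_def by measurable
    have "(\<integral>\<^sup>+r. (F (r *\<^sub>R \<omega>) * ennreal ((1 / s (norm (r *\<^sub>R \<omega>))) ^ Suc ?n / Suc ?n) * indicator {w. norm w < 1} (r *\<^sub>R \<omega>))
      * ennreal (r ^ (?n - 1)) * indicator {0<..1} r \<partial>lborel) = (\<integral>\<^sup>+r. f r * indicator {0<..<1} r \<partial>lborel)"
    proof (rule nn_integral_cong)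
      fix r :: real
      show "(F (r *\<^sub>R \<omega>) * ennreal ((1 / s (norm (r *\<^sub>R \<omega>))) ^ Suc ?n / Suc ?n) * indicator {w. norm w < 1} (r *\<^sub>R \<omega>))
        * ennreal (r ^ (?n - 1)) * indicator {0<..1} r = f r * indicator {0<..<1} r"
        using s_pos[of r] \<omega> by (cases "0 < r \<and> r < 1")
          (auto simp: f_def F_def indicator_def ennreal_mult divide_inverse mult_ac simp del: power_Suc)
    qed
    also have "\<dots> = (\<integral>\<^sup>+\<rho>. f (tanh \<rho>) * ennreal (1 / (cosh \<rho>)\<^sup>2) * indicator {0<..} \<rho> \<partial>lborel)"
      by (rule tanh_substitution) measurable
    also have "\<dots> = (\<integral>\<^sup>+\<rho>. ennreal (1 / (?n + 1)) * (G (cosh \<rho>, sinh \<rho> *\<^sub>R \<omega>) * ennreal (sinh \<rho> ^ (CARD('n) - 1)) * indicator {0<..} \<rho>) \<partial>lborel)"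
    proof (rule nn_integral_cong)
      fix \<rho> :: real
      show "f (tanh \<rho>) * ennreal (1 / (cosh \<rho>)\<^sup>2) * indicator {0<..} \<rho> =
         ennreal (1 / (?n + 1)) * (G (cosh \<rho>, sinh \<rho> *\<^sub>R \<omega>) * ennreal (sinh \<rho> ^ (CARD('n) - 1)) * indicator {0<..} \<rho>)"
      proof (cases "0 < \<rho>")
        case True
        have sr: "s (tanh \<rho>) = 1 / cosh \<rho>" by (simp add: s_def real_sqrt_divide one_minus_tanh_square)
        obtain m where m: "?n = Suc m" by (cases ?n) auto
        have c0: "cosh \<rho> \<noteq> 0" by simp
        have "(1 / s (tanh \<rho>)) ^ Suc ?n / Suc ?n * tanh \<rho> ^ (?n - 1) * (1 / (cosh \<rho>)\<^sup>2) = 1 / (?n + 1) * sinh \<rho> ^ (?n - 1)"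
        proof -
          have is1: "1 / s (tanh \<rho>) = cosh \<rho>" by (simp add: sr)
          have "cosh \<rho> ^ Suc ?n * tanh \<rho> ^ (?n - 1) * (1 / (cosh \<rho>)\<^sup>2) = sinh \<rho> ^ (?n - 1)"
            unfolding m tanh_def using c0 by (simp add: power_divide power2_eq_square)
          then have "cosh \<rho> ^ Suc ?n * tanh \<rho> ^ (?n - 1) * (1 / (cosh \<rho>)\<^sup>2) / Suc ?n = sinh \<rho> ^ (?n - 1) / Suc ?n"
            by (rule arg_cong)
          then show ?thesis unfolding is1 by (simp add: mult_ac)
        qed
        moreover have "1 / s (tanh \<rho>) = cosh \<rho>" "tanh \<rho> / s (tanh \<rho>) = sinh \<rho>"
          unfolding sr by (simp_all add: tanh_def)
        ultimately show ?thesis using True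
          by (simp add: f_def mult_ac del: power_Suc flip: ennreal_mult')
             (simp add: mult.left_commute[of "ennreal _" "G _"] flip: ennreal_mult' )
      qed simp
    qed
    also have "\<dots> = ennreal (1 / (?n + 1)) * (\<integral>\<^sup>+\<rho>. G (cosh \<rho>, sinh \<rho> *\<^sub>R \<omega>) * ennreal (sinh \<rho> ^ (CARD('n) - 1)) * indicator {0<..} \<rho> \<partial>lborel)"
    proof (rule nn_integral_cmult)
      have "(\<lambda>\<rho>. G (cosh \<rho>, sinh \<rho> *\<^sub>R \<omega>)) \<in> borel_measurable borel"
        by (intro measurable_compose[OF _ G] borel_measurable_continuous_onI continuous_intros)
      moreover have "(\<lambda>\<rho>::real. sinh \<rho>) \<in> borel_measurable borel"
        by (intro borel_measurable_continuous_onI continuous_intros)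
      ultimately show "(\<lambda>\<rho>. G (cosh \<rho>, sinh \<rho> *\<^sub>R \<omega>) * ennreal (sinh \<rho> ^ (CARD('n) - 1)) * indicator {0<..} \<rho>) \<in> borel_measurable lborel"
        by simp
    qed
    finally show "(\<integral>\<^sup>+r. (F (r *\<^sub>R \<omega>) * ennreal ((1 / s (norm (r *\<^sub>R \<omega>))) ^ Suc ?n / Suc ?n) * indicator {w. norm w < 1} (r *\<^sub>R \<omega>))
      * ennreal (r ^ (?n - 1)) * indicator {0<..1} r \<partial>lborel) = \<dots>" .
  qed
  also have "\<dots> = ennreal (1 / (?n + 1)) * (\<integral>\<^sup>+y. G y \<partial>hyp_vol)"
  proof -
    interpret S: finite_measure "sphere_measure :: (real ^ 'n) measure" by (rule finite_measure_sphere)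
    have "(\<lambda>(\<omega>::real^'n, \<rho>). G (cosh \<rho>, sinh \<rho> *\<^sub>R \<omega>) * ennreal (sinh \<rho> ^ (CARD('n) - 1)) * indicator {0<..} \<rho>) \<in> borel_measurable (borel \<Otimes>\<^sub>M borel)"
    proof -
      have "(\<lambda>z::(real^'n) \<times> real. G (cosh (snd z), sinh (snd z) *\<^sub>R fst z)) \<in> borel_measurable borel"
        by (intro measurable_compose[OF _ G] borel_measurable_continuous_onI continuous_intros)
      moreover have "(\<lambda>z::(real^'n) \<times> real. sinh (snd z)) \<in> borel_measurable borel" "(\<lambda>z::(real^'n) \<times> real. snd z) \<in> borel_measurable borel"
        by (intro borel_measurable_continuous_onI continuous_intros)+
      ultimately show ?thesis unfolding borel_prod case_prod_beta by simp
    qed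
    then have "(\<lambda>(\<omega>::real^'n, \<rho>). G (cosh \<rho>, sinh \<rho> *\<^sub>R \<omega>) * ennreal (sinh \<rho> ^ (CARD('n) - 1)) * indicator {0<..} \<rho>) \<in> borel_measurable (borel \<Otimes>\<^sub>M lborel)"
      by (simp cong: measurable_cong_sets sets_pair_measure_cong)
    from lborel.borel_measurable_nn_integral[OF this]
    have "(\<lambda>\<omega>::real^'n. \<integral>\<^sup>+\<rho>. G (cosh \<rho>, sinh \<rho> *\<^sub>R \<omega>) * ennreal (sinh \<rho> ^ (CARD('n) - 1)) * indicator {0<..} \<rho> \<partial>lborel) \<in> borel_measurable sphere_measure"
      unfolding measurable_cong_sets[OF sets_sphere_measure refl] by (rule measurable_restrict_space1)
    then show ?thesis
      using G by (subst nn_integral_hyp_vol) (auto intro: measurable_restrict_space1 simp: nn_integral_cmult)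
  qed
  finally show ?thesis by (simp add: H_def)
qed

text \<open>The reflection exchanging \<open>x\<close> with the origin preserves Lebesgue measure,
  the Lorentz form and the cone, so the two cone integrals coincide.\<close>

lemma nn_integral_hyp_vol_lorentz:
  fixes x :: "'n::finite point" and F :: "real \<Rightarrow> ennreal"
  assumes [measurable]: "F \<in> borel_measurable borel" and x: "x \<in> hyperboloid"
  shows "(\<integral>\<^sup>+y. F (lorentz x y) \<partial>hyp_vol) = (\<integral>\<^sup>+y. F (lorentz hyp_origin y) \<partial>(hyp_vol :: 'n point measure))"
proof -
  obtain R where R: "linear R" "\<And>z. R (R z) = z" "\<And>a b. lorentz (R a) (R b) = lorentz a b" "R x = hyp_origin"
    using ex_lorentz_involution[OF x] by blast
  have [measurable]: "R \<in> borel_measurable borel"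
    using R by (intro borel_measurable_continuous_onI linear_continuous_on) (simp add: linear_conv_bounded_linear)
  note [measurable] = unit_cone_measurable
  define E where "E = (\<lambda>(x :: 'n point) z. F (lorentz x (z /\<^sub>R sqrt (lorentz z z))) * indicator unit_cone z)"
  have [measurable]: "E x \<in> borel_measurable borel" for x unfolding E_def by measurable
  have xx: "0 < lorentz x x" "0 < fst x" using x by (auto simp: hyperboloid_def)
  have "R z \<in> unit_cone" if "z \<in> unit_cone" for z
  proof -
    \<comment> \<open>The time coordinate of \<open>R z\<close> is its Lorentz product with the
      origin \<open>R x\<close>, hence the product of z and x, which is positive for forward
      timelike vectors. So \<open>R\<close> does not exchange the two halves of the light
      cone.\<close>
    have "fst (R z) = lorentz (R z) (R x)" unfolding R(4) by (simp add: lorentz_def)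
    also have "\<dots> > 0"
    proof -
      have "0 < lorentz z z" "0 < fst z" using that by (auto simp: unit_cone_def)
      then show ?thesis using lorentz_forward_pos[of z x] xx by (simp add: R(3))
    qed
    finally show ?thesis using that by (simp add: unit_cone_def R(3))
  qed
  then have RC: "R z \<in> unit_cone \<longleftrightarrow> z \<in> unit_cone" for z using R(2) by metis
  have "(\<integral>\<^sup>+z. E x z \<partial>lborel) = (\<integral>\<^sup>+z. E x (R z) \<partial>lborel)"
    using nn_integral_distr[of R lborel borel "E x"] by (simp add: distr_lborel_linear_involution[OF R(1,2)])
  also have "\<dots> = (\<integral>\<^sup>+z. E hyp_origin z \<partial>lborel)"
  proof (rule nn_integral_cong)
    fix z
    have "lorentz x (R z /\<^sub>R sqrt (lorentz (R z) (R z))) = lorentz (R x) (z /\<^sub>R sqrt (lorentz z z))"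
      using R(3)[of x "R z"] by (simp add: lorentz_simps R(2,3))
    then show "E x (R z) = E hyp_origin z" by (simp add: E_def RC R(4) indicator_def)
  qed
  finally have "ennreal (1 / (CARD('n) + 1)) * (\<integral>\<^sup>+y. F (lorentz x y) \<partial>hyp_vol)
      = ennreal (1 / (CARD('n) + 1)) * (\<integral>\<^sup>+y. F (lorentz hyp_origin y) \<partial>(hyp_vol :: 'n point measure))"
    unfolding E_def by (subst (asm) (1 2) nn_integral_cone) auto
  then show ?thesis
    by (subst (asm) ennreal_mult_cancel_left) auto
qed

section \<open>The distribution of the hyperbolic distance\<close>

definition sphere_area :: "'n::finite itself \<Rightarrow> real" where
  "sphere_area (_ :: 'n itself) = measure (sphere_measure :: (real ^ 'n) measure) (sphere 0 1)"

lemma emeasure_sphere_area: "emeasure (sphere_measure :: (real ^ 'n::finite) measure) (sphere 0 1) = ennreal (sphere_area TYPE('n))"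
  using finite_sphere_measure[where 'n = 'n] by (simp add: sphere_area_def emeasure_eq_ennreal_measure less_top[symmetric])

lemma sphere_area_pos: "0 < sphere_area TYPE('n::finite)"
  using sphere_measure_pos[where 'n = 'n] by (simp add: emeasure_sphere_area)

definition hyp_radial :: "'n::finite itself \<Rightarrow> real measure" where
  "hyp_radial (_ :: 'n itself) = density lborel (\<lambda>r. ennreal (sphere_area TYPE('n) * sinh r ^ (CARD('n) - 1)) * indicator {0<..} r)"

lemma sets_hyp_radial [simp, measurable_cong]: "sets (hyp_radial TYPE('n::finite)) = sets borel"
  by (simp add: hyp_radial_def)

lemma sets_hyp_vol [simp, measurable_cong]: "sets (hyp_vol :: 'n::finite point measure) = sets (restrict_space borel hyperboloid)"
  by (simp add: hyp_vol_def)

lemma space_hyp_vol [simp]: "space (hyp_vol :: 'n::finite point measure) = hyperboloid"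
  by (simp add: hyp_vol_def space_restrict_space)

text \<open>The cut-off confines \<open>arcosh\<close> to the half line on which it is continuous;
  Lorentz products of points of the hyperboloid lie there.\<close>

lemma arcosh_measurable [measurable]: "(\<lambda>x. if x \<ge> 1 then arcosh x else 0) \<in> borel_measurable (borel :: real measure)"
proof -
  have "(\<lambda>x::real. indicator {1..} x *\<^sub>R arcosh x) \<in> borel_measurable borel"
    by (intro borel_measurable_continuous_on_indicator continuous_intros) auto
  moreover have "(\<lambda>x::real. indicator {1..} x *\<^sub>R arcosh x) = (\<lambda>x. if x \<ge> 1 then arcosh x else 0)"
    by (auto simp: indicator_def)
  ultimately show ?thesis by simp
qed

text \<open>The reversed Cauchy-Schwarz inequality: with a and b the norms of the space components,
  (1 + a^2)(1 + b^2) - (1 + a b)^2 = (a - b)^2.\<close>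

lemma lorentz_ge_1:
  assumes "x \<in> hyperboloid" "y \<in> hyperboloid"
  shows "1 \<le> lorentz x y"
proof -
  define a where "a = norm (snd x)"
  define b where "b = norm (snd y)"
  have "1 + a * b \<le> sqrt ((1 + a\<^sup>2) * (1 + b\<^sup>2))"
  proof (rule real_le_rsqrt)
    have "(1 + a\<^sup>2) * (1 + b\<^sup>2) - (1 + a * b)\<^sup>2 = (a - b)\<^sup>2" by (simp add: power2_eq_square algebra_simps)
    then show "(1 + a * b)\<^sup>2 \<le> (1 + a\<^sup>2) * (1 + b\<^sup>2)" using zero_le_power2[of "a - b"] by linarith
  qed
  moreover have "snd x \<bullet> snd y \<le> a * b" unfolding a_def b_def by (rule norm_cauchy_schwarz)
  ultimately show ?thesis
    using assms[THEN hyperboloid_fst] by (simp add: lorentz_def a_def b_def real_sqrt_mult)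
qed

lemma hdist_nonneg: "x \<in> hyperboloid \<Longrightarrow> y \<in> hyperboloid \<Longrightarrow> 0 \<le> hdist x y"
  using lorentz_ge_1[of x y] by (simp add: hdist_def arcosh_real_def add_increasing2)

lemma cosh_hdist: "x \<in> hyperboloid \<Longrightarrow> y \<in> hyperboloid \<Longrightarrow> cosh (hdist x y) = lorentz x y"
  using lorentz_ge_1[of x y] by (simp add: hdist_def)

lemma hdist_measurable:
  assumes "x \<in> hyperboloid"
  shows "hdist x \<in> borel_measurable hyp_vol"
proof -
  have "(\<lambda>y. lorentz x y) \<in> borel_measurable (restrict_space borel hyperboloid)"
    by (rule measurable_restrict_space1) measurable
  from measurable_compose[OF this arcosh_measurable]
  have "(\<lambda>y. if lorentz x y \<ge> 1 then arcosh (lorentz x y) else 0) \<in> borel_measurable hyp_vol"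
    by (simp cong: measurable_cong_sets)
  then show ?thesis
    by (rule measurable_cong[THEN iffD1, rotated]) (auto simp: hdist_def lorentz_ge_1[OF assms])
qed

text \<open>Invariance moves the base point to the origin, from which the distance is the polar
  radius.\<close>

lemma nn_integral_hdist:
  fixes x :: "'n::finite point" and F :: "real \<Rightarrow> ennreal"
  assumes [measurable]: "F \<in> borel_measurable borel" and x: "x \<in> hyperboloid"
  shows "(\<integral>\<^sup>+y. F (hdist x y) \<partial>hyp_vol) = (\<integral>\<^sup>+r. F r \<partial>hyp_radial TYPE('n))"
proof -
  define A where "A = (\<lambda>x::real. if x \<ge> 1 then arcosh x else 0)"
  have [measurable]: "A \<in> borel_measurable borel" unfolding A_def by measurable
  have o: "(hyp_origin :: 'n point) \<in> hyperboloid" by (simp add: hyperboloid_def lorentz_def)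
  have "(\<integral>\<^sup>+y. F (hdist x y) \<partial>hyp_vol) = (\<integral>\<^sup>+y. F (A (lorentz x y)) \<partial>hyp_vol)"
    by (rule nn_integral_cong) (auto simp: A_def hdist_def lorentz_ge_1[OF x])
  also have "\<dots> = (\<integral>\<^sup>+y. F (A (lorentz hyp_origin y)) \<partial>(hyp_vol :: 'n point measure))"
    by (rule nn_integral_hyp_vol_lorentz[OF _ x]) measurable
  also have "\<dots> = (\<integral>\<^sup>+\<omega>. (\<integral>\<^sup>+\<rho>. F (A (lorentz hyp_origin (cosh \<rho>, sinh \<rho> *\<^sub>R \<omega>))) * ennreal (sinh \<rho> ^ (CARD('n) - 1)) * indicator {0<..} \<rho> \<partial>lborel) \<partial>(sphere_measure :: (real ^ 'n) measure))"
    by (rule nn_integral_hyp_vol) (rule measurable_restrict_space1, measurable)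
  also have "\<dots> = (\<integral>\<^sup>+\<omega>. (\<integral>\<^sup>+\<rho>. F \<rho> * ennreal (sinh \<rho> ^ (CARD('n) - 1)) * indicator {0<..} \<rho> \<partial>lborel) \<partial>(sphere_measure :: (real ^ 'n) measure))"
    by (intro nn_integral_cong) (auto simp: A_def lorentz_def arcosh_cosh_real cosh_real_ge_1 indicator_def)
  also have "\<dots> = ennreal (sphere_area TYPE('n)) * (\<integral>\<^sup>+\<rho>. F \<rho> * ennreal (sinh \<rho> ^ (CARD('n) - 1)) * indicator {0<..} \<rho> \<partial>lborel)"
    using emeasure_sphere_area[where 'n = 'n] by (simp add: mult.commute)
  also have "\<dots> = (\<integral>\<^sup>+\<rho>. ennreal (sphere_area TYPE('n)) * (F \<rho> * ennreal (sinh \<rho> ^ (CARD('n) - 1)) * indicator {0<..} \<rho>) \<partial>lborel)"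
    by (rule nn_integral_cmult[symmetric]) measurable
  also have "\<dots> = (\<integral>\<^sup>+r. F r \<partial>hyp_radial TYPE('n))"
    unfolding hyp_radial_def using sphere_area_pos[where 'n = 'n]
    by (subst nn_integral_density) (auto intro!: nn_integral_cong simp: ennreal_mult' mult_ac)
  finally show ?thesis .
qed

lemma distr_hdist:
  fixes x :: "'n::finite point"
  assumes x: "x \<in> hyperboloid"
  shows "distr hyp_vol borel (hdist x) = hyp_radial TYPE('n)"
proof (rule measure_eqI)
  fix A assume "A \<in> sets (distr hyp_vol borel (hdist x))"
  then have [measurable]: "A \<in> sets borel" by simp
  have "emeasure (distr hyp_vol borel (hdist x)) A = (\<integral>\<^sup>+z. indicator A z \<partial>distr hyp_vol borel (hdist x))" by simp
  also have "\<dots> = (\<integral>\<^sup>+y. indicator A (hdist x y) \<partial>hyp_vol)"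
    using hdist_measurable[OF x] by (intro nn_integral_distr) auto
  also have "\<dots> = emeasure (hyp_radial TYPE('n)) A"
    by (subst nn_integral_hdist[OF _ x]) auto
  finally show "emeasure (distr hyp_vol borel (hdist x)) A = emeasure (hyp_radial TYPE('n)) A" .
qed simp

section \<open>The heat mass for small and large times\<close>

lemma gauss_exp_line:
  fixes u b :: real
  assumes u: "0 < u"
  shows "has_bochner_integral lborel (\<lambda>r. exp (- r\<^sup>2 / (4 * u)) * exp (b * r)) (2 * sqrt (pi * u) * exp (b\<^sup>2 * u))"
proof -
  have "has_bochner_integral lborel (\<lambda>x::real. exp (- x\<^sup>2)) (sqrt pi)"
    using has_bochner_integral_even_function[OF gaussian_moment_even_pos[where k = 0]] by simp
  then have "has_bochner_integral lborel (\<lambda>r. exp (- (- b * sqrt u + 1 / (2 * sqrt u) * r)\<^sup>2)) (sqrt pi /\<^sub>R \<bar>1 / (2 * sqrt u)\<bar>)"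
    using u by (subst (asm) lborel_has_bochner_integral_real_affine_iff[where c = "1 / (2 * sqrt u)" and t = "- b * sqrt u"]) auto
  from has_bochner_integral_mult_right[OF this, of "exp (b\<^sup>2 * u)"]
  have "has_bochner_integral lborel (\<lambda>r. exp (b\<^sup>2 * u) * exp (- (- b * sqrt u + 1 / (2 * sqrt u) * r)\<^sup>2)) (exp (b\<^sup>2 * u) * (sqrt pi /\<^sub>R \<bar>1 / (2 * sqrt u)\<bar>))"
    by simp
  moreover have "exp (b\<^sup>2 * u) * exp (- (- b * sqrt u + 1 / (2 * sqrt u) * r)\<^sup>2) = exp (- r\<^sup>2 / (4 * u)) * exp (b * r)" for r
  proof -
    have "(- b * sqrt u + 1 / (2 * sqrt u) * r)\<^sup>2 = b\<^sup>2 * u - b * r + r\<^sup>2 / (4 * u)"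
      using u by (simp add: power2_sum power2_diff power_mult_distrib power_divide)
    then show ?thesis by (simp flip: exp_add)
  qed
  moreover have "exp (b\<^sup>2 * u) * (sqrt pi /\<^sub>R \<bar>1 / (2 * sqrt u)\<bar>) = 2 * sqrt (pi * u) * exp (b\<^sup>2 * u)"
    using u by (simp add: real_sqrt_mult)
  ultimately show ?thesis by (simp only:)
qed

definition gauss_int :: "(real \<Rightarrow> real) \<Rightarrow> real \<Rightarrow> real" where
  "gauss_int f u = (\<integral>r. indicator {0..} r * (exp (- r\<^sup>2 / (4 * u)) * f r) \<partial>lborel)"

lemma gauss_int_bound_exp:
  assumes u: "0 < u" and [measurable]: "f \<in> borel_measurable borel" and f: "\<And>r. 0 \<le> r \<Longrightarrow> \<bar>f r\<bar> \<le> K * exp (b * r)"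
  shows "integrable lborel (\<lambda>r. indicator {0..} r * (exp (- r\<^sup>2 / (4 * u)) * f r))" (is ?int)
    and "\<bar>gauss_int f u\<bar> \<le> K * (2 * sqrt (pi * u) * exp (b\<^sup>2 * u))" (is ?bound)
proof -
  have K: "0 \<le> K" using f[of 0] by simp
  have int: "integrable lborel (\<lambda>r. K * (exp (- r\<^sup>2 / (4 * u)) * exp (b * r)))"
    using gauss_exp_line[OF u, of b] by (intro integrable_mult_right) (auto simp: has_bochner_integral_iff)
  have le: "\<bar>indicator {0..} r * (exp (- r\<^sup>2 / (4 * u)) * f r)\<bar> \<le> K * (exp (- r\<^sup>2 / (4 * u)) * exp (b * r))" for r
  proof (cases "0 \<le> r")
    case True
    then show ?thesis using mult_left_mono[OF f[OF True], of "exp (- r\<^sup>2 / (4 * u))"] by (simp add: abs_mult mult_ac)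
  qed (use K in simp)
  show ?int
    by (rule Bochner_Integration.integrable_bound[OF int]) (use le K in auto)
  have "\<bar>gauss_int f u\<bar> \<le> (\<integral>r. \<bar>indicator {0..} r * (exp (- r\<^sup>2 / (4 * u)) * f r)\<bar> \<partial>lborel)"
    unfolding gauss_int_def by (rule integral_abs_bound)
  also have "\<dots> \<le> (\<integral>r. K * (exp (- r\<^sup>2 / (4 * u)) * exp (b * r)) \<partial>lborel)"
    using \<open>?int\<close> int le by (intro integral_mono integrable_abs) auto
  also have "\<dots> = K * (2 * sqrt (pi * u) * exp (b\<^sup>2 * u))"
    using gauss_exp_line[OF u, of b] by (simp add: has_bochner_integral_iff)
  finally show ?bound .
qed

text \<open>Half of the exponent absorbs the factor r at the price of 2 sqrt u; the other half is
  the Gaussian at time 2 u.\<close>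

lemma gauss_int_bound_linear:
  assumes u: "0 < u" and [measurable]: "f \<in> borel_measurable borel" and f: "\<And>r. 0 \<le> r \<Longrightarrow> \<bar>f r\<bar> \<le> K * (r * exp (b * r))"
    and K: "0 \<le> K"
  shows "\<bar>gauss_int f u\<bar> \<le> (2 * K * sqrt u) * (2 * sqrt (pi * (2 * u)) * exp (b\<^sup>2 * (2 * u)))"
proof -
  define g where "g = (\<lambda>r. exp (- r\<^sup>2 / (8 * u)) * f r)"
  have [measurable]: "g \<in> borel_measurable borel" unfolding g_def by measurable
  have eq: "gauss_int f u = gauss_int g (2 * u)"
    unfolding gauss_int_def g_def by (intro Bochner_Integration.integral_cong) (auto simp flip: exp_add)
  show ?thesis
    unfolding eq
  proof (rule gauss_int_bound_exp(2))
    fix r :: real assume r: "0 \<le> r"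
    define x where "x = r / sqrt u"
    have "x \<le> 2 * (1 + x\<^sup>2 / 8)"
    proof -
      have "0 \<le> (x - 2)\<^sup>2" by simp
      then show ?thesis by (simp add: power2_eq_square algebra_simps)
    qed
    also have "\<dots> \<le> 2 * exp (x\<^sup>2 / 8)" by (intro mult_left_mono exp_ge_add_one_self) simp
    finally have "x * exp (- (x\<^sup>2 / 8)) \<le> 2 * exp (x\<^sup>2 / 8) * exp (- (x\<^sup>2 / 8))" by (rule mult_right_mono) simp
    then have "x * exp (- (x\<^sup>2 / 8)) \<le> 2" by (simp add: mult.assoc flip: exp_add)
    moreover have "x\<^sup>2 / 8 = r\<^sup>2 / (8 * u)" using u by (simp add: x_def power_divide)
    ultimately have "(x * exp (- r\<^sup>2 / (8 * u))) * sqrt u \<le> 2 * sqrt u"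
      using u by (intro mult_right_mono) auto
    moreover have "(x * exp (- r\<^sup>2 / (8 * u))) * sqrt u = r * exp (- r\<^sup>2 / (8 * u))"
      using u by (simp add: x_def)
    ultimately have *: "r * exp (- r\<^sup>2 / (8 * u)) \<le> 2 * sqrt u" by (simp only:)
    have "\<bar>g r\<bar> \<le> exp (- r\<^sup>2 / (8 * u)) * (K * (r * exp (b * r)))"
      using f[OF r] by (simp add: g_def abs_mult)
    also have "\<dots> = K * exp (b * r) * (r * exp (- r\<^sup>2 / (8 * u)))" by simp
    also have "\<dots> \<le> K * exp (b * r) * (2 * sqrt u)" using K by (intro mult_left_mono *) auto
    finally show "\<bar>g r\<bar> \<le> 2 * K * sqrt u * exp (b * r)" by (simp add: mult_ac)
  qed (use u in auto)
qed

lemma gauss_int_bound_decay: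
  assumes u: "0 < u" and b: "0 < b"
  shows "\<bar>gauss_int (\<lambda>r. exp (- b * r)) u\<bar> \<le> 1 / b"
proof -
  have nn: "(\<integral>\<^sup>+r. ennreal (exp (- b * r)) * indicator {0..} r \<partial>lborel) = ennreal (0 - (- exp (- b * 0) / b))"
  proof (rule nn_integral_FTC_atLeast)
    have "((\<lambda>u. exp (- b * u)) \<longlongrightarrow> 0) at_top"
      using b by (intro filterlim_compose[OF exp_at_bot] filterlim_tendsto_neg_mult_at_bot[OF tendsto_const _ filterlim_ident]) auto
    from tendsto_divide[OF tendsto_minus[OF this] tendsto_const[of b]] b
    show "((\<lambda>u. - exp (- b * u) / b) \<longlongrightarrow> 0) at_top" by simp
  qed (use b in \<open>auto intro!: derivative_eq_intros\<close>)
  have "ennreal (gauss_int (\<lambda>r. exp (- b * r)) u) \<le> (\<integral>\<^sup>+r. ennreal (exp (- b * r)) * indicator {0..} r \<partial>lborel)"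
  proof -
    have "gauss_int (\<lambda>r. exp (- b * r)) u = enn2real (\<integral>\<^sup>+r. ennreal (indicator {0..} r * (exp (- r\<^sup>2 / (4 * u)) * exp (- b * r))) \<partial>lborel)"
      unfolding gauss_int_def by (intro integral_eq_nn_integral AE_I2) auto
    moreover have "(\<integral>\<^sup>+r. ennreal (indicator {0..} r * (exp (- r\<^sup>2 / (4 * u)) * exp (- b * r))) \<partial>lborel) \<le> (\<integral>\<^sup>+r. ennreal (exp (- b * r)) * indicator {0..} r \<partial>lborel)"
      using u by (intro nn_integral_mono) (auto simp: indicator_def intro!: ennreal_leI mult_left_le_one_le)
    moreover have "ennreal (enn2real X) \<le> X" for X by (simp add: ennreal_enn2real_if)
    ultimately show ?thesis using order_trans by (simp only:) blast
  qed
  then have "ennreal (gauss_int (\<lambda>r. exp (- b * r)) u) \<le> ennreal (1 / b)" unfolding nn by simp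
  then have "gauss_int (\<lambda>r. exp (- b * r)) u \<le> 1 / b" using b by (subst (asm) ennreal_le_iff) auto
  moreover have "0 \<le> gauss_int (\<lambda>r. exp (- b * r)) u" unfolding gauss_int_def by (intro integral_nonneg_AE AE_I2) auto
  ultimately show ?thesis by simp
qed

text \<open>The whole-line integral is explicit and the missing half reflects to the integral of
  exp(-b r). For b > 0 that correction stays bounded while the main term grows like exp(b^2
  u).\<close>

lemma gauss_int_exp:
  assumes u: "0 < u"
  shows "gauss_int (\<lambda>r. exp (b * r)) u = 2 * sqrt (pi * u) * exp (b\<^sup>2 * u) - gauss_int (\<lambda>r. exp (- b * r)) u"
proof -
  have i: "integrable lborel (\<lambda>r. indicator {0..} r * (exp (- r\<^sup>2 / (4 * u)) * exp (b * r)))" for b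
    by (rule gauss_int_bound_exp(1)[OF u, of _ 1 b]) auto
  have "gauss_int (\<lambda>r. exp (- b * r)) u = (\<integral>r. indicator {..0} r * (exp (- r\<^sup>2 / (4 * u)) * exp (b * r)) \<partial>lborel)"
    unfolding gauss_int_def
    by (subst lborel_integral_real_affine[where c = "-1" and t = 0]) (auto simp: indicator_def intro!: Bochner_Integration.integral_cong)
  also have "\<dots> = (\<integral>r. exp (- r\<^sup>2 / (4 * u)) * exp (b * r) - indicator {0..} r * (exp (- r\<^sup>2 / (4 * u)) * exp (b * r)) \<partial>lborel)"
    by (intro integral_cong_AE eventually_mono[OF AE_lborel_singleton[of 0]]) (auto simp: indicator_def)
  also have "\<dots> = 2 * sqrt (pi * u) * exp (b\<^sup>2 * u) - gauss_int (\<lambda>r. exp (b * r)) u"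
    unfolding gauss_int_def using gauss_exp_line[OF u, of b] i[of b]
    by (subst Bochner_Integration.integral_diff) (auto simp: has_bochner_integral_iff)
  finally show ?thesis by simp
qed

lemma gauss_int_split:
  assumes u: "0 < u" and [measurable]: "f \<in> borel_measurable borel" and f: "\<And>r. 0 \<le> r \<Longrightarrow> \<bar>f r - \<kappa> * exp (c * r)\<bar> \<le> K * exp (d * r)"
  shows "gauss_int f u = \<kappa> * gauss_int (\<lambda>r. exp (c * r)) u + gauss_int (\<lambda>r. f r - \<kappa> * exp (c * r)) u"
proof -
  have 1: "integrable lborel (\<lambda>r. indicator {0..} r * (exp (- r\<^sup>2 / (4 * u)) * exp (c * r)))"
    by (rule gauss_int_bound_exp(1)[OF u, of _ 1 c]) auto
  have 2: "integrable lborel (\<lambda>r. indicator {0..} r * (exp (- r\<^sup>2 / (4 * u)) * (f r - \<kappa> * exp (c * r))))"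
    by (rule gauss_int_bound_exp(1)[OF u _ f]) auto
  have "gauss_int f u = (\<integral>r. \<kappa> * (indicator {0..} r * (exp (- r\<^sup>2 / (4 * u)) * exp (c * r))) + indicator {0..} r * (exp (- r\<^sup>2 / (4 * u)) * (f r - \<kappa> * exp (c * r))) \<partial>lborel)"
    unfolding gauss_int_def by (intro Bochner_Integration.integral_cong) (auto simp: algebra_simps)
  then show ?thesis
    using 1 2 unfolding gauss_int_def by (subst (asm) Bochner_Integration.integral_add) auto
qed

lemma exp_minus_le_inverse: "0 < d \<Longrightarrow> 0 < u \<Longrightarrow> exp (- d * u) \<le> 1 / d / u" for d u :: real
proof -
  assume "0 < d" "0 < u"
  moreover have "d * u \<le> exp (d * u)" using exp_ge_add_one_self[of "d * u"] by linarith
  ultimately show ?thesis by (simp add: exp_minus field_simps)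
qed

text \<open>The time factor of the heat kernel: the power comes from the one-dimensional Gaussian,
  and c^2 = ((n - 1)/2)^2 is the bottom of the spectrum of the hyperbolic Laplacian.\<close>

definition heat_normalizer :: "real \<Rightarrow> real \<Rightarrow> real" where
  "heat_normalizer c u = u powr (- (1/2)) * exp (- c\<^sup>2 * u)"

lemma heat_normalizer_nonneg: "0 \<le> heat_normalizer c u"
  by (simp add: heat_normalizer_def)

lemma heat_normalizer_sqrt: "0 < u \<Longrightarrow> heat_normalizer c u * sqrt u = exp (- c\<^sup>2 * u)"
  by (simp add: heat_normalizer_def powr_half_sqrt[symmetric] powr_minus)

text \<open>The leading exponential contributes exactly 2 sqrt(pi) kappa apart from a bounded
  integral times the normalizer. The remainder is damped by exp(-(c^2 - (c - 1/2)^2) u) = exp(-(c -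
  1/4) u), of which only 1/u is kept. A gap 1/2 in the growth, rather than 1, keeps this strict for
  c = 1/2, that is n = 2, where (c - 1)^2 = c^2.\<close>

lemma gauss_int_large:
  assumes c: "1/2 \<le> c" and f [measurable]: "f \<in> borel_measurable borel"
    and le: "\<And>r. 0 \<le> r \<Longrightarrow> \<bar>f r - \<kappa> * exp (c * r)\<bar> \<le> K * exp ((c - 1/2) * r)"
  shows "\<exists>K'\<ge>0. \<forall>u\<ge>1. \<bar>heat_normalizer c u * gauss_int f u - 2 * sqrt pi * \<kappa>\<bar> \<le> K' / u"
proof (intro exI[of _ "\<bar>\<kappa>\<bar> * (1 / c * (1 / c\<^sup>2)) + K * (2 * sqrt pi * 4)"] conjI allI impI)
  have K: "0 \<le> K" using le[of 0] by simp
  then show "0 \<le> \<bar>\<kappa>\<bar> * (1 / c * (1 / c\<^sup>2)) + K * (2 * sqrt pi * 4)" using c by simp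
  fix u :: real assume u1: "1 \<le> u"
  then have u: "0 < u" by simp
  define g where "g = (\<lambda>r. f r - \<kappa> * exp (c * r))"
  have [measurable]: "g \<in> borel_measurable borel" unfolding g_def by measurable
  have main: "heat_normalizer c u * (2 * sqrt (pi * u) * exp (c\<^sup>2 * u)) = 2 * sqrt pi"
  proof -
    have "heat_normalizer c u * (2 * sqrt (pi * u) * exp (c\<^sup>2 * u)) = 2 * sqrt pi * (heat_normalizer c u * sqrt u) * exp (c\<^sup>2 * u)"
      by (simp add: real_sqrt_mult mult_ac)
    also have "\<dots> = 2 * sqrt pi" unfolding heat_normalizer_sqrt[OF u] by (simp flip: exp_add)
    finally show ?thesis .
  qed
  have eq: "heat_normalizer c u * gauss_int f u - 2 * sqrt pi * \<kappa> = - \<kappa> * (heat_normalizer c u * gauss_int (\<lambda>r. exp (- c * r)) u) + heat_normalizer c u * gauss_int g u"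
  proof -
    have dist: "N * (\<kappa> * (A - B) + C) = \<kappa> * (N * A) - \<kappa> * (N * B) + N * C" for N A B C :: real by (simp add: algebra_simps)
    have "heat_normalizer c u * gauss_int f u = \<kappa> * (heat_normalizer c u * (2 * sqrt (pi * u) * exp (c\<^sup>2 * u)))
      - \<kappa> * (heat_normalizer c u * gauss_int (\<lambda>r. exp (- c * r)) u) + heat_normalizer c u * gauss_int g u"
    proof -
      have "gauss_int f u = \<kappa> * gauss_int (\<lambda>r. exp (c * r)) u + gauss_int g u"
        unfolding g_def by (rule gauss_int_split[OF u f le])
      also have "gauss_int (\<lambda>r. exp (c * r)) u = 2 * sqrt (pi * u) * exp (c\<^sup>2 * u) - gauss_int (\<lambda>r. exp (- c * r)) u"
        by (rule gauss_int_exp[OF u])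
      finally have s: "gauss_int f u = \<kappa> * (2 * sqrt (pi * u) * exp (c\<^sup>2 * u) - gauss_int (\<lambda>r. exp (- c * r)) u) + gauss_int g u" .
      show ?thesis unfolding s by (rule dist)
    qed
    then show ?thesis unfolding main by simp
  qed
  have "\<bar>heat_normalizer c u * gauss_int (\<lambda>r. exp (- c * r)) u\<bar> \<le> (1 / c\<^sup>2 / u) * (1 / c)"
    unfolding abs_mult
  proof (rule mult_mono)
    have "u powr (- (1/2)) \<le> u powr 0" using u1 by (intro powr_mono) auto
    then have "heat_normalizer c u \<le> 1 * exp (- c\<^sup>2 * u)" using u unfolding heat_normalizer_def by (intro mult_right_mono) auto
    also have "\<dots> \<le> 1 / c\<^sup>2 / u" using exp_minus_le_inverse[of "c\<^sup>2" u] c u by simp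
    finally show "\<bar>heat_normalizer c u\<bar> \<le> 1 / c\<^sup>2 / u" using heat_normalizer_nonneg[of c u] by simp
    show "\<bar>gauss_int (\<lambda>r. exp (- c * r)) u\<bar> \<le> 1 / c" using c by (intro gauss_int_bound_decay u) auto
  qed (use u in auto)
  from mult_left_mono[OF this, of "\<bar>\<kappa>\<bar>"]
  have b1: "\<bar>- \<kappa> * (heat_normalizer c u * gauss_int (\<lambda>r. exp (- c * r)) u)\<bar> \<le> \<bar>\<kappa>\<bar> * (1 / c * (1 / c\<^sup>2)) / u"
    by (simp add: abs_mult mult_ac)
  have "\<bar>heat_normalizer c u * gauss_int g u\<bar> \<le> heat_normalizer c u * (K * (2 * sqrt (pi * u) * exp ((c - 1/2)\<^sup>2 * u)))"
    unfolding abs_mult using heat_normalizer_nonneg[of c u] le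
    by (intro mult_mono gauss_int_bound_exp(2)[OF u]) (auto simp: g_def K)
  also have "\<dots> = K * 2 * sqrt pi * ((heat_normalizer c u * sqrt u) * exp ((c - 1/2)\<^sup>2 * u))"
    by (simp add: real_sqrt_mult mult_ac)
  also have "\<dots> \<le> K * 2 * sqrt pi * (4 / u)"
  proof (intro mult_left_mono)
    have "(heat_normalizer c u * sqrt u) * exp ((c - 1/2)\<^sup>2 * u) = exp (- (c - 1/4) * u)"
      unfolding heat_normalizer_sqrt[OF u] exp_add[symmetric] by (simp add: power2_eq_square algebra_simps)
    also have "\<dots> \<le> exp (- (1/4) * u)" using c u mult_right_mono[of "- (c - 1/4)" "- (1/4)" u] by simp
    also have "\<dots> \<le> 4 / u" using exp_minus_le_inverse[of "1/4" u] u by simp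
    finally show "heat_normalizer c u * sqrt u * exp ((c - 1 / 2)\<^sup>2 * u) \<le> 4 / u" .
  qed (use K in simp)
  finally have b2: "\<bar>heat_normalizer c u * gauss_int g u\<bar> \<le> K * (2 * sqrt pi * 4) / u" by (simp add: mult.left_commute)
  show "\<bar>heat_normalizer c u * gauss_int f u - 2 * sqrt pi * \<kappa>\<bar> \<le> (\<bar>\<kappa>\<bar> * (1 / c * (1 / c\<^sup>2)) + K * (2 * sqrt pi * 4)) / u"
    unfolding eq using b1 b2 by (simp add: add_divide_distrib)
qed

text \<open>The value at 0 contributes a half-line Gaussian, sqrt(pi u), which the normalizer turns
  into sqrt(pi) up to exp(-c^2 u). The linear remainder is O(sqrt u) by
  \<open>gauss_int_bound_linear\<close>.\<close>

lemma gauss_int_small: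
  assumes f [measurable]: "f \<in> borel_measurable borel"
    and le: "\<And>r. 0 \<le> r \<Longrightarrow> \<bar>f r - \<kappa>\<bar> \<le> K * (r * exp (b * r))" and K: "0 \<le> K"
  shows "\<exists>K'\<ge>0. \<forall>u. 0 < u \<and> u \<le> 1 \<longrightarrow> \<bar>heat_normalizer c u * gauss_int f u - sqrt pi * \<kappa>\<bar> \<le> K' * sqrt u"
proof (intro exI[of _ "sqrt pi * \<bar>\<kappa>\<bar> * c\<^sup>2 + 2 * K * (2 * sqrt (pi * 2) * exp (b\<^sup>2 * 2))"] conjI allI impI)
  show "0 \<le> sqrt pi * \<bar>\<kappa>\<bar> * c\<^sup>2 + 2 * K * (2 * sqrt (pi * 2) * exp (b\<^sup>2 * 2))" using K by simp
  fix u :: real assume "0 < u \<and> u \<le> 1"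
  then have u: "0 < u" "u \<le> 1" by auto
  define g where "g = (\<lambda>r. f r - \<kappa>)"
  have [measurable]: "g \<in> borel_measurable borel" unfolding g_def by measurable
  have le': "\<bar>f r - \<kappa> * exp (0 * r)\<bar> \<le> K * exp ((b + 1) * r)" if "0 \<le> r" for r
  proof -
    have "r \<le> exp r" using exp_ge_add_one_self[of r] by linarith
    then have "r * exp (b * r) \<le> exp r * exp (b * r)" by (intro mult_right_mono) auto
    then have "K * (r * exp (b * r)) \<le> K * exp ((b + 1) * r)" using K by (intro mult_left_mono) (auto simp: algebra_simps exp_add)
    then show ?thesis using le[OF that] by simp
  qed
  have "gauss_int (\<lambda>r. 1) u = sqrt (pi * u)" using gauss_int_exp[OF u(1), of 0] by simp
  then have eq0: "gauss_int f u = \<kappa> * sqrt (pi * u) + gauss_int g u"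
    using gauss_int_split[OF u(1) f le'] by (simp add: g_def)
  have "heat_normalizer c u * (\<kappa> * sqrt (pi * u)) = sqrt pi * \<kappa> * (heat_normalizer c u * sqrt u)" by (simp add: real_sqrt_mult mult_ac)
  then have eq: "heat_normalizer c u * gauss_int f u - sqrt pi * \<kappa> = sqrt pi * \<kappa> * (exp (- c\<^sup>2 * u) - 1) + heat_normalizer c u * gauss_int g u"
    unfolding eq0 heat_normalizer_sqrt[OF u(1)] by (simp add: algebra_simps)
  have "\<bar>exp (- c\<^sup>2 * u) - 1\<bar> \<le> c\<^sup>2 * u"
  proof -
    have "0 \<le> c\<^sup>2 * u" using u by simp
    then have "exp (- c\<^sup>2 * u) \<le> 1" by simp
    then show ?thesis using exp_ge_add_one_self[of "- c\<^sup>2 * u"] by simp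
  qed
  also have "\<dots> \<le> c\<^sup>2 * sqrt u"
    using u by (intro mult_left_mono) (auto intro!: real_le_rsqrt simp: power2_eq_square mult_left_le)
  finally have "\<bar>sqrt pi * \<kappa> * (exp (- c\<^sup>2 * u) - 1)\<bar> \<le> sqrt pi * \<bar>\<kappa>\<bar> * (c\<^sup>2 * sqrt u)"
    unfolding abs_mult by (intro mult_mono) auto
  then have b1: "\<bar>sqrt pi * \<kappa> * (exp (- c\<^sup>2 * u) - 1)\<bar> \<le> sqrt pi * \<bar>\<kappa>\<bar> * c\<^sup>2 * sqrt u" by (simp add: mult_ac)
  have "\<bar>heat_normalizer c u * gauss_int g u\<bar> \<le> heat_normalizer c u * ((2 * K * sqrt u) * (2 * sqrt (pi * (2 * u)) * exp (b\<^sup>2 * (2 * u))))"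
    unfolding abs_mult using heat_normalizer_nonneg[of c u] le K u
    by (intro mult_mono gauss_int_bound_linear) (auto simp: g_def)
  also have "\<dots> = (2 * K * sqrt u) * (2 * sqrt (pi * 2) * (heat_normalizer c u * sqrt u * exp (b\<^sup>2 * (2 * u))))"
    by (simp add: real_sqrt_mult mult_ac)
  also have "\<dots> \<le> (2 * K * sqrt u) * (2 * sqrt (pi * 2) * (1 * exp (b\<^sup>2 * 2)))"
    unfolding heat_normalizer_sqrt[OF u(1)] using u K
    by (intro mult_left_mono mult_mono) (auto simp: mult_left_le_one_le)
  finally have b2: "\<bar>heat_normalizer c u * gauss_int g u\<bar> \<le> 2 * K * (2 * sqrt (pi * 2) * exp (b\<^sup>2 * 2)) * sqrt u" by (simp add: mult_ac)
  show "\<bar>heat_normalizer c u * gauss_int f u - sqrt pi * \<kappa>\<bar> \<le> (sqrt pi * \<bar>\<kappa>\<bar> * c\<^sup>2 + 2 * K * (2 * sqrt (pi * 2) * exp (b\<^sup>2 * 2))) * sqrt u"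
    unfolding eq using b1 b2 by (simp add: distrib_right)
qed

definition heat_shape :: "nat \<Rightarrow> nat \<Rightarrow> real \<Rightarrow> real" where
  "heat_shape e j r = cosh (r / 2) ^ e * (cosh r - 1) ^ j"

lemma heat_shape_measurable [measurable]: "heat_shape e j \<in> borel_measurable borel"
  unfolding heat_shape_def[abs_def] by measurable

lemma heat_shape_nonneg: "0 \<le> heat_shape e j r"
  using versine_nonneg[of r] by (simp add: heat_shape_def)

lemma cosh_le_exp: "0 \<le> x \<Longrightarrow> cosh x \<le> exp x" for x :: real
  by (simp add: cosh_def)

lemma heat_shape_le_exp:
  assumes "0 \<le> r"
  shows "heat_shape e j r \<le> exp ((real e / 2 + real j) * r)"
proof -
  have "cosh (r / 2) ^ e \<le> exp (r / 2) ^ e" using assms by (intro power_mono cosh_le_exp) auto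
  moreover have "(cosh r - 1) ^ j \<le> exp r ^ j"
    using assms cosh_le_exp[of r] versine_nonneg[of r] by (intro power_mono) auto
  ultimately have "heat_shape e j r \<le> exp (r / 2) ^ e * exp r ^ j"
    unfolding heat_shape_def using versine_nonneg[of r] by (intro mult_mono) auto
  also have "\<dots> = exp ((real e / 2 + real j) * r)"
    by (simp add: exp_of_nat_mult[symmetric] algebra_simps flip: exp_add)
  finally show ?thesis .
qed

text \<open>In terms of z = exp(-r), cosh(r/2) is (1/2) exp(r/2) (1 + z) and cosh r - 1 is (1/2)
  exp(r) (1 - z)^2. The quotient by the leading term is (1 + z)^e (1 - z)^(2j), which Bernoulli's
  inequality keeps within O(z) of 1.\<close>

lemma heat_shape_large:
  assumes r: "0 \<le> r" and e: "e \<le> 1"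
  shows "\<bar>heat_shape e j r - 1 / 2 ^ (e + j) * exp ((real e / 2 + real j) * r)\<bar>
    \<le> (2 * real j + 1) * exp ((real e / 2 + real j - 1) * r)"
proof -
  define z where "z = exp (- r)"
  have z: "0 \<le> z" "z \<le> 1" using r by (auto simp: z_def)
  define y where "y = (1 + z) ^ e * (1 - z) ^ (2 * j)"
  have "cosh (r / 2) = 1/2 * exp (r / 2) * (1 + z)"
    by (simp add: cosh_def z_def algebra_simps flip: exp_add)
  moreover have "cosh r - 1 = 1/2 * exp r * (1 - z)\<^sup>2"
    by (simp add: cosh_def z_def power2_eq_square algebra_simps flip: exp_add)
  ultimately have "heat_shape e j r = (1/2) ^ e * exp (r / 2) ^ e * (1 + z) ^ e * ((1/2) ^ j * exp r ^ j * (1 - z) ^ (2 * j))"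
    by (simp only: heat_shape_def power_mult_distrib power_mult)
  also have "\<dots> = (1/2) ^ (e + j) * (exp (r / 2) ^ e * exp r ^ j) * y"
    by (simp add: y_def power_add mult_ac)
  also have "exp (r / 2) ^ e * exp r ^ j = exp ((real e / 2 + real j) * r)"
    by (simp add: exp_of_nat_mult[symmetric] algebra_simps flip: exp_add)
  finally have eq: "heat_shape e j r - 1 / 2 ^ (e + j) * exp ((real e / 2 + real j) * r) = 1 / 2 ^ (e + j) * exp ((real e / 2 + real j) * r) * (y - 1)"
    by (simp add: power_one_over right_diff_distrib diff_divide_distrib)
  have "\<bar>y - 1\<bar> \<le> (2 * real j + 1) * z"
  proof -
    have a: "1 \<le> (1 + z) ^ e" "(1 + z) ^ e \<le> 1 + z" using z e by (cases e; auto)+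
    have b: "(1 - z) ^ (2 * j) \<le> 1" "0 \<le> (1 - z) ^ (2 * j)" using z by (auto simp: power_le_one)
    have c: "1 - 2 * real j * z \<le> (1 - z) ^ (2 * j)"
      using Bernoulli_inequality[of "- z" "2 * j"] z by simp
    have "y \<le> (1 + z) * 1" unfolding y_def using a b z by (intro mult_mono) auto
    moreover have "1 * (1 - z) ^ (2 * j) \<le> y" unfolding y_def using a b by (intro mult_right_mono) auto
    moreover have "0 \<le> real j * z" using z by simp
    ultimately show ?thesis using c z unfolding abs_le_iff distrib_right by linarith
  qed
  then have "\<bar>heat_shape e j r - 1 / 2 ^ (e + j) * exp ((real e / 2 + real j) * r)\<bar> \<le> 1 / 2 ^ (e + j) * exp ((real e / 2 + real j) * r) * ((2 * real j + 1) * z)"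
    unfolding eq abs_mult by (intro mult_mono) auto
  also have "\<dots> \<le> 1 * exp ((real e / 2 + real j) * r) * ((2 * real j + 1) * z)"
    using z by (intro mult_right_mono) auto
  also have "\<dots> = (2 * real j + 1) * exp ((real e / 2 + real j - 1) * r)"
    by (simp add: z_def algebra_simps flip: exp_add)
  finally show ?thesis .
qed

lemma cosh_minus_one_le: "0 \<le> x \<Longrightarrow> cosh x - 1 \<le> x * exp x" for x :: real
proof -
  assume x: "0 \<le> x"
  have "exp x * (1 - x) \<le> exp x * exp (- x)" using exp_ge_add_one_self[of "- x"] by (intro mult_left_mono) auto
  then have "exp x - 1 \<le> x * exp x" by (simp add: algebra_simps flip: exp_add)
  moreover have "cosh x \<le> exp x" using x by (rule cosh_le_exp)
  ultimately show ?thesis by linarith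
qed

lemma heat_shape_small:
  assumes r: "0 \<le> r" and e: "e \<le> 1"
  shows "\<bar>heat_shape e j r - (if j = 0 then 1 else 0)\<bar> \<le> r * exp ((real j + 1) * r)"
proof (cases j)
  case 0
  have "cosh (r / 2) - 1 \<le> r / 2 * exp (r / 2)" using r by (intro cosh_minus_one_le) simp
  also have "\<dots> \<le> r * exp r" using r by (intro mult_mono) auto
  finally have "cosh (r / 2) - 1 \<le> r * exp r" .
  moreover have "e = 0 \<or> e = 1" using e by auto
  ultimately show ?thesis using 0 r cosh_real_ge_1[of "r / 2"] by (auto simp: heat_shape_def)
next
  case (Suc k)
  have "cosh (r / 2) ^ e \<le> exp (r / 2) ^ 1"
  proof -
    have "cosh (r / 2) ^ e \<le> cosh (r / 2) ^ 1" using e by (intro power_increasing cosh_real_ge_1) auto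
    then show ?thesis using cosh_le_exp[of "r / 2"] r by simp
  qed
  also have "\<dots> \<le> exp r" using r by simp
  finally have 1: "cosh (r / 2) ^ e \<le> exp r" .
  have 2: "(cosh r - 1) ^ k \<le> exp r ^ k" using r cosh_le_exp[of r] versine_nonneg[of r] by (intro power_mono) auto
  have 3: "cosh r - 1 \<le> r * exp r" using r by (rule cosh_minus_one_le)
  have "cosh (r / 2) ^ e * ((cosh r - 1) * (cosh r - 1) ^ k) \<le> exp r * ((r * exp r) * exp r ^ k)"
    using 1 2 3 r versine_nonneg[of r] by (intro mult_mono) auto
  also have "\<dots> = r * exp ((real j + 1) * r)"
    by (simp add: Suc exp_of_nat_mult[symmetric] algebra_simps flip: exp_add)
  finally show ?thesis using heat_shape_nonneg[of e j r] by (simp add: heat_shape_def Suc)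
qed

lemma gauss_moment_eq:
  assumes u: "0 < u"
  shows "gauss_moment e (1 / (4 * u)) j = ennreal (gauss_int (heat_shape e j) u)"
proof -
  have i: "integrable lborel (\<lambda>r. indicator {0..} r * (exp (- r\<^sup>2 / (4 * u)) * heat_shape e j r))"
    using heat_shape_le_exp[of _ e j] heat_shape_nonneg[of e j]
    by (intro gauss_int_bound_exp(1)[OF u, of _ 1 "real e / 2 + real j"]) auto
  have "gauss_moment e (1 / (4 * u)) j = (\<integral>\<^sup>+r. ennreal (indicator {0..} r * (exp (- r\<^sup>2 / (4 * u)) * heat_shape e j r)) \<partial>lborel)"
    unfolding gauss_moment_def by (intro nn_integral_cong) (auto simp: heat_shape_def indicator_def mult_ac)
  also have "\<dots> = ennreal (gauss_int (heat_shape e j) u)"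
    unfolding gauss_int_def using i heat_shape_nonneg by (intro nn_integral_eq_integral) auto
  finally show ?thesis .
qed

text \<open>The positive density called p_u in the overview.\<close>

definition heat_density :: "nat \<Rightarrow> real \<Rightarrow> real \<Rightarrow> real" where
  "heat_density n u r = heat_normalizer ((real n - 1) / 2) u * heat_profile n (1 / (4 * u)) r"

lemma heat_density_nonneg: "2 \<le> n \<Longrightarrow> 0 < u \<Longrightarrow> 0 \<le> r \<Longrightarrow> 0 \<le> heat_density n u r"
  by (simp add: heat_density_def heat_normalizer_nonneg heat_profile_nonneg)

lemma heat_density_measurable [measurable]:
  assumes [measurable]: "f \<in> borel_measurable M" "g \<in> borel_measurable M"
  shows "(\<lambda>x. heat_density n (f x) (g x)) \<in> borel_measurable M"
  unfolding heat_density_def heat_normalizer_def by measurable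

lemma heat_density_mass:
  assumes n: "2 \<le> n"
  obtains d L e where "\<And>i. 0 \<le> d i" "0 < d L" "e \<le> 1" "real e / 2 + real L = (real n - 1) / 2"
    "\<And>u. 0 < u \<Longrightarrow> (\<integral>\<^sup>+r. ennreal (heat_density n u r * sinh r ^ (n - 1) * (cosh r - 1) ^ j) * indicator {0..} r \<partial>lborel)
      = ennreal (heat_normalizer ((real n - 1) / 2) u * gauss_int (\<lambda>r. \<Sum>i\<le>L. d i * heat_shape e (j + i) r) u)"
proof -
  obtain d L e where d: "\<And>i. 0 \<le> d i" "0 < d L" "2 * L + e + 1 = n" "e \<le> 1"
    "\<And>l. 0 < l \<Longrightarrow> (\<integral>\<^sup>+r. ennreal (heat_profile n l r * sinh r ^ (n - 1) * (cosh r - 1) ^ j) * indicator {0..} r \<partial>lborel)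
      = (\<Sum>i\<le>L. ennreal (d i) * gauss_moment e l (j + i))"
    using heat_mass[OF n, of j] by blast
  have e: "real e / 2 + real L = (real n - 1) / 2" unfolding d(3)[symmetric] by (simp add: field_simps)
  show ?thesis
  proof (rule that[of d L e])
    fix u :: real assume u: "0 < u"
    let ?N = "heat_normalizer ((real n - 1) / 2) u"
    have gi0: "0 \<le> gauss_int (heat_shape e i) u" for i
      unfolding gauss_int_def using heat_shape_nonneg by (intro integral_nonneg_AE AE_I2) auto
    have "(\<integral>\<^sup>+r. ennreal (heat_density n u r * sinh r ^ (n - 1) * (cosh r - 1) ^ j) * indicator {0..} r \<partial>lborel)
      = (\<integral>\<^sup>+r. ennreal ?N * (ennreal (heat_profile n (1 / (4 * u)) r * sinh r ^ (n - 1) * (cosh r - 1) ^ j) * indicator {0..} r) \<partial>lborel)"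
      using heat_normalizer_nonneg by (intro nn_integral_cong) (simp add: heat_density_def mult.assoc ennreal_mult')
    also have "\<dots> = ennreal ?N * (\<Sum>i\<le>L. ennreal (d i) * gauss_moment e (1 / (4 * u)) (j + i))"
      using u d(5)[of "1 / (4 * u)"] by (subst nn_integral_cmult) auto
    also have "(\<Sum>i\<le>L. ennreal (d i) * gauss_moment e (1 / (4 * u)) (j + i)) = (\<Sum>i\<le>L. ennreal (d i * gauss_int (heat_shape e (j + i)) u))"
      using d(1) by (simp add: gauss_moment_eq[OF u] ennreal_mult')
    also have "\<dots> = ennreal (\<Sum>i\<le>L. d i * gauss_int (heat_shape e (j + i)) u)"
      using d(1) gi0 by (intro sum_ennreal) simp
    also have "(\<Sum>i\<le>L. d i * gauss_int (heat_shape e (j + i)) u) = gauss_int (\<lambda>r. \<Sum>i\<le>L. d i * heat_shape e (j + i) r) u"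
    proof -
      have i: "integrable lborel (\<lambda>r. indicator {0..} r * (exp (- r\<^sup>2 / (4 * u)) * heat_shape e i r))" for i
        using heat_shape_le_exp[of _ e i] heat_shape_nonneg[of e i]
        by (intro gauss_int_bound_exp(1)[OF u, of _ 1 "real e / 2 + real i"]) auto
      have "gauss_int (\<lambda>r. \<Sum>i\<le>L. d i * heat_shape e (j + i) r) u = (\<integral>r. (\<Sum>i\<le>L. d i * (indicator {0..} r * (exp (- r\<^sup>2 / (4 * u)) * heat_shape e (j + i) r))) \<partial>lborel)"
        unfolding gauss_int_def sum_distrib_left by (intro Bochner_Integration.integral_cong refl sum.cong) (simp add: mult_ac)
      also have "\<dots> = (\<Sum>i\<le>L. \<integral>r. d i * (indicator {0..} r * (exp (- r\<^sup>2 / (4 * u)) * heat_shape e (j + i) r)) \<partial>lborel)"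
        by (rule Bochner_Integration.integral_sum) (intro integrable_mult_right i)
      also have "\<dots> = (\<Sum>i\<le>L. d i * gauss_int (heat_shape e (j + i)) u)"
        unfolding gauss_int_def by simp
      finally show ?thesis by simp
    qed
    finally show "(\<integral>\<^sup>+r. ennreal (heat_density n u r * sinh r ^ (n - 1) * (cosh r - 1) ^ j) * indicator {0..} r \<partial>lborel)
      = ennreal (?N * gauss_int (\<lambda>r. \<Sum>i\<le>L. d i * heat_shape e (j + i) r) u)"
      using heat_normalizer_nonneg by (simp add: ennreal_mult')
  qed (use d e in auto)
qed

text \<open>The mass is a Gaussian integral of a positive combination of shapes. For large r only
  the shape with index \<open>L\<close> reaches the growth exp(c r), the others being smaller by at
  least exp(r), and this gives the positive limit. At r = 0 only the shape with index 0 is nonzero,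
  and its coefficient gives the limit for small times.\<close>

lemma heat_density_total_mass:
  assumes n: "2 \<le> n"
  obtains m \<kappa>\<^sub>0 \<kappa>\<^sub>1 K where "0 < \<kappa>\<^sub>1" "0 \<le> K" "\<And>u. 0 < u \<Longrightarrow> 0 \<le> m u"
    "\<And>u. 0 < u \<Longrightarrow> (\<integral>\<^sup>+r. ennreal (heat_density n u r * sinh r ^ (n - 1)) * indicator {0..} r \<partial>lborel) = ennreal (m u)"
    "\<And>u. 1 \<le> u \<Longrightarrow> \<bar>m u - \<kappa>\<^sub>1\<bar> \<le> K / u"
    "\<And>u. 0 < u \<Longrightarrow> u \<le> 1 \<Longrightarrow> \<bar>m u - \<kappa>\<^sub>0\<bar> \<le> K * sqrt u"
proof -
  let ?c = "(real n - 1) / 2"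
  obtain d L e where d: "\<And>i. 0 \<le> d i" "0 < d L" "e \<le> 1" "real e / 2 + real L = ?c"
    "\<And>u. 0 < u \<Longrightarrow> (\<integral>\<^sup>+r. ennreal (heat_density n u r * sinh r ^ (n - 1) * (cosh r - 1) ^ 0) * indicator {0..} r \<partial>lborel)
      = ennreal (heat_normalizer ?c u * gauss_int (\<lambda>r. \<Sum>i\<le>L. d i * heat_shape e (0 + i) r) u)"
    using heat_density_mass[OF n, of 0] by blast
  define f where "f = (\<lambda>r. \<Sum>i\<le>L. d i * heat_shape e (0 + i) r)"
  have [measurable]: "f \<in> borel_measurable borel" unfolding f_def by measurable
  have f0: "0 \<le> f r" for r unfolding f_def using d(1) heat_shape_nonneg by (intro sum_nonneg) auto
  define k where "k = d L * (1 / 2 ^ (e + L))"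
  define K where "K = (\<Sum>i\<le>L. d i * (2 * real i + 1))"
  have large: "\<bar>f r - k * exp (?c * r)\<bar> \<le> K * exp ((?c - 1/2) * r)" if r: "0 \<le> r" for r
  proof -
    define g where "g = (\<lambda>i. if i = L then 1 / 2 ^ (e + L) * exp (?c * r) else 0)"
    have "f r - k * exp (?c * r) = (\<Sum>i\<le>L. d i * (heat_shape e i r - g i))"
      by (simp add: f_def k_def g_def right_diff_distrib sum_subtractf if_distrib[of "\<lambda>x. d _ * x"] cong: if_cong)
    also have "\<bar>\<dots>\<bar> \<le> (\<Sum>i\<le>L. \<bar>d i * (heat_shape e i r - g i)\<bar>)" by (rule sum_abs)
    also have "\<dots> \<le> (\<Sum>i\<le>L. d i * ((2 * real i + 1) * exp ((?c - 1/2) * r)))"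
    proof (rule sum_mono)
      fix i assume i: "i \<in> {..L}"
      have "\<bar>heat_shape e i r - g i\<bar> \<le> (2 * real i + 1) * exp ((?c - 1/2) * r)"
      proof (cases "i = L")
        case True
        have "\<bar>heat_shape e L r - 1 / 2 ^ (e + L) * exp (?c * r)\<bar> \<le> (2 * real L + 1) * exp ((?c - 1) * r)"
          using heat_shape_large[OF r d(3), of L] unfolding d(4) .
        also have "\<dots> \<le> (2 * real L + 1) * exp ((?c - 1/2) * r)"
          using r by (intro mult_left_mono) (auto intro!: mult_right_mono)
        finally show ?thesis using True by (simp add: g_def)
      next
        case False
        then have "real i \<le> real L - 1" using i by auto
        then have "real e / 2 + real i \<le> ?c - 1/2" using d(4) by linarith
        then have "exp ((real e / 2 + real i) * r) \<le> 1 * exp ((?c - 1/2) * r)" using r by (auto intro!: mult_right_mono)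
        also have "\<dots> \<le> (2 * real i + 1) * exp ((?c - 1/2) * r)" by (intro mult_right_mono) auto
        finally show ?thesis using False heat_shape_le_exp[OF r, of e i] heat_shape_nonneg[of e i r] by (simp add: g_def)
      qed
      then show "\<bar>d i * (heat_shape e i r - g i)\<bar> \<le> d i * ((2 * real i + 1) * exp ((?c - 1/2) * r))"
        using d(1) by (simp add: abs_mult mult_left_mono)
    qed
    also have "\<dots> = K * exp ((?c - 1/2) * r)" by (simp add: K_def sum_distrib_right mult.assoc)
    finally show ?thesis .
  qed
  have K0: "0 \<le> (\<Sum>i\<le>L. d i)" using d(1) by (intro sum_nonneg) auto
  have small: "\<bar>f r - d 0\<bar> \<le> (\<Sum>i\<le>L. d i) * (r * exp ((real L + 1) * r))" if r: "0 \<le> r" for r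
  proof -
    have "f r - d 0 = (\<Sum>i\<le>L. d i * (heat_shape e i r - (if i = 0 then 1 else 0)))"
      by (simp add: f_def right_diff_distrib sum_subtractf if_distrib[of "\<lambda>x. d _ * x"] cong: if_cong)
    also have "\<bar>\<dots>\<bar> \<le> (\<Sum>i\<le>L. \<bar>d i * (heat_shape e i r - (if i = 0 then 1 else 0))\<bar>)" by (rule sum_abs)
    also have "\<dots> \<le> (\<Sum>i\<le>L. d i * (r * exp ((real L + 1) * r)))"
    proof (rule sum_mono)
      fix i assume i: "i \<in> {..L}"
      have "\<bar>heat_shape e i r - (if i = 0 then 1 else 0)\<bar> \<le> r * exp ((real i + 1) * r)"
        by (rule heat_shape_small[OF r d(3)])
      also have "\<dots> \<le> r * exp ((real L + 1) * r)" using r i by (auto intro!: mult_left_mono mult_right_mono)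
      finally show "\<bar>d i * (heat_shape e i r - (if i = 0 then 1 else 0))\<bar> \<le> d i * (r * exp ((real L + 1) * r))"
        using d(1) by (simp add: abs_mult mult_left_mono)
    qed
    also have "\<dots> = (\<Sum>i\<le>L. d i) * (r * exp ((real L + 1) * r))" by (simp add: sum_distrib_right)
    finally show ?thesis .
  qed
  have c: "1/2 \<le> ?c" using n by simp
  obtain K1 where K1: "K1 \<ge> 0" "\<And>u. 1 \<le> u \<Longrightarrow> \<bar>heat_normalizer ?c u * gauss_int f u - 2 * sqrt pi * k\<bar> \<le> K1 / u"
    using gauss_int_large[OF c _ large] by auto
  obtain K2 where K2: "K2 \<ge> 0" "\<And>u. 0 < u \<Longrightarrow> u \<le> 1 \<Longrightarrow> \<bar>heat_normalizer ?c u * gauss_int f u - sqrt pi * d 0\<bar> \<le> K2 * sqrt u"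
    using gauss_int_small[OF _ small K0, of ?c] by auto
  show ?thesis
  proof (rule that[of "2 * sqrt pi * k" "max K1 K2" "\<lambda>u. heat_normalizer ?c u * gauss_int f u" "sqrt pi * d 0"])
    show "0 < 2 * sqrt pi * k" using d(2) by (simp add: k_def)
    show "0 \<le> max K1 K2" using K1(1) by simp
    show "0 \<le> heat_normalizer ?c u * gauss_int f u" for u
      unfolding gauss_int_def using f0 heat_normalizer_nonneg by (intro mult_nonneg_nonneg integral_nonneg_AE AE_I2) auto
    show "(\<integral>\<^sup>+r. ennreal (heat_density n u r * sinh r ^ (n - 1)) * indicator {0..} r \<partial>lborel) = ennreal (heat_normalizer ?c u * gauss_int f u)" if "0 < u" for u
      using d(5)[OF that] by (simp add: f_def)
    show "\<bar>heat_normalizer ?c u * gauss_int f u - 2 * sqrt pi * k\<bar> \<le> max K1 K2 / u" if "1 \<le> u" for u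
      using order_trans[OF K1(2)[OF that] divide_right_mono[OF max.cobounded1[of K1 K2], of u]] that by simp
    show "\<bar>heat_normalizer ?c u * gauss_int f u - sqrt pi * d 0\<bar> \<le> max K1 K2 * sqrt u" if "0 < u" "u \<le> 1" for u
      using order_trans[OF K2(2)[OF that] mult_right_mono[OF max.cobounded2[of K2 K1], of "sqrt u"]] that by simp
  qed
qed

text \<open>The extra factor cosh r - 1 shifts all shape indices to at least 1, so the combination
  vanishes at r = 0 and \<open>gauss_int_small\<close> applies with limit 0.\<close>

lemma heat_density_versine_moment:
  assumes n: "2 \<le> n"
  obtains K where "0 \<le> K" "\<And>u. 0 < u \<Longrightarrow> u \<le> 1 \<Longrightarrow>
    (\<integral>\<^sup>+r. ennreal (heat_density n u r * sinh r ^ (n - 1) * (cosh r - 1)) * indicator {0..} r \<partial>lborel) \<le> ennreal (K * sqrt u)"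
proof -
  let ?c = "(real n - 1) / 2"
  obtain d L e where d: "\<And>i. 0 \<le> d i" "0 < d L" "e \<le> 1" "real e / 2 + real L = ?c"
    "\<And>u. 0 < u \<Longrightarrow> (\<integral>\<^sup>+r. ennreal (heat_density n u r * sinh r ^ (n - 1) * (cosh r - 1) ^ 1) * indicator {0..} r \<partial>lborel)
      = ennreal (heat_normalizer ?c u * gauss_int (\<lambda>r. \<Sum>i\<le>L. d i * heat_shape e (1 + i) r) u)"
    using heat_density_mass[OF n, of 1] by blast
  define f where "f = (\<lambda>r. \<Sum>i\<le>L. d i * heat_shape e (1 + i) r)"
  have [measurable]: "f \<in> borel_measurable borel" unfolding f_def by measurable
  have f0: "0 \<le> f r" for r unfolding f_def using d(1) heat_shape_nonneg by (intro sum_nonneg) auto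
  have K0: "0 \<le> (\<Sum>i\<le>L. d i)" using d(1) by (intro sum_nonneg) auto
  have small: "\<bar>f r - 0\<bar> \<le> (\<Sum>i\<le>L. d i) * (r * exp ((real L + 2) * r))" if r: "0 \<le> r" for r
  proof -
    have "f r \<le> (\<Sum>i\<le>L. d i * (r * exp ((real L + 2) * r)))"
      unfolding f_def
    proof (rule sum_mono)
      fix i assume i: "i \<in> {..L}"
      have "heat_shape e (1 + i) r \<le> r * exp ((real (1 + i) + 1) * r)"
        using heat_shape_small[OF r d(3), of "1 + i"] by simp
      also have "\<dots> \<le> r * exp ((real L + 2) * r)" using r i by (auto intro!: mult_left_mono mult_right_mono)
      finally show "d i * heat_shape e (1 + i) r \<le> d i * (r * exp ((real L + 2) * r))"
        using d(1) by (simp add: mult_left_mono)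
    qed
    also have "\<dots> = (\<Sum>i\<le>L. d i) * (r * exp ((real L + 2) * r))" by (simp add: sum_distrib_right)
    finally show ?thesis using f0[of r] by simp
  qed
  obtain K where K: "K \<ge> 0" "\<And>u. 0 < u \<Longrightarrow> u \<le> 1 \<Longrightarrow> \<bar>heat_normalizer ?c u * gauss_int f u - sqrt pi * 0\<bar> \<le> K * sqrt u"
    using gauss_int_small[OF _ small K0, of ?c] by auto
  show ?thesis
  proof (rule that[OF K(1)])
    fix u :: real assume u: "0 < u" "u \<le> 1"
    have "heat_normalizer ?c u * gauss_int f u \<le> K * sqrt u" using K(2)[OF u] by simp
    then show "(\<integral>\<^sup>+r. ennreal (heat_density n u r * sinh r ^ (n - 1) * (cosh r - 1)) * indicator {0..} r \<partial>lborel) \<le> ennreal (K * sqrt u)"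
      using d(5)[OF u(1)] by (simp add: f_def ennreal_leI)
  qed
qed

section \<open>Expansions of one-dimensional integrals\<close>

lemma has_bochner_powr_near_0:
  assumes d: "0 < d"
  shows "integrable lborel (\<lambda>u::real. indicator {0<..1} u * u powr (d - 1))"
proof (rule integrableI_bounded)
  have "((\<lambda>x::real. x powr (d - 1)) has_integral (1 powr (d - 1 + 1) / (d - 1 + 1))) {0..1}"
    using d by (intro has_integral_powr_from_0) auto
  then have "(\<integral>\<^sup>+u. ennreal (u powr (d - 1)) * indicator {0..1} u \<partial>lborel) = ennreal (1 / d)"
    using d by (subst nn_integral_has_integral_lebesgue[symmetric])
      (auto simp: nn_integral_completion mult.commute indicator_def intro!: nn_integral_cong)
  moreover have "(\<integral>\<^sup>+u. ennreal (norm (indicator {0<..1} u * u powr (d - 1))) \<partial>lborel) \<le> (\<integral>\<^sup>+u. ennreal (u powr (d - 1)) * indicator {0..1} u \<partial>lborel)"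
    by (intro nn_integral_mono) (auto simp: indicator_def)
  ultimately show "(\<integral>\<^sup>+u. ennreal (norm (indicator {0<..1} u * u powr (d - 1))) \<partial>lborel) < \<infinity>"
    by (auto simp: less_top[symmetric] top_unique)
qed measurable

lemma has_bochner_powr_at_infinity:
  assumes d: "0 < d"
  shows "has_bochner_integral lborel (\<lambda>u::real. indicator {1<..} u * u powr (- 1 - d)) (1 / d)"
proof (rule has_bochner_integral_nn_integral)
  have "(\<integral>\<^sup>+u. ennreal (indicator {1<..} u * u powr (- 1 - d)) \<partial>lborel) = (\<integral>\<^sup>+u. ennreal (u powr (- 1 - d)) * indicator {1..} u \<partial>lborel)"
    by (intro nn_integral_cong_AE eventually_mono[OF AE_lborel_singleton[of 1]]) (auto simp: indicator_def)
  also have "\<dots> = ennreal (0 - (- (1 powr (- d)) / d))"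
  proof (rule nn_integral_FTC_atLeast)
    show "((\<lambda>u. - (u powr (- d)) / d) has_real_derivative u powr (- 1 - d)) (at u)" if "1 \<le> u" for u :: real
      using that d by (auto intro!: derivative_eq_intros simp: powr_diff powr_minus field_simps)
    have "((\<lambda>u::real. u powr (- d)) \<longlongrightarrow> 0) at_top" using d by (intro tendsto_neg_powr filterlim_ident) auto
    from tendsto_divide[OF tendsto_minus[OF this] tendsto_const[of d]] d
    show "((\<lambda>u::real. - (u powr (- d)) / d) \<longlongrightarrow> 0) at_top" by simp
  qed auto
  finally show "(\<integral>\<^sup>+u. ennreal (indicator {1<..} u * u powr (- 1 - d)) \<partial>lborel) = ennreal (1 / d)" by simp
qed (use d in auto)

definition power_majorant :: "real \<Rightarrow> real \<Rightarrow> real" where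
  "power_majorant d u = indicator {0<..1} u * u powr (d - 1) + indicator {1<..} u * u powr (- 2)"

lemma integrable_power_majorant: "0 < d \<Longrightarrow> integrable lborel (power_majorant d)"
  unfolding power_majorant_def[abs_def]
  using has_bochner_powr_at_infinity[of 1]
  by (intro Bochner_Integration.integrable_add has_bochner_powr_near_0) (auto simp: has_bochner_integral_iff)

lemma power_majorant_nonneg: "0 \<le> power_majorant d u"
  by (simp add: power_majorant_def)

text \<open>A gain u^e at small times and 1/u at large ones make u^(-1-a) integrable with one
  majorant for all \<open>a\<close> up to \<open>e - d\<close>.\<close>

lemma power_majorant_bound:
  fixes g :: "real \<Rightarrow> real"
  assumes u: "0 < u" and K: "0 \<le> K" and e: "0 < e" and a: "0 \<le> a" "a \<le> e - d"
    and g: "u \<le> 1 \<Longrightarrow> \<bar>g u\<bar> \<le> K * u powr e" "1 < u \<Longrightarrow> \<bar>g u\<bar> \<le> K / u"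
  shows "u powr (- 1 - a) * \<bar>g u\<bar> \<le> K * power_majorant d u"
proof (cases "u \<le> 1")
  case True
  have "u powr (- 1 - a) * \<bar>g u\<bar> \<le> u powr (- 1 - a) * (K * u powr e)" using g(1)[OF True] by (intro mult_left_mono) auto
  also have "\<dots> = K * u powr (e - a - 1)" using u by (simp add: powr_add[symmetric] algebra_simps)
  also have "\<dots> \<le> K * u powr (d - 1)" using True u K a by (intro mult_left_mono powr_mono') auto
  finally show ?thesis using True u by (simp add: power_majorant_def)
next
  case False
  have "u powr (- 1 - a) * \<bar>g u\<bar> \<le> u powr (- 1 - a) * (K / u)" using g(2) False by (intro mult_left_mono) auto
  also have "\<dots> \<le> u powr (- 1) * (K / u)" using False K a by (intro mult_right_mono powr_mono) auto
  also have "\<dots> = K * u powr (- 2)" using u by (simp add: powr_minus powr_numeral power2_eq_square field_simps)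
  finally show ?thesis using False by (simp add: power_majorant_def)
qed

text \<open>Right limits take the form used in \<open>integral_dominated_convergence_at\<close>,
  with the parameter confined to an interval on which a majorant is available.\<close>

lemma at_right_0_eq: "0 < b \<Longrightarrow> at_right (0::real) = at 0 within {0<..<b}"
  by (rule at_within_nhd[of _ "{..<b}"]) auto

text \<open>The pole is the integral of kappa u^(-1-a) over u > 1. After this is subtracted,
  \<open>Q\<close> is O(sqrt u) at 0 and O(1/u) at infinity, so the rest converges uniformly for a <
  1/4, which leaves u^(1/4) to spare at 0.\<close>

lemma mellin_expansion:
  assumes [measurable]: "Q \<in> borel_measurable borel" and K: "0 \<le> K"
    and Q: "\<And>u. 0 < u \<Longrightarrow> u \<le> 1 \<Longrightarrow> \<bar>Q u\<bar> \<le> K * sqrt u" "\<And>u. 1 \<le> u \<Longrightarrow> \<bar>Q u - \<kappa>\<bar> \<le> K / u"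
  obtains \<Lambda> \<Lambda>\<^sub>0 where "(\<Lambda> \<longlongrightarrow> \<Lambda>\<^sub>0) (at_right 0)"
    "\<And>a. 0 < a \<Longrightarrow> a < 1/4 \<Longrightarrow> has_bochner_integral lborel (\<lambda>u. indicator {0<..} u * (u powr (- 1 - a) * Q u)) (\<kappa> / a + \<Lambda> a)"
proof -
  define D where "D = (\<lambda>u. Q u - \<kappa> * indicator {1<..} u)"
  define f where "f = (\<lambda>a u. indicator {0<..} u * (u powr (- 1 - a) * D u))"
  have [measurable]: "D \<in> borel_measurable borel" unfolding D_def by measurable
  have [measurable]: "f a \<in> borel_measurable borel" for a unfolding f_def by measurable
  have bound: "\<bar>f a u\<bar> \<le> K * power_majorant (1/4) u" if "0 \<le> a" "a < 1/4" for a u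
  proof (cases "0 < u")
    case True
    have "u powr (- 1 - a) * \<bar>D u\<bar> \<le> K * power_majorant (1/4) u"
      by (rule power_majorant_bound[of u K "1/2"]) (use True K that Q in \<open>auto simp: D_def powr_half_sqrt\<close>)
    then show ?thesis using True by (simp add: f_def abs_mult)
  qed (use K power_majorant_nonneg in \<open>simp add: f_def\<close>)
  have int: "integrable lborel (\<lambda>u. K * power_majorant (1/4) u)"
    by (intro integrable_mult_right integrable_power_majorant) simp
  define \<Lambda> where "\<Lambda> = (\<lambda>a. \<integral>u. f a u \<partial>lborel)"
  show ?thesis
  proof
    have "((\<lambda>a. \<integral>u. f a u \<partial>lborel) \<longlongrightarrow> (\<integral>u. f 0 u \<partial>lborel)) (at 0 within {0<..<1/4})"
    proof (rule integral_dominated_convergence_at(1)[where w = "\<lambda>u. K * power_majorant (1/4) u"])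
      show "AE u in lborel. ((\<lambda>a. f a u) \<longlongrightarrow> f 0 u) (at 0 within {0<..<1/4})"
        unfolding f_def by (intro AE_I2) (auto intro!: tendsto_eq_intros simp: indicator_def)
      show "AE u in lborel. norm (f a u) \<le> K * power_majorant (1/4) u" if "a \<in> {0<..<1/4} - {0}" for a
        using bound[of a] that by (intro AE_I2) auto
    qed (use int in auto)
    then show "(\<Lambda> \<longlongrightarrow> (\<integral>u. f 0 u \<partial>lborel)) (at_right 0)" by (simp add: \<Lambda>_def at_right_0_eq[of "1/4"])
    fix a :: real assume a: "0 < a" "a < 1/4"
    have "integrable lborel (f a)"
      by (rule Bochner_Integration.integrable_bound[OF int]) (use bound[of a] a K power_majorant_nonneg in auto)
    then have 1: "has_bochner_integral lborel (f a) (\<Lambda> a)" by (simp add: has_bochner_integral_iff \<Lambda>_def)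
    have 2: "has_bochner_integral lborel (\<lambda>u. \<kappa> * (indicator {1<..} u * u powr (- 1 - a))) (\<kappa> * (1 / a))"
      using has_bochner_integral_mult_right[OF has_bochner_powr_at_infinity[OF a(1)], of \<kappa>] by simp
    have "(\<lambda>u. \<kappa> * (indicator {1<..} u * u powr (- 1 - a)) + f a u) = (\<lambda>u. indicator {0<..} u * (u powr (- 1 - a) * Q u))"
      by (auto simp: f_def D_def fun_eq_iff indicator_def algebra_simps)
    with has_bochner_integral_add[OF 2 1]
    show "has_bochner_integral lborel (\<lambda>u. indicator {0<..} u * (u powr (- 1 - a) * Q u)) (\<kappa> / a + \<Lambda> a)" by simp
  qed
qed

text \<open>The substitution u = t^2 y gives the integral of exp(-1/(4y))/y up to 1/t^2. Removing
  1/y on the part from 1 to 1/t^2, which contributes -2 ln t, leaves the absolutely integrable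
  function \<open>g\<close>, truncated at 1/t^2.\<close>

lemma incomplete_exponential_integral:
  obtains c :: real where "((\<lambda>t::real. (\<integral>u. indicator {0<..1} u * (1 / u * exp (- t\<^sup>2 / (4 * u))) \<partial>lborel) + 2 * ln t) \<longlongrightarrow> c) (at_right 0)"
    "\<And>t. 0 < t \<Longrightarrow> integrable lborel (\<lambda>u::real. indicator {0<..1} u * (1 / u * exp (- t\<^sup>2 / (4 * u))))"
proof -
  define g where "g = (\<lambda>y::real. indicator {0<..} y * (1 / y * (exp (- 1 / (4 * y)) - indicator {1..} y)))"
  define f where "f = (\<lambda>t y::real. indicator {..1 / t\<^sup>2} y * g y)"
  define w where "w = (\<lambda>y::real. 4 * power_majorant 1 y)"
  have inv: "1 / y * exp (- 1 / (4 * y)) \<le> 4" if "0 < y" for y :: real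
  proof -
    have "1 / (4 * y) * exp (- (1 / (4 * y))) \<le> 1"
    proof -
      have "1 / (4 * y) \<le> exp (1 / (4 * y))" using exp_ge_add_one_self[of "1 / (4 * y)"] by linarith
      then have "1 / (4 * y) * exp (- (1 / (4 * y))) \<le> exp (1 / (4 * y)) * exp (- (1 / (4 * y)))" by (rule mult_right_mono) simp
      also have "\<dots> = 1" by (simp flip: exp_add)
      finally show ?thesis .
    qed
    then show ?thesis by simp
  qed
  have wb: "\<bar>g y\<bar> \<le> w y" for y
  proof (cases "0 < y")
    case True
    show ?thesis
    proof (cases "y < 1")
      case lt: True
      then show ?thesis using True inv[OF True] by (simp add: g_def w_def power_majorant_def)
    next
      case False
      have "exp (- 1 / (4 * y)) - 1 \<le> 0" "- (1 / (4 * y)) \<le> exp (- 1 / (4 * y)) - 1"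
        using True exp_ge_add_one_self[of "- (1 / (4 * y))"] by auto
      then have "\<bar>exp (- 1 / (4 * y)) - 1\<bar> \<le> 1 / (4 * y)" by (simp add: abs_le_iff)
      then have "1 / y * \<bar>exp (- 1 / (4 * y)) - 1\<bar> \<le> 1 / y * (1 / (4 * y))" using True by (intro mult_left_mono) auto
      also have "\<dots> \<le> 4 * y powr (- 2)" using True by (simp add: powr_minus powr_numeral power2_eq_square divide_simps)
      finally have "\<bar>g y\<bar> \<le> 4 * y powr (- 2)" using False True by (simp add: g_def abs_mult)
      then show ?thesis using False by (cases "y = 1") (auto simp: w_def power_majorant_def)
    qed
  qed (simp add: g_def w_def power_majorant_nonneg)
  have [measurable]: "g \<in> borel_measurable borel" unfolding g_def by measurable
  have wi: "integrable lborel w" unfolding w_def by (intro integrable_mult_right integrable_power_majorant) simp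
  have fi: "integrable lborel (f t)" for t
    by (rule Bochner_Integration.integrable_bound[OF wi]) (use wb in \<open>auto simp: f_def indicator_def w_def power_majorant_nonneg intro!: AE_I2\<close>)
  have lim: "((\<lambda>t. \<integral>y. f t y \<partial>lborel) \<longlongrightarrow> (\<integral>y. g y \<partial>lborel)) (at 0 within {0<..<1})"
  proof (rule integral_dominated_convergence_at(1)[where w = w])
    show "AE y in lborel. ((\<lambda>t. f t y) \<longlongrightarrow> g y) (at 0 within {0<..<1})"
    proof (rule AE_I2)
      fix y :: real
      have "filterlim (\<lambda>t::real. 1 / t\<^sup>2) at_top (at_right 0)" by real_asymp
      then have "\<forall>\<^sub>F t in at_right 0. y \<le> 1 / t\<^sup>2" by (simp add: filterlim_at_top)
      then have "\<forall>\<^sub>F t in at_right 0. f t y = g y" by eventually_elim (simp add: f_def)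
      then show "((\<lambda>t. f t y) \<longlongrightarrow> g y) (at 0 within {0<..<1})"
        using at_right_0_eq[of 1] by (simp add: tendsto_eventually)
    qed
    show "AE y in lborel. norm (f t y) \<le> w y" for t
      using wb by (auto simp: f_def indicator_def w_def power_majorant_nonneg intro!: AE_I2)
  qed (use wi in \<open>auto simp: f_def\<close>)
  have main: "integrable lborel (\<lambda>u::real. indicator {0<..1} u * (1 / u * exp (- t\<^sup>2 / (4 * u)))) \<and>
     (\<integral>u. indicator {0<..1} u * (1 / u * exp (- t\<^sup>2 / (4 * u))) \<partial>lborel) + 2 * ln t = (\<integral>y. f t y \<partial>lborel)"
    if t: "0 < t" "t < 1" for t :: real
  proof -
    define T where "T = 1 / t\<^sup>2"
    have T: "1 < T" using t by (simp add: T_def power_less_one_iff)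
    have ln: "has_bochner_integral lborel (\<lambda>y. 1 / y * indicator {1..T} y) (ln T - ln 1)"
      by (rule has_bochner_integral_FTC_Icc_nonneg) (use T in \<open>auto intro!: derivative_eq_intros\<close>)
    have "has_bochner_integral lborel (f t) (\<integral>y. f t y \<partial>lborel)" using fi[of t] by (simp add: has_bochner_integral_iff)
    from has_bochner_integral_add[OF this ln]
    have A: "has_bochner_integral lborel (\<lambda>y. indicator {0<..T} y * (1 / y * exp (- 1 / (4 * y)))) ((\<integral>y. f t y \<partial>lborel) + ln T)"
    proof (rule has_bochner_integral_cong[OF refl _ _, THEN iffD1, rotated -1])
      show "f t y + 1 / y * indicator {1..T} y = indicator {0<..T} y * (1 / y * exp (- 1 / (4 * y)))" for y
        by (auto simp: f_def g_def T_def[symmetric] indicator_def algebra_simps)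
    qed simp
    have B: "has_bochner_integral lborel (\<lambda>u. indicator {0<..T} (u / t\<^sup>2) * (1 / (u / t\<^sup>2) * exp (- 1 / (4 * (u / t\<^sup>2))))) (((\<integral>y. f t y \<partial>lborel) + ln T) /\<^sub>R \<bar>1 / t\<^sup>2\<bar>)"
      using A t by (subst (asm) lborel_has_bochner_integral_real_affine_iff[where c = "1 / t\<^sup>2" and t = 0]) auto
    have C: "has_bochner_integral lborel (\<lambda>u. 1 / t\<^sup>2 * (indicator {0<..T} (u / t\<^sup>2) * (1 / (u / t\<^sup>2) * exp (- 1 / (4 * (u / t\<^sup>2)))))) ((\<integral>y. f t y \<partial>lborel) + ln T)"
      using has_bochner_integral_mult_right[OF B, of "1 / t\<^sup>2"] t by simp
    have D: "1 / t\<^sup>2 * (indicator {0<..T} (u / t\<^sup>2) * (1 / (u / t\<^sup>2) * exp (- 1 / (4 * (u / t\<^sup>2))))) = indicator {0<..1} u * (1 / u * exp (- t\<^sup>2 / (4 * u)))" for u :: real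
      using t by (auto simp: T_def indicator_def divide_simps zero_less_mult_iff mult_le_0_iff)
    from C have E: "has_bochner_integral lborel (\<lambda>u. indicator {0<..1} u * (1 / u * exp (- t\<^sup>2 / (4 * u)))) ((\<integral>y. f t y \<partial>lborel) + ln T)"
      unfolding D .
    have "ln T = - 2 * ln t" using t by (simp add: T_def ln_div ln_realpow)
    then show ?thesis using E by (simp add: has_bochner_integral_iff)
  qed
  show ?thesis
  proof
    have "\<forall>\<^sub>F t in at_right 0. (\<integral>y. f t y \<partial>lborel) = (\<integral>u. indicator {0<..1} u * (1 / u * exp (- t\<^sup>2 / (4 * u))) \<partial>lborel) + 2 * ln t"
      unfolding at_right_0_eq[OF zero_less_one] using main by (auto simp: eventually_at_filter)
    from Lim_transform_eventually[OF _ this] lim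
    show "((\<lambda>t. (\<integral>u. indicator {0<..1} u * (1 / u * exp (- t\<^sup>2 / (4 * u))) \<partial>lborel) + 2 * ln t) \<longlongrightarrow> (\<integral>y. g y \<partial>lborel)) (at_right 0)"
      by (simp add: at_right_0_eq[of 1])
    show "integrable lborel (\<lambda>u::real. indicator {0<..1} u * (1 / u * exp (- t\<^sup>2 / (4 * u))))" if t: "0 < t" for t
    proof -
      \<comment> \<open>The substitution argument is for \<open>t < 1\<close>; a larger
        \<open>t\<close> only makes the integrand smaller, so it is compared with the one at
        \<open>s\<close>.\<close>
      define s where "s = min t (1/2)"
      have s: "0 < s" "s < 1" "s\<^sup>2 \<le> t\<^sup>2" using t by (auto simp: s_def intro!: power_mono)
      show ?thesis
      proof (rule Bochner_Integration.integrable_bound[OF conjunct1[OF main[OF s(1,2)]]])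
        show "AE u in lborel. norm (indicator {0<..1} u * (1 / u * exp (- t\<^sup>2 / (4 * u)))) \<le> norm (indicator {0<..1} u * (1 / u * exp (- s\<^sup>2 / (4 * u))))"
        proof (rule AE_I2)
          fix u :: real
          show "norm (indicator {0<..1} u * (1 / u * exp (- t\<^sup>2 / (4 * u)))) \<le> norm (indicator {0<..1} u * (1 / u * exp (- s\<^sup>2 / (4 * u))))"
          proof (cases "u \<in> {0<..1}")
            case True
            then have u: "0 < u" by simp
            then have "s\<^sup>2 / (4 * u) \<le> t\<^sup>2 / (4 * u)" using s by (intro divide_right_mono) auto
            then have "1 / u * exp (- t\<^sup>2 / (4 * u)) \<le> 1 / u * exp (- s\<^sup>2 / (4 * u))" using u by (intro mult_left_mono) auto
            then show ?thesis using True by (simp add: abs_mult)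
          qed simp
        qed
      qed measurable
    qed
  qed
qed

text \<open>Mirror image of \<open>mellin_expansion\<close>: here the nonzero limit at u = 0 makes
  the integral of 1/u diverge, and exp(-t^2/(4u)) cuts it off near u = t^2, whence the logarithm.
  Away from this part the cut-off is removed by dominated convergence.\<close>

lemma poisson_expansion:
  assumes [measurable]: "q \<in> borel_measurable borel" and K: "0 \<le> K"
    and q: "\<And>u. 0 < u \<Longrightarrow> u \<le> 1 \<Longrightarrow> \<bar>q u - \<kappa>\<bar> \<le> K * sqrt u" "\<And>u. 1 \<le> u \<Longrightarrow> \<bar>q u\<bar> \<le> K / u"
  obtains \<eta> \<eta>\<^sub>0 where "(\<eta> \<longlongrightarrow> \<eta>\<^sub>0) (at_right 0)"
    "\<And>t. 0 < t \<Longrightarrow> has_bochner_integral lborel (\<lambda>u. indicator {0<..} u * (1 / u * exp (- t\<^sup>2 / (4 * u)) * q u)) (- 2 * \<kappa> * ln t + \<eta> t)"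
proof -
  obtain c :: real where c: "((\<lambda>t::real. (\<integral>u. indicator {0<..1} u * (1 / u * exp (- t\<^sup>2 / (4 * u))) \<partial>lborel) + 2 * ln t) \<longlongrightarrow> c) (at_right 0)"
    "\<And>t. 0 < t \<Longrightarrow> integrable lborel (\<lambda>u::real. indicator {0<..1} u * (1 / u * exp (- t\<^sup>2 / (4 * u))))"
    using incomplete_exponential_integral by blast
  define D where "D = (\<lambda>u. q u - \<kappa> * indicator {..1} u)"
  define f where "f = (\<lambda>t u. indicator {0<..} u * (1 / u * exp (- t\<^sup>2 / (4 * u)) * D u))"
  have [measurable]: "D \<in> borel_measurable borel" unfolding D_def by measurable
  have [measurable]: "f a \<in> borel_measurable borel" for a unfolding f_def by measurable
  have bound: "\<bar>f t u\<bar> \<le> K * power_majorant (1/2) u" for t u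
  proof (cases "0 < u")
    case True
    have "u powr (- 1 - 0) * \<bar>D u\<bar> \<le> K * power_majorant (1/2) u"
      by (rule power_majorant_bound[of u K "1/2"]) (use True K q in \<open>auto simp: D_def powr_half_sqrt\<close>)
    then have "1 / u * \<bar>D u\<bar> \<le> K * power_majorant (1/2) u" using True by (simp add: powr_minus inverse_eq_divide)
    moreover have "exp (- t\<^sup>2 / (4 * u)) * (1 / u * \<bar>D u\<bar>) \<le> 1 * (1 / u * \<bar>D u\<bar>)" using True by (intro mult_right_mono) auto
    ultimately have "exp (- t\<^sup>2 / (4 * u)) * (1 / u * \<bar>D u\<bar>) \<le> K * power_majorant (1/2) u" by linarith
    moreover have "\<bar>f t u\<bar> = exp (- t\<^sup>2 / (4 * u)) * (1 / u * \<bar>D u\<bar>)" using True by (simp add: f_def abs_mult mult_ac)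
    ultimately show ?thesis by simp
  qed (use K power_majorant_nonneg in \<open>simp add: f_def\<close>)
  have int: "integrable lborel (\<lambda>u. K * power_majorant (1/2) u)"
    by (intro integrable_mult_right integrable_power_majorant) simp
  have fi: "integrable lborel (f t)" for t
    by (rule Bochner_Integration.integrable_bound[OF int]) (use bound[of t] K power_majorant_nonneg in auto)
  define \<eta> where "\<eta> = (\<lambda>t. (\<integral>u. f t u \<partial>lborel) + \<kappa> * ((\<integral>u. indicator {0<..1} u * (1 / u * exp (- t\<^sup>2 / (4 * u))) \<partial>lborel) + 2 * ln t))"
  show ?thesis
  proof
    have "((\<lambda>t. \<integral>u. f t u \<partial>lborel) \<longlongrightarrow> (\<integral>u. f 0 u \<partial>lborel)) (at 0 within {0<..<1})"
    proof (rule integral_dominated_convergence_at(1)[where w = "\<lambda>u. K * power_majorant (1/2) u"])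
      show "AE u in lborel. ((\<lambda>t. f t u) \<longlongrightarrow> f 0 u) (at 0 within {0<..<1})"
      proof (rule AE_I2)
        fix u
        have "isCont (\<lambda>t. f t u) 0" unfolding f_def by (cases "u = 0") (auto intro!: continuous_intros)
        then show "((\<lambda>t. f t u) \<longlongrightarrow> f 0 u) (at 0 within {0<..<1})" unfolding isCont_def by (rule tendsto_within_subset) simp
      qed
    qed (use int bound in auto)
    then show "(\<eta> \<longlongrightarrow> (\<integral>u. f 0 u \<partial>lborel) + \<kappa> * c) (at_right 0)"
      unfolding \<eta>_def using c(1) by (intro tendsto_intros) (simp_all add: at_right_0_eq[of 1])
    fix t :: real assume t: "0 < t"
    have 1: "has_bochner_integral lborel (f t) (\<integral>u. f t u \<partial>lborel)" using fi by (simp add: has_bochner_integral_iff)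
    have 2: "has_bochner_integral lborel (\<lambda>u. \<kappa> * (indicator {0<..1} u * (1 / u * exp (- t\<^sup>2 / (4 * u))))) (\<kappa> * (\<integral>u. indicator {0<..1} u * (1 / u * exp (- t\<^sup>2 / (4 * u))) \<partial>lborel))"
      using c(2)[OF t] by (intro has_bochner_integral_mult_right) (simp add: has_bochner_integral_iff)
    have "(\<lambda>u. f t u + \<kappa> * (indicator {0<..1} u * (1 / u * exp (- t\<^sup>2 / (4 * u))))) = (\<lambda>u. indicator {0<..} u * (1 / u * exp (- t\<^sup>2 / (4 * u)) * q u))"
      by (auto simp: f_def D_def fun_eq_iff indicator_def algebra_simps add_divide_distrib diff_divide_distrib)
    with has_bochner_integral_add[OF 1 2]
    show "has_bochner_integral lborel (\<lambda>u. indicator {0<..} u * (1 / u * exp (- t\<^sup>2 / (4 * u)) * q u)) (- 2 * \<kappa> * ln t + \<eta> t)"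
      by (simp add: \<eta>_def algebra_simps)
  qed
qed

section \<open>Radial integrals of the kernels\<close>

definition hyp_heat_kernel :: "nat \<Rightarrow> (real \<Rightarrow> real) \<Rightarrow> real \<Rightarrow> real" where
  "hyp_heat_kernel n v \<rho> = (\<integral>u. indicator {0<..} u * (v u * heat_density n u \<rho>) \<partial>lborel)"

text \<open>\<open>heat_density\<close> contains the power u^(-1/2) that \<open>heat_mix\<close>
  keeps in its weight; hence the shift in the \<open>heat_weight\<close> condition.\<close>

definition mix_weight :: "(real \<Rightarrow> real) \<Rightarrow> bool" where
  "mix_weight v \<longleftrightarrow> v \<in> borel_measurable borel \<and> (\<forall>u>0. 0 \<le> v u) \<and> heat_weight (\<lambda>u. v u * u powr (- (1/2)))"

lemma mix_weight_powr_exp: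
  assumes "0 \<le> a"
  shows "mix_weight (\<lambda>u. u powr (- 1 - a) * exp (- b\<^sup>2 / (4 * u)))"
proof -
  have "heat_weight (\<lambda>u. u powr (- (3/2 + a)) * exp (- b\<^sup>2 / (4 * u)))" using assms by (intro heat_weight_powr) simp
  also have "(\<lambda>u. u powr (- (3/2 + a)) * exp (- b\<^sup>2 / (4 * u))) = (\<lambda>u. u powr (- 1 - a) * exp (- b\<^sup>2 / (4 * u)) * u powr (- (1/2)))"
    by (rule ext) (simp add: mult.assoc mult.left_commute powr_add[symmetric] mult.commute[of "exp _"])
  finally show ?thesis unfolding mix_weight_def by simp
qed

lemma heat_mix_conv_kernel:
  "heat_mix n (((real n - 1) / 2)\<^sup>2) (\<lambda>u. v u * u powr (- (1/2))) \<rho> = hyp_heat_kernel n v \<rho>"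
  unfolding heat_mix_def hyp_heat_kernel_def heat_density_def heat_normalizer_def by (simp add: mult_ac)

lemma hyp_heat_kernel_integrable:
  assumes n: "2 \<le> n" and v: "mix_weight v" and \<rho>: "0 < \<rho>"
  shows "integrable lborel (\<lambda>u. indicator {0<..} u * (v u * heat_density n u \<rho>))"
proof -
  have "integrable lborel (\<lambda>u. indicator {0<..} u * ((v u * u powr (- (1/2))) * exp (- (((real n - 1) / 2)\<^sup>2) * u) * heat_profile n (1 / (4 * u)) \<rho>))"
    using n v \<rho> by (intro heat_mix_integrable) (auto simp: mix_weight_def)
  then show ?thesis by (simp add: heat_density_def heat_normalizer_def mult_ac)
qed

lemma hyp_heat_kernel_nonneg:
  assumes "2 \<le> n" "mix_weight v" "0 \<le> \<rho>"
  shows "0 \<le> hyp_heat_kernel n v \<rho>"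
  unfolding hyp_heat_kernel_def using assms heat_density_nonneg
  by (intro integral_nonneg_AE AE_I2) (auto simp: mix_weight_def indicator_def)

lemma hyp_heat_kernel_nn:
  assumes n: "2 \<le> n" and v: "mix_weight v" and \<rho>: "0 < \<rho>"
  shows "ennreal (hyp_heat_kernel n v \<rho>) = (\<integral>\<^sup>+u. ennreal (indicator {0<..} u * (v u * heat_density n u \<rho>)) \<partial>lborel)"
  unfolding hyp_heat_kernel_def using hyp_heat_kernel_integrable[OF assms] heat_density_nonneg[OF n] v \<rho>
  by (intro nn_integral_eq_integral[symmetric]) (auto simp: mix_weight_def indicator_def)

lemma hyp_heat_kernel_measurable [measurable]:
  assumes "mix_weight v"
  shows "hyp_heat_kernel n v \<in> borel_measurable borel"
proof -
  have [measurable]: "v \<in> borel_measurable borel" using assms by (simp add: mix_weight_def)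
  show ?thesis
    unfolding hyp_heat_kernel_def[abs_def] by (rule lborel.borel_measurable_lebesgue_integral) measurable
qed

definition heat_average :: "nat \<Rightarrow> (real \<Rightarrow> real) \<Rightarrow> real \<Rightarrow> ennreal" where
  "heat_average n \<phi> u = (\<integral>\<^sup>+r. ennreal (heat_density n u r * sinh r ^ (n - 1) * \<phi> r) * indicator {0..} r \<partial>lborel)"

lemma heat_average_measurable [measurable]:
  assumes [measurable]: "\<phi> \<in> borel_measurable borel"
  shows "heat_average n \<phi> \<in> borel_measurable borel"
  unfolding heat_average_def[abs_def] by (rule lborel.borel_measurable_nn_integral) measurable

text \<open>Reduces every radial integral of a mixture to an integral over time, to which the
  preceding expansions apply. The proof is Tonelli.\<close>

lemma nn_integral_hyp_heat_kernel:
  fixes \<phi> :: "real \<Rightarrow> real"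
  assumes n: "2 \<le> CARD('n::finite)" and v: "mix_weight v" and [measurable]: "\<phi> \<in> borel_measurable borel" and \<phi>: "\<And>r. 0 \<le> \<phi> r"
  shows "(\<integral>\<^sup>+\<rho>. ennreal (\<phi> \<rho> * hyp_heat_kernel CARD('n) v \<rho>) \<partial>hyp_radial TYPE('n))
    = ennreal (sphere_area TYPE('n)) * (\<integral>\<^sup>+u. ennreal (v u) * indicator {0<..} u * heat_average CARD('n) \<phi> u \<partial>lborel)"
proof -
  let ?n = "CARD('n)" and ?\<omega> = "sphere_area TYPE('n)"
  note [measurable] = hyp_heat_kernel_measurable[OF v]
  have [measurable]: "v \<in> borel_measurable borel" using v by (simp add: mix_weight_def)
  have v0: "0 \<le> v u" if "0 < u" for u using v that by (simp add: mix_weight_def)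
  have \<omega>: "0 < ?\<omega>" by (rule sphere_area_pos)
  have "(\<integral>\<^sup>+\<rho>. ennreal (\<phi> \<rho> * hyp_heat_kernel ?n v \<rho>) \<partial>hyp_radial TYPE('n))
    = (\<integral>\<^sup>+\<rho>. ennreal (?\<omega> * sinh \<rho> ^ (?n - 1)) * indicator {0<..} \<rho> * ennreal (\<phi> \<rho> * hyp_heat_kernel ?n v \<rho>) \<partial>lborel)"
    unfolding hyp_radial_def by (rule nn_integral_density) measurable
  also have "\<dots> = (\<integral>\<^sup>+\<rho>. \<integral>\<^sup>+u. ennreal ?\<omega> * (ennreal (v u) * indicator {0<..} u * (ennreal (heat_density ?n u \<rho> * sinh \<rho> ^ (?n - 1) * \<phi> \<rho>) * indicator {0<..} \<rho>)) \<partial>lborel \<partial>lborel)"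
  proof (rule nn_integral_cong)
    fix \<rho> :: real
    show "ennreal (?\<omega> * sinh \<rho> ^ (?n - 1)) * indicator {0<..} \<rho> * ennreal (\<phi> \<rho> * hyp_heat_kernel ?n v \<rho>)
      = (\<integral>\<^sup>+u. ennreal ?\<omega> * (ennreal (v u) * indicator {0<..} u * (ennreal (heat_density ?n u \<rho> * sinh \<rho> ^ (?n - 1) * \<phi> \<rho>) * indicator {0<..} \<rho>)) \<partial>lborel)"
    proof (cases "0 < \<rho>")
      case True
      define A where "A = ?\<omega> * sinh \<rho> ^ (?n - 1) * \<phi> \<rho>"
      have A: "0 \<le> A" using \<omega> True \<phi> by (simp add: A_def)
      have "ennreal (?\<omega> * sinh \<rho> ^ (?n - 1)) * ennreal (\<phi> \<rho> * hyp_heat_kernel ?n v \<rho>) = ennreal A * ennreal (hyp_heat_kernel ?n v \<rho>)"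
        using \<omega> True \<phi>[of \<rho>] hyp_heat_kernel_nonneg[OF n v, of \<rho>] by (simp add: A_def mult_ac flip: ennreal_mult)
      also have "\<dots> = (\<integral>\<^sup>+u. ennreal A * ennreal (indicator {0<..} u * (v u * heat_density ?n u \<rho>)) \<partial>lborel)"
        unfolding hyp_heat_kernel_nn[OF n v True] by (rule nn_integral_cmult[symmetric]) measurable
      also have "\<dots> = (\<integral>\<^sup>+u. ennreal ?\<omega> * (ennreal (v u) * indicator {0<..} u * (ennreal (heat_density ?n u \<rho> * sinh \<rho> ^ (?n - 1) * \<phi> \<rho>) * indicator {0<..} \<rho>)) \<partial>lborel)"
      proof (rule nn_integral_cong)
        fix u :: real
        show "ennreal A * ennreal (indicator {0<..} u * (v u * heat_density ?n u \<rho>))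
          = ennreal ?\<omega> * (ennreal (v u) * indicator {0<..} u * (ennreal (heat_density ?n u \<rho> * sinh \<rho> ^ (?n - 1) * \<phi> \<rho>) * indicator {0<..} \<rho>))"
        proof (cases "0 < u")
          case u: True
          have h: "0 \<le> heat_density ?n u \<rho>" using u True n by (intro heat_density_nonneg) auto
          have "A * (v u * heat_density ?n u \<rho>) = ?\<omega> * (v u * (heat_density ?n u \<rho> * sinh \<rho> ^ (?n - 1) * \<phi> \<rho>))"
            unfolding A_def by (simp only: mult_ac)
          then show ?thesis using u True \<omega> v0[OF u] A
            by (simp only: ennreal_mult'[symmetric] less_imp_le indicator_simps greaterThan_iff mult_1 mult_1_right)
        qed simp
      qed
      finally show ?thesis using True by simp
    qed simp
  qed
  also have "\<dots> = (\<integral>\<^sup>+u. \<integral>\<^sup>+\<rho>. ennreal ?\<omega> * (ennreal (v u) * indicator {0<..} u * (ennreal (heat_density ?n u \<rho> * sinh \<rho> ^ (?n - 1) * \<phi> \<rho>) * indicator {0<..} \<rho>)) \<partial>lborel \<partial>lborel)"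
    by (rule lborel_pair.Fubini'[symmetric]) measurable
  also have "\<dots> = (\<integral>\<^sup>+u. ennreal ?\<omega> * (ennreal (v u) * indicator {0<..} u * heat_average ?n \<phi> u) \<partial>lborel)"
  proof (rule nn_integral_cong)
    fix u :: real
    have "(\<integral>\<^sup>+\<rho>. ennreal ?\<omega> * (ennreal (v u) * indicator {0<..} u * (ennreal (heat_density ?n u \<rho> * sinh \<rho> ^ (?n - 1) * \<phi> \<rho>) * indicator {0<..} \<rho>)) \<partial>lborel)
      = ennreal ?\<omega> * (ennreal (v u) * indicator {0<..} u * (\<integral>\<^sup>+\<rho>. ennreal (heat_density ?n u \<rho> * sinh \<rho> ^ (?n - 1) * \<phi> \<rho>) * indicator {0<..} \<rho> \<partial>lborel))"
      by (subst nn_integral_cmult, measurable) (subst nn_integral_cmult, measurable)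
    also have "(\<integral>\<^sup>+\<rho>. ennreal (heat_density ?n u \<rho> * sinh \<rho> ^ (?n - 1) * \<phi> \<rho>) * indicator {0<..} \<rho> \<partial>lborel) = heat_average ?n \<phi> u"
      unfolding heat_average_def by (intro nn_integral_cong_AE eventually_mono[OF AE_lborel_singleton[of 0]]) (auto simp: indicator_def)
    finally show "(\<integral>\<^sup>+\<rho>. ennreal ?\<omega> * (ennreal (v u) * indicator {0<..} u * (ennreal (heat_density ?n u \<rho> * sinh \<rho> ^ (?n - 1) * \<phi> \<rho>) * indicator {0<..} \<rho>)) \<partial>lborel)
      = ennreal ?\<omega> * (ennreal (v u) * indicator {0<..} u * heat_average ?n \<phi> u)" .
  qed
  also have "\<dots> = ennreal ?\<omega> * (\<integral>\<^sup>+u. ennreal (v u) * indicator {0<..} u * heat_average ?n \<phi> u \<partial>lborel)"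
    by (rule nn_integral_cmult) measurable
  finally show ?thesis .
qed

lemma heat_average_mono:
  assumes "2 \<le> n" "0 < u" "\<And>r. 0 \<le> r \<Longrightarrow> \<phi> r \<le> \<psi> r"
  shows "heat_average n \<phi> u \<le> heat_average n \<psi> u"
  unfolding heat_average_def
proof (rule nn_integral_mono)
  fix r :: real
  show "ennreal (heat_density n u r * sinh r ^ (n - 1) * \<phi> r) * indicator {0..} r \<le> ennreal (heat_density n u r * sinh r ^ (n - 1) * \<psi> r) * indicator {0..} r"
  proof (cases "0 \<le> r")
    case True
    then have "heat_density n u r * sinh r ^ (n - 1) * \<phi> r \<le> heat_density n u r * sinh r ^ (n - 1) * \<psi> r"
      using heat_density_nonneg[OF assms(1,2) True] by (intro mult_left_mono assms(3) mult_nonneg_nonneg) auto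
    then show ?thesis using True by (simp add: ennreal_leI)
  qed simp
qed

lemma heat_average_cmult:
  assumes [measurable]: "\<phi> \<in> borel_measurable borel" and c: "0 \<le> c"
  shows "heat_average n (\<lambda>r. c * \<phi> r) u = ennreal c * heat_average n \<phi> u"
proof -
  have "heat_average n (\<lambda>r. c * \<phi> r) u = (\<integral>\<^sup>+r. ennreal c * (ennreal (heat_density n u r * sinh r ^ (n - 1) * \<phi> r) * indicator {0..} r) \<partial>lborel)"
    unfolding heat_average_def
  proof (rule nn_integral_cong)
    fix r :: real
    have "heat_density n u r * sinh r ^ (n - 1) * (c * \<phi> r) = c * (heat_density n u r * sinh r ^ (n - 1) * \<phi> r)"
      by (simp only: mult_ac)
    then show "ennreal (heat_density n u r * sinh r ^ (n - 1) * (c * \<phi> r)) * indicator {0..} r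
      = ennreal c * (ennreal (heat_density n u r * sinh r ^ (n - 1) * \<phi> r) * indicator {0..} r)"
      by (simp only: ennreal_mult'[OF c] mult.assoc)
  qed
  also have "\<dots> = ennreal c * heat_average n \<phi> u" unfolding heat_average_def by (rule nn_integral_cmult) measurable
  finally show ?thesis .
qed

lemma heat_average_add:
  assumes n: "2 \<le> n" and u: "0 < u" and [measurable]: "\<phi> \<in> borel_measurable borel" "\<psi> \<in> borel_measurable borel"
    and nn: "\<And>r. 0 \<le> r \<Longrightarrow> 0 \<le> \<phi> r" "\<And>r. 0 \<le> r \<Longrightarrow> 0 \<le> \<psi> r"
  shows "heat_average n (\<lambda>r. \<phi> r + \<psi> r) u = heat_average n \<phi> u + heat_average n \<psi> u"
proof -
  have "heat_average n (\<lambda>r. \<phi> r + \<psi> r) u = (\<integral>\<^sup>+r. ennreal (heat_density n u r * sinh r ^ (n - 1) * \<phi> r) * indicator {0..} r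
      + ennreal (heat_density n u r * sinh r ^ (n - 1) * \<psi> r) * indicator {0..} r \<partial>lborel)"
    unfolding heat_average_def
    by (intro nn_integral_cong) (use nn heat_density_nonneg[OF n u] in \<open>auto simp: indicator_def distrib_left\<close>)
  then show ?thesis unfolding heat_average_def by (subst (asm) nn_integral_add) auto
qed

lemma sinh_ge_self: "0 \<le> x \<Longrightarrow> x \<le> sinh x" for x :: real
proof -
  assume x: "0 \<le> x"
  have "\<exists>y. ((\<lambda>x. sinh x - x) has_real_derivative y) (at z) \<and> 0 \<le> y" for z :: real
    by (rule exI[of _ "cosh z - 1"]) (auto intro!: derivative_eq_intros simp: cosh_real_ge_1)
  then have "sinh 0 - 0 \<le> sinh x - x" by (intro DERIV_nonneg_imp_nondecreasing[OF x]) blast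
  then show ?thesis by simp
qed

text \<open>Interpolates between the bounded total mass and the average of \<open>cosh r - 1 \<ge> r\<^sup>2 / 2\<close>, which
  is \<open>O(sqrt u)\<close>; the exponents are not sharp.\<close>

lemma heat_average_near:
  assumes n: "2 \<le> n" and b: "0 < b" "b \<le> 2"
  obtains K where "0 \<le> K" "\<And>u. 0 < u \<Longrightarrow> u \<le> 1 \<Longrightarrow> heat_average n (\<lambda>r. r powr b) u \<le> ennreal (K * u powr (b / 4))"
    "\<And>u. 0 < u \<Longrightarrow> u \<le> 1 \<Longrightarrow> heat_average n (indicator {1<..}) u \<le> ennreal (K * sqrt u)"
proof -
  obtain m :: "real \<Rightarrow> real" and \<kappa>0 \<kappa>1 K :: real where m: "0 < \<kappa>1" "0 \<le> K" "\<And>u. 0 < u \<Longrightarrow> 0 \<le> m u"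
    "\<And>u. 0 < u \<Longrightarrow> (\<integral>\<^sup>+r. ennreal (heat_density n u r * sinh r ^ (n - 1)) * indicator {0..} r \<partial>lborel) = ennreal (m u)"
    "\<And>u. 1 \<le> u \<Longrightarrow> \<bar>m u - \<kappa>1\<bar> \<le> K / u" "\<And>u. 0 < u \<Longrightarrow> u \<le> 1 \<Longrightarrow> \<bar>m u - \<kappa>0\<bar> \<le> K * sqrt u"
    by (rule heat_density_total_mass[OF n]) (rule that, assumption+)
  obtain V where V: "0 \<le> V" "\<And>u. 0 < u \<Longrightarrow> u \<le> 1 \<Longrightarrow>
    (\<integral>\<^sup>+r. ennreal (heat_density n u r * sinh r ^ (n - 1) * (cosh r - 1)) * indicator {0..} r \<partial>lborel) \<le> ennreal (V * sqrt u)"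
    by (rule heat_density_versine_moment[OF n]) (rule that, assumption+)
  have H1: "heat_average n (\<lambda>r. 1) u = ennreal (m u)" if "0 < u" for u
    using m(4)[OF that] by (simp add: heat_average_def)
  have HV: "heat_average n (\<lambda>r. cosh r - 1) u \<le> ennreal (V * sqrt u)" if "0 < u" "u \<le> 1" for u
    using V(2)[OF that] by (simp add: heat_average_def)
  have sq: "r\<^sup>2 \<le> 2 * (cosh r - 1)" if "0 \<le> r" for r :: real
  proof -
    have "r / 2 \<le> sinh (r / 2)" using that by (intro sinh_ge_self) simp
    then have "(r / 2)\<^sup>2 \<le> (sinh (r / 2))\<^sup>2" using that by (intro power_mono) auto
    then show ?thesis using versine_half[of r] by (simp add: power_divide)
  qed
  define c1 where "c1 = 1 / (cosh 1 - 1 :: real)"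
  have cosh1: "(1::real) < cosh 1" using cosh_real_nonneg_less_iff[of 0 1] by simp
  define B where "B = max (\<bar>\<kappa>0\<bar> + K + 2 * V) (c1 * V)"
  show ?thesis
  proof (rule that[of B])
    show "0 \<le> B" unfolding B_def using m(2) V(1) by simp
    fix u :: real assume u: "0 < u" "u \<le> 1"
    have su: "0 < sqrt u" "sqrt u \<le> 1" using u by auto
    have "r powr b \<le> u powr (b / 4) * (1 + 2 / sqrt u * (cosh r - 1))" if r: "0 \<le> r" for r
    proof -
      \<comment> \<open>Then r^b = y^(b/2) u^(b/4), and y^(b/2) is at most 1 + y because b <= 2. The
        scale sqrt u is the one at which the average of cosh r - 1, divided by it, stays
        bounded.\<close>
      define y where "y = r\<^sup>2 / sqrt u"
      have y: "0 \<le> y" using su by (simp add: y_def)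
      have "r powr b = (y * sqrt u) powr (b / 2)"
        using r u by (simp add: y_def powr_powr flip: powr_numeral)
      also have "\<dots> = y powr (b / 2) * u powr (b / 4)" using y u by (simp add: powr_mult powr_powr flip: powr_half_sqrt)
      also have "y powr (b / 2) \<le> 1 + y"
      proof (cases "y \<le> 1")
        case True
        then have "y powr (b / 2) \<le> 1" using y b by (intro powr_le1) auto
        then show ?thesis using y by linarith
      next
        case False
        then have "y powr (b / 2) \<le> y powr 1" using b by (intro powr_mono) auto
        then show ?thesis using y by simp
      qed
      also have "1 + y \<le> 1 + 2 / sqrt u * (cosh r - 1)" using sq[OF r] su by (simp add: y_def divide_right_mono)
      finally show ?thesis by (simp add: mult_right_mono mult.commute)
    qed
    then have "heat_average n (\<lambda>r. r powr b) u \<le> heat_average n (\<lambda>r. u powr (b / 4) * (1 + 2 / sqrt u * (cosh r - 1))) u"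
      by (rule heat_average_mono[OF n u(1)])
    also have "\<dots> = ennreal (u powr (b / 4)) * heat_average n (\<lambda>r. 1 + 2 / sqrt u * (cosh r - 1)) u"
      by (rule heat_average_cmult) auto
    also have "heat_average n (\<lambda>r. 1 + 2 / sqrt u * (cosh r - 1)) u = heat_average n (\<lambda>r. 1) u + heat_average n (\<lambda>r. 2 / sqrt u * (cosh r - 1)) u"
      using versine_nonneg su by (intro heat_average_add n u(1)) (auto intro!: mult_nonneg_nonneg)
    also have "heat_average n (\<lambda>r. 2 / sqrt u * (cosh r - 1)) u = ennreal (2 / sqrt u) * heat_average n (\<lambda>r. cosh r - 1) u"
      using su by (intro heat_average_cmult) auto
    also have "ennreal (u powr (b / 4)) * (heat_average n (\<lambda>r. 1) u + ennreal (2 / sqrt u) * heat_average n (\<lambda>r. cosh r - 1) u)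
      \<le> ennreal (u powr (b / 4)) * (ennreal (\<bar>\<kappa>0\<bar> + K) + ennreal (2 / sqrt u) * ennreal (V * sqrt u))"
    proof (intro mult_left_mono add_mono HV u zero_le)
      have "m u \<le> \<bar>\<kappa>0\<bar> + K * sqrt u" using m(6)[OF u] by linarith
      also have "\<dots> \<le> \<bar>\<kappa>0\<bar> + K * 1" using su m(2) by (intro add_left_mono mult_left_mono) auto
      finally show "heat_average n (\<lambda>r. 1) u \<le> ennreal (\<bar>\<kappa>0\<bar> + K)" unfolding H1[OF u(1)] by (intro ennreal_leI) simp
    qed
    also have "\<dots> = ennreal (u powr (b / 4) * (\<bar>\<kappa>0\<bar> + K + 2 * V))"
    proof -
      have "ennreal (2 / sqrt u) * ennreal (V * sqrt u) = ennreal (2 * V)" using su V(1) by (simp flip: ennreal_mult)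
      then show ?thesis using m(2) V(1) by (simp flip: ennreal_plus ennreal_mult)
    qed
    also have "\<dots> \<le> ennreal (B * u powr (b / 4))"
      unfolding B_def by (intro ennreal_leI) (simp add: mult.commute mult_left_mono)
    finally show "heat_average n (\<lambda>r. r powr b) u \<le> ennreal (B * u powr (b / 4))" .
    have "(indicator {1<..} r :: real) \<le> c1 * (cosh r - 1)" if "0 \<le> r" for r
    proof (cases "1 < r")
      case True
      then have "cosh 1 \<le> cosh r" using cosh_real_nonneg_le_iff[of 1 r] by simp
      then show ?thesis using True cosh1 by (simp add: c1_def)
    qed (use cosh1 versine_nonneg[of r] in \<open>simp add: c1_def\<close>)
    then have "heat_average n (indicator {1<..}) u \<le> heat_average n (\<lambda>r. c1 * (cosh r - 1)) u"
      by (rule heat_average_mono[OF n u(1)])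
    also have "\<dots> = ennreal c1 * heat_average n (\<lambda>r. cosh r - 1) u"
      using cosh1 by (intro heat_average_cmult) (auto simp: c1_def)
    also have "\<dots> \<le> ennreal c1 * ennreal (V * sqrt u)" by (intro mult_left_mono HV u) simp
    also have "\<dots> = ennreal (c1 * V * sqrt u)" using cosh1 V(1) su by (simp add: c1_def mult.assoc flip: ennreal_mult)
    also have "\<dots> \<le> ennreal (B * sqrt u)" unfolding B_def using su by (intro ennreal_leI mult_right_mono) auto
    finally show "heat_average n (indicator {1<..}) u \<le> ennreal (B * sqrt u)" .
  qed
qed

text \<open>On a bounded ball the profile is bounded for u >= 1, while the normalizer decays like
  exp(-c^2 u) with c > 0; only 1/u is retained.\<close>

lemma heat_average_ball:
  assumes n: "2 \<le> n" and R: "0 \<le> R"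
  obtains K where "0 \<le> K" "\<And>u. 1 \<le> u \<Longrightarrow> heat_average n (indicator {..R}) u \<le> ennreal (K / u)"
proof -
  let ?c = "(real n - 1) / 2"
  have c: "0 < ?c" using n by simp
  obtain C k where C: "0 \<le> C" "\<And>l \<rho>. 0 \<le> l \<Longrightarrow> 0 \<le> \<rho> \<Longrightarrow> heat_profile n l \<rho> \<le> C * (1 + l) ^ k * exp (- l * \<rho>\<^sup>2)"
    using heat_profile_bound[OF n] by blast
  define K where "K = 1 / ?c\<^sup>2 * (C * 2 ^ k) * sinh R ^ (n - 1) * R"
  have K: "0 \<le> K" using C(1) R c by (simp add: K_def)
  show ?thesis
  proof (rule that[OF K])
    fix u :: real assume u1: "1 \<le> u"
    then have u: "0 < u" by simp
    define D where "D = 1 / ?c\<^sup>2 / u * (C * 2 ^ k) * sinh R ^ (n - 1)"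
    have D: "0 \<le> D" using C(1) R c u by (simp add: D_def)
    have le: "heat_density n u r * sinh r ^ (n - 1) \<le> D" if r: "0 \<le> r" "r \<le> R" for r
    proof -
      have "u powr (- (1/2)) \<le> u powr 0" using u1 by (intro powr_mono) auto
      then have "heat_normalizer ?c u \<le> 1 * exp (- ?c\<^sup>2 * u)" using u unfolding heat_normalizer_def by (intro mult_right_mono) auto
      also have "\<dots> \<le> 1 / ?c\<^sup>2 / u" using exp_minus_le_inverse[of "?c\<^sup>2" u] c u by simp
      finally have 1: "heat_normalizer ?c u \<le> 1 / ?c\<^sup>2 / u" .
      have "heat_profile n (1 / (4 * u)) r \<le> C * (1 + 1 / (4 * u)) ^ k * exp (- (1 / (4 * u)) * r\<^sup>2)"
        using u r by (intro C(2)) auto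
      also have "\<dots> \<le> C * 2 ^ k * 1"
        using u u1 C(1) by (intro mult_mono mult_left_mono power_mono) (auto simp: divide_le_eq)
      finally have 2: "heat_profile n (1 / (4 * u)) r \<le> C * 2 ^ k" by simp
      have 3: "sinh r ^ (n - 1) \<le> sinh R ^ (n - 1)" using r by (intro power_mono) auto
      have "0 \<le> 1 / ?c\<^sup>2 / u" using u by simp
      then have "heat_normalizer ?c u * heat_profile n (1 / (4 * u)) r * sinh r ^ (n - 1) \<le> 1 / ?c\<^sup>2 / u * (C * 2 ^ k) * sinh R ^ (n - 1)"
        using 1 2 3 heat_normalizer_nonneg[of ?c u] heat_profile_nonneg[of n "1 / (4 * u)" r] n r u C(1)
        by (intro mult_mono mult_nonneg_nonneg) auto
      then show ?thesis by (simp add: heat_density_def D_def)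
    qed
    have "heat_average n (indicator {..R}) u \<le> (\<integral>\<^sup>+r. ennreal D * indicator {0..R} r \<partial>lborel)"
      unfolding heat_average_def using le by (intro nn_integral_mono) (auto simp: indicator_def intro!: ennreal_leI)
    also have "\<dots> = ennreal D * ennreal R" using R by (subst nn_integral_cmult_indicator) auto
    also have "\<dots> = ennreal (K / u)" using D R by (simp add: D_def K_def mult_ac flip: ennreal_mult)
    finally show "heat_average n (indicator {..R}) u \<le> ennreal (K / u)" .
  qed
qed

text \<open>The fractional kernel corresponds to a = s p / 2. The value a = 0 is the common limit of
  the fractional profiles as a -> 0 and of the Poisson profiles as t -> 0.\<close>

definition frac_profile :: "nat \<Rightarrow> real \<Rightarrow> real \<Rightarrow> real" where
  "frac_profile n a = hyp_heat_kernel n (\<lambda>u. u powr (- 1 - a))"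

definition poisson_profile :: "nat \<Rightarrow> real \<Rightarrow> real \<Rightarrow> real" where
  "poisson_profile n t = hyp_heat_kernel n (\<lambda>u. u powr (- 1) * exp (- t\<^sup>2 / (4 * u)))"

lemma mix_weight_powr: "0 \<le> a \<Longrightarrow> mix_weight (\<lambda>u. u powr (- 1 - a))"
  using mix_weight_powr_exp[of a 0] by simp

lemma mix_weight_poisson: "mix_weight (\<lambda>u. u powr (- 1) * exp (- t\<^sup>2 / (4 * u)))"
  using mix_weight_powr_exp[of 0 t] by simp

lemma frac_profile_measurable: "0 \<le> a \<Longrightarrow> frac_profile n a \<in> borel_measurable borel"
  unfolding frac_profile_def by (intro hyp_heat_kernel_measurable mix_weight_powr)

lemma poisson_profile_measurable [measurable]: "poisson_profile n t \<in> borel_measurable borel"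
  unfolding poisson_profile_def by (intro hyp_heat_kernel_measurable mix_weight_poisson)

lemma frac_profile_nonneg: "2 \<le> n \<Longrightarrow> 0 \<le> a \<Longrightarrow> 0 \<le> \<rho> \<Longrightarrow> 0 \<le> frac_profile n a \<rho>"
  unfolding frac_profile_def by (intro hyp_heat_kernel_nonneg mix_weight_powr)

lemma poisson_profile_nonneg: "2 \<le> n \<Longrightarrow> 0 \<le> \<rho> \<Longrightarrow> 0 \<le> poisson_profile n t \<rho>"
  unfolding poisson_profile_def by (intro hyp_heat_kernel_nonneg mix_weight_poisson)

lemma hyp_heat_kernel_mono:
  assumes "2 \<le> n" "mix_weight v" "mix_weight w" "0 < \<rho>" "\<And>u. 0 < u \<Longrightarrow> v u \<le> w u"
  shows "hyp_heat_kernel n v \<rho> \<le> hyp_heat_kernel n w \<rho>"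
  unfolding hyp_heat_kernel_def using assms heat_density_nonneg[of n]
  by (intro integral_mono hyp_heat_kernel_integrable) (auto simp: indicator_def intro!: mult_right_mono)

text \<open>The weight u^(-1-a) is at most u^(-1-a0) for u <= 1 and at most 1/u for u > 1. The sum
  of the two profiles is a majorant uniform in \<open>a\<close>.\<close>

lemma frac_profile_le:
  assumes n: "2 \<le> n" and a: "0 \<le> a" "a \<le> a0" and \<rho>: "0 < \<rho>"
  shows "frac_profile n a \<rho> \<le> frac_profile n a0 \<rho> + frac_profile n 0 \<rho>"
proof -
  have i: "integrable lborel (\<lambda>u. indicator {0<..} u * (u powr (- 1 - a) * heat_density n u \<rho>))" if "0 \<le> a" for a
    using that by (intro hyp_heat_kernel_integrable n mix_weight_powr \<rho>)
  have "frac_profile n a \<rho> \<le> (\<integral>u. indicator {0<..} u * (u powr (- 1 - a0) * heat_density n u \<rho>) + indicator {0<..} u * (u powr (- 1 - 0) * heat_density n u \<rho>) \<partial>lborel)"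
    unfolding frac_profile_def hyp_heat_kernel_def
  proof (intro integral_mono Bochner_Integration.integrable_add i)
    fix u :: real
    show "indicator {0<..} u * (u powr (- 1 - a) * heat_density n u \<rho>) \<le> indicator {0<..} u * (u powr (- 1 - a0) * heat_density n u \<rho>) + indicator {0<..} u * (u powr (- 1 - 0) * heat_density n u \<rho>)"
    proof (cases "0 < u")
      case True
      have "u powr (- 1 - a) \<le> u powr (- 1 - a0) + u powr (- 1 - 0)"
      proof (cases "u \<le> 1")
        case u1: True
        have "u powr (- 1 - a) \<le> u powr (- 1 - a0)" using True u1 a by (intro powr_mono') auto
        then show ?thesis by (simp add: add_increasing2)
      next
        case False
        have "u powr (- 1 - a) \<le> u powr (- 1 - 0)" using False a by (intro powr_mono) auto
        then show ?thesis by (simp add: add_increasing)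
      qed
      from mult_right_mono[OF this heat_density_nonneg[OF n True, of \<rho>]] show ?thesis
        using True \<rho> by (simp add: distrib_right)
    qed simp
  qed (use a in auto)
  also have "\<dots> = frac_profile n a0 \<rho> + frac_profile n 0 \<rho>"
    unfolding frac_profile_def hyp_heat_kernel_def using a by (intro Bochner_Integration.integral_add i) auto
  finally show ?thesis .
qed

lemma poisson_profile_le:
  assumes "2 \<le> n" "0 < \<rho>"
  shows "poisson_profile n t \<rho> \<le> frac_profile n 0 \<rho>"
  unfolding poisson_profile_def frac_profile_def using assms
  by (intro hyp_heat_kernel_mono mix_weight_poisson mix_weight_powr) (auto intro!: divide_right_mono)

lemma frac_profile_tendsto:
  assumes n: "2 \<le> n" and \<rho>: "0 < \<rho>"
  shows "((\<lambda>a. frac_profile n a \<rho>) \<longlongrightarrow> frac_profile n 0 \<rho>) (at_right 0)"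
proof -
  define f where "f = (\<lambda>a u. indicator {0<..} u * (u powr (- 1 - a) * heat_density n u \<rho>))"
  have i: "integrable lborel (f a)" if "0 \<le> a" for a
    unfolding f_def using that by (intro hyp_heat_kernel_integrable n mix_weight_powr \<rho>)
  have "((\<lambda>a. \<integral>u. f a u \<partial>lborel) \<longlongrightarrow> (\<integral>u. f 0 u \<partial>lborel)) (at 0 within {0<..<1})"
  proof (rule integral_dominated_convergence_at(1)[where w = "\<lambda>u. f 1 u + f 0 u"])
    show "AE u in lborel. ((\<lambda>a. f a u) \<longlongrightarrow> f 0 u) (at 0 within {0<..<1})"
      unfolding f_def by (intro AE_I2) (auto intro!: tendsto_eq_intros simp: indicator_def)
    show "AE u in lborel. norm (f a u) \<le> f 1 u + f 0 u" if a: "a \<in> {0<..<1} - {0}" for a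
    proof (rule AE_I2)
      fix u :: real
      show "norm (f a u) \<le> f 1 u + f 0 u"
      proof (cases "0 < u")
        case True
        have "u powr (- 1 - a) \<le> u powr (- 1 - 1) + u powr (- 1 - 0)"
        proof (cases "u \<le> 1")
          case u1: True
          have "u powr (- 1 - a) \<le> u powr (- 1 - 1)" using True u1 a by (intro powr_mono') auto
          then show ?thesis by (simp add: add_increasing2)
        next
          case False
          have "u powr (- 1 - a) \<le> u powr (- 1 - 0)" using False a by (intro powr_mono) auto
          then show ?thesis by (simp add: add_increasing)
        qed
        from mult_right_mono[OF this heat_density_nonneg[OF n True, of \<rho>]] show ?thesis
          using True \<rho> heat_density_nonneg[OF n True, of \<rho>] by (simp add: f_def distrib_right abs_mult)
      qed (simp add: f_def)
    qed
  qed (use i in auto)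
  then show ?thesis by (simp add: frac_profile_def hyp_heat_kernel_def f_def at_right_0_eq[of 1])
qed

lemma poisson_profile_tendsto:
  assumes n: "2 \<le> n" and \<rho>: "0 < \<rho>"
  shows "((\<lambda>t. poisson_profile n t \<rho>) \<longlongrightarrow> frac_profile n 0 \<rho>) (at_right 0)"
proof -
  define f where "f = (\<lambda>t u. indicator {0<..} u * (u powr (- 1) * exp (- t\<^sup>2 / (4 * u)) * heat_density n u \<rho>))"
  have i: "integrable lborel (f t)" for t
    unfolding f_def by (intro hyp_heat_kernel_integrable n mix_weight_poisson \<rho>)
  have "((\<lambda>t. \<integral>u. f t u \<partial>lborel) \<longlongrightarrow> (\<integral>u. f 0 u \<partial>lborel)) (at 0 within {0<..<1})"
  proof (rule integral_dominated_convergence_at(1)[where w = "f 0"])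
    show "AE u in lborel. ((\<lambda>t. f t u) \<longlongrightarrow> f 0 u) (at 0 within {0<..<1})"
    proof (rule AE_I2)
      fix u
      have "isCont (\<lambda>t. f t u) 0" unfolding f_def by (cases "u = 0") (auto intro!: continuous_intros)
      then show "((\<lambda>t. f t u) \<longlongrightarrow> f 0 u) (at 0 within {0<..<1})" unfolding isCont_def by (rule tendsto_within_subset) simp
    qed
    show "AE u in lborel. norm (f t u) \<le> f 0 u" for t
    proof (rule AE_I2)
      fix u :: real
      show "norm (f t u) \<le> f 0 u"
        using heat_density_nonneg[OF n, of u \<rho>] \<rho>
        by (cases "0 < u") (auto simp: f_def abs_mult intro!: divide_right_mono mult_left_le_one_le)
    qed
  qed (use i in auto)
  then show ?thesis by (simp add: poisson_profile_def frac_profile_def hyp_heat_kernel_def f_def at_right_0_eq[of 1])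
qed

lemma has_bochner_integral_hyp_heat_kernel:
  fixes \<phi> :: "real \<Rightarrow> real"
  assumes n: "2 \<le> CARD('n::finite)" and v: "mix_weight v" and [measurable]: "\<phi> \<in> borel_measurable borel" and \<phi>: "\<And>r. 0 \<le> \<phi> r"
    and avg: "\<And>u. 0 < u \<Longrightarrow> heat_average CARD('n) \<phi> u = ennreal (q u)" "\<And>u. 0 < u \<Longrightarrow> 0 \<le> q u"
    and q: "has_bochner_integral lborel (\<lambda>u. indicator {0<..} u * (v u * q u)) I"
  shows "has_bochner_integral (hyp_radial TYPE('n)) (\<lambda>\<rho>. \<phi> \<rho> * hyp_heat_kernel CARD('n) v \<rho>) (sphere_area TYPE('n) * I)"
proof (rule has_bochner_integral_nn_integral)
  have [measurable]: "hyp_heat_kernel CARD('n) v \<in> borel_measurable borel" by (rule hyp_heat_kernel_measurable[OF v])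
  show "(\<lambda>\<rho>. \<phi> \<rho> * hyp_heat_kernel CARD('n) v \<rho>) \<in> borel_measurable (hyp_radial TYPE('n))" by measurable
  have v0: "0 \<le> v u" if "0 < u" for u using v that by (simp add: mix_weight_def)
  have I: "I = (\<integral>u. indicator {0<..} u * (v u * q u) \<partial>lborel)" "integrable lborel (\<lambda>u. indicator {0<..} u * (v u * q u))"
    using q by (auto simp: has_bochner_integral_iff)
  have nn: "0 \<le> indicator {0<..} u * (v u * q u)" for u using v0 avg(2) by (auto simp: indicator_def)
  then have I0: "0 \<le> I" unfolding I(1) by (intro integral_nonneg_AE AE_I2)
  then show "0 \<le> sphere_area TYPE('n) * I" using sphere_area_pos[where 'n = 'n] by simp
  have "(\<integral>\<^sup>+\<rho>. ennreal (\<phi> \<rho> * hyp_heat_kernel CARD('n) v \<rho>) \<partial>hyp_radial TYPE('n))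
    = ennreal (sphere_area TYPE('n)) * (\<integral>\<^sup>+u. ennreal (v u) * indicator {0<..} u * heat_average CARD('n) \<phi> u \<partial>lborel)"
    by (rule nn_integral_hyp_heat_kernel[OF n v _ \<phi>]) measurable
  also have "(\<integral>\<^sup>+u. ennreal (v u) * indicator {0<..} u * heat_average CARD('n) \<phi> u \<partial>lborel) = (\<integral>\<^sup>+u. ennreal (indicator {0<..} u * (v u * q u)) \<partial>lborel)"
    using v0 avg by (intro nn_integral_cong) (auto simp: indicator_def ennreal_mult)
  also have "\<dots> = ennreal I" unfolding I(1) using I(2) nn by (intro nn_integral_eq_integral) auto
  finally show "(\<integral>\<^sup>+\<rho>. ennreal (\<phi> \<rho> * hyp_heat_kernel CARD('n) v \<rho>) \<partial>hyp_radial TYPE('n)) = ennreal (sphere_area TYPE('n) * I)"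
    using I0 sphere_area_pos[where 'n = 'n] by (simp add: ennreal_mult)
  have "AE \<rho> in hyp_radial TYPE('n). 0 < \<rho>"
    unfolding hyp_radial_def by (subst AE_density) (auto simp: indicator_def intro!: AE_I2)
  then show "AE \<rho> in hyp_radial TYPE('n). 0 \<le> \<phi> \<rho> * hyp_heat_kernel CARD('n) v \<rho>"
    by eventually_elim (use \<phi> hyp_heat_kernel_nonneg[OF n v] in auto)
qed

text \<open>\<open>Q\<close> and \<open>q\<close> are the masses outside and inside the unit ball,
  with sum \<open>m\<close>. For large times the inner mass is O(1/u), so \<open>Q\<close> inherits
  the limit \<open>k1\<close>; for small times the outer mass is O(sqrt u), so \<open>q\<close>
  inherits \<open>k0\<close>. The two expansions then apply.\<close>

lemma radial_kernel_integrals: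
  assumes n: "2 \<le> CARD('n::finite)"
  obtains \<kappa>\<^sub>1 \<kappa>\<^sub>0 \<Lambda> \<Lambda>\<^sub>0 \<eta> \<eta>\<^sub>0 where "0 < \<kappa>\<^sub>1" "(\<Lambda> \<longlongrightarrow> \<Lambda>\<^sub>0) (at_right 0)" "(\<eta> \<longlongrightarrow> \<eta>\<^sub>0) (at_right 0)"
    "\<And>a. 0 < a \<Longrightarrow> a < 1/4 \<Longrightarrow> has_bochner_integral (hyp_radial TYPE('n)) (\<lambda>\<rho>. indicator {1<..} \<rho> * frac_profile CARD('n) a \<rho>) (\<kappa>\<^sub>1 / a + \<Lambda> a)"
    "\<And>t. 0 < t \<Longrightarrow> has_bochner_integral (hyp_radial TYPE('n)) (\<lambda>\<rho>. indicator {..1} \<rho> * poisson_profile CARD('n) t \<rho>) (\<kappa>\<^sub>0 * ln t + \<eta> t)"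
proof -
  let ?n = "CARD('n)" and ?\<omega> = "sphere_area TYPE('n)"
  obtain m :: "real \<Rightarrow> real" and k0 k1 K :: real where m: "0 < k1" "0 \<le> K" "\<And>u. 0 < u \<Longrightarrow> 0 \<le> m u"
    "\<And>u. 0 < u \<Longrightarrow> (\<integral>\<^sup>+r. ennreal (heat_density ?n u r * sinh r ^ (?n - 1)) * indicator {0..} r \<partial>lborel) = ennreal (m u)"
    "\<And>u. 1 \<le> u \<Longrightarrow> \<bar>m u - k1\<bar> \<le> K / u" "\<And>u. 0 < u \<Longrightarrow> u \<le> 1 \<Longrightarrow> \<bar>m u - k0\<bar> \<le> K * sqrt u"
    by (rule heat_density_total_mass[OF n]) (rule that, assumption+)
  obtain A :: real where A: "0 \<le> A" "\<And>u. 0 < u \<Longrightarrow> u \<le> 1 \<Longrightarrow> heat_average ?n (indicator {1<..}) u \<le> ennreal (A * sqrt u)"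
    by (rule heat_average_near[OF n, of 1]) (simp, simp, rule that, assumption+)
  obtain B :: real where B: "0 \<le> B" "\<And>u. 1 \<le> u \<Longrightarrow> heat_average ?n (indicator {..1}) u \<le> ennreal (B / u)"
    by (rule heat_average_ball[OF n, of 1]) (simp, rule that, assumption+)
  define Q where "Q = (\<lambda>u. enn2real (heat_average ?n (indicator {1<..}) u))"
  define q where "q = (\<lambda>u. enn2real (heat_average ?n (indicator {..1}) u))"
  have [measurable]: "Q \<in> borel_measurable borel" "q \<in> borel_measurable borel" unfolding Q_def q_def by measurable
  have Qq0: "0 \<le> Q u" "0 \<le> q u" for u by (auto simp: Q_def q_def)
  have sum: "heat_average ?n (indicator {1<..}) u + heat_average ?n (indicator {..1}) u = ennreal (m u)" if "0 < u" for u
  proof -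
    have "heat_average ?n (\<lambda>r. indicator {1<..} r + indicator {..1} r) u = heat_average ?n (indicator {1<..}) u + heat_average ?n (indicator {..1}) u"
      by (rule heat_average_add[OF n that]) auto
    moreover have "(\<lambda>r::real. indicator {1<..} r + indicator {..1} r :: real) = (\<lambda>r. 1)" by (auto simp: indicator_def)
    ultimately show ?thesis using m(4)[OF that] by (simp add: heat_average_def)
  qed
  have fin: "heat_average ?n (indicator {1<..}) u < top" "heat_average ?n (indicator {..1}) u < top" if "0 < u" for u
  proof -
    have "heat_average ?n (indicator {1<..}) u + heat_average ?n (indicator {..1}) u < top" unfolding sum[OF that] by simp
    then show "heat_average ?n (indicator {1<..}) u < top" "heat_average ?n (indicator {..1}) u < top" by auto
  qed
  have Q: "heat_average ?n (indicator {1<..}) u = ennreal (Q u)" and q: "heat_average ?n (indicator {..1}) u = ennreal (q u)" if "0 < u" for u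
    using fin[OF that] by (auto simp: Q_def q_def)
  have Qm: "Q u + q u = m u" if "0 < u" for u
    using sum[OF that] Qq0 m(3)[OF that] unfolding Q[OF that] q[OF that] by (simp flip: ennreal_plus)
  have Q1: "Q u \<le> A * sqrt u" if "0 < u" "u \<le> 1" for u
    using A(2)[OF that] A(1) that unfolding Q[OF that(1)] by (subst (asm) ennreal_le_iff) auto
  have q1: "q u \<le> B / u" if "1 \<le> u" for u
    using B(2)[OF that] B(1) that q[of u] by (simp add: ennreal_le_iff)
  define C where "C = K + A + B"
  have C: "0 \<le> C" using m(2) A(1) B(1) by (simp add: C_def)
  have Cu: "C * sqrt u = K * sqrt u + A * sqrt u + B * sqrt u" "C / u = K / u + A / u + B / u" for u
    by (auto simp: C_def algebra_simps add_divide_distrib)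
  have pos: "0 \<le> K * sqrt u" "0 \<le> A * sqrt u" "0 \<le> B * sqrt u" "0 \<le> K / u" "0 \<le> A / u" "0 \<le> B / u" if "0 < u" for u
    using that m(2) A(1) B(1) by auto
  obtain \<Lambda> \<Lambda>\<^sub>0 where \<Lambda>: "(\<Lambda> \<longlongrightarrow> \<Lambda>\<^sub>0) (at_right 0)"
    "\<And>a. 0 < a \<Longrightarrow> a < 1/4 \<Longrightarrow> has_bochner_integral lborel (\<lambda>u. indicator {0<..} u * (u powr (- 1 - a) * Q u)) (k1 / a + \<Lambda> a)"
  proof (rule mellin_expansion[of Q C k1])
    show "\<bar>Q u\<bar> \<le> C * sqrt u" if "0 < u" "u \<le> 1" for u
      using Q1[OF that] Qq0(1)[of u] pos[OF that(1)] Cu(1)[of u] by linarith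
    show "\<bar>Q u - k1\<bar> \<le> C / u" if "1 \<le> u" for u
    proof -
      have u: "0 < u" using that by simp
      show ?thesis using Qm[OF u] m(5)[OF that] q1[OF that] Qq0(2)[of u] pos[OF u] Cu(2)[of u] by linarith
    qed
  qed (use C that in auto)
  obtain \<eta> \<eta>\<^sub>0 where \<eta>: "(\<eta> \<longlongrightarrow> \<eta>\<^sub>0) (at_right 0)"
    "\<And>t. 0 < t \<Longrightarrow> has_bochner_integral lborel (\<lambda>u. indicator {0<..} u * (1 / u * exp (- t\<^sup>2 / (4 * u)) * q u)) (- 2 * k0 * ln t + \<eta> t)"
  proof (rule poisson_expansion[of q C k0])
    show "\<bar>q u - k0\<bar> \<le> C * sqrt u" if "0 < u" "u \<le> 1" for u
      using Qm[OF that(1)] m(6)[OF that] Q1[OF that] Qq0(1)[of u] pos[OF that(1)] Cu(1)[of u] by linarith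
    show "\<bar>q u\<bar> \<le> C / u" if "1 \<le> u" for u
    proof -
      have u: "0 < u" using that by simp
      show ?thesis using q1[OF that] Qq0(2)[of u] pos[OF u] Cu(2)[of u] by linarith
    qed
  qed (use C that in auto)
  show ?thesis
  proof (rule that[of "?\<omega> * k1" "\<lambda>a. ?\<omega> * \<Lambda> a" "?\<omega> * \<Lambda>\<^sub>0" "\<lambda>t. ?\<omega> * \<eta> t" "?\<omega> * \<eta>\<^sub>0" "?\<omega> * (- 2 * k0)"])
    show "0 < ?\<omega> * k1" using m(1) sphere_area_pos[where 'n = 'n] by simp
    show "((\<lambda>a. ?\<omega> * \<Lambda> a) \<longlongrightarrow> ?\<omega> * \<Lambda>\<^sub>0) (at_right 0)" "((\<lambda>t. ?\<omega> * \<eta> t) \<longlongrightarrow> ?\<omega> * \<eta>\<^sub>0) (at_right 0)"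
      by (intro tendsto_mult_left \<Lambda> \<eta>)+
    show "has_bochner_integral (hyp_radial TYPE('n)) (\<lambda>\<rho>. indicator {1<..} \<rho> * frac_profile CARD('n) a \<rho>) (?\<omega> * k1 / a + ?\<omega> * \<Lambda> a)"
      if a: "0 < a" "a < 1/4" for a
    proof -
      have "has_bochner_integral (hyp_radial TYPE('n)) (\<lambda>\<rho>. indicator {1<..} \<rho> * frac_profile CARD('n) a \<rho>) (?\<omega> * (k1 / a + \<Lambda> a))"
        unfolding frac_profile_def using a
        by (intro has_bochner_integral_hyp_heat_kernel[OF n mix_weight_powr _ _ Q Qq0(1) \<Lambda>(2)]) auto
      then show ?thesis by (simp add: distrib_left)
    qed
    show "has_bochner_integral (hyp_radial TYPE('n)) (\<lambda>\<rho>. indicator {..1} \<rho> * poisson_profile CARD('n) t \<rho>) (?\<omega> * (- 2 * k0) * ln t + ?\<omega> * \<eta> t)"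
      if t: "0 < t" for t
    proof -
      have "has_bochner_integral lborel (\<lambda>u. indicator {0<..} u * (u powr (- 1) * exp (- t\<^sup>2 / (4 * u)) * q u)) (- 2 * k0 * ln t + \<eta> t)"
        using \<eta>(2)[OF t] by (rule has_bochner_integral_cong[OF refl _ refl, THEN iffD1, rotated]) (simp add: indicator_def powr_minus inverse_eq_divide)
      then have "has_bochner_integral (hyp_radial TYPE('n)) (\<lambda>\<rho>. indicator {..1} \<rho> * poisson_profile CARD('n) t \<rho>) (?\<omega> * (- 2 * k0 * ln t + \<eta> t))"
        unfolding poisson_profile_def
        by (intro has_bochner_integral_hyp_heat_kernel[OF n mix_weight_poisson _ _ q Qq0(2)]) auto
      then show ?thesis by (simp only: distrib_left mult.assoc)
    qed
  qed
qed

text \<open>The power rho^b has heat average O(u^(b/4)) at small times, which beats u^(-1-a) exactly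
  when a < b/4 and thus allows a = 0. The bounded range of the radius gives O(1/u) at large
  times.\<close>

lemma frac_profile_near_integrable:
  assumes n: "2 \<le> CARD('n::finite)" and b: "0 < b" "b \<le> 2" and a: "0 \<le> a" "a < b / 4" and R: "0 \<le> R"
  shows "integrable (hyp_radial TYPE('n)) (\<lambda>\<rho>. \<rho> powr b * indicator {..R} \<rho> * frac_profile CARD('n) a \<rho>)"
proof (rule integrableI_nonneg)
  let ?n = "CARD('n)"
  have v: "mix_weight (\<lambda>u. u powr (- 1 - a))" using a by (intro mix_weight_powr)
  have [measurable]: "frac_profile ?n a \<in> borel_measurable borel" using a by (intro frac_profile_measurable)
  show "(\<lambda>\<rho>. \<rho> powr b * indicator {..R} \<rho> * frac_profile ?n a \<rho>) \<in> borel_measurable (hyp_radial TYPE('n))" by measurable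
  have "AE \<rho> in hyp_radial TYPE('n). 0 < \<rho>"
    unfolding hyp_radial_def by (subst AE_density) (auto simp: indicator_def intro!: AE_I2)
  then show "AE \<rho> in hyp_radial TYPE('n). 0 \<le> \<rho> powr b * indicator {..R} \<rho> * frac_profile ?n a \<rho>"
    by eventually_elim (use frac_profile_nonneg[OF n a(1)] in auto)
  obtain A :: real where A: "0 \<le> A" "\<And>u. 0 < u \<Longrightarrow> u \<le> 1 \<Longrightarrow> heat_average ?n (\<lambda>r. r powr b) u \<le> ennreal (A * u powr (b / 4))"
    by (rule heat_average_near[OF n b]) (rule that, assumption+)
  obtain B :: real where B: "0 \<le> B" "\<And>u. 1 \<le> u \<Longrightarrow> heat_average ?n (indicator {..R}) u \<le> ennreal (B / u)"
    by (rule heat_average_ball[OF n R]) (rule that, assumption+)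
  define C where "C = max A (R powr b * B)"
  have C: "0 \<le> C" using A(1) by (simp add: C_def)
  let ?\<phi> = "\<lambda>r. r powr b * indicator {..R} r"
  have bound: "ennreal (u powr (- 1 - a)) * heat_average ?n ?\<phi> u \<le> ennreal (C * power_majorant (b / 4 - a) u)" if u: "0 < u" for u
  proof (cases "u \<le> 1")
    case True
    have "heat_average ?n ?\<phi> u \<le> heat_average ?n (\<lambda>r. r powr b) u"
      by (rule heat_average_mono[OF n u]) (auto simp: indicator_def)
    also have "\<dots> \<le> ennreal (A * u powr (b / 4))" by (rule A(2)[OF u True])
    also have "\<dots> \<le> ennreal (C * u powr (b / 4))" by (intro ennreal_leI mult_right_mono) (auto simp: C_def)
    finally have "ennreal (u powr (- 1 - a)) * heat_average ?n ?\<phi> u \<le> ennreal (u powr (- 1 - a)) * ennreal (C * u powr (b / 4))"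
      by (rule mult_left_mono) simp
    also have "\<dots> = ennreal (u powr (- 1 - a) * \<bar>C * u powr (b / 4)\<bar>)" using C by (simp add: ennreal_mult')
    also have "\<dots> \<le> ennreal (C * power_majorant (b / 4 - a) u)"
      using True u C a by (intro ennreal_leI power_majorant_bound[of u C "b / 4" a "b / 4 - a" "\<lambda>u. C * u powr (b / 4)"]) auto
    finally show ?thesis .
  next
    case False
    have "heat_average ?n ?\<phi> u \<le> heat_average ?n (\<lambda>r. R powr b * indicator {..R} r) u"
      by (rule heat_average_mono[OF n u]) (use b in \<open>auto simp: indicator_def intro!: powr_mono2\<close>)
    also have "\<dots> = ennreal (R powr b) * heat_average ?n (indicator {..R}) u" by (rule heat_average_cmult) auto
    also have "\<dots> \<le> ennreal (R powr b) * ennreal (B / u)" using False by (intro mult_left_mono B(2)) auto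
    also have "\<dots> = ennreal (R powr b * B / u)" by (simp add: ennreal_mult'[symmetric])
    also have "\<dots> \<le> ennreal (C / u)" using u by (intro ennreal_leI divide_right_mono) (auto simp: C_def)
    finally have "ennreal (u powr (- 1 - a)) * heat_average ?n ?\<phi> u \<le> ennreal (u powr (- 1 - a)) * ennreal (C / u)"
      by (rule mult_left_mono) simp
    also have "\<dots> = ennreal (u powr (- 1 - a) * \<bar>C / u\<bar>)" using C u by (simp add: ennreal_mult'[symmetric])
    also have "\<dots> \<le> ennreal (C * power_majorant (b / 4 - a) u)"
      using False u C a by (intro ennreal_leI power_majorant_bound[of u C "b / 4" a "b / 4 - a" "\<lambda>u. C / u"]) auto
    finally show ?thesis .
  qed
  have int: "integrable lborel (\<lambda>u. C * power_majorant (b / 4 - a) u)"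
    using a by (intro integrable_mult_right integrable_power_majorant) simp
  have "(\<integral>\<^sup>+\<rho>. ennreal (?\<phi> \<rho> * hyp_heat_kernel ?n (\<lambda>u. u powr (- 1 - a)) \<rho>) \<partial>hyp_radial TYPE('n))
    = ennreal (sphere_area TYPE('n)) * (\<integral>\<^sup>+u. ennreal (u powr (- 1 - a)) * indicator {0<..} u * heat_average ?n ?\<phi> u \<partial>lborel)"
    by (rule nn_integral_hyp_heat_kernel[OF n v]) auto
  also have "\<dots> \<le> ennreal (sphere_area TYPE('n)) * (\<integral>\<^sup>+u. ennreal (C * power_majorant (b / 4 - a) u) \<partial>lborel)"
    using bound by (intro mult_left_mono nn_integral_mono) (auto simp: indicator_def)
  also have "\<dots> = ennreal (sphere_area TYPE('n)) * ennreal (\<integral>u. C * power_majorant (b / 4 - a) u \<partial>lborel)"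
    using int C power_majorant_nonneg by (subst nn_integral_eq_integral) auto
  also have "\<dots> < \<infinity>" by (simp add: ennreal_mult_less_top)
  finally show "(\<integral>\<^sup>+\<rho>. ennreal (\<rho> powr b * indicator {..R} \<rho> * frac_profile ?n a \<rho>) \<partial>hyp_radial TYPE('n)) < \<infinity>"
    by (simp add: frac_profile_def)
qed

section \<open>The operators\<close>

text \<open>The function G of the overview: the constants of the kernel without the vanishing factor
  \<open>s\<close>. The base \<open>n - 1\<close> is the number 2 c of
  \<open>bessel_K_mixture\<close>.\<close>

definition frac_factor :: "nat \<Rightarrow> real \<Rightarrow> real \<Rightarrow> real" where
  "frac_factor n p s = (if odd n then a_const n s p else a_const n s p / sqrt pi) * ((1/2) * (real n - 1) powr (- ((1 + s * p) / 2)))"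

definition poisson_factor :: "nat \<Rightarrow> real" where
  "poisson_factor n = (1/2) * (real n - 1) powr (- (1/2))"

lemma frac_kernel_eq_profile:
  assumes n: "2 \<le> n" and s: "0 \<le> s * p" and \<rho>: "0 < \<rho>"
  shows "frac_kernel n s p \<rho> = s * frac_factor n p s * frac_profile n (s * p / 2) \<rho>"
proof -
  have "heat_mix n (((real n - 1) / 2)\<^sup>2) (\<lambda>u. u powr (- ((1 + s * p) / 2 + 1))) \<rho> = frac_profile n (s * p / 2) \<rho>"
  proof -
    have "(\<lambda>u. u powr (- ((1 + s * p) / 2 + 1))) = (\<lambda>u. u powr (- 1 - s * p / 2) * u powr (- (1/2)))"
    proof (rule ext)
      fix u :: real
      have "- ((1 + s * p) / 2 + 1) = (- 1 - s * p / 2) + (- (1/2))" by (simp add: field_simps)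
      then show "u powr (- ((1 + s * p) / 2 + 1)) = u powr (- 1 - s * p / 2) * u powr (- (1/2))" by (simp only: powr_add)
    qed
    then show ?thesis by (simp only: heat_mix_conv_kernel frac_profile_def)
  qed
  moreover have "2 * ((real n - 1) / 2) = real n - 1" by simp
  ultimately show ?thesis
    using frac_kernel_eq_heat_mix[OF n s \<rho>] by (simp only: frac_factor_def mult.assoc)
qed

lemma poisson_kernel_eq_profile:
  assumes n: "2 \<le> n" and \<rho>: "0 < \<rho>"
  shows "poisson_kernel n \<rho> t = poisson_factor n * poisson_profile n t \<rho>"
proof -
  have "heat_mix n (((real n - 1) / 2)\<^sup>2) (\<lambda>u. u powr (- (3/2)) * exp (- t\<^sup>2 / (4 * u))) \<rho> = poisson_profile n t \<rho>"
  proof -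
    have "(\<lambda>u. u powr (- (3/2)) * exp (- t\<^sup>2 / (4 * u))) = (\<lambda>u. u powr (- 1) * exp (- t\<^sup>2 / (4 * u)) * u powr (- (1/2)))"
    proof (rule ext)
      fix u :: real
      have "u powr (- (3/2)) = u powr (- 1) * u powr (- (1/2))" using powr_add[of u "- 1" "- (1/2)"] by simp
      then show "u powr (- (3/2)) * exp (- t\<^sup>2 / (4 * u)) = u powr (- 1) * exp (- t\<^sup>2 / (4 * u)) * u powr (- (1/2))" by (simp only: mult_ac)
    qed
    then show ?thesis by (simp only: heat_mix_conv_kernel poisson_profile_def)
  qed
  moreover have "2 * ((real n - 1) / 2) = real n - 1" by simp
  ultimately show ?thesis
    using poisson_kernel_eq_heat_mix[OF n \<rho>, of t] by (simp only: poisson_factor_def mult.assoc)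
qed

text \<open>The role of \<open>sigma_const\<close>: it turns the constant of the Poisson kernel into
  that of the fractional kernel at s = 0, so the integral of the local part enters both operators
  with the same factor.\<close>

lemma frac_factor_0: "frac_factor n p 0 = sigma_const n p * poisson_factor n"
  by (simp add: frac_factor_def sigma_const_def poisson_factor_def)

lemma frac_factor_0_pos:
  assumes "2 \<le> n" "1 < p"
  shows "0 < frac_factor n p 0"
  using assms by (auto simp: frac_factor_def a_const_def intro!: divide_pos_pos mult_pos_pos Gamma_real_pos)

text \<open>After A times \<open>Phi p (f x)\<close> is subtracted and divided by \<open>s\<close>,
  this difference quotient remains next to the cancelled pole; its limit enters delta.\<close>

lemma frac_factor_differentiable:
  assumes "2 \<le> n" "1 < p"
  shows "((\<lambda>s. (frac_factor n p s - frac_factor n p 0) / s) \<longlongrightarrow> deriv (frac_factor n p) 0) (at_right 0)"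
proof -
  have "(\<lambda>s. a_const n s p) differentiable (at 0)"
  proof -
    have G: "(\<lambda>s. Gamma (1 - s :: real)) differentiable (at 0)"
    proof -
      have "((\<lambda>s. Gamma (1 - s :: real)) has_real_derivative Gamma (1 - 0) * Digamma (1 - 0) * (- 1)) (at 0)"
        by (rule DERIV_chain2[OF has_field_derivative_Gamma]) (auto intro!: derivative_eq_intros)
      then show ?thesis unfolding real_differentiable_def by blast
    qed
    have P: "(\<lambda>s. (real n - 1) powr ((1 + s * p) / 2)) differentiable (at 0)"
      "(\<lambda>s. (2::real) powr (s * (p - 2) + (real n + 3) / 2)) differentiable (at 0)"
      unfolding real_differentiable_def using assms by (auto intro!: exI derivative_eq_intros)
    have G0: "Gamma ((p + 1) / 2) \<noteq> 0" using assms by (intro less_imp_neq[THEN not_sym] Gamma_real_pos) auto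
    show ?thesis
      unfolding a_const_def using G0
      by (intro differentiable_divide differentiable_mult differentiable_const P G) auto
  qed
  moreover have "(\<lambda>s. (real n - 1) powr (- ((1 + s * p) / 2))) differentiable (at 0)"
    unfolding real_differentiable_def using assms by (auto intro!: exI derivative_eq_intros)
  ultimately have "frac_factor n p differentiable (at 0)"
    unfolding frac_factor_def[abs_def] by (cases "odd n") (auto intro!: differentiable_mult differentiable_divide)
  then have "(frac_factor n p has_real_derivative deriv (frac_factor n p) 0) (at 0)"
    by (simp add: DERIV_deriv_iff_real_differentiable)
  then have "((\<lambda>s. (frac_factor n p s - frac_factor n p 0) / (s - 0)) \<longlongrightarrow> deriv (frac_factor n p) 0) (at 0)"
    by (simp add: has_field_derivative_iff)
  then show ?thesis by (simp add: filterlim_at_split)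
qed

lemma frac_factor_tendsto:
  assumes "2 \<le> n" "1 < p"
  shows "((\<lambda>s. frac_factor n p s) \<longlongrightarrow> frac_factor n p 0) (at_right 0)"
proof -
  have "((\<lambda>s. (frac_factor n p s - frac_factor n p 0) / s * s + frac_factor n p 0) \<longlongrightarrow> deriv (frac_factor n p) 0 * 0 + frac_factor n p 0) (at_right 0)"
    by (intro tendsto_add tendsto_mult frac_factor_differentiable assms tendsto_const tendsto_ident_at)
  moreover have "\<forall>\<^sub>F s in at_right 0. (frac_factor n p s - frac_factor n p 0) / s * s + frac_factor n p 0 = frac_factor n p s"
    by (auto simp: eventually_at_filter)
  ultimately show ?thesis by (auto intro: Lim_transform_eventually)
qed

lemma norm_Phi: "norm (Phi p z) = norm z powr (p - 1)"
proof (cases "z = 0")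
  case False
  then have "norm z powr (p - 2) * norm z = norm z powr (p - 1)"
    by (simp add: powr_mult_base mult.commute)
  then show ?thesis by (simp add: Phi_def norm_mult)
qed (simp add: Phi_def)

lemma Phi_measurable [measurable]:
  assumes [measurable]: "h \<in> borel_measurable M"
  shows "(\<lambda>y. Phi p (h y)) \<in> borel_measurable M"
  unfolding Phi_def by measurable

lemma hyperboloid_measurable_continuous:
  fixes f :: "'n::finite point \<Rightarrow> complex"
  assumes "continuous_on hyperboloid f"
  shows "f \<in> borel_measurable hyp_vol"
  using borel_measurable_continuous_on_restrict[OF assms] by (simp cong: measurable_cong_sets)

lemma continuous_on_hdist:
  fixes x :: "'n::finite point"
  assumes "x \<in> hyperboloid"
  shows "continuous_on hyperboloid (hdist x)"
proof -
  have "continuous_on hyperboloid (lorentz x)"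
    unfolding lorentz_def[abs_def] by (intro continuous_intros)
  then show ?thesis unfolding hdist_def[abs_def]
    by (rule continuous_on_compose2[OF continuous_on_arcosh[OF order.refl]]) (use lorentz_ge_1[OF assms] in auto)
qed

text \<open>The local part vanishes at \<open>x\<close> and has bounded support, hence is integrable against all kernels
  with small \<open>s\<close>, down to \<open>s = 0\<close>.\<close>

definition local_part :: "real \<Rightarrow> ('n::finite point \<Rightarrow> complex) \<Rightarrow> 'n point \<Rightarrow> 'n point \<Rightarrow> complex" where
  "local_part p f x y = Phi p (f x - f y) - of_real (indicator {1<..} (hdist x y)) * Phi p (f x)"

lemma local_part_measurable:
  fixes f :: "'n::finite point \<Rightarrow> complex"
  assumes f: "f \<in> Cc_hyp" and x: "x \<in> hyperboloid"
  shows "local_part p f x \<in> borel_measurable hyp_vol"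
proof -
  note [measurable] = hdist_measurable[OF x]
  have [measurable]: "f \<in> borel_measurable hyp_vol"
    using f by (intro hyperboloid_measurable_continuous) (simp add: Cc_hyp_def)
  show ?thesis unfolding local_part_def[abs_def] by measurable
qed

text \<open>Within distance 1 the local Lipschitz condition gives the exponent alpha (p - 1), up to
  \<open>R\<close> boundedness of \<open>f\<close> suffices, and beyond \<open>R\<close> the point
  \<open>y\<close> is outside the support, so the two terms of \<open>local_part\<close>
  cancel.\<close>

lemma local_part_bound:
  fixes f :: "'n::finite point \<Rightarrow> complex"
  assumes f: "f \<in> Cc_hyp" "f \<in> Lip_loc \<alpha>" and x: "x \<in> hyperboloid" and p: "1 < p" and \<alpha>: "0 < \<alpha>"
  obtains C R b where "0 \<le> C" "0 \<le> R" "0 < b" "b \<le> 2"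
    "\<And>y. y \<in> hyperboloid \<Longrightarrow> 0 < hdist x y \<Longrightarrow> norm (local_part p f x y) \<le> C * (hdist x y powr b * indicator {..R} (hdist x y))"
proof -
  define K where "K = hyperboloid \<inter> closure {y \<in> hyperboloid. f y \<noteq> 0}"
  have K: "compact K" "K \<subseteq> hyperboloid" using f(1) by (auto simp: K_def Cc_hyp_def)
  have fK: "y \<in> K" if "y \<in> hyperboloid" "f y \<noteq> 0" for y
    using that closure_subset[of "{y \<in> hyperboloid. f y \<noteq> 0}"] by (auto simp: K_def)
  have cf: "continuous_on hyperboloid f" using f(1) by (simp add: Cc_hyp_def)
  obtain M where M: "M > 0" "\<And>y. y \<in> K \<Longrightarrow> norm (f y) \<le> M"
    using compact_imp_bounded[OF compact_continuous_image[OF continuous_on_subset[OF cf K(2)] K(1)]]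
    unfolding bounded_pos by auto
  have M': "norm (f y) \<le> M" if "y \<in> hyperboloid" for y
    using M fK[OF that] by (cases "f y = 0") auto
  obtain R0 where R0: "\<And>y. y \<in> K \<Longrightarrow> hdist x y \<le> R0"
    using compact_imp_bounded[OF compact_continuous_image[OF continuous_on_subset[OF continuous_on_hdist[OF x] K(2)] K(1)]]
    unfolding bounded_iff by (auto simp: abs_le_iff)
  \<comment> \<open>At least 1, so that beyond \<open>R\<close> the indicator in
    \<open>local_part\<close> is already 1.\<close>
  define R where "R = max 1 R0"
  obtain L where L: "\<And>y. y \<in> hyperboloid \<Longrightarrow> y \<noteq> x \<Longrightarrow> hdist x y \<le> 1 \<Longrightarrow> norm (f x - f y) / hdist x y powr \<alpha> \<le> L"
  proof -
    have "bdd_above ((\<lambda>y. cmod (f x - f y) / hdist x y powr \<alpha>) ` {y \<in> hyperboloid. y \<noteq> x \<and> hdist x y \<le> 1})"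
      using f(2) x by (simp add: Lip_loc_def)
    then show ?thesis using that by (auto simp: bdd_above_def)
  qed
  define L' where "L' = max L 0"
  \<comment> \<open>The cap keeps the exponent within the range \<open>b <= 2\<close> of
    \<open>heat_average_near\<close>; on distances at most 1 a smaller exponent gives a weaker
    bound.\<close>
  define b where "b = min (\<alpha> * (p - 1)) 1"
  define M1 where "M1 = (2 * M) powr (p - 1) + M powr (p - 1)"
  define C where "C = max (L' powr (p - 1)) M1"
  have b: "0 < b" "b \<le> \<alpha> * (p - 1)" "b \<le> 1" using p \<alpha> by (auto simp: b_def)
  have C0: "0 \<le> C" using powr_ge_zero[of L' "p - 1"] unfolding C_def by linarith
  show ?thesis
  proof (rule that[of C R b])
    fix y assume y: "y \<in> hyperboloid" and d: "0 < hdist x y"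
    define \<rho> where "\<rho> = hdist x y"
    have \<rho>: "0 < \<rho>" using d by (simp add: \<rho>_def)
    have "hdist x x = 0" using x by (simp add: hdist_def hyperboloid_def)
    then have ne: "y \<noteq> x" using d by auto
    have M1: "norm (local_part p f x y) \<le> M1"
    proof -
      have "norm (f x - f y) \<le> 2 * M" using norm_triangle_ineq4[of "f x" "f y"] M'[OF x] M'[OF y] by linarith
      then have "norm (f x - f y) powr (p - 1) \<le> (2 * M) powr (p - 1)" using p by (intro powr_mono2) auto
      moreover have "norm (f x) powr (p - 1) \<le> M powr (p - 1)" using p M'[OF x] by (intro powr_mono2) auto
      moreover have "norm (local_part p f x y) \<le> norm (Phi p (f x - f y)) + norm (of_real (indicator {1<..} (hdist x y)) * Phi p (f x))"
        unfolding local_part_def by (rule norm_triangle_ineq4)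
      moreover have "norm (of_real (indicator {1<..} (hdist x y)) * Phi p (f x)) \<le> norm (Phi p (f x))"
        by (simp add: norm_mult indicator_def)
      ultimately show ?thesis unfolding M1_def norm_Phi by linarith
    qed
    have "norm (local_part p f x y) \<le> C * (\<rho> powr b * indicator {..R} \<rho>)"
    proof -
      consider "\<rho> \<le> 1" | "1 < \<rho>" "\<rho> \<le> R" | "R < \<rho>" by linarith
      then show ?thesis
      proof cases
        case 1
        have "norm (f x - f y) \<le> L * \<rho> powr \<alpha>"
          using L[OF y ne] 1 \<rho> by (simp add: \<rho>_def divide_le_eq)
        also have "\<dots> \<le> L' * \<rho> powr \<alpha>" by (intro mult_right_mono) (auto simp: L'_def)
        finally have "norm (f x - f y) powr (p - 1) \<le> (L' * \<rho> powr \<alpha>) powr (p - 1)" using p by (intro powr_mono2) auto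
        also have "\<dots> = L' powr (p - 1) * \<rho> powr (\<alpha> * (p - 1))" by (simp add: powr_mult powr_powr L'_def)
        also have "\<dots> \<le> C * \<rho> powr b"
          using 1 \<rho> b C0 by (intro mult_mono powr_mono') (auto simp: C_def)
        finally have "norm (Phi p (f x - f y)) \<le> C * \<rho> powr b" by (simp add: norm_Phi)
        moreover have "local_part p f x y = Phi p (f x - f y)" using 1 by (simp add: local_part_def \<rho>_def)
        moreover have "\<rho> \<le> R" using 1 by (simp add: R_def)
        ultimately show ?thesis by simp
      next
        case 2
        have "M1 * 1 \<le> C * \<rho> powr b"
          using 2 b M(1) by (intro mult_mono ge_one_powr_ge_zero) (auto simp: C_def M1_def max_def)
        then show ?thesis using M1 2 by simp
      next
        case 3
        then have "\<not> \<rho> \<le> R0" "1 < \<rho>" by (auto simp: R_def)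
        then have "f y = 0" using R0[of y] fK[OF y] by (auto simp: \<rho>_def)
        then have "local_part p f x y = 0" using \<open>1 < \<rho>\<close> by (simp add: local_part_def \<rho>_def)
        then show ?thesis using 3 by simp
      qed
    qed
    then show "norm (local_part p f x y) \<le> C * (hdist x y powr b * indicator {..R} (hdist x y))" by (simp add: \<rho>_def)
  qed (use b C0 in \<open>auto simp: R_def\<close>)
qed

text \<open>The kernel formulas hold at positive distance only; the law of the distance is carried
  by the positive half line, so the exceptional set is null.\<close>

lemma AE_hdist_pos:
  fixes x :: "'n::finite point"
  assumes x: "x \<in> hyperboloid"
  shows "AE y in hyp_vol. y \<in> hyperboloid \<and> 0 < hdist x y"
proof -
  have "AE \<rho> in hyp_radial TYPE('n). 0 < \<rho>"
    unfolding hyp_radial_def by (subst AE_density) (auto simp: indicator_def intro!: AE_I2)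
  then have "AE \<rho> in distr hyp_vol borel (hdist x). 0 < \<rho>" unfolding distr_hdist[OF x] .
  then have "AE y in hyp_vol. 0 < hdist x y"
    using hdist_measurable[OF x] by (subst (asm) AE_distr_iff) auto
  then show ?thesis using AE_space by eventually_elim auto
qed

lemma integrable_hdist:
  fixes x :: "'n::finite point" and F :: "real \<Rightarrow> real"
  assumes x: "x \<in> hyperboloid" and F: "has_bochner_integral (hyp_radial TYPE('n)) F I"
  shows "has_bochner_integral hyp_vol (\<lambda>y. F (hdist x y)) I"
proof -
  have m: "F \<in> borel_measurable borel" using F by (auto simp: has_bochner_integral_iff dest: borel_measurable_integrable)
  show ?thesis
    using F hdist_measurable[OF x] m unfolding distr_hdist[OF x, symmetric] has_bochner_integral_iff
    by (simp add: integrable_distr_eq integral_distr)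
qed

lemma at_right_p_half:
  fixes p :: real
  assumes "0 < p"
  shows "filterlim (\<lambda>s. s * p / 2) (at_right 0) (at_right 0)"
  unfolding filterlim_at
proof
  show "\<forall>\<^sub>F s in at_right 0. s * p / 2 \<in> {0<..} \<and> s * p / 2 \<noteq> 0"
    using assms by (auto simp: eventually_at_filter)
  show "((\<lambda>s. s * p / 2) \<longlongrightarrow> 0) (at_right 0)" by (auto intro!: tendsto_eq_intros)
qed

lemma local_part_dominated:
  fixes f :: "'n::finite point \<Rightarrow> complex"
  assumes n: "2 \<le> CARD('n)" and f: "f \<in> Cc_hyp" "f \<in> Lip_loc \<alpha>" and x: "x \<in> hyperboloid" and p: "1 < p" and \<alpha>: "0 < \<alpha>"
  obtains C R b where "0 < b" "b \<le> 2" "\<And>y. y \<in> hyperboloid \<Longrightarrow> 0 < hdist x y \<Longrightarrow> norm (local_part p f x y) \<le> C * (hdist x y powr b * indicator {..R} (hdist x y))"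
    "\<And>a. 0 \<le> a \<Longrightarrow> a < b / 4 \<Longrightarrow> integrable hyp_vol (\<lambda>y. C * (hdist x y powr b * indicator {..R} (hdist x y) * frac_profile CARD('n) a (hdist x y)))"
proof -
  obtain C R b where B: "0 \<le> C" "0 \<le> R" "0 < b" "b \<le> 2"
    "\<And>y. y \<in> hyperboloid \<Longrightarrow> 0 < hdist x y \<Longrightarrow> norm (local_part p f x y) \<le> C * (hdist x y powr b * indicator {..R} (hdist x y))"
    using local_part_bound[OF f x p \<alpha>] by blast
  have "integrable hyp_vol (\<lambda>y. C * (hdist x y powr b * indicator {..R} (hdist x y) * frac_profile CARD('n) a (hdist x y)))"
    if a: "0 \<le> a" "a < b / 4" for a
  proof -
    have "has_bochner_integral (hyp_radial TYPE('n)) (\<lambda>\<rho>. \<rho> powr b * indicator {..R} \<rho> * frac_profile CARD('n) a \<rho>)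
      (\<integral>\<rho>. \<rho> powr b * indicator {..R} \<rho> * frac_profile CARD('n) a \<rho> \<partial>hyp_radial TYPE('n))"
      using frac_profile_near_integrable[OF n B(3,4) a B(2)] by (simp add: has_bochner_integral_iff)
    from integrable_hdist[OF x this] show ?thesis by (auto simp: has_bochner_integral_iff)
  qed
  with B show ?thesis using that[of b C R] by blast
qed

text \<open>The fractional profiles are dominated by those at 0 and at one small positive parameter,
  the Poisson profiles by the one at 0. The bound on the local part makes these majorants
  integrable, and both families tend pointwise to the profile at 0, hence the common limit.\<close>

lemma local_part_integral_frac:
  fixes f :: "'n::finite point \<Rightarrow> complex"
  assumes n: "2 \<le> CARD('n)" and f: "f \<in> Cc_hyp" "f \<in> Lip_loc \<alpha>" and x: "x \<in> hyperboloid" and p: "1 < p" and \<alpha>: "0 < \<alpha>"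
  defines "I \<equiv> \<lambda>a. \<integral>y. local_part p f x y * of_real (frac_profile CARD('n) a (hdist x y)) \<partial>hyp_vol"
  shows "(I \<longlongrightarrow> I 0) (at_right 0)"
    and "\<forall>\<^sub>F a in at_right 0. integrable hyp_vol (\<lambda>y. local_part p f x y * of_real (frac_profile CARD('n) a (hdist x y)))"
    and "((\<lambda>t. \<integral>y. local_part p f x y * of_real (poisson_profile CARD('n) t (hdist x y)) \<partial>hyp_vol) \<longlongrightarrow> I 0) (at_right 0)"
    and "\<And>t. integrable hyp_vol (\<lambda>y. local_part p f x y * of_real (poisson_profile CARD('n) t (hdist x y)))"
proof -
  let ?n = "CARD('n)"
  note [measurable] = hdist_measurable[OF x] local_part_measurable[OF f(1) x]
  obtain C R b where B: "0 < b" "b \<le> 2"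
    "\<And>y. y \<in> hyperboloid \<Longrightarrow> 0 < hdist x y \<Longrightarrow> norm (local_part p f x y) \<le> C * (hdist x y powr b * indicator {..R} (hdist x y))"
    "\<And>a. 0 \<le> a \<Longrightarrow> a < b / 4 \<Longrightarrow> integrable hyp_vol (\<lambda>y. C * (hdist x y powr b * indicator {..R} (hdist x y) * frac_profile ?n a (hdist x y)))"
    by (rule local_part_dominated[OF n f x p \<alpha>]) (rule that, assumption+)
  define w where "w = (\<lambda>a y. C * (hdist x y powr b * indicator {..R} (hdist x y) * frac_profile ?n a (hdist x y)))"
  have wi: "integrable hyp_vol (w a)" if "0 \<le> a" "a < b / 4" for a unfolding w_def by (rule B(4)[OF that])
  have fm: "(\<lambda>y. local_part p f x y * of_real (frac_profile ?n a (hdist x y))) \<in> borel_measurable hyp_vol" if "0 \<le> a" for a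
  proof -
    note [measurable] = frac_profile_measurable[OF that, of ?n]
    show ?thesis by measurable
  qed
  have pm: "(\<lambda>y. local_part p f x y * of_real (poisson_profile ?n t (hdist x y))) \<in> borel_measurable hyp_vol" for t
    by measurable
  have le: "norm (local_part p f x y * of_real k) \<le> w a y"
    if y: "y \<in> hyperboloid" "0 < hdist x y" and "0 \<le> k" "k \<le> frac_profile ?n a (hdist x y)" for y k a
  proof -
    have "norm (local_part p f x y) * k \<le> C * (hdist x y powr b * indicator {..R} (hdist x y)) * frac_profile ?n a (hdist x y)"
      using B(3)[OF y] that by (intro mult_mono) (auto intro: order_trans[OF norm_ge_zero])
    then show ?thesis using \<open>0 \<le> k\<close> by (simp add: w_def norm_mult mult.assoc)
  qed
  \<comment> \<open>Any value strictly between 0 and b/4 would serve.\<close>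
  define a0 where "a0 = b / 8"
  have a0: "0 < a0" "a0 < b / 4" using B(1) by (auto simp: a0_def)
  have le2: "norm (local_part p f x y * of_real (frac_profile ?n a (hdist x y))) \<le> w a0 y + w 0 y"
    if y: "y \<in> hyperboloid" "0 < hdist x y" and a: "0 \<le> a" "a \<le> a0" for y a
  proof -
    have "0 \<le> C * (hdist x y powr b * indicator {..R} (hdist x y))" using order_trans[OF norm_ge_zero B(3)[OF y]] .
    moreover have "norm (local_part p f x y * of_real (frac_profile ?n a (hdist x y))) \<le> w a y"
      by (rule le[OF y frac_profile_nonneg[OF n a(1)] order.refl]) (use y in simp)
    moreover have "C * (hdist x y powr b * indicator {..R} (hdist x y)) * frac_profile ?n a (hdist x y)
      \<le> C * (hdist x y powr b * indicator {..R} (hdist x y)) * (frac_profile ?n a0 (hdist x y) + frac_profile ?n 0 (hdist x y))"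
      by (intro mult_left_mono frac_profile_le[OF n a y(2)] calculation(1))
    ultimately show ?thesis by (simp add: w_def algebra_simps)
  qed
  have w2: "integrable hyp_vol (\<lambda>y. w a0 y + w 0 y)" using a0 B(1) by (intro Bochner_Integration.integrable_add wi) auto
  have fi: "integrable hyp_vol (\<lambda>y. local_part p f x y * of_real (frac_profile ?n a (hdist x y)))" if a: "0 \<le> a" "a \<le> a0" for a
    by (rule Bochner_Integration.integrable_bound[OF w2 fm[OF a(1)]])
       (use AE_hdist_pos[OF x] in \<open>eventually_elim, auto intro: order_trans[OF le2[OF _ _ a] abs_ge_self]\<close>)
  have w0: "integrable hyp_vol (w 0)" using B(1) by (intro wi) auto
  show "(I \<longlongrightarrow> I 0) (at_right 0)"
  proof -
    have "(I \<longlongrightarrow> I 0) (at 0 within {0<..<a0})"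
      unfolding I_def
    proof (rule integral_dominated_convergence_at(1)[where w = "\<lambda>y. w a0 y + w 0 y"])
      show "AE y in hyp_vol. ((\<lambda>a. local_part p f x y * of_real (frac_profile ?n a (hdist x y))) \<longlongrightarrow> local_part p f x y * of_real (frac_profile ?n 0 (hdist x y))) (at 0 within {0<..<a0})"
        using AE_hdist_pos[OF x]
        by eventually_elim (auto intro!: tendsto_intros frac_profile_tendsto n simp: at_right_0_eq[OF a0(1), symmetric])
      show "AE y in hyp_vol. norm (local_part p f x y * of_real (frac_profile ?n a (hdist x y))) \<le> w a0 y + w 0 y" if "a \<in> {0<..<a0} - {0}" for a
        using AE_hdist_pos[OF x] by eventually_elim (use that le2 in auto)
    qed (use w2 fm in auto)
    then show ?thesis by (simp add: at_right_0_eq[OF a0(1)])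
  qed
  show "\<forall>\<^sub>F a in at_right 0. integrable hyp_vol (\<lambda>y. local_part p f x y * of_real (frac_profile ?n a (hdist x y)))"
    unfolding at_right_0_eq[OF a0(1)] using fi by (auto simp: eventually_at_filter)
  have lep: "AE y in hyp_vol. norm (local_part p f x y * of_real (poisson_profile ?n t (hdist x y))) \<le> w 0 y" for t
    using AE_hdist_pos[OF x] by eventually_elim (auto intro!: le poisson_profile_nonneg poisson_profile_le n)
  show "integrable hyp_vol (\<lambda>y. local_part p f x y * of_real (poisson_profile ?n t (hdist x y)))" for t
    by (rule Bochner_Integration.integrable_bound[OF w0 pm])
       (use lep[of t] in \<open>eventually_elim, auto intro: order_trans[OF _ abs_ge_self]\<close>)
  have "((\<lambda>t. \<integral>y. local_part p f x y * of_real (poisson_profile ?n t (hdist x y)) \<partial>hyp_vol) \<longlongrightarrow> I 0) (at 0 within {0<..<1})"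
    unfolding I_def
  proof (rule integral_dominated_convergence_at(1)[where w = "w 0"])
    show "AE y in hyp_vol. ((\<lambda>t. local_part p f x y * of_real (poisson_profile ?n t (hdist x y))) \<longlongrightarrow> local_part p f x y * of_real (frac_profile ?n 0 (hdist x y))) (at 0 within {0<..<1})"
      using AE_hdist_pos[OF x]
      by eventually_elim (auto intro!: tendsto_intros poisson_profile_tendsto n simp: at_right_0_eq[OF zero_less_one, symmetric])
  qed (use w0 fm pm lep in auto)
  then show "((\<lambda>t. \<integral>y. local_part p f x y * of_real (poisson_profile ?n t (hdist x y)) \<partial>hyp_vol) \<longlongrightarrow> I 0) (at_right 0)"
    by (simp add: at_right_0_eq[OF zero_less_one])
qed

text \<open>Local and far part are both integrable against the kernel, so the truncated integrals
  converge to an ordinary integral by dominated convergence and the principal value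
  disappears.\<close>

lemma frac_plap_eq:
  fixes f :: "'n::finite point \<Rightarrow> complex"
  assumes n: "2 \<le> CARD('n)" and f: "f \<in> Cc_hyp" and x: "x \<in> hyperboloid" and s: "0 < s" "0 < p"
    and loc: "integrable hyp_vol (\<lambda>y. local_part p f x y * of_real (frac_profile CARD('n) (s * p / 2) (hdist x y)))"
    and far: "has_bochner_integral (hyp_radial TYPE('n)) (\<lambda>\<rho>. indicator {1<..} \<rho> * frac_profile CARD('n) (s * p / 2) \<rho>) M"
  shows "frac_plap s p f x = of_real (s * frac_factor CARD('n) p s) *
    ((\<integral>y. local_part p f x y * of_real (frac_profile CARD('n) (s * p / 2) (hdist x y)) \<partial>hyp_vol) + of_real M * Phi p (f x))"
proof -
  let ?n = "CARD('n)" and ?a = "s * p / 2"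
  note [measurable] = hdist_measurable[OF x] local_part_measurable[OF f x]
  define F0 where "F0 = (\<lambda>y. of_real (s * frac_factor ?n p s) * (local_part p f x y * of_real (frac_profile ?n ?a (hdist x y))
     + of_real (indicator {1<..} (hdist x y) * frac_profile ?n ?a (hdist x y)) * Phi p (f x)))"
  have far': "has_bochner_integral hyp_vol (\<lambda>y. indicator {1<..} (hdist x y) * frac_profile ?n ?a (hdist x y)) M"
    using integrable_hdist[OF x far] .
  have far_i: "integrable hyp_vol (\<lambda>y. of_real (indicator {1<..} (hdist x y) * frac_profile ?n ?a (hdist x y)) :: complex)"
    using far' by (intro integrable_of_real) (auto simp: has_bochner_integral_iff)
  have int: "integrable hyp_vol F0"
    unfolding F0_def by (intro integrable_mult_right Bochner_Integration.integrable_add loc integrable_mult_left far_i)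
  have [measurable]: "F0 \<in> borel_measurable hyp_vol" using int by (rule borel_measurable_integrable)
  have eq: "Phi p (f x - f y) * of_real (frac_kernel ?n s p (hdist x y)) = F0 y" if "0 < hdist x y" for y
    using frac_kernel_eq_profile[OF n _ that, of s p] s by (simp add: F0_def local_part_def algebra_simps)
  have "((\<lambda>\<epsilon>. \<integral>y. indicator {y \<in> hyperboloid. hdist x y > \<epsilon>} y *\<^sub>R F0 y \<partial>hyp_vol) \<longlongrightarrow> (\<integral>y. F0 y \<partial>hyp_vol)) (at 0 within {0<..<1})"
  proof (rule integral_dominated_convergence_at(1)[where w = "\<lambda>y. norm (F0 y)"])
    show "AE y in hyp_vol. ((\<lambda>\<epsilon>. indicator {y \<in> hyperboloid. hdist x y > \<epsilon>} y *\<^sub>R F0 y) \<longlongrightarrow> F0 y) (at 0 within {0<..<1})"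
      using AE_hdist_pos[OF x]
    proof eventually_elim
      case (elim y)
      have "\<forall>\<^sub>F \<epsilon> in at_right 0. \<epsilon> < hdist x y" using elim by (intro eventually_at_right_less[THEN eventually_mono] eventually_at_rightI[of 0 "hdist x y"]) auto
      then have "\<forall>\<^sub>F \<epsilon> in at_right 0. indicator {y \<in> hyperboloid. hdist x y > \<epsilon>} y *\<^sub>R F0 y = F0 y"
        by eventually_elim (use elim in simp)
      then show ?case unfolding at_right_0_eq[OF zero_less_one, symmetric] by (rule tendsto_eventually)
    qed
    show "(\<lambda>y. indicator {y \<in> hyperboloid. hdist x y > \<epsilon>} y *\<^sub>R F0 y) \<in> borel_measurable hyp_vol" for \<epsilon>
    proof -
      have "{y \<in> space hyp_vol. hdist x y > \<epsilon>} \<in> sets hyp_vol" by measurable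
      then have [measurable]: "{y \<in> hyperboloid. hdist x y > \<epsilon>} \<in> sets hyp_vol" by simp
      show ?thesis by measurable
    qed
    show "AE y in hyp_vol. norm (indicator {y \<in> hyperboloid. hdist x y > \<epsilon>} y *\<^sub>R F0 y) \<le> norm (F0 y)" for \<epsilon>
      by (auto simp: indicator_def)
  qed (use int in auto)
  then have "((\<lambda>\<epsilon>. \<integral>y. indicator {y \<in> hyperboloid. hdist x y > \<epsilon>} y *\<^sub>R F0 y \<partial>hyp_vol) \<longlongrightarrow> (\<integral>y. F0 y \<partial>hyp_vol)) (at_right 0)"
    by (simp add: at_right_0_eq[OF zero_less_one])
  moreover have "\<forall>\<^sub>F \<epsilon> in at_right 0. (\<integral>y. indicator {y \<in> hyperboloid. hdist x y > \<epsilon>} y *\<^sub>R F0 y \<partial>hyp_vol)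
    = (LINT y:{y \<in> hyperboloid. hdist x y > \<epsilon>}|hyp_vol. Phi p (f x - f y) * of_real (frac_kernel ?n s p (hdist x y)))"
    unfolding at_right_0_eq[OF zero_less_one] set_lebesgue_integral_def eventually_at_filter
    by (intro always_eventually allI impI Bochner_Integration.integral_cong refl) (auto simp: indicator_def eq)
  ultimately have "((\<lambda>\<epsilon>. LINT y:{y \<in> hyperboloid. hdist x y > \<epsilon>}|hyp_vol. Phi p (f x - f y) * of_real (frac_kernel ?n s p (hdist x y))) \<longlongrightarrow> (\<integral>y. F0 y \<partial>hyp_vol)) (at_right 0)"
    by (rule Lim_transform_eventually)
  then have "frac_plap s p f x = (\<integral>y. F0 y \<partial>hyp_vol)"
    unfolding frac_plap_def by (intro tendsto_Lim) auto
  also have "\<dots> = of_real (s * frac_factor ?n p s) *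
    ((\<integral>y. local_part p f x y * of_real (frac_profile ?n ?a (hdist x y)) \<partial>hyp_vol) + of_real M * Phi p (f x))"
  proof -
    have "(\<integral>y. of_real (indicator {1<..} (hdist x y) * frac_profile ?n ?a (hdist x y)) * Phi p (f x) \<partial>hyp_vol)
      = (\<integral>y. of_real (indicator {1<..} (hdist x y) * frac_profile ?n ?a (hdist x y)) \<partial>hyp_vol) * Phi p (f x)"
      by (rule Bochner_Integration.integral_mult_left_zero)
    also have "(\<integral>y. of_real (indicator {1<..} (hdist x y) * frac_profile ?n ?a (hdist x y)) \<partial>hyp_vol) = (of_real M :: complex)"
      using far' by (subst integral_of_real) (auto simp: has_bochner_integral_iff)
    finally show ?thesis
      unfolding F0_def by (simp only: integral_mult_right_zero Bochner_Integration.integral_add[OF loc integrable_mult_left[OF far_i]])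
  qed
  finally show ?thesis .
qed

text \<open>Subtracting \<open>Phi p (f x)\<close> everywhere leaves the local part minus
  \<open>Phi p (f x)\<close> on the unit ball. It is therefore the mass of the Poisson kernel near
  \<open>x\<close> that produces the logarithm.\<close>

lemma ext_op_eq:
  fixes f :: "'n::finite point \<Rightarrow> complex"
  assumes n: "2 \<le> CARD('n)" and x: "x \<in> hyperboloid"
    and f: "f \<in> Cc_hyp"
    and loc: "integrable hyp_vol (\<lambda>y. local_part p f x y * of_real (poisson_profile CARD('n) t (hdist x y)))"
    and near: "has_bochner_integral (hyp_radial TYPE('n)) (\<lambda>\<rho>. indicator {..1} \<rho> * poisson_profile CARD('n) t \<rho>) N"
  shows "ext_op (\<lambda>y. Phi p (f x - f y) - Phi p (f x)) x t = of_real (poisson_factor CARD('n)) *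
    ((\<integral>y. local_part p f x y * of_real (poisson_profile CARD('n) t (hdist x y)) \<partial>hyp_vol) - of_real N * Phi p (f x))"
proof -
  let ?n = "CARD('n)"
  have near': "has_bochner_integral hyp_vol (\<lambda>y. indicator {..1} (hdist x y) * poisson_profile ?n t (hdist x y)) N"
    using integrable_hdist[OF x near] .
  have near_i: "integrable hyp_vol (\<lambda>y. of_real (indicator {..1} (hdist x y) * poisson_profile ?n t (hdist x y)) :: complex)"
    using near' by (intro integrable_of_real) (auto simp: has_bochner_integral_iff)
  define F0 where "F0 = (\<lambda>y. of_real (poisson_factor ?n) * (local_part p f x y * of_real (poisson_profile ?n t (hdist x y))
     - of_real (indicator {..1} (hdist x y) * poisson_profile ?n t (hdist x y)) * Phi p (f x)))"
  have int: "integrable hyp_vol F0"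
    unfolding F0_def by (intro integrable_mult_right Bochner_Integration.integrable_diff loc integrable_mult_left near_i)
  have eq: "(Phi p (f x - f y) - Phi p (f x)) * of_real (poisson_kernel ?n (hdist x y) t) = F0 y" if "0 < hdist x y" for y
    using poisson_kernel_eq_profile[OF n that, of t] by (simp add: F0_def local_part_def indicator_def algebra_simps)
  have [measurable]: "F0 \<in> borel_measurable hyp_vol" using int by (rule borel_measurable_integrable)
  note [measurable] = hdist_measurable[OF x]
  have [measurable]: "f \<in> borel_measurable hyp_vol"
    using f by (intro hyperboloid_measurable_continuous) (simp add: Cc_hyp_def)
  define F where "F = (\<lambda>y. (Phi p (f x - f y) - Phi p (f x)) * of_real (poisson_kernel ?n (hdist x y) t))"
  have "(\<lambda>y. if 0 < hdist x y then F0 y else (Phi p (f x - f y) - Phi p (f x)) * of_real (poisson_kernel ?n 0 t)) \<in> borel_measurable hyp_vol"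
    by measurable
  then have Fm: "F \<in> borel_measurable hyp_vol"
    by (rule measurable_cong[THEN iffD1, rotated]) (use eq hdist_nonneg[OF x] in \<open>force simp: F_def\<close>)
  have "(\<integral>y. F y \<partial>hyp_vol) = (\<integral>y. F0 y \<partial>hyp_vol)"
  proof (rule integral_cong_AE[OF Fm])
    show "AE y in hyp_vol. F y = F0 y"
      using AE_hdist_pos[OF x] by eventually_elim (auto simp: F_def eq)
  qed measurable
  also have "\<dots> = of_real (poisson_factor ?n) *
    ((\<integral>y. local_part p f x y * of_real (poisson_profile ?n t (hdist x y)) \<partial>hyp_vol) - of_real N * Phi p (f x))"
  proof -
    have "(\<integral>y. of_real (indicator {..1} (hdist x y) * poisson_profile ?n t (hdist x y)) * Phi p (f x) \<partial>hyp_vol)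
      = (\<integral>y. of_real (indicator {..1} (hdist x y) * poisson_profile ?n t (hdist x y)) \<partial>hyp_vol) * Phi p (f x)"
      by (rule Bochner_Integration.integral_mult_left_zero)
    also have "(\<integral>y. of_real (indicator {..1} (hdist x y) * poisson_profile ?n t (hdist x y)) \<partial>hyp_vol) = (of_real N :: complex)"
      using near' by (subst integral_of_real) (auto simp: has_bochner_integral_iff)
    finally show ?thesis
      unfolding F0_def by (simp only: integral_mult_right_zero Bochner_Integration.integral_diff[OF loc integrable_mult_left[OF near_i]])
  qed
  finally show ?thesis by (simp add: ext_op_def F_def)
qed

text \<open>A cut-off of the height function shows that the constant in the definition of \<open>A_const\<close> is unique.\<close>

definition height_cutoff :: "'n::finite point \<Rightarrow> complex" where
  "height_cutoff y = of_real (max 0 (2 - fst y))"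

lemma height_cutoff_Cc: "height_cutoff \<in> (Cc_hyp :: ('n::finite point \<Rightarrow> complex) set)"
proof -
  let ?S = "hyperboloid \<inter> closure {x \<in> hyperboloid. height_cutoff x \<noteq> 0} :: 'n point set"
  \<comment> \<open>The condition \<open>0 < fst x\<close> is not closed, but on the hyperboloid it
    amounts to \<open>1 <= fst x\<close>, which is.\<close>
  have hyp: "(hyperboloid :: 'n point set) = {x. lorentz x x = 1} \<inter> {x. 1 \<le> fst x}"
  proof -
    have "1 \<le> fst x" if "x \<in> hyperboloid" for x :: "'n point"
      using hyperboloid_fst[OF that] by simp
    then show ?thesis by (force simp: hyperboloid_def)
  qed
  have "continuous_on UNIV (\<lambda>x :: 'n point. lorentz x x)" unfolding lorentz_def by (intro continuous_intros)
  then have closed_hyp: "closed (hyperboloid :: 'n point set)"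
    unfolding hyp by (intro closed_Int closed_Collect_eq closed_Collect_le continuous_intros)
  have "{x \<in> hyperboloid. height_cutoff x \<noteq> 0} \<subseteq> {x :: 'n point. fst x \<le> 2}"
    by (auto simp: height_cutoff_def max_def split: if_splits)
  moreover have "closed {x :: 'n point. fst x \<le> 2}" by (intro closed_Collect_le continuous_intros)
  ultimately have sub: "?S \<subseteq> hyperboloid \<inter> {x. fst x \<le> 2}" by (meson Int_mono closure_minimal order_refl)
  have "bounded ?S"
    unfolding bounded_iff
  proof (intro exI ballI)
    fix z assume "z \<in> ?S"
    then have z: "z \<in> hyperboloid" "fst z \<le> 2" using sub by auto
    then have "fst z * fst z - snd z \<bullet> snd z = 1" "0 < fst z" by (auto simp: hyperboloid_def lorentz_def)
    then have "(norm (snd z))\<^sup>2 \<le> (fst z)\<^sup>2" unfolding power2_norm_eq_inner by (simp add: power2_eq_square)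
    then have "norm (snd z) \<le> fst z" using \<open>0 < fst z\<close> by (rule power2_le_imp_le[OF _ less_imp_le])
    moreover have "norm z \<le> norm (fst z) + norm (snd z)"
      using norm_Pair_le[of "fst z" "snd z"] unfolding prod.collapse .
    moreover have "norm (fst z) = fst z" using \<open>0 < fst z\<close> by (simp only: real_norm_def abs_of_pos)
    ultimately show "norm z \<le> 4" using z(2) by linarith
  qed
  then have "compact ?S" using closed_hyp by (simp add: compact_eq_bounded_closed closed_Int)
  moreover have "continuous_on hyperboloid (height_cutoff :: 'n point \<Rightarrow> complex)"
    unfolding height_cutoff_def[abs_def] by (intro continuous_intros)
  ultimately show ?thesis by (simp add: Cc_hyp_def)
qed

text \<open>The arcosh of the height is the distance to the origin. The addition formula and
  Cauchy-Schwarz give cosh(a - b) <= \<open>lorentz x y\<close>, a reversed triangle inequality for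
  these distances, and the mean value inequality for \<open>cosh\<close> returns to heights.\<close>

lemma fst_diff_le_hdist:
  fixes x y :: "'n::finite point"
  assumes x: "x \<in> hyperboloid" and y: "y \<in> hyperboloid" and r: "hdist x y \<le> r"
  shows "\<bar>fst x - fst y\<bar> \<le> sinh (arcosh (fst x) + r) * hdist x y"
proof -
  define a where "a = arcosh (fst x)"
  define b where "b = arcosh (fst y)"
  have ge1: "1 \<le> fst x" "1 \<le> fst y" using x y by (simp_all add: hyperboloid_fst)
  have ca: "fst x = cosh a" "fst y = cosh b" using ge1 by (simp_all add: a_def b_def)
  have ab: "0 \<le> a" "0 \<le> b" using ge1 by (auto simp: a_def b_def arcosh_real_def add_increasing2)
  have sn: "norm (snd z) = sinh c" if "z \<in> hyperboloid" "fst z = cosh c" "0 \<le> c" for z :: "'n point" and c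
  proof -
    have "(norm (snd z))\<^sup>2 = (sinh c)\<^sup>2"
      using that unfolding power2_norm_eq_inner sinh_square_eq by (simp add: hyperboloid_def lorentz_def power2_eq_square)
    then show ?thesis using that(3) by (simp add: power2_eq_iff_nonneg)
  qed
  have "cosh (a - b) = cosh a * cosh b - sinh a * sinh b" by (rule cosh_diff)
  also have "\<dots> \<le> lorentz x y"
    using norm_cauchy_schwarz[of "snd x" "snd y"]
    unfolding lorentz_def ca sn[OF x ca(1) ab(1)] sn[OF y ca(2) ab(2)] by linarith
  also have "\<dots> = cosh (hdist x y)" using x y by (simp add: cosh_hdist)
  finally have "cosh \<bar>a - b\<bar> \<le> cosh (hdist x y)" by (simp add: cosh_real_abs)
  then have d: "\<bar>a - b\<bar> \<le> hdist x y" using hdist_nonneg[OF x y] by (subst (asm) cosh_real_nonneg_le_iff) auto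
  have "norm (cosh a - cosh b) \<le> sinh (a + r) * norm (a - b)"
  proof (rule field_differentiable_bound[of "{0..a + r}" cosh sinh])
    fix z assume "z \<in> {0..a + r}"
    then show "norm (sinh z) \<le> sinh (a + r)" by simp
  qed (use ab d r in \<open>auto intro!: derivative_eq_intros\<close>)
  also have "\<dots> \<le> sinh (a + r) * hdist x y" using d ab hdist_nonneg[OF x y] r by (intro mult_left_mono) auto
  finally show ?thesis unfolding ca[symmetric] real_norm_def unfolding a_def .
qed

lemma height_cutoff_Lip:
  assumes \<alpha>: "0 < \<alpha>" "\<alpha> < 1"
  shows "height_cutoff \<in> (Lip_loc \<alpha> :: ('n::finite point \<Rightarrow> complex) set)"
  unfolding Lip_loc_def
proof (intro CollectI ballI allI impI)
  fix x :: "'n point" and r :: real assume x: "x \<in> hyperboloid" and r: "0 < r"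
  define C where "C = sinh (arcosh (fst x) + r)"
  have "1 \<le> fst x" using x by (simp add: hyperboloid_fst)
  then have C: "0 \<le> C" using r by (simp add: C_def arcosh_real_def add_increasing2 add_nonneg_nonneg)
  show "bdd_above ((\<lambda>y. cmod (height_cutoff x - height_cutoff y) / hdist x y powr \<alpha>) ` {y \<in> hyperboloid. y \<noteq> x \<and> hdist x y \<le> r})"
    unfolding bdd_above_def
  proof (intro exI ballI)
    fix v assume "v \<in> (\<lambda>y. cmod (height_cutoff x - height_cutoff y) / hdist x y powr \<alpha>) ` {y \<in> hyperboloid. y \<noteq> x \<and> hdist x y \<le> r}"
    then obtain y where y: "y \<in> hyperboloid" "hdist x y \<le> r" and v: "v = cmod (height_cutoff x - height_cutoff y) / hdist x y powr \<alpha>" by auto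
    have d0: "0 \<le> hdist x y" using x y by (intro hdist_nonneg)
    have "cmod (height_cutoff x - height_cutoff y) \<le> \<bar>fst x - fst y\<bar>"
      unfolding height_cutoff_def of_real_diff[symmetric] norm_of_real by auto
    also have "\<dots> \<le> C * hdist x y" unfolding C_def by (rule fst_diff_le_hdist[OF x y])
    finally have "v \<le> C * hdist x y / hdist x y powr \<alpha>" unfolding v by (intro divide_right_mono) auto
    also have "\<dots> \<le> C * r powr (1 - \<alpha>)"
    \<comment> \<open>For distance 0 the quotient is 0 by the conventions for division and
      \<open>powr\<close>.\<close>
    proof (cases "hdist x y = 0")
      case False
      then have "hdist x y / hdist x y powr \<alpha> = hdist x y powr (1 - \<alpha>)" using d0 by (simp add: powr_diff)
      also have "\<dots> \<le> r powr (1 - \<alpha>)" using d0 y \<alpha> by (intro powr_mono2) auto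
      finally show ?thesis using mult_left_mono[OF _ C] by fastforce
    qed (use C in simp)
    finally show "v \<le> C * r powr (1 - \<alpha>)" .
  qed
qed

lemma half_mellin_tendsto:
  fixes p :: real
  assumes "0 < p" "(h \<longlongrightarrow> l) (at_right 0)"
  shows "((\<lambda>s. h (s * p / 2)) \<longlongrightarrow> l) (at_right 0)"
  using filterlim_compose[OF assms(2) at_right_p_half[OF assms(1)]] .

lemma eventually_half:
  fixes p :: real
  assumes "0 < p" "\<forall>\<^sub>F a in at_right 0. P a"
  shows "\<forall>\<^sub>F s in at_right 0. P (s * p / 2)"
  using at_right_p_half[OF assms(1)] assms(2) unfolding filterlim_iff by blast

theorem theorem1p3:
  assumes "CARD('n::finite) \<ge> 2"
  shows "\<exists>(\<gamma> :: real) (\<delta> :: real \<Rightarrow> real).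
    \<forall>p > 1. \<forall>\<alpha> \<in> {0<..<1}. \<forall>f :: 'n point \<Rightarrow> complex. f \<in> Cc_hyp \<inter> Lip_loc \<alpha> \<longrightarrow>
      (\<forall>x \<in> hyperboloid.
         (log_quotient p f x \<longlongrightarrow> log_plap p f x) (at_right 0) \<and>
         (\<exists>L. ((\<lambda>t. of_real (sigma_const CARD('n) p) *
                   (ext_op (\<lambda>y. Phi p (f x - f y) - Phi p (f x)) x t
                     + of_real (\<gamma> * ln t) * Phi p (f x))) \<longlongrightarrow> L) (at_right 0) \<and>
              log_plap p f x = L + of_real (\<delta> p) * Phi p (f x)))"
proof -
  let ?n = "CARD('n)"
  note n = assms
  \<comment> \<open>These are fixed before \<open>p\<close>, \<open>f\<close> and \<open>x\<close>,
    which is why gamma depends only on the dimension and delta only on the dimension and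
    \<open>p\<close>.\<close>
  obtain \<kappa>\<^sub>1 \<kappa>\<^sub>0 :: real and \<Lambda> :: "real \<Rightarrow> real" and \<Lambda>\<^sub>0 :: real and \<eta> :: "real \<Rightarrow> real" and \<eta>\<^sub>0 :: real
    where k: "0 < \<kappa>\<^sub>1" "(\<Lambda> \<longlongrightarrow> \<Lambda>\<^sub>0) (at_right 0)" "(\<eta> \<longlongrightarrow> \<eta>\<^sub>0) (at_right 0)"
    "\<And>a. 0 < a \<Longrightarrow> a < 1/4 \<Longrightarrow> has_bochner_integral (hyp_radial TYPE('n)) (\<lambda>\<rho>. indicator {1<..} \<rho> * frac_profile ?n a \<rho>) (\<kappa>\<^sub>1 / a + \<Lambda> a)"
    "\<And>t. 0 < t \<Longrightarrow> has_bochner_integral (hyp_radial TYPE('n)) (\<lambda>\<rho>. indicator {..1} \<rho> * poisson_profile ?n t \<rho>) (\<kappa>\<^sub>0 * ln t + \<eta> t)"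
    by (rule radial_kernel_integrals[OF n]) (rule that, assumption+)
  define G where "G = frac_factor ?n"
  define I where "I = (\<lambda>p (f :: 'n point \<Rightarrow> complex) x a. \<integral>y. local_part p f x y * of_real (frac_profile ?n a (hdist x y)) \<partial>hyp_vol)"
  \<comment> \<open>With a = s p / 2, the prefactor \<open>s\<close> of the kernel cancels the pole
    of the far mass and leaves twice its residue divided by \<open>p\<close>.\<close>
  define A where "A = (\<lambda>p. G p 0 * (\<kappa>\<^sub>1 * 2 / p))"
  have plap: "\<forall>\<^sub>F s in at_right 0. frac_plap s p f x =
      of_real (s * G p s) * (I p f x (s * p / 2) + of_real (\<Lambda> (s * p / 2)) * Phi p (f x)) + of_real (G p s * (\<kappa>\<^sub>1 * 2 / p)) * Phi p (f x)"
    if p: "1 < p" and \<alpha>: "0 < \<alpha>" and f: "f \<in> Cc_hyp" "f \<in> Lip_loc \<alpha>" and x: "x \<in> hyperboloid"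
    for p \<alpha> and f :: "'n point \<Rightarrow> complex" and x
  proof -
    have p0: "0 < p" using p by simp
    have "\<forall>\<^sub>F a in at_right (0::real). 0 < a \<and> a < 1/4"
      unfolding at_right_0_eq[of "1/4", simplified] by (auto simp: eventually_at_filter)
    from eventually_half[OF p0 this] eventually_half[OF p0 local_part_integral_frac(2)[OF n f x p \<alpha>]]
    show ?thesis
    proof eventually_elim
      case (elim s)
      have s: "0 < s" using elim(1) p by (simp add: zero_less_mult_iff)
      have "s * (\<kappa>\<^sub>1 / (s * p / 2)) = \<kappa>\<^sub>1 * 2 / p" using s p by simp
      then have *: "s * G p s * (\<kappa>\<^sub>1 / (s * p / 2)) = G p s * (\<kappa>\<^sub>1 * 2 / p)" using s p by (simp add: field_simps)
      have "frac_plap s p f x = of_real (s * G p s) * (I p f x (s * p / 2) + of_real (\<kappa>\<^sub>1 / (s * p / 2) + \<Lambda> (s * p / 2)) * Phi p (f x))"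
        unfolding I_def G_def using elim k(4)[of "s * p / 2"] by (intro frac_plap_eq[OF n f(1) x s p0]) auto
      also have "\<dots> = of_real (s * G p s) * (I p f x (s * p / 2) + of_real (\<Lambda> (s * p / 2)) * Phi p (f x)) + of_real (s * G p s * (\<kappa>\<^sub>1 / (s * p / 2))) * Phi p (f x)"
        unfolding of_real_add of_real_mult distrib_left distrib_right by (simp only: mult_ac add_ac)
      finally show ?case unfolding * .
    qed
  qed
  have limA: "((\<lambda>s. frac_plap s p f x) \<longlongrightarrow> of_real (A p) * Phi p (f x)) (at_right 0)"
    if p: "1 < p" and \<alpha>: "0 < \<alpha>" and f: "f \<in> Cc_hyp" "f \<in> Lip_loc \<alpha>" and x: "x \<in> hyperboloid"
    for p \<alpha> and f :: "'n point \<Rightarrow> complex" and x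
  proof (rule Lim_transform_eventually)
    have p0: "0 < p" using p by simp
    have "((\<lambda>s. of_real (s * G p s) * (I p f x (s * p / 2) + of_real (\<Lambda> (s * p / 2)) * Phi p (f x)) + of_real (G p s * (\<kappa>\<^sub>1 * 2 / p)) * Phi p (f x))
      \<longlongrightarrow> of_real (0 * G p 0) * (I p f x 0 + of_real \<Lambda>\<^sub>0 * Phi p (f x)) + of_real (G p 0 * (\<kappa>\<^sub>1 * 2 / p)) * Phi p (f x)) (at_right 0)"
      unfolding G_def I_def
      by (intro tendsto_add tendsto_mult tendsto_of_real tendsto_const tendsto_ident_at frac_factor_tendsto[OF n p]
        half_mellin_tendsto[OF p0 local_part_integral_frac(1)[OF n f x p \<alpha>]] half_mellin_tendsto[OF p0 k(2)])
    then show "((\<lambda>s. of_real (s * G p s) * (I p f x (s * p / 2) + of_real (\<Lambda> (s * p / 2)) * Phi p (f x)) + of_real (G p s * (\<kappa>\<^sub>1 * 2 / p)) * Phi p (f x))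
      \<longlongrightarrow> of_real (A p) * Phi p (f x)) (at_right 0)" by (simp add: A_def)
    show "\<forall>\<^sub>F s in at_right 0. of_real (s * G p s) * (I p f x (s * p / 2) + of_real (\<Lambda> (s * p / 2)) * Phi p (f x)) + of_real (G p s * (\<kappa>\<^sub>1 * 2 / p)) * Phi p (f x) = frac_plap s p f x"
      using plap[OF p \<alpha> f x] by eventually_elim simp
  qed
  have A_eq: "A_const TYPE('n) p = A p" if p: "1 < p" for p
    unfolding A_const_def
  proof (rule the_equality)
    show "A p > 0 \<and> (\<forall>\<alpha>\<in>{0<..<1}. \<forall>f\<in>Cc_hyp \<inter> Lip_loc \<alpha>. \<forall>x\<in>(hyperboloid :: 'n point set).
      ((\<lambda>s. frac_plap s p f x) \<longlongrightarrow> of_real (A p) * Phi p (f x)) (at_right 0))"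
      using limA[OF p] frac_factor_0_pos[OF n p] k(1) p by (auto simp: A_def G_def)
    fix B assume B: "B > 0 \<and> (\<forall>\<alpha>\<in>{0<..<1}. \<forall>f\<in>Cc_hyp \<inter> Lip_loc \<alpha>. \<forall>x\<in>(hyperboloid :: 'n point set).
      ((\<lambda>s. frac_plap s p f x) \<longlongrightarrow> of_real B * Phi p (f x)) (at_right 0))"
    \<comment> \<open>The cut-off equals 1 at the origin, where \<open>Phi\<close> is then 1 as
      well, so the limit of the operator there determines the constant.\<close>
    have o: "(hyp_origin :: 'n point) \<in> hyperboloid" by (simp add: hyperboloid_def lorentz_def)
    have f: "(height_cutoff :: 'n point \<Rightarrow> complex) \<in> Cc_hyp" "(height_cutoff :: 'n point \<Rightarrow> complex) \<in> Lip_loc (1/2)"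
      using height_cutoff_Cc height_cutoff_Lip[of "1/2"] by auto
    have "((\<lambda>s. frac_plap s p height_cutoff (hyp_origin :: 'n point)) \<longlongrightarrow> of_real B * Phi p (height_cutoff (hyp_origin :: 'n point))) (at_right 0)"
      using B o f by (auto dest!: conjunct2 bspec[of _ _ "1/2"])
    moreover have "((\<lambda>s. frac_plap s p height_cutoff (hyp_origin :: 'n point)) \<longlongrightarrow> of_real (A p) * Phi p (height_cutoff (hyp_origin :: 'n point))) (at_right 0)"
      by (rule limA[OF p _ f o]) simp
    ultimately have "of_real B * Phi p (height_cutoff (hyp_origin :: 'n point)) = of_real (A p) * Phi p (height_cutoff (hyp_origin :: 'n point))"
      by (intro tendsto_unique[of "at_right (0::real)"]) auto
    then show "B = A p" by (simp add: height_cutoff_def Phi_def)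
  qed
  define D where "D = (\<lambda>p. deriv (G p) 0)"
  \<comment> \<open>Chosen to cancel the logarithm that the near mass contributes to
    \<open>ext_op\<close> with a minus sign.\<close>
  define \<gamma> where "\<gamma> = poisson_factor ?n * \<kappa>\<^sub>0"
  \<comment> \<open>Three multiples of \<open>Phi p (f x)\<close>: the finite part of the far mass,
    the derivative of the factor multiplied by the residue of the pole, and the finite part of the
    near mass, which the extension carries with the opposite sign.\<close>
  define \<delta> where "\<delta> = (\<lambda>p. G p 0 * \<Lambda>\<^sub>0 + D p * (\<kappa>\<^sub>1 * 2 / p) + G p 0 * \<eta>\<^sub>0)"
  show ?thesis
  proof (intro exI[of _ \<gamma>] exI[of _ \<delta>] allI impI ballI)
    fix p \<alpha> :: real and f :: "'n point \<Rightarrow> complex" and x :: "'n point"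
    assume p: "1 < p" and \<alpha>': "\<alpha> \<in> {0<..<1}" and ff: "f \<in> Cc_hyp \<inter> Lip_loc \<alpha>" and x: "x \<in> hyperboloid"
    have \<alpha>: "0 < \<alpha>" and f: "f \<in> Cc_hyp" "f \<in> Lip_loc \<alpha>" and p0: "0 < p" using \<alpha>' ff p by auto
    define V where "V = Phi p (f x)"
    define J where "J = I p f x"
    have J: "(J \<longlongrightarrow> J 0) (at_right 0)" unfolding J_def I_def by (rule local_part_integral_frac(1)[OF n f x p \<alpha>])
    define Q where "Q = of_real (G p 0) * (J 0 + of_real \<Lambda>\<^sub>0 * V) + of_real (D p * (\<kappa>\<^sub>1 * 2 / p)) * V"
    have lim: "(log_quotient p f x \<longlongrightarrow> Q) (at_right 0)"
    proof (rule Lim_transform_eventually)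
      show "((\<lambda>s. of_real (G p s) * (J (s * p / 2) + of_real (\<Lambda> (s * p / 2)) * V) + of_real ((G p s - G p 0) / s * (\<kappa>\<^sub>1 * 2 / p)) * V) \<longlongrightarrow> Q) (at_right 0)"
        unfolding Q_def G_def D_def
        by (intro tendsto_add tendsto_mult tendsto_of_real tendsto_const frac_factor_tendsto[OF n p] frac_factor_differentiable[OF n p]
          half_mellin_tendsto[OF p0 J] half_mellin_tendsto[OF p0 k(2)])
      have "\<forall>\<^sub>F s in at_right (0::real). 0 < s" by (simp add: eventually_at_filter)
      with plap[OF p \<alpha> f x]
      show "\<forall>\<^sub>F s in at_right 0. of_real (G p s) * (J (s * p / 2) + of_real (\<Lambda> (s * p / 2)) * V) + of_real ((G p s - G p 0) / s * (\<kappa>\<^sub>1 * 2 / p)) * V = log_quotient p f x s"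
      proof eventually_elim
        case (elim s)
        have s: "(of_real s :: complex) \<noteq> 0" "(of_real p :: complex) \<noteq> 0" using elim(2) p by simp_all
        show ?case
          unfolding log_quotient_def A_eq[OF p] elim(1) A_def J_def[symmetric] V_def[symmetric]
          using s by (simp add: field_simps)
      qed
    qed
    then have log_eq: "log_plap p f x = Q" unfolding log_plap_def by (intro tendsto_Lim) auto
    define E where "E = (\<lambda>t. \<integral>y. local_part p f x y * of_real (poisson_profile ?n t (hdist x y)) \<partial>hyp_vol)"
    have E: "(E \<longlongrightarrow> J 0) (at_right 0)"
      unfolding E_def J_def I_def by (rule local_part_integral_frac(3)[OF n f x p \<alpha>])
    have extlim: "((\<lambda>t. of_real (sigma_const ?n p) * (ext_op (\<lambda>y. Phi p (f x - f y) - Phi p (f x)) x t + of_real (\<gamma> * ln t) * Phi p (f x)))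
      \<longlongrightarrow> of_real (G p 0) * (J 0 - of_real \<eta>\<^sub>0 * V)) (at_right 0)"
    proof (rule Lim_transform_eventually)
      show "((\<lambda>t. of_real (G p 0) * (E t - of_real (\<eta> t) * V)) \<longlongrightarrow> of_real (G p 0) * (J 0 - of_real \<eta>\<^sub>0 * V)) (at_right 0)"
        by (intro tendsto_intros E k(3))
      have "\<forall>\<^sub>F t in at_right (0::real). 0 < t" by (simp add: eventually_at_filter)
      then show "\<forall>\<^sub>F t in at_right 0. of_real (G p 0) * (E t - of_real (\<eta> t) * V)
        = of_real (sigma_const ?n p) * (ext_op (\<lambda>y. Phi p (f x - f y) - Phi p (f x)) x t + of_real (\<gamma> * ln t) * Phi p (f x))"
      proof eventually_elim
        case (elim t)
        have *: "ext_op (\<lambda>y. Phi p (f x - f y) - Phi p (f x)) x t = of_real (poisson_factor ?n) * (E t - of_real (\<kappa>\<^sub>0 * ln t + \<eta> t) * Phi p (f x))"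
          unfolding E_def by (rule ext_op_eq[OF n x f(1) local_part_integral_frac(4)[OF n f x p \<alpha>] k(5)[OF elim]])
        show ?case unfolding * by (simp add: G_def frac_factor_0 \<gamma>_def V_def algebra_simps)
      qed
    qed
    have "Q = of_real (G p 0) * (J 0 - of_real \<eta>\<^sub>0 * V) + of_real (\<delta> p) * Phi p (f x)"
      by (simp add: Q_def \<delta>_def V_def algebra_simps)
    then show "(log_quotient p f x \<longlongrightarrow> log_plap p f x) (at_right 0) \<and>
         (\<exists>L. ((\<lambda>t. of_real (sigma_const CARD('n) p) *
                   (ext_op (\<lambda>y. Phi p (f x - f y) - Phi p (f x)) x t
                     + of_real (\<gamma> * ln t) * Phi p (f x))) \<longlongrightarrow> L) (at_right 0) \<and>
              log_plap p f x = L + of_real (\<delta> p) * Phi p (f x))"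
      using lim extlim log_eq by auto
  qed
qed

end
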